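(* Let $\mathbb{P}$ be a Borel probability measure on $\mathbb{H}_+(d)$ with $\mathbb{P}(\mathbb{H}_{++}(d))>0$ and $\mathbb{E}\operatorname{tr}S<+\infty$ for $S\sim\mathbb{P}$, and let $\mathbb{A}=Q_0+\mathbb{M}$ be an affine subspace of $\mathbb{H}(d)$ with $\mathbb{H}_{++}(d)\cap\mathbb{A}\ne\emptyset$. Let $S_1,S_2,\dots$ be i.i.d. with law $\mathbb{P}$, let $Q_*$ be the barycenter of $\mathbb{P}$ in $\mathbb{A}$ and $Q_n$ the empirical barycenter in $\mathbb{A}$ of $S_1,\dots,S_n$. Then, as $n\to\infty$: (A) $\sqrt n\,(Q_n-Q_* )$ converges weakly to $\mathcal{N}(0,\Xi)$, where $\Xi:\mathbb{M}\to\mathbb{M}$ is the self-adjoint operator $\Xi=F^{-1}(\Sigma)_{\mathbb{M}}F^{-1}$ defined in the context. (B) If moreover the covariance operator $\Sigma=\operatorname{Var}(T_{Q_*}^S)$ is non-degenerate, then $\sqrt n\,\hat{\Xi}_n^{-1/2}(Q_n-Q_* )$ converges weakly to $\mathcal{N}(0,(\mathrm{Id})_{\mathbb{M}})$, where $\hat{\Xi}_n=\hat F_n^{-1}(\hat\Sigma_n)_{\mathbb{M}}\hat F_n^{-1}$ is the empirical counterpart of $\Xi$ defined in the context. (Here $\Xi$ is just the name of an operator, the Greek capital letter Xi.)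
   Context: $\mathbb{H}(d)$ is the real vector space of $d\times d$ complex Hermitian matrices with inner product $\langle X,Y\rangle=\operatorname{tr}(XY)$; $\mathbb{H}_+(d)$, $\mathbb{H}_{++}(d)$ are the positive semi-definite and positive definite ones. $d_{BW}^2(Q,S)=\operatorname{tr}Q+\operatorname{tr}S-2\operatorname{tr}(Q^{1/2}SQ^{1/2})^{1/2}$. For $Q\in\mathbb{H}_{++}(d)$, $S\in\mathbb{H}_+(d)$, $T_Q^S=Q^{-1/2}(Q^{1/2}SQ^{1/2})^{1/2}Q^{-1/2}$, and $dT_Q^S:\mathbb{H}(d)\to\mathbb{H}(d)$ denotes the Fréchet differential at $Q$ of the map $Q\mapsto T_Q^S$ ($S$ fixed); it is a self-adjoint, negative semi-definite linear operator. $\mathbb{M}\subseteq\mathbb{H}(d)$ is a real linear subspace, $\Pi_{\mathbb{M}}$ the orthogonal projector onto it, and for a linear operator $A$ on $\mathbb{H}(d)$, $(A)_{\mathbb{M}}:\mathbb{M}\to\mathbb{M}$ is the compression $(A)_{\mathbb{M}}(X)=\Pi_{\mathbb{M}}A(X)$; $(\mathrm{Id})_{\mathbb{M}}$ is the identity of $\mathbb{M}$. $Q_*$ is the unique minimizer over $\mathbb{H}_+(d)\cap\mathbb{A}$ of $Q\mapsto\mathbb{E}\,d_{BW}^2(Q,S)$ (it is positive definite), and $Q_n$ is the (measurable) minimizer over $\mathbb{H}_+(d)\cap\mathbb{A}$ of $Q\mapsto\frac1n\sum_{i=1}^nd_{BW}^2(Q,S_i)$; it is unique and positive definite as soon as some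 $S_i\in\mathbb{H}_{++}(d)$, hence with probability tending to $1$. For $A,B\in\mathbb{H}(d)$, $(A\otimes B)(X)=\langle B,X\rangle A$. Covariance operators: $$\Sigma=\operatorname{Var}(T_{Q_*}^S)=\mathbb{E}\,(T_{Q_*}^S-\mathbb{E}T_{Q_*}^S)\otimes(T_{Q_*}^S-\mathbb{E}T_{Q_*}^S),\qquad\hat\Sigma_n=\frac1n\sum_{i=1}^n(T_{Q_n}^{S_i}-I)\otimes(T_{Q_n}^{S_i}-I),$$ $$F=-\mathbb{E}\,(dT_{Q_*}^S)_{\mathbb{M}},\qquad\hat F_n=-\frac1n\sum_{i=1}^n(dT_{Q_n}^{S_i})_{\mathbb{M}},$$ $$\Xi=F^{-1}(\Sigma)_{\mathbb{M}}F^{-1},\qquad\hat\Xi_n=\hat F_n^{-1}(\hat\Sigma_n)_{\mathbb{M}}\hat F_n^{-1}\quad\text{(operators }\mathbb{M}\to\mathbb{M}).$$ Quantities depending on $Q_n$ and inverses are considered on the event, of probability tending to $1$, where they are well defined (and set arbitrarily elsewhere). $\mathcal{N}(0,C)$ is the centred Gaussian law on $\mathbb{M}$ with covariance operator $C$. *)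

theory Defs
  imports "HOL-Probability.Probability"
begin

type_synonym 'd cmat = "complex ^ 'd ^ 'd"

section \<open>Hermitian matrices\<close>

definition hermitian :: "('d::finite) cmat set" where
  "hermitian = {A. \<forall>i j. A $ i $ j = cnj (A $ j $ i)}"

text \<open>The library inner product of \<^typ>\<open>complex ^ 'd\<close> is the real part of the Hermitian one, so
  \<open>v \<bullet> (A *v v)\<close> is the real part of \<open>v* A v\<close>, which is real for Hermitian \<open>A\<close>.\<close>

definition psd :: "('d::finite) cmat set" where
  "psd = {A \<in> hermitian. \<forall>v. 0 \<le> v \<bullet> (A *v v)}"

definition pd :: "('d::finite) cmat set" where
  "pd = {A \<in> hermitian. \<forall>v. v \<noteq> 0 \<longrightarrow> 0 < v \<bullet> (A *v v)}"

text \<open>The space of Hermitian matrices is a real subspace of the Euclidean space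
  \<^typ>\<open>complex ^ 'd ^ 'd\<close>; the library inner product restricts to \<open>tr (X Y)\<close> on it.\<close>

lemma inner_hermitian_eq_trace:
  fixes X Y :: "('d::finite) cmat"
  assumes "X \<in> hermitian" "Y \<in> hermitian"
  shows "complex_of_real (X \<bullet> Y) = trace (X ** Y)"
proof -
  have X: "cnj (X $ i $ j) = X $ j $ i" for i j
    using assms(1) unfolding hermitian_def by (metis (mono_tags, lifting) mem_Collect_eq)
  have Y: "cnj (Y $ i $ j) = Y $ j $ i" for i j
    using assms(2) unfolding hermitian_def by (metis (mono_tags, lifting) mem_Collect_eq)
  have cnj_tr: "cnj (trace (X ** Y)) = trace (X ** Y)"
  proof -
    have "cnj (trace (X ** Y)) = (\<Sum>i\<in>UNIV. \<Sum>j\<in>UNIV. X $ j $ i * Y $ i $ j)"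
      by (simp add: trace_def matrix_matrix_mult_def X Y)
    also have "\<dots> = (\<Sum>j\<in>UNIV. \<Sum>i\<in>UNIV. X $ j $ i * Y $ i $ j)"
      by (rule sum.swap)
    finally show ?thesis
      by (simp add: trace_def matrix_matrix_mult_def)
  qed
  have "Re (X $ i $ j * Y $ j $ i) = X $ i $ j \<bullet> Y $ i $ j" for i j
    by (subst Y[of i j, symmetric]) (simp add: inner_complex_def)
  then have "X \<bullet> Y = Re (trace (X ** Y))"
    by (simp add: inner_vec_def trace_def matrix_matrix_mult_def)
  moreover have "Im (trace (X ** Y)) = 0"
    using arg_cong[OF cnj_tr, of Im] by simp
  ultimately show ?thesis
    by (simp add: complex_eq_iff)
qed

definition msqrt :: "('d::finite) cmat \<Rightarrow> 'd cmat" where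
  "msqrt A = (THE R. R \<in> psd \<and> R ** R = A)"

section \<open>Bures--Wasserstein distance, optimal maps and barycenters\<close>

definition bw_dist2 :: "('d::finite) cmat \<Rightarrow> 'd cmat \<Rightarrow> real" where
  "bw_dist2 Q S =
     Re (trace Q) + Re (trace S) - 2 * Re (trace (msqrt (msqrt Q ** S ** msqrt Q)))"

definition bw_map :: "('d::finite) cmat \<Rightarrow> 'd cmat \<Rightarrow> 'd cmat" where
  "bw_map Q S =
     matrix_inv (msqrt Q) ** msqrt (msqrt Q ** S ** msqrt Q) ** matrix_inv (msqrt Q)"

text \<open>For \<open>Q \<in> pd\<close> all Hermitian matrices near \<open>Q\<close> are positive definite, so the derivative
  within \<^const>\<open>hermitian\<close> is the differential on the space of Hermitian matrices. It is
  determined only on Hermitian arguments and must only be evaluated there.\<close>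

definition bw_map_deriv :: "('d::finite) cmat \<Rightarrow> 'd cmat \<Rightarrow> 'd cmat \<Rightarrow> 'd cmat" where
  "bw_map_deriv Q S = frechet_derivative (\<lambda>R. bw_map R S) (at Q within hermitian)"

definition bw_barycenter :: "('d::finite) cmat measure \<Rightarrow> 'd cmat set \<Rightarrow> 'd cmat \<Rightarrow> bool" where
  "bw_barycenter P A Q \<longleftrightarrow>
     is_arg_min (\<lambda>R. \<integral>S. bw_dist2 R S \<partial>P) (\<lambda>R. R \<in> psd \<inter> A) Q"

text \<open>Below, \<open>s i\<close> for \<open>i \<in> {1..n}\<close> is the sample of size \<open>n\<close>.\<close>

definition emp_bw_barycenter ::
    "nat \<Rightarrow> (nat \<Rightarrow> ('d::finite) cmat) \<Rightarrow> 'd cmat set \<Rightarrow> 'd cmat \<Rightarrow> bool" where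
  "emp_bw_barycenter n s A Q \<longleftrightarrow>
     is_arg_min (\<lambda>R. (1 / real n) * (\<Sum>i=1..n. bw_dist2 R (s i))) (\<lambda>R. R \<in> psd \<inter> A) Q"

section \<open>Operators on a subspace\<close>

text \<open>An operator on a subspace \<open>M\<close> is represented by a function on the ambient space of which only
  the values on \<open>M\<close> are relevant; its inverse is \<^term>\<open>inv_into M A\<close>. Expectations of random
  operators are taken pointwise.\<close>

definition orth_proj :: "('a::euclidean_space) set \<Rightarrow> 'a \<Rightarrow> 'a" where
  "orth_proj M X = (THE Y. Y \<in> M \<and> X - Y \<in> orthogonal_comp M)"

definition compress :: "('a::euclidean_space) set \<Rightarrow> ('a \<Rightarrow> 'a) \<Rightarrow> 'a \<Rightarrow> 'a" where
  "compress M A X = orth_proj M (A X)"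

definition tensor_op :: "'a::real_inner \<Rightarrow> 'a \<Rightarrow> 'a \<Rightarrow> 'a" where
  "tensor_op A B X = (B \<bullet> X) *\<^sub>R A"

text \<open>The square root of a positive semi-definite operator \<open>A\<close> on \<open>M\<close>: its values on \<open>M\<close> are unique,
  and its linear extension to the ambient space is arbitrary.\<close>

definition op_sqrt :: "('a::euclidean_space) set \<Rightarrow> ('a \<Rightarrow> 'a) \<Rightarrow> 'a \<Rightarrow> 'a" where
  "op_sqrt M A = (SOME B. linear B \<and> B ` M \<subseteq> M \<and>
     (\<forall>X\<in>M. \<forall>Y\<in>M. B X \<bullet> Y = X \<bullet> B Y) \<and> (\<forall>X\<in>M. 0 \<le> B X \<bullet> X) \<and>
     (\<forall>X\<in>M. B (B X) = A X))"

section \<open>Covariance operators of the barycenter\<close>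

definition Sigma_op :: "('d::finite) cmat measure \<Rightarrow> 'd cmat \<Rightarrow> 'd cmat \<Rightarrow> 'd cmat" where
  "Sigma_op P Q X =
     (let m = (\<integral>S. bw_map Q S \<partial>P)
      in \<integral>S. tensor_op (bw_map Q S - m) (bw_map Q S - m) X \<partial>P)"

definition F_op ::
    "('d::finite) cmat measure \<Rightarrow> 'd cmat set \<Rightarrow> 'd cmat \<Rightarrow> 'd cmat \<Rightarrow> 'd cmat" where
  "F_op P M Q X = - (\<integral>S. compress M (bw_map_deriv Q S) X \<partial>P)"

definition Sigma_hat ::
    "nat \<Rightarrow> (nat \<Rightarrow> ('d::finite) cmat) \<Rightarrow> 'd cmat \<Rightarrow> 'd cmat \<Rightarrow> 'd cmat" where
  "Sigma_hat n s Q X =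
     (1 / real n) *\<^sub>R (\<Sum>i=1..n. tensor_op (bw_map Q (s i) - mat 1) (bw_map Q (s i) - mat 1) X)"

definition F_hat ::
    "nat \<Rightarrow> (nat \<Rightarrow> ('d::finite) cmat) \<Rightarrow> 'd cmat set \<Rightarrow> 'd cmat \<Rightarrow> 'd cmat \<Rightarrow> 'd cmat" where
  "F_hat n s M Q X =
     - ((1 / real n) *\<^sub>R (\<Sum>i=1..n. compress M (bw_map_deriv Q (s i)) X))"

definition Xi_op ::
    "('d::finite) cmat measure \<Rightarrow> 'd cmat set \<Rightarrow> 'd cmat \<Rightarrow> 'd cmat \<Rightarrow> 'd cmat" where
  "Xi_op P M Q = inv_into M (F_op P M Q) \<circ> compress M (Sigma_op P Q) \<circ> inv_into M (F_op P M Q)"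

definition Xi_hat ::
    "nat \<Rightarrow> (nat \<Rightarrow> ('d::finite) cmat) \<Rightarrow> 'd cmat set \<Rightarrow> 'd cmat \<Rightarrow> 'd cmat \<Rightarrow> 'd cmat" where
  "Xi_hat n s M Q =
     inv_into M (F_hat n s M Q) \<circ> compress M (Sigma_hat n s Q) \<circ> inv_into M (F_hat n s M Q)"

text \<open>When \<open>Xi_hat\<close> and its inverse square root make sense: the differentials exist since
  \<open>Q \<in> pd\<close>, and the operators to be inverted are invertible on \<open>M\<close>. (A positive semi-definite
  operator is invertible iff its square root is.)\<close>

definition Xi_hat_well_defined ::
    "nat \<Rightarrow> (nat \<Rightarrow> ('d::finite) cmat) \<Rightarrow> 'd cmat set \<Rightarrow> 'd cmat \<Rightarrow> bool" where
  "Xi_hat_well_defined n s M Q \<longleftrightarrow>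
     Q \<in> pd \<and> bij_betw (F_hat n s M Q) M M \<and> bij_betw (Xi_hat n s M Q) M M"

section \<open>Gaussian laws and weak convergence\<close>

text \<open>The point mass at \<open>0\<close> counts as a normal law, of variance \<open>0\<close>.\<close>

definition centred_normal :: "real measure \<Rightarrow> bool" where
  "centred_normal \<mu> \<longleftrightarrow>
     \<mu> = return borel 0 \<or> (\<exists>\<sigma>>0. \<mu> = density lborel (\<lambda>x. ennreal (normal_density 0 \<sigma> x)))"

definition centred_gaussian ::
    "('a::euclidean_space) set \<Rightarrow> ('a \<Rightarrow> 'a) \<Rightarrow> 'a measure \<Rightarrow> bool" where
  "centred_gaussian M C N \<longleftrightarrow>
     prob_space N \<and> sets N = sets borel \<and> (AE Z in N. Z \<in> M) \<and>
     (\<forall>X\<in>M. centred_normal (distr N borel (\<lambda>Z. X \<bullet> Z))) \<and>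
     (\<forall>X\<in>M. C X = (\<integral>Z. tensor_op Z Z X \<partial>N))"

text \<open>The library's \<^const>\<open>weak_conv_m\<close> only covers laws on the real line.\<close>

definition weak_conv_law :: "(nat \<Rightarrow> ('a::topological_space) measure) \<Rightarrow> 'a measure \<Rightarrow> bool" where
  "weak_conv_law \<mu> \<nu> \<longleftrightarrow>
     (\<forall>f :: 'a \<Rightarrow> real. continuous_on UNIV f \<and> bounded (range f) \<longrightarrow>
        (\<lambda>n. \<integral>x. f x \<partial>\<mu> n) \<longlonglongrightarrow> (\<integral>x. f x \<partial>\<nu>))"

end

theory Submission
  imports Defs
begin

text \<open>
  The expected squared distance is a convex function of \<open>Q\<close> with gradient \<open>I - E T\<^sub>Q\<close>, where \<open>T\<^sub>Q\<close> is
  the optimal map from \<open>Q\<close> to \<open>S\<close>. Both barycenters are therefore zeros, up to the orthogonal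
  complement of \<open>M\<close>, of a monotone map: the population one of \<open>I - E T\<^sub>Q\<close>, the empirical one of its
  sample mean. A Taylor expansion of the second map around \<open>Qs\<close> gives
  \<open>F (Q\<^sub>n - Qs) = W\<^sub>n + o(Q\<^sub>n - Qs)\<close>, where \<open>W\<^sub>n\<close> is the sample mean of the projection \<open>V\<close> of \<open>T\<^sub>Q\<^sub>s - I\<close>
  to \<open>M\<close> and \<open>F\<close> is minus the mean differential. As \<open>V\<close> is centred with covariance operator the
  compression of \<open>\<Sigma>\<close>, the central limit theorem for \<open>W\<^sub>n\<close> yields the limit law
  \<open>N(0, F\<^sup>-\<^sup>1 \<Sigma> F\<^sup>-\<^sup>1)\<close>. The standardised version follows since the plug-in operators converge and the
  square root of positive semi-definite operators is continuous.

  What makes this work for singular \<open>S\<close>, with constants that are integrable in \<open>S\<close>, is the formula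
  \<open>T\<^sub>Q = (1/\<pi>) \<integral> (u\<^sup>2 + S Q)\<^sup>-\<^sup>1 S du\<close> over the real line (\<open>bw_map_eq\<close>). The integrand \<open>r\<close> is positive
  semi-definite, it satisfies \<open>r' - r = r' (Q - Q') r\<close> for two values of \<open>Q\<close> (\<open>res_diff\<close>), and it is
  bounded by a multiple of \<open>s / (u\<^sup>2 + s)\<close>, \<open>s = norm S\<close> (\<open>res_norm\<close>), whose integral is \<open>\<pi> sqrt s\<close>.
  Hence \<open>T\<close> is differentiable in \<open>Q\<close> with differential \<open>- (1/\<pi>) \<integral> r X r du\<close>, and \<open>T\<close>, its differential
  and the Taylor remainder have bounds of the form \<open>const * sqrt (norm S)\<close> that are locally uniform
  in \<open>Q\<close> (\<open>bw_bounds_exist\<close>). The moment assumption says precisely that \<open>sqrt (norm S)\<close> is square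
  integrable. The same formula at \<open>Q = I\<close> produces square roots of matrices.

  Convexity enters through \<open>bw_dist2_gradient_inequality\<close>. It shows that \<open>Qs\<close> is positive definite
  (\<open>Qs_pd\<close>), because the gradient blows up at singular matrices, and it localises the empirical
  barycenter (\<open>emp_location\<close>): a minimiser outside a small ball around \<open>Qs\<close> is incompatible with the
  strong monotonicity of the empirical gradient inside the ball. On an event whose probability
  tends to one this gives consistency, positive definiteness and the rate \<open>n\<^sup>-\<^sup>1\<^sup>/\<^sup>2\<close> at once
  (\<open>likely_regular\<close>).

  The probabilistic part consists of a weak law of large numbers (\<open>weak_law\<close>), Gaussian laws as
  images of independent standard normal variables (\<open>gaussian_on_subspace_exists\<close>), and the passage
  from one-dimensional projections to weak convergence in a Euclidean space
  (\<open>weak_conv_law_perturbation\<close>): a bounded continuous function is approximated by a trigonometric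
  polynomial on a large ball, with a bound on the whole space (\<open>trigpoly_approximation\<close>).
\<close>

section \<open>Complex matrices as a Euclidean space\<close>

definition adj :: "('d::finite) cmat \<Rightarrow> 'd cmat" where
  "adj A = (\<chi> i j. cnj (A $ j $ i))"

lemma adj_nth [simp]: "adj A $ i $ j = cnj (A $ j $ i)"
  by (simp add: adj_def)

lemma adj_adj [simp]: "adj (adj A) = A"
  by (simp add: vec_eq_iff)

lemma adj_mat_1 [simp]: "adj (mat 1) = mat 1"
  by (simp add: vec_eq_iff mat_def)

lemma adj_mult: "adj (A ** B) = adj B ** adj A"
  by (simp add: vec_eq_iff matrix_matrix_mult_def mult.commute)

lemma adj_add: "adj (A + B) = adj A + adj B"
  by (simp add: vec_eq_iff)

lemma adj_scaleR: "adj (r *\<^sub>R A) = r *\<^sub>R adj A"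
  by (simp add: vec_eq_iff)

lemma adj_diff: "adj (A - B) = adj A - adj B"
  by (simp add: vec_eq_iff)

lemma linear_adj: "linear adj"
  by (intro linearI adj_add adj_scaleR)

lemma hermitian_iff_adj: "A \<in> hermitian \<longleftrightarrow> adj A = A"
  unfolding hermitian_def mem_Collect_eq vec_eq_iff adj_nth by metis

lemma subspace_hermitian: "subspace (hermitian :: ('d::finite) cmat set)"
  by (auto simp: subspace_def hermitian_iff_adj adj_add adj_scaleR) (simp add: vec_eq_iff)

lemma closed_hermitian: "closed (hermitian :: ('d::finite) cmat set)"
  by (rule closed_subspace[OF subspace_hermitian])

lemma inner_complex_mult_left: "x \<bullet> (a * y) = (cnj a * x) \<bullet> (y::complex)"
  by (simp add: inner_complex_def algebra_simps)

lemma inner_mv_adj: "x \<bullet> (A *v y) = (adj A *v x) \<bullet> (y :: complex ^ ('d::finite))"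
proof -
  have "x \<bullet> (A *v y) = (\<Sum>i\<in>UNIV. \<Sum>j\<in>UNIV. x $ i \<bullet> (A $ i $ j * y $ j))"
    by (simp add: inner_vec_def matrix_vector_mult_def inner_sum_right)
  also have "\<dots> = (\<Sum>j\<in>UNIV. \<Sum>i\<in>UNIV. x $ i \<bullet> (A $ i $ j * y $ j))"
    by (rule sum.swap)
  also have "\<dots> = (\<Sum>j\<in>UNIV. \<Sum>i\<in>UNIV. (cnj (A $ i $ j) * x $ i) \<bullet> y $ j)"
    by (intro sum.cong refl inner_complex_mult_left)
  also have "\<dots> = (adj A *v x) \<bullet> y"
    by (simp add: inner_vec_def matrix_vector_mult_def inner_sum_left)
  finally show ?thesis .
qed

lemma inner_mv_hermitian:
  "A \<in> hermitian \<Longrightarrow> (A *v x) \<bullet> y = x \<bullet> (A *v (y :: complex ^ ('d::finite)))"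
  by (simp add: inner_mv_adj hermitian_iff_adj)

lemma mv_axis: "(A *v axis j 1) $ i = (A :: ('d::finite) cmat) $ i $ j"
proof -
  have "A $ i $ k * axis j 1 $ k = (if k = j then A $ i $ k else 0)" for k
    by (simp add: axis_def)
  then show ?thesis by (simp add: matrix_vector_mult_def)
qed

text \<open>The norm and inner product of matrices are the Frobenius ones. Reading them off the columns
  reduces statements about products to statements about vectors.\<close>

lemma inner_matrix_columns:
  "A \<bullet> (B :: ('d::finite) cmat) = (\<Sum>j\<in>UNIV. (A *v axis j 1) \<bullet> (B *v axis j 1))"
  unfolding inner_vec_def mv_axis by (rule sum.swap)

lemma norm_matrix_columns:
  "(norm (A :: ('d::finite) cmat))\<^sup>2 = (\<Sum>j\<in>UNIV. (norm (A *v axis j 1))\<^sup>2)"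
  by (simp add: power2_norm_eq_inner inner_matrix_columns)

lemma inner_mm_adj: "X \<bullet> (A ** Y) = (adj A ** X) \<bullet> (Y :: ('d::finite) cmat)"
  by (simp add: inner_matrix_columns matrix_vector_mul_assoc[symmetric] inner_mv_adj)

lemma inner_adj_adj: "adj X \<bullet> adj Y = X \<bullet> (Y :: ('d::finite) cmat)"
  unfolding inner_vec_def adj_nth
  by (subst sum.swap) (simp add: inner_complex_def)

lemma inner_mm_adj_right: "X \<bullet> (Y ** A) = (X ** adj A) \<bullet> (Y :: ('d::finite) cmat)"
  using inner_mm_adj[of "adj X" "adj A" "adj Y"] inner_adj_adj[of X "Y ** A"]
    inner_adj_adj[of "X ** adj A" Y]
  by (simp add: adj_mult)

lemma Re_trace: "Re (trace A) = mat 1 \<bullet> (A :: ('d::finite) cmat)"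
proof -
  have "mat 1 $ i $ j \<bullet> A $ i $ j = (if j = i then Re (A $ i $ i) else 0)" for i j
    by (auto simp: mat_def inner_complex_def)
  then show ?thesis
    by (simp add: trace_def inner_vec_def)
qed

lemma norm_mv: "norm (A *v x) \<le> norm (A :: ('d::finite) cmat) * norm x"
proof -
  have "norm ((A *v x) $ i) \<le> norm (A $ i) * norm x" for i
  proof -
    have "norm ((A *v x) $ i) \<le> (\<Sum>j\<in>UNIV. norm (A $ i $ j) * norm (x $ j))"
      unfolding matrix_vector_mult_def by (simp add: norm_mult[symmetric] norm_sum)
    also have "\<dots> \<le> norm (A $ i) * norm x"
      using L2_set_mult_ineq[of "\<lambda>j. norm (A $ i $ j)" "\<lambda>j. norm (x $ j)" UNIV]
      by (simp add: norm_vec_def)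
    finally show ?thesis .
  qed
  then have "norm (A *v x) \<le> L2_set (\<lambda>i. norm (A $ i) * norm x) UNIV"
    unfolding norm_vec_def[of "A *v x"] by (intro L2_set_mono) auto
  also have "\<dots> = norm A * norm x"
    by (simp add: norm_vec_def[of A] L2_set_left_distrib)
  finally show ?thesis .
qed

text \<open>Passing from the operator norm to the Frobenius norm costs a factor that depends on the
  dimension; the constants that this produces are harmless below.\<close>

lemma norm_matrix_le_of_mv:
  assumes "0 \<le> c" "\<And>x. norm (A *v x) \<le> c * norm x"
  shows "norm (A :: ('d::finite) cmat) \<le> c * real CARD('d)"
proof -
  have "(norm A)\<^sup>2 \<le> (\<Sum>j\<in>(UNIV::'d set). c\<^sup>2)"
    unfolding norm_matrix_columns
    using assms(2)[of "axis _ 1"] by (intro sum_mono power_mono) (auto simp: norm_axis_1)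
  also have "\<dots> \<le> (c * real CARD('d))\<^sup>2"
    proof -
    have "real CARD('d) \<le> real CARD('d) * real CARD('d)"
      using of_nat_mono[OF le_square[of "CARD('d)"], where 'a = real] by simp
    then have "c\<^sup>2 * real CARD('d) \<le> c\<^sup>2 * (real CARD('d) * real CARD('d))"
      by (intro mult_left_mono) auto
    then show ?thesis
      by (simp add: power_mult_distrib power2_eq_square mult_ac)
  qed
  finally show ?thesis
    using assms(1) by (auto intro: power2_le_imp_le)
qed

lemma norm_mm_op:
  fixes A B :: "('d::finite) cmat"
  assumes "0 \<le> c" "\<And>x. norm (A *v x) \<le> c * norm x"
  shows "norm (A ** B) \<le> c * norm B"
proof -
  have "(norm (A ** B))\<^sup>2 \<le> (\<Sum>j\<in>(UNIV::'d set). (c * norm (B *v axis j 1))\<^sup>2)"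
    unfolding norm_matrix_columns matrix_vector_mul_assoc[symmetric]
    using assms(2) by (intro sum_mono power_mono) auto
  also have "\<dots> = (c * norm B)\<^sup>2"
    by (simp add: power_mult_distrib norm_matrix_columns[of B] sum_distrib_left)
  finally show ?thesis
    using assms(1) by (auto intro: power2_le_imp_le)
qed

lemma norm_mm: "norm (A ** B) \<le> norm (A :: ('d::finite) cmat) * norm (B :: 'd cmat)"
  by (rule norm_mm_op[OF norm_ge_zero norm_mv])

lemma scaleR_mm_left: "(r *\<^sub>R A) ** B = r *\<^sub>R ((A :: ('d::finite) cmat) ** (B :: 'd cmat))"
  by (simp add: vec_eq_iff matrix_matrix_mult_def scaleR_sum_right)

lemma scaleR_mm_right: "A ** (r *\<^sub>R B) = r *\<^sub>R ((A :: ('d::finite) cmat) ** (B :: 'd cmat))"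
  by (simp add: vec_eq_iff matrix_matrix_mult_def scaleR_sum_right)

lemma matrix_add_rdistrib: "(A + B) ** C = A ** C + (B :: ('d::finite) cmat) ** (C :: 'd cmat)"
  by (simp add: vec_eq_iff matrix_matrix_mult_def algebra_simps sum.distrib)

lemma bounded_bilinear_mm:
  "bounded_bilinear ((**) :: ('d::finite) cmat \<Rightarrow> 'd cmat \<Rightarrow> 'd cmat)"
  by (rule bounded_bilinear.intro)
    (auto simp: matrix_add_ldistrib matrix_add_rdistrib
      scaleR_mm_left scaleR_mm_right
      intro!: exI[of _ 1] norm_mm)

lemmas continuous_on_mm [continuous_intros] =
  bounded_bilinear.continuous_on[OF bounded_bilinear_mm]
lemmas tendsto_mm [tendsto_intros] = bounded_bilinear.tendsto[OF bounded_bilinear_mm]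
lemmas mm_diff_left = bounded_bilinear.diff_left[OF bounded_bilinear_mm]
lemmas mm_diff_right = bounded_bilinear.diff_right[OF bounded_bilinear_mm]
lemmas mm_add_left = bounded_bilinear.add_left[OF bounded_bilinear_mm]
lemmas mm_add_right = bounded_bilinear.add_right[OF bounded_bilinear_mm]
lemmas mm_minus_left = bounded_bilinear.minus_left[OF bounded_bilinear_mm]
lemmas mm_minus_right = bounded_bilinear.minus_right[OF bounded_bilinear_mm]
lemmas mm_zero_left [simp] = bounded_bilinear.zero_left[OF bounded_bilinear_mm]
lemmas mm_zero_right [simp] = bounded_bilinear.zero_right[OF bounded_bilinear_mm]
lemmas mm_distribs = mm_diff_left mm_diff_right mm_add_left mm_add_right
  mm_minus_left mm_minus_right scaleR_mm_left scaleR_mm_right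

lemma mv_scaleR_left: "(r *\<^sub>R A) *v x = r *\<^sub>R (A *v (x :: complex ^ ('d::finite)))"
  by (simp add: vec_eq_iff matrix_vector_mult_def scaleR_sum_right)

lemma mv_scaleR_right: "A *v (r *\<^sub>R x) = r *\<^sub>R (A *v (x :: complex ^ ('d::finite)))"
  by (simp add: vec_eq_iff matrix_vector_mult_def scaleR_sum_right)

lemma bounded_bilinear_mv:
  "bounded_bilinear ((*v) :: ('d::finite) cmat \<Rightarrow> complex ^ 'd \<Rightarrow> complex ^ 'd)"
  by (rule bounded_bilinear.intro)
    (auto simp: matrix_vector_mult_add_rdistrib matrix_vector_right_distrib mv_scaleR_left
      mv_scaleR_right intro!: exI[of _ 1] norm_mv)

lemmas mv_distribs = bounded_bilinear.diff_left[OF bounded_bilinear_mv]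
  bounded_bilinear.diff_right[OF bounded_bilinear_mv]
  bounded_bilinear.add_left[OF bounded_bilinear_mv]
  bounded_bilinear.add_right[OF bounded_bilinear_mv]
  bounded_bilinear.minus_left[OF bounded_bilinear_mv]
  bounded_bilinear.minus_right[OF bounded_bilinear_mv]
  mv_scaleR_left mv_scaleR_right
lemmas continuous_on_mv [continuous_intros] =
  bounded_bilinear.continuous_on[OF bounded_bilinear_mv]

lemma matrix_eqI_mv: "(\<And>x. A *v x = B *v x) \<Longrightarrow> A = (B :: ('d::finite) cmat)"
  by (simp add: matrix_eq)

lemma invertible_if_kernel_trivial:
  assumes "\<And>x. A *v x = 0 \<Longrightarrow> x = 0"
  shows "invertible (A :: ('d::finite) cmat)"
  using assms unfolding invertible_left_inverse matrix_left_invertible_ker by blast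

lemma matrix_inv_mult:
  assumes "invertible (A :: ('d::finite) cmat)"
  shows "A ** matrix_inv A = mat 1" "matrix_inv A ** A = mat 1"
  using someI_ex[OF assms[unfolded invertible_def]] by (auto simp: matrix_inv_def)

section \<open>Self-adjoint operators on a subspace\<close>

text \<open>The form \<open>\<lambda> \<langle>x, x\<rangle> - \<langle>f x, x\<rangle>\<close>, with \<open>\<lambda>\<close> the maximum, is non-negative on \<open>M\<close> and vanishes at \<open>e\<close>. So
  its derivative at \<open>e\<close> vanishes in all directions of \<open>M\<close>, which is the eigenvalue equation.\<close>

lemma rayleigh_max_eigenvector:
  fixes f :: "'a::euclidean_space \<Rightarrow> 'a"
  assumes M: "subspace M" and f: "linear f" "f ` M \<subseteq> M"
    and sym: "\<And>x y. x \<in> M \<Longrightarrow> y \<in> M \<Longrightarrow> f x \<bullet> y = x \<bullet> f y"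
    and e: "e \<in> M" "norm e = 1"
    and max: "\<And>x. x \<in> M \<Longrightarrow> norm x = 1 \<Longrightarrow> f x \<bullet> x \<le> f e \<bullet> e"
  shows "f e = (f e \<bullet> e) *\<^sub>R e"
proof -
  define l where "l = f e \<bullet> e"
  define g where "g x = l * (x \<bullet> x) - f x \<bullet> x" for x
  have g_nonneg: "0 \<le> g x" if "x \<in> M" for x
  proof (cases "x = 0")
    case True
    then show ?thesis using linear_0[OF f(1)] by (simp add: g_def)
  next
    case False
    let ?y = "x /\<^sub>R norm x"
    have "f ?y \<bullet> ?y \<le> l"
      using that False unfolding l_def by (intro max) (auto simp: M subspace_mul)
    then have "(f x \<bullet> x) / (norm x)\<^sup>2 \<le> l"
      using False by (simp add: linear_scale[OF f(1)] power2_eq_square field_simps)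
    then show ?thesis
      using False by (simp add: g_def power2_norm_eq_inner[symmetric] field_simps)
  qed
  have orth: "(l *\<^sub>R e - f e) \<bullet> y = 0" if y: "y \<in> M" for y
  proof -
    let ?c = "(l *\<^sub>R e - f e) \<bullet> y"
    have expand: "g (e + t *\<^sub>R y) = 2 * t * ?c + t\<^sup>2 * g y" for t
    proof -
      have "f y \<bullet> e = f e \<bullet> y" using sym[OF y e(1)] by (simp add: inner_commute)
      then show ?thesis
        using e(2) unfolding g_def linear_add[OF f(1)] linear_scale[OF f(1)]
        by (simp add: inner_add_left inner_add_right inner_diff_left l_def[symmetric] norm_eq_1
            inner_commute[of y e] power2_eq_square algebra_simps)
    qed
    have pos: "0 \<le> 2 * t * ?c + t\<^sup>2 * g y" for t
      using g_nonneg[of "e + t *\<^sub>R y"] e(1) y M expand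
      by (simp add: subspace_add subspace_mul)
    have gy: "0 \<le> g y" by (rule g_nonneg[OF y])
    \<comment> \<open>This \<open>t\<close> is close to the minimiser \<open>- ?c / g y\<close> of the polynomial; adding \<open>1\<close> keeps it defined for \<open>g y = 0\<close>.\<close>
    have "0 \<le> 2 * (- ?c / (g y + 1)) * ?c + (- ?c / (g y + 1))\<^sup>2 * g y" by (rule pos)
    also have "\<dots> = ?c\<^sup>2 * (- (g y + 2)) / (g y + 1)\<^sup>2"
      using gy by (simp add: divide_simps power2_eq_square) (simp add: algebra_simps)
    finally have "?c\<^sup>2 \<le> 0"
      using gy by (simp add: zero_le_divide_iff mult_le_0_iff zero_le_mult_iff)
    then show ?thesis by simp
  qed
  have "l *\<^sub>R e - f e \<in> M"
    using e(1) f(2) M by (auto intro!: subspace_diff subspace_mul)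
  from orth[OF this] show ?thesis by (simp add: l_def)
qed

text \<open>Rayleigh quotients have maximisers on the compact unit sphere of \<open>M\<close>, and the orthogonal
  complement of an eigenvector in \<open>M\<close> is invariant: induction on the dimension.\<close>

theorem spectral_theorem_subspace:
  fixes f :: "'a::euclidean_space \<Rightarrow> 'a"
  assumes M: "subspace M" and f: "linear f" "f ` M \<subseteq> M"
    and sym: "\<And>x y. x \<in> M \<Longrightarrow> y \<in> M \<Longrightarrow> f x \<bullet> y = x \<bullet> f y"
  shows "\<exists>B. finite B \<and> B \<subseteq> M \<and> pairwise orthogonal B \<and> (\<forall>b\<in>B. norm b = 1) \<and> span B = M \<and>
    (\<forall>b\<in>B. f b = (f b \<bullet> b) *\<^sub>R b)"
  using assms
proof (induction "dim M" arbitrary: M rule: less_induct)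
  case less
  note M = less.prems(1) and fM = less.prems(3) and sym = less.prems(4)
  show ?case
  proof (cases "M = {0}")
    case True
    then show ?thesis by (intro exI[of _ "{}"]) auto
  next
    case False
    then obtain x where x: "x \<in> M" "x \<noteq> 0" using subspace_0[OF M] by auto
    have "x /\<^sub>R norm x \<in> M \<inter> sphere 0 1"
      using x M by (auto simp: subspace_mul)
    then have ne: "M \<inter> sphere 0 1 \<noteq> {}" by blast
    have cpt: "compact (M \<inter> sphere 0 1)"
      by (simp add: closed_subspace[OF M] closed_Int_compact)
    have "continuous_on (M \<inter> sphere 0 1) (\<lambda>x. f x \<bullet> x)"
      using linear_continuous_on[OF f(1)[unfolded linear_conv_bounded_linear]]
      by (intro continuous_intros) (auto intro: continuous_on_subset)
    from continuous_attains_sup[OF cpt ne this]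
    obtain e where e: "e \<in> M" "norm e = 1"
      and max: "\<And>x. x \<in> M \<Longrightarrow> norm x = 1 \<Longrightarrow> f x \<bullet> x \<le> f e \<bullet> e" by auto
    have eig: "f e = (f e \<bullet> e) *\<^sub>R e"
      by (rule rayleigh_max_eigenvector[OF M f(1) fM sym e max])
    define M' where "M' = {x \<in> M. e \<bullet> x = 0}"
    have M': "subspace M'"
      using M by (auto simp: M'_def subspace_def inner_add_right)
    have sub: "M' \<subset> M"
    proof -
      have "e \<notin> M'" using e(2) by (simp add: M'_def norm_eq_1)
      moreover have "M' \<subseteq> M" by (auto simp: M'_def)
      ultimately show ?thesis using e(1) by blast
    qed
    have dim: "dim M' < dim M"
      using sub M M' by (metis dim_psubset span_eq_iff)
    have fM': "f ` M' \<subseteq> M'"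
    proof
      fix y assume "y \<in> f ` M'"
      then obtain z where z: "z \<in> M" "e \<bullet> z = 0" "y = f z" by (auto simp: M'_def)
      have "e \<bullet> f z = f e \<bullet> z" using sym[OF e(1) z(1)] by simp
      also have "\<dots> = 0" by (subst eig) (simp add: z)
      finally show "y \<in> M'" using z fM by (auto simp: M'_def)
    qed
    have "\<exists>B. finite B \<and> B \<subseteq> M' \<and> pairwise orthogonal B \<and> (\<forall>b\<in>B. norm b = 1) \<and> span B = M' \<and>
      (\<forall>b\<in>B. f b = (f b \<bullet> b) *\<^sub>R b)"
      using sym by (intro less.hyps[OF dim M' f(1) fM']) (auto simp: M'_def)
    then obtain B where B: "finite B" "B \<subseteq> M'" "pairwise orthogonal B" "\<forall>b\<in>B. norm b = 1"
      "span B = M'" "\<forall>b\<in>B. f b = (f b \<bullet> b) *\<^sub>R b" by blast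
    have "pairwise orthogonal (insert e B)"
      using B(2,3) by (auto simp: pairwise_insert M'_def orthogonal_def inner_commute)
    moreover have "span (insert e B) = M"
    proof
      show "span (insert e B) \<subseteq> M"
        using B(2) e(1) M by (intro span_minimal) (auto simp: M'_def)
      show "M \<subseteq> span (insert e B)"
      proof
        fix x assume "x \<in> M"
        then have "x - (e \<bullet> x) *\<^sub>R e \<in> M'"
          using e M by (auto simp: M'_def subspace_diff subspace_mul inner_diff_right norm_eq_1)
        then have "x - (e \<bullet> x) *\<^sub>R e \<in> span B" using B(5) by simp
        then show "x \<in> span (insert e B)" by (auto simp: span_insert)
      qed
    qed
    ultimately show ?thesis
      using B e eig sub by (intro exI[of _ "insert e B"]) auto
  qed
qed

lemma orthonormal_expansion:
  fixes B :: "'a::euclidean_space set"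
  assumes "finite B" "pairwise orthogonal B" "\<And>b. b \<in> B \<Longrightarrow> norm b = 1" "x \<in> span B"
  shows "x = (\<Sum>b\<in>B. (x \<bullet> b) *\<^sub>R b)"
  using orthonormal_basis_expand[of B x] assms by simp

lemma orthonormal_parseval:
  fixes B :: "'a::euclidean_space set"
  assumes "finite B" "pairwise orthogonal B" "\<And>b. b \<in> B \<Longrightarrow> norm b = 1" "x \<in> span B"
  shows "x \<bullet> y = (\<Sum>b\<in>B. (x \<bullet> b) * (y \<bullet> b))"
  by (subst orthonormal_expansion[OF assms]) (simp_all add: inner_sum_left inner_commute[of y])

definition psd_on :: "('a::euclidean_space) set \<Rightarrow> ('a \<Rightarrow> 'a) \<Rightarrow> bool" where
  "psd_on M f \<longleftrightarrow> linear f \<and> f ` M \<subseteq> M \<and> (\<forall>X\<in>M. \<forall>Y\<in>M. f X \<bullet> Y = X \<bullet> f Y) \<and> (\<forall>X\<in>M. 0 \<le> f X \<bullet> X)"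

lemma psd_on_sqrt_exists:
  fixes f :: "'a::euclidean_space \<Rightarrow> 'a"
  assumes M: "subspace M" and f: "psd_on M f"
  shows "\<exists>g. psd_on M g \<and> (\<forall>X\<in>M. g (g X) = f X)"
proof -
  from spectral_theorem_subspace[OF M, of f] f
  obtain B where B: "finite B" "B \<subseteq> M" "pairwise orthogonal B" "\<And>b. b \<in> B \<Longrightarrow> norm b = 1"
    "span B = M" "\<And>b. b \<in> B \<Longrightarrow> f b = (f b \<bullet> b) *\<^sub>R b" by (auto simp: psd_on_def)
  define g where "g x = (\<Sum>b\<in>B. (sqrt (f b \<bullet> b) * (x \<bullet> b)) *\<^sub>R b)" for x
  have lin: "linear g"
    by (rule linearI) (simp_all add: g_def inner_add_left algebra_simps sum.distrib scaleR_sum_right)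
  have gb: "g b = sqrt (f b \<bullet> b) *\<^sub>R b" if "b \<in> B" for b
  proof -
    have "g b = (\<Sum>c\<in>B. if c = b then sqrt (f b \<bullet> b) *\<^sub>R b else 0)"
      unfolding g_def using that B(3,4)
      by (intro sum.cong) (auto simp: pairwise_def orthogonal_def norm_eq_1)
    then show ?thesis using that B(1) by simp
  qed
  have sq: "g (g x) = f x" if x: "x \<in> M" for x
  proof -
    have "g (g b) = f b" if "b \<in> B" for b
    proof -
      have "0 \<le> f b \<bullet> b" using f B(2) that by (auto simp: psd_on_def)
      then have "g (g b) = (f b \<bullet> b) *\<^sub>R b" by (simp add: gb[OF that] linear_scale[OF lin])
      then show ?thesis using B(6)[OF that] by simp
    qed
    then have "(g \<circ> g) b = f b" if "b \<in> B" for b using that by simp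
    moreover have "linear (g \<circ> g)" using lin by (rule linear_compose) (rule lin)
    moreover have "linear f" using f by (simp add: psd_on_def)
    ultimately have "(g \<circ> g) x = f x"
      using x B(5) linear_eq_on_span[of "g \<circ> g" f B x] by blast
    then show ?thesis by simp
  qed
  have "psd_on M g"
    unfolding psd_on_def
  proof (intro conjI ballI)
    show "linear g" by (rule lin)
    show "g ` M \<subseteq> M" using B(1,2) M unfolding g_def
      by (auto intro!: subspace_sum subspace_mul)
    show "g X \<bullet> Y = X \<bullet> g Y" for X Y
      unfolding g_def inner_sum_left inner_sum_right
      by (intro sum.cong refl) (simp add: inner_commute[of _ Y])
    show "0 \<le> g X \<bullet> X" if "X \<in> M" for X
    proof -
      have "g X \<bullet> X = (\<Sum>b\<in>B. sqrt (f b \<bullet> b) * (X \<bullet> b)\<^sup>2)"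
        unfolding g_def inner_sum_left
        by (intro sum.cong refl) (simp add: inner_commute[of _ X] power2_eq_square)
      also have "\<dots> \<ge> 0" using f B(2) by (intro sum_nonneg) (auto simp: psd_on_def)
      finally show ?thesis .
    qed
  qed
  with sq show ?thesis by blast
qed

text \<open>At a unit eigenvector \<open>e\<close> of \<open>D = B1 - B2\<close> with eigenvalue \<open>\<mu>\<close> one has
  \<open>\<langle>(B1\<^sup>2 - B2\<^sup>2) e, e\<rangle> = \<mu> \<langle>(B1 + B2) e, e\<rangle>\<close>, and \<open>\<bar>\<mu>\<bar> \<le> \<langle>(B1 + B2) e, e\<rangle>\<close>. So the square root of
  positive semi-definite operators is Hoelder continuous of order \<open>1/2\<close>, with no lower bound on
  the spectrum.\<close>

lemma psd_on_sqrt_hoelder: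
  fixes B1 B2 :: "'a::euclidean_space \<Rightarrow> 'a"
  assumes M: "subspace M" and B1: "psd_on M B1" and B2: "psd_on M B2"
    and c: "\<And>x. x \<in> M \<Longrightarrow> norm (B1 (B1 x) - B2 (B2 x)) \<le> c * norm x"
    and x: "x \<in> M"
  shows "norm (B1 x - B2 x) \<le> sqrt c * norm x"
proof -
  define D where "D x = B1 x - B2 x" for x
  note b1 = B1[unfolded psd_on_def] and b2 = B2[unfolded psd_on_def]
  have lin: "linear D" using b1 b2 unfolding D_def by (intro linear_compose_sub) auto
  have inv: "D ` M \<subseteq> M" using b1 b2 M unfolding D_def by (auto intro!: subspace_diff)
  have sym: "D x \<bullet> y = x \<bullet> D y" if "x \<in> M" "y \<in> M" for x y
    using b1 b2 that by (simp add: D_def inner_diff_left inner_diff_right)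
  from spectral_theorem_subspace[OF M lin inv sym]
  obtain E where E: "finite E" "E \<subseteq> M" "pairwise orthogonal E" "\<And>b. b \<in> E \<Longrightarrow> norm b = 1"
    "span E = M" "\<And>b. b \<in> E \<Longrightarrow> D b = (D b \<bullet> b) *\<^sub>R b" by blast
  have eig: "(D e \<bullet> e)\<^sup>2 \<le> c" if e: "e \<in> E" for e
  proof -
    let ?\<mu> = "D e \<bullet> e" and ?p = "B1 e \<bullet> e" and ?q = "B2 e \<bullet> e"
    have eM: "e \<in> M" using e E by auto
    have "(B1 (B1 e) - B2 (B2 e)) \<bullet> e = B1 (D e) \<bullet> e + D (B2 e) \<bullet> e"
      using b1 by (simp add: D_def linear_diff inner_diff_left)
    also have "\<dots> = ?\<mu> * ?p + ?\<mu> * ?q"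
    proof -
      have "B1 (D e) \<bullet> e = ?\<mu> * ?p"
        by (subst E(6)[OF e]) (use b1 in \<open>simp add: linear_scale\<close>)
      moreover have "D (B2 e) \<bullet> e = B2 e \<bullet> D e" using b2 eM by (intro sym) auto
      moreover have "B2 e \<bullet> D e = ?\<mu> * ?q" by (subst E(6)[OF e]) simp
      ultimately show ?thesis by simp
    qed
    finally have "?\<mu> * (?p + ?q) \<le> c" "- (?\<mu> * (?p + ?q)) \<le> c"
      using c[OF eM] E(4)[OF e] Cauchy_Schwarz_ineq2[of "B1 (B1 e) - B2 (B2 e)" e]
      by (auto simp: algebra_simps)
    moreover have "0 \<le> ?p" "0 \<le> ?q" using b1 b2 eM by auto
    then have "\<bar>?\<mu>\<bar> \<le> ?p + ?q" unfolding D_def inner_diff_left by arith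
    then have "\<bar>?\<mu>\<bar> * \<bar>?\<mu>\<bar> \<le> \<bar>?\<mu>\<bar> * (?p + ?q)" by (intro mult_left_mono) auto
    ultimately show ?thesis by (auto simp: power2_eq_square abs_if split: if_splits)
  qed
  have Dx: "D x \<in> span E" and x': "x \<in> span E" using x inv E(5) by auto
  have coef: "D x \<bullet> e = (D e \<bullet> e) * (x \<bullet> e)" if "e \<in> E" for e
  proof -
    have "D x \<bullet> e = x \<bullet> D e" using that E x by (intro sym) auto
    also have "\<dots> = (D e \<bullet> e) * (x \<bullet> e)" by (subst E(6)[OF that]) simp
    finally show ?thesis .
  qed
  have "(norm (D x))\<^sup>2 = (\<Sum>e\<in>E. (D e \<bullet> e)\<^sup>2 * (x \<bullet> e)\<^sup>2)"
    unfolding power2_norm_eq_inner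
    by (subst orthonormal_parseval[OF E(1,3,4) Dx])
      (auto simp: coef power2_eq_square mult_ac)
  also have "\<dots> \<le> (\<Sum>e\<in>E. c * (x \<bullet> e)\<^sup>2)"
    by (intro sum_mono mult_right_mono eig) auto
  also have "\<dots> = c * (norm x)\<^sup>2"
  proof -
    have "(norm x)\<^sup>2 = (\<Sum>e\<in>E. (x \<bullet> e)\<^sup>2)"
      unfolding power2_norm_eq_inner unfolding power2_eq_square
      by (rule orthonormal_parseval[OF E(1,3,4) x'])
    then show ?thesis by (simp add: sum_distrib_left)
  qed
  finally have "sqrt ((norm (D x))\<^sup>2) \<le> sqrt (c * (norm x)\<^sup>2)" by (rule real_sqrt_le_mono)
  then show ?thesis by (simp add: D_def real_sqrt_mult)
qed

section \<open>The kernel s / (u^2 + s)\<close>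

lemma has_bochner_integral_cauchy_kernel:
  assumes "0 \<le> s"
  shows "has_bochner_integral lborel (\<lambda>u::real. s / (u\<^sup>2 + s)) (pi * sqrt s)"
proof (cases "s = 0")
  case True
  then show ?thesis by (simp add: has_bochner_integral_zero)
next
  case False
  with assms have s: "0 < s" by simp
  have std: "has_bochner_integral lborel (\<lambda>u::real. inverse (1 + u\<^sup>2)) pi"
    using integrable_inverse_1_plus_square LBINT_inverse_1_plus_square
    by (simp add: has_bochner_integral_iff set_integrable_def interval_lebesgue_integral_def
        set_lebesgue_integral_def)
  have "has_bochner_integral lborel (\<lambda>u::real. inverse (1 + (0 + (1 / sqrt s) * u)\<^sup>2)) (pi /\<^sub>R \<bar>1 / sqrt s\<bar>)"
    using s std by (subst lborel_has_bochner_integral_real_affine_iff[symmetric]) auto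
  moreover have "inverse (1 + (0 + (1 / sqrt s) * u)\<^sup>2) = s / (u\<^sup>2 + s)" for u
    using s by (simp add: power_divide field_simps)
  ultimately show ?thesis
    using s by (simp add: mult.commute)
qed

lemma kernel_le_1: "0 \<le> s \<Longrightarrow> s / (u\<^sup>2 + s) \<le> (1::real)"
  using zero_le_power2[of u] by (auto simp: divide_le_eq_1 less_le)

text \<open>All estimates for integrals of resolvents go through this bound. The point \<open>u = 0\<close>, at which the
  resolvent of a singular matrix does not exist, is a null set.\<close>

lemma integral_kernel_bound:
  fixes f :: "real \<Rightarrow> 'a::{banach, second_countable_topology}"
  assumes s: "0 \<le> s" and meas: "f \<in> borel_measurable lborel"
    and bound: "\<And>u. u \<noteq> 0 \<Longrightarrow> norm (f u) \<le> c * (s / (u\<^sup>2 + s))"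
  shows "integrable lborel f" "norm ((1 / pi) *\<^sub>R (\<integral>u. f u \<partial>lborel)) \<le> c * sqrt s"
proof -
  note k = has_bochner_integral_mult_right[OF has_bochner_integral_cauchy_kernel[OF s], of c]
  have ae: "AE u in lborel. norm (f u) \<le> c * (s / (u\<^sup>2 + s))"
    using AE_lborel_singleton[of "0::real"] bound by (auto elim!: eventually_mono)
  have "integrable lborel (\<lambda>u. c * (s / (u\<^sup>2 + s)))"
    using k by (rule integrable.intros)
  from this meas show int: "integrable lborel f"
    by (rule Bochner_Integration.integrable_bound)
      (use ae in \<open>auto elim!: eventually_mono simp del: times_divide_eq_right intro: order_trans[OF _ abs_ge_self]\<close>)
  have "norm (\<integral>u. f u \<partial>lborel) \<le> (\<integral>u. norm (f u) \<partial>lborel)"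
    by (rule integral_norm_bound)
  also have "\<dots> \<le> (\<integral>u. c * (s / (u\<^sup>2 + s)) \<partial>lborel)"
    by (rule integral_mono_AE[OF integrable_norm[OF int] integrable.intros[OF k] ae])
  also have "\<dots> = c * (pi * sqrt s)"
    using k by (rule has_bochner_integral_integral_eq)
  finally show "norm ((1 / pi) *\<^sub>R (\<integral>u. f u \<partial>lborel)) \<le> c * sqrt s"
    by (simp add: field_simps)
qed

section \<open>Positive definite matrices\<close>

text \<open>All eigenvalues of \<open>Q\<close> are at least \<open>q\<close>.\<close>

definition pd_ge :: "real \<Rightarrow> ('d::finite) cmat \<Rightarrow> bool" where
  "pd_ge q Q \<longleftrightarrow> Q \<in> hermitian \<and> (\<forall>v. q * (norm v)\<^sup>2 \<le> v \<bullet> (Q *v v))"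

lemma pd_ge_imp_pd: "0 < q \<Longrightarrow> pd_ge q Q \<Longrightarrow> Q \<in> pd"
  unfolding pd_ge_def pd_def
proof (intro CollectI conjI allI impI)
  fix v :: "complex ^ 'a"
  assume "0 < q" "Q \<in> hermitian \<and> (\<forall>v. q * (norm v)\<^sup>2 \<le> v \<bullet> (Q *v v))" "v \<noteq> 0"
  then show "0 < v \<bullet> (Q *v v)" by (auto intro: less_le_trans[of 0 "q * (norm v)\<^sup>2"])
qed auto

lemma pd_imp_psd: "Q \<in> pd \<Longrightarrow> Q \<in> psd"
  unfolding pd_def psd_def by (auto simp: less_imp_le) (metis inner_zero_left less_imp_le order_refl)

lemma psd_hermitian: "Q \<in> psd \<Longrightarrow> Q \<in> hermitian"
  by (simp add: psd_def)

lemma psdD: "Q \<in> psd \<Longrightarrow> 0 \<le> v \<bullet> (Q *v v)"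
  by (simp add: psd_def)

lemma pd_hermitian: "Q \<in> pd \<Longrightarrow> Q \<in> hermitian"
  by (simp add: pd_def)

lemma hermitian_adj: "Q \<in> hermitian \<Longrightarrow> adj Q = Q"
  by (simp add: hermitian_iff_adj)

lemma mat_1_pd: "mat 1 \<in> (pd :: ('d::finite) cmat set)"
  by (simp add: pd_def hermitian_iff_adj)

lemma pd_imp_pd_ge:
  assumes "(Q :: ('d::finite) cmat) \<in> pd"
  shows "\<exists>q>0. pd_ge q Q"
proof -
  let ?S = "sphere (0 :: complex ^ 'd) 1"
  have ne: "?S \<noteq> {}" by simp
  have "continuous_on ?S (\<lambda>v. v \<bullet> (Q *v v))" by (intro continuous_intros)
  from continuous_attains_inf[OF compact_sphere ne this]
  obtain e where e: "norm e = 1" and min: "\<And>v. norm v = 1 \<Longrightarrow> e \<bullet> (Q *v e) \<le> v \<bullet> (Q *v v)"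
    by (auto simp: dist_norm)
  define q where "q = e \<bullet> (Q *v e)"
  have "e \<noteq> 0" using e by auto
  then have q: "0 < q" using assms by (auto simp: q_def pd_def)
  have "q * (norm v)\<^sup>2 \<le> v \<bullet> (Q *v v)" for v
  proof (cases "v = 0")
    case False
    have "q \<le> (v /\<^sub>R norm v) \<bullet> (Q *v (v /\<^sub>R norm v))"
      unfolding q_def using False by (intro min) simp
    then show ?thesis
      using False by (simp add: mv_scaleR_right power2_eq_square field_simps)
  qed simp
  then show ?thesis using q assms by (auto simp: pd_ge_def pd_def)
qed

lemma pd_ge_perturb:
  assumes "pd_ge q Q" "R \<in> hermitian" "norm (R - Q) \<le> \<delta>"
  shows "pd_ge (q - \<delta>) (R :: ('d::finite) cmat)"
proof -
  have "(q - \<delta>) * (norm v)\<^sup>2 \<le> v \<bullet> (R *v v)" for v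
  proof -
    have "\<bar>v \<bullet> ((R - Q) *v v)\<bar> \<le> norm v * norm ((R - Q) *v v)"
      by (rule Cauchy_Schwarz_ineq2)
    also have "\<dots> \<le> norm v * (norm (R - Q) * norm v)"
      by (intro mult_left_mono norm_mv) auto
    also have "\<dots> \<le> norm v * (\<delta> * norm v)"
      using assms(3) by (intro mult_left_mono mult_right_mono) auto
    finally have "- (\<delta> * (norm v)\<^sup>2) \<le> v \<bullet> (R *v v) - v \<bullet> (Q *v v)"
      by (simp add: mv_distribs inner_diff_right power2_eq_square mult_ac)
    moreover have "q * (norm v)\<^sup>2 \<le> v \<bullet> (Q *v v)" using assms(1) by (simp add: pd_ge_def)
    ultimately show ?thesis by (simp add: algebra_simps)
  qed
  then show ?thesis using assms(2) by (simp add: pd_ge_def)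
qed

lemma pd_invertible: "Q \<in> pd \<Longrightarrow> invertible (Q :: ('d::finite) cmat)"
  by (rule invertible_if_kernel_trivial) (force simp: pd_def)

lemma psd_scaleR: "A \<in> psd \<Longrightarrow> 0 \<le> r \<Longrightarrow> r *\<^sub>R A \<in> (psd :: ('d::finite) cmat set)"
  by (simp add: psd_def hermitian_iff_adj adj_scaleR mv_distribs)

lemma pd_psd_add: "A \<in> pd \<Longrightarrow> B \<in> psd \<Longrightarrow> A + B \<in> (pd :: ('d::finite) cmat set)"
  by (simp add: psd_def pd_def hermitian_iff_adj adj_add mv_distribs inner_add_right add_pos_nonneg)

lemma pd_scaleR: "A \<in> pd \<Longrightarrow> 0 < r \<Longrightarrow> r *\<^sub>R A \<in> (pd :: ('d::finite) cmat set)"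
  by (simp add: pd_def hermitian_iff_adj adj_scaleR mv_distribs)

lemma psd_congruence: "S \<in> psd \<Longrightarrow> adj C ** S ** C \<in> (psd :: ('d::finite) cmat set)"
  by (simp add: psd_def hermitian_iff_adj adj_mult matrix_mul_assoc
      matrix_vector_mul_assoc[symmetric] inner_mv_adj[of _ "adj C"])

lemma closed_psd: "closed (psd :: ('d::finite) cmat set)"
proof -
  have "psd = hermitian \<inter> (\<Inter>v. {A :: 'd cmat. 0 \<le> v \<bullet> (A *v v)})"
    by (auto simp: psd_def)
  moreover have "closed {A :: 'd cmat. 0 \<le> v \<bullet> (A *v v)}" for v
    by (intro closed_Collect_le continuous_intros)
  ultimately show ?thesis
    using closed_hermitian by (metis (no_types, lifting) closed_INT closed_Int)
qed

section \<open>The resolvent\<close>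

text \<open>For invertible \<open>S\<close> this is \<open>(u\<^sup>2 S\<^sup>-\<^sup>1 + Q)\<^sup>-\<^sup>1\<close>. Written as below it makes sense for
  singular \<open>S\<close> too, and all estimates hold uniformly in \<open>S\<close>.\<close>

definition res :: "real \<Rightarrow> ('d::finite) cmat \<Rightarrow> 'd cmat \<Rightarrow> 'd cmat" where
  "res u Q S = matrix_inv (u\<^sup>2 *\<^sub>R mat 1 + S ** Q) ** S"

text \<open>The argument of type \<open>itself\<close> carries the dimension, whose appearance comes from the comparison
  of the Frobenius norm with the operator norm. \<open>q\<close> stands for a lower bound on the eigenvalues of
  \<open>Q\<close> and \<open>K\<close> for a bound on its norm.\<close>

definition res_const :: "'d::finite itself \<Rightarrow> real \<Rightarrow> real \<Rightarrow> real" where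
  "res_const _ q K = real CARD('d) * (1 + (1 + K) / q)"

context
  fixes u :: real and Q S :: "('d::finite) cmat"
  assumes u: "u \<noteq> 0" and Q: "Q \<in> pd" and S: "S \<in> psd"
begin

lemma res_invertible: "invertible (u\<^sup>2 *\<^sub>R mat 1 + S ** Q)"
proof (rule invertible_if_kernel_trivial)
  fix x assume "(u\<^sup>2 *\<^sub>R mat 1 + S ** Q) *v x = 0"
  then have "u\<^sup>2 *\<^sub>R x + S *v (Q *v x) = 0"
    by (simp add: mv_distribs matrix_vector_mul_assoc)
  then have "(Q *v x) \<bullet> (u\<^sup>2 *\<^sub>R x + S *v (Q *v x)) = 0" by simp
  then have "u\<^sup>2 * (x \<bullet> (Q *v x)) + (Q *v x) \<bullet> (S *v (Q *v x)) = 0"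
    by (simp add: inner_add_right inner_commute)
  moreover have "0 \<le> (Q *v x) \<bullet> (S *v (Q *v x))" by (rule psdD[OF S])
  ultimately have "u\<^sup>2 * (x \<bullet> (Q *v x)) \<le> 0" by simp
  then have "x \<bullet> (Q *v x) \<le> 0" using u by (simp add: mult_le_0_iff)
  then show "x = 0" using Q by (auto simp: pd_def)
qed

lemma res_unique:
  assumes "u\<^sup>2 *\<^sub>R R + S ** Q ** R = S"
  shows "R = res u Q S"
proof -
  have "(u\<^sup>2 *\<^sub>R mat 1 + S ** Q) ** R = S"
    using assms by (simp add: mm_distribs)
  then have "res u Q S = matrix_inv (u\<^sup>2 *\<^sub>R mat 1 + S ** Q) ** (u\<^sup>2 *\<^sub>R mat 1 + S ** Q) ** R"
    by (simp add: res_def matrix_mul_assoc[symmetric])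
  then show ?thesis by (simp add: matrix_inv_mult[OF res_invertible])
qed

lemma res_eq: "u\<^sup>2 *\<^sub>R res u Q S + S ** Q ** res u Q S = S"
proof -
  have "(u\<^sup>2 *\<^sub>R mat 1 + S ** Q) ** res u Q S = S"
    by (simp add: res_def matrix_mul_assoc matrix_inv_mult[OF res_invertible])
  then show ?thesis by (simp add: mm_distribs)
qed

text \<open>\<open>(u\<^sup>2 + S Q) S = S (u\<^sup>2 + Q S)\<close>, so the inverses can be moved from one side of \<open>S\<close> to the other.\<close>

lemma res_hermitian: "res u Q S \<in> hermitian"
proof -
  let ?A = "u\<^sup>2 *\<^sub>R mat 1 + S ** Q"
  let ?N = "matrix_inv ?A"
  have sa: "adj S = S" "adj Q = Q"
    using S Q by (auto intro: hermitian_adj psd_hermitian pd_hermitian)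
  have "adj ?A ** adj ?N = mat 1"
    unfolding adj_mult[symmetric] by (simp add: matrix_inv_mult[OF res_invertible])
  then have "?N ** S = ?N ** S ** (adj ?A ** adj ?N)" by simp
  also have "\<dots> = ?N ** (S ** adj ?A) ** adj ?N" by (simp only: matrix_mul_assoc)
  also have "S ** adj ?A = ?A ** S"
    by (simp add: adj_add adj_scaleR adj_mult sa mm_distribs matrix_mul_assoc)
  also have "?N ** (?A ** S) ** adj ?N = (?N ** ?A) ** S ** adj ?N" by (simp only: matrix_mul_assoc)
  also have "\<dots> = S ** adj ?N" by (simp add: matrix_inv_mult[OF res_invertible])
  finally show ?thesis by (simp add: hermitian_iff_adj res_def adj_mult sa)
qed

text \<open>With \<open>z = v - Q w\<close> one has \<open>u\<^sup>2 w = S z\<close>, hence \<open>\<langle>w, z\<rangle> \<ge> 0\<close>. Positivity of the resolvent and both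
  bounds on its norm are consequences.\<close>

lemma res_vector:
  fixes v defines "w \<equiv> res u Q S *v v"
  shows "u\<^sup>2 *\<^sub>R w = S *v (v - Q *v w)" "w \<bullet> (Q *v w) \<le> w \<bullet> v"
proof -
  have "(u\<^sup>2 *\<^sub>R res u Q S + S ** Q ** res u Q S) *v v = S *v v" by (simp add: res_eq)
  then show 1: "u\<^sup>2 *\<^sub>R w = S *v (v - Q *v w)"
    by (simp add: w_def mv_distribs matrix_vector_mul_assoc[symmetric] algebra_simps)
  let ?z = "v - Q *v w"
  have "u\<^sup>2 * (w \<bullet> ?z) = ?z \<bullet> (S *v ?z)"
    unfolding 1[symmetric] by (simp add: inner_commute)
  then have "0 \<le> u\<^sup>2 * (w \<bullet> ?z)" using psdD[OF S] by simp
  then have "0 \<le> w \<bullet> ?z" using u by (simp add: zero_le_mult_iff)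
  then show "w \<bullet> (Q *v w) \<le> w \<bullet> v" by (simp add: inner_diff_right)
qed

lemma res_psd: "res u Q S \<in> psd"
  unfolding psd_def
proof (intro CollectI conjI allI res_hermitian)
  fix v
  have "0 \<le> (res u Q S *v v) \<bullet> (Q *v (res u Q S *v v))"
    by (rule psdD[OF pd_imp_psd[OF Q]])
  then show "0 \<le> v \<bullet> (res u Q S *v v)"
    using res_vector(2)[of v] by (simp add: inner_commute)
qed

text \<open>Let \<open>w\<close> be the image of \<open>v\<close>. From \<open>q \<bar>w\<bar>\<^sup>2 \<le> \<langle>w, Q w\<rangle> \<le> \<langle>w, v\<rangle>\<close> one gets \<open>\<bar>w\<bar> \<le> \<bar>v\<bar> / q\<close>, and from
  \<open>u\<^sup>2 w = S (v - Q w)\<close> a bound on \<open>u\<^sup>2 \<bar>w\<bar>\<close>. Adding \<open>norm S\<close> times the first to the second gives the kernel.\<close>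

lemma res_norm:
  assumes q: "0 < q" "pd_ge q Q" and K: "norm Q \<le> K"
  shows "norm (res u Q S) \<le> res_const TYPE('d) q K * (norm S / (u\<^sup>2 + norm S))"
proof -
  have "norm (res u Q S *v v) \<le> (1 + (1 + K) / q) * (norm S / (u\<^sup>2 + norm S)) * norm v" for v
  proof -
    define w where "w = res u Q S *v v"
    have K0: "0 \<le> K" using K norm_ge_zero order_trans by blast
    have "q * (norm w)\<^sup>2 \<le> w \<bullet> (Q *v w)" using q(2) by (simp add: pd_ge_def)
    also have "\<dots> \<le> w \<bullet> v" unfolding w_def by (rule res_vector)
    also have "\<dots> \<le> norm w * norm v" by (rule norm_cauchy_schwarz)
    finally have "q * norm w * norm w \<le> norm v * norm w"
      by (simp add: power2_eq_square mult_ac)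
    then have "q * norm w \<le> norm v" by (cases "w = 0") auto
    then have w: "norm w \<le> norm v / q" using q(1) by (simp add: field_simps)
    have "norm (v - Q *v w) \<le> norm v + K * (norm v / q)"
    proof (rule order_trans[OF norm_triangle_ineq4])
      have "norm (Q *v w) \<le> norm Q * norm w" by (rule norm_mv)
      also have "\<dots> \<le> K * (norm v / q)" using K w K0 by (intro mult_mono) auto
      finally show "norm v + norm (Q *v w) \<le> norm v + K * (norm v / q)" by simp
    qed
    then have "norm S * norm (v - Q *v w) \<le> norm S * (norm v + K * (norm v / q))"
      by (rule mult_left_mono) simp
    moreover have "u\<^sup>2 * norm w \<le> norm S * norm (v - Q *v w)"
      using norm_mv[of S "v - Q *v w"] res_vector(1)[of v] unfolding w_def[symmetric]
      by (metis abs_of_nonneg norm_scaleR zero_le_power2)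
    moreover have "norm S * norm w \<le> norm S * (norm v / q)"
      using w by (intro mult_left_mono) auto
    ultimately have "(u\<^sup>2 + norm S) * norm w \<le> norm S * (norm v + K * (norm v / q)) + norm S * (norm v / q)"
      by (simp add: distrib_right)
    also have "\<dots> = norm S * ((1 + (1 + K) / q) * norm v)"
      by (simp add: add_divide_distrib algebra_simps)
    finally have "(u\<^sup>2 + norm S) * norm w \<le> norm S * ((1 + (1 + K) / q) * norm v)" .
    moreover have "0 < u\<^sup>2 + norm S" using u by (simp add: add_pos_nonneg)
    ultimately have "norm w \<le> norm S * ((1 + (1 + K) / q) * norm v) / (u\<^sup>2 + norm S)"
      by (simp add: pos_le_divide_eq mult.commute)
    then show ?thesis by (simp add: w_def mult_ac)
  qed
  then have "norm (res u Q S) \<le> (1 + (1 + K) / q) * (norm S / (u\<^sup>2 + norm S)) * real CARD('d)"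
    using order_trans[OF norm_ge_zero K] q(1)
    by (intro norm_matrix_le_of_mv)
      (auto intro!: mult_nonneg_nonneg divide_nonneg_nonneg add_nonneg_nonneg)
  then show ?thesis by (simp add: res_const_def mult_ac)
qed

lemma res_pd:
  assumes S': "S \<in> pd"
  shows "res u Q S \<in> pd"
  unfolding pd_def
proof (intro CollectI conjI allI impI res_hermitian)
  fix v :: "complex ^ 'd" assume v: "v \<noteq> 0"
  let ?w = "res u Q S *v v"
  have "?w \<noteq> 0"
  proof
    assume "?w = 0"
    then have "S *v v = 0" using res_vector(1)[of v] by simp
    then have "v \<bullet> (S *v v) = 0" by simp
    then show False using S' v by (auto simp: pd_def)
  qed
  then have "0 < ?w \<bullet> (Q *v ?w)" using Q by (simp add: pd_def)
  then show "0 < v \<bullet> ?w" using res_vector(2)[of v] by (simp add: inner_commute)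
qed

lemma res_eigenvector:
  assumes Q1: "Q = mat 1" and e: "S *v e = l *\<^sub>R e" and l: "0 \<le> l"
  shows "res u Q S *v e = (l / (u\<^sup>2 + l)) *\<^sub>R e"
proof -
  let ?A = "u\<^sup>2 *\<^sub>R mat 1 + S ** Q"
  have pos: "u\<^sup>2 + l \<noteq> 0" using u l by (metis add_nonneg_eq_0_iff zero_eq_power2 zero_le_power2)
  have "?A *v e = (u\<^sup>2 + l) *\<^sub>R e"
    using e by (simp add: Q1 mv_distribs scaleR_left_distrib)
  then have "matrix_inv ?A *v (?A *v e) = (u\<^sup>2 + l) *\<^sub>R (matrix_inv ?A *v e)"
    by (simp add: mv_scaleR_right)
  then have "e = (u\<^sup>2 + l) *\<^sub>R (matrix_inv ?A *v e)"
    by (simp add: matrix_vector_mul_assoc matrix_inv_mult[OF res_invertible])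
  then have "(1 / (u\<^sup>2 + l)) *\<^sub>R e = matrix_inv ?A *v e"
    using pos by (metis (no_types, lifting) nonzero_eq_divide_eq scaleR_one scaleR_scaleR)
  then have "(l / (u\<^sup>2 + l)) *\<^sub>R e = l *\<^sub>R (matrix_inv ?A *v e)"
    by (metis mult.commute mult_1 scaleR_scaleR times_divide_eq_left)
  also have "\<dots> = matrix_inv ?A *v (S *v e)" by (simp add: e mv_scaleR_right)
  finally show ?thesis by (simp add: res_def matrix_vector_mul_assoc)
qed

end

text \<open>The resolvent identity. It is the only source of differentiability in \<open>Q\<close>.\<close>

lemma res_diff:
  assumes u: "u \<noteq> 0" and Q: "Q \<in> pd" and Q': "Q' \<in> pd" and S: "S \<in> psd"
  shows "res u Q' S - res u Q S = res u Q' S ** (Q - Q') ** res u Q (S :: ('d::finite) cmat)"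
proof -
  let ?A = "u\<^sup>2 *\<^sub>R mat 1 + S ** Q'"
  have "?A ** (res u Q' S - res u Q S) = S ** (Q - Q') ** res u Q S"
    using res_eq[OF u Q' S] res_eq[OF u Q S]
    by (simp add: mm_distribs) (simp add: algebra_simps)
  then have "matrix_inv ?A ** ?A ** (res u Q' S - res u Q S)
      = matrix_inv ?A ** (S ** (Q - Q') ** res u Q S)"
    by (metis matrix_mul_assoc)
  then show ?thesis
    by (simp add: res_def[of u Q'] matrix_inv_mult[OF res_invertible[OF u Q' S]]
      matrix_mul_assoc mm_diff_left mm_diff_right)
qed

text \<open>Continuity in \<open>u\<close> makes the integrals over \<open>u\<close> meaningful. It comes from the resolvent identity in
  \<open>u\<close>, in which the inverse of \<open>u\<^sup>2 + S Q\<close> is expressed as \<open>u\<^sup>-\<^sup>2 (1 - r Q)\<close> through the resolvent \<open>r\<close> itself.\<close>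

lemma res_continuous:
  assumes Q: "Q \<in> pd" and S: "(S :: ('d::finite) cmat) \<in> psd"
  shows "continuous_on (- {0}) (\<lambda>u. res u Q S)"
proof (rule continuous_at_imp_continuous_on, rule ballI)
  fix v :: real assume "v \<in> - {0}"
  then have v: "v \<noteq> 0" by simp
  obtain q where q: "0 < q" "pd_ge q Q" using pd_imp_pd_ge[OF Q] by blast
  define \<kappa> where "\<kappa> = res_const TYPE('d) q (norm Q)"
  have \<kappa>: "norm (res u Q S) \<le> \<kappa>" if "u \<noteq> 0" for u
  proof -
    have "norm (res u Q S) \<le> \<kappa> * (norm S / (u\<^sup>2 + norm S))"
      unfolding \<kappa>_def by (rule res_norm[OF that Q S q]) simp
    also have "\<dots> \<le> \<kappa> * 1"
      using q(1) kernel_le_1[of "norm S" u] by (intro mult_left_mono) (auto simp: \<kappa>_def res_const_def)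
    finally show ?thesis by simp
  qed
  define N where "N u = matrix_inv (u\<^sup>2 *\<^sub>R mat 1 + S ** Q)" for u :: real
  have N: "u\<^sup>2 *\<^sub>R N u = mat 1 - res u Q S ** Q" if "u \<noteq> 0" for u
  proof -
    have "N u ** (u\<^sup>2 *\<^sub>R mat 1 + S ** Q) = mat 1"
      unfolding N_def by (rule matrix_inv_mult[OF res_invertible[OF that Q S]])
    then show ?thesis by (simp add: mm_distribs res_def N_def matrix_mul_assoc algebra_simps)
  qed
  have diff: "u\<^sup>2 *\<^sub>R (res u Q S - res v Q S) = (v\<^sup>2 - u\<^sup>2) *\<^sub>R ((mat 1 - res u Q S ** Q) ** res v Q S)"
    if "u \<noteq> 0" for u
  proof -
    let ?A = "u\<^sup>2 *\<^sub>R mat 1 + S ** Q"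
    have "?A ** (res u Q S - res v Q S) = (v\<^sup>2 - u\<^sup>2) *\<^sub>R res v Q S"
      using res_eq[OF that Q S] res_eq[OF v Q S]
      by (simp add: mm_distribs) (simp add: algebra_simps)
    then have "N u ** ?A ** (res u Q S - res v Q S) = N u ** ((v\<^sup>2 - u\<^sup>2) *\<^sub>R res v Q S)"
      by (metis matrix_mul_assoc)
    then have "res u Q S - res v Q S = (v\<^sup>2 - u\<^sup>2) *\<^sub>R (N u ** res v Q S)"
      by (simp add: N_def matrix_inv_mult[OF res_invertible[OF that Q S]] scaleR_mm_right)
    then have "u\<^sup>2 *\<^sub>R (res u Q S - res v Q S) = (v\<^sup>2 - u\<^sup>2) *\<^sub>R ((u\<^sup>2 *\<^sub>R N u) ** res v Q S)"
      by (simp add: scaleR_mm_left mult.commute)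
    then show ?thesis by (simp add: N[OF that])
  qed
  define c where "c = (norm (mat 1 :: 'd cmat) + \<kappa> * norm Q) * norm (res v Q S)"
  have bound: "norm (res u Q S - res v Q S) \<le> \<bar>v\<^sup>2 - u\<^sup>2\<bar> * c / u\<^sup>2" if "u \<noteq> 0" for u
  proof -
    have "norm (res u Q S ** Q) \<le> \<kappa> * norm Q"
      using norm_mm[of "res u Q S" Q] mult_right_mono[OF \<kappa>[OF that] norm_ge_zero[of Q]] by linarith
    then have "norm (mat 1 - res u Q S ** Q) \<le> norm (mat 1 :: 'd cmat) + \<kappa> * norm Q"
      using norm_triangle_ineq4[of "mat 1" "res u Q S ** Q"] by linarith
    then have "norm ((mat 1 - res u Q S ** Q) ** res v Q S) \<le> c"
      using norm_mm[of "mat 1 - res u Q S ** Q" "res v Q S"] mult_right_mono[OF _ norm_ge_zero]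
      unfolding c_def by (meson order_trans)
    then have "\<bar>v\<^sup>2 - u\<^sup>2\<bar> * norm ((mat 1 - res u Q S ** Q) ** res v Q S) \<le> \<bar>v\<^sup>2 - u\<^sup>2\<bar> * c"
      by (rule mult_left_mono) simp
    moreover have "u\<^sup>2 * norm (res u Q S - res v Q S) =
        \<bar>v\<^sup>2 - u\<^sup>2\<bar> * norm ((mat 1 - res u Q S ** Q) ** res v Q S)"
      using arg_cong[OF diff[OF that], of norm] by simp
    ultimately show ?thesis using that by (simp add: field_simps)
  qed
  have "((\<lambda>u. \<bar>v\<^sup>2 - u\<^sup>2\<bar> * c / u\<^sup>2) \<longlongrightarrow> \<bar>v\<^sup>2 - v\<^sup>2\<bar> * c / v\<^sup>2) (at v)"
    using v by (intro tendsto_intros) auto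
  then have lim: "((\<lambda>u. \<bar>v\<^sup>2 - u\<^sup>2\<bar> * c / u\<^sup>2) \<longlongrightarrow> 0) (at v)" by simp
  have "eventually (\<lambda>u. u \<noteq> 0) (at v)"
    using v by (rule tendsto_imp_eventually_ne[OF tendsto_ident_at])
  then have "eventually (\<lambda>u. norm (res u Q S - res v Q S) \<le> \<bar>v\<^sup>2 - u\<^sup>2\<bar> * c / u\<^sup>2) (at v)"
    by (rule eventually_mono) (rule bound)
  from Lim_null_comparison[OF this lim]
  show "isCont (\<lambda>u. res u Q S) v"
    by (simp add: isCont_def LIM_zero_iff)
qed

section \<open>The optimal map as an integral of resolvents\<close>

text \<open>The optimal map, by a formula in which \<open>Q\<close> only enters through the resolvent, so that it can be
  differentiated under the integral sign. At \<open>Q = 1\<close> it is the square root of \<open>S\<close>.\<close>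

definition bwT :: "('d::finite) cmat \<Rightarrow> 'd cmat \<Rightarrow> 'd cmat" where
  "bwT Q S = (1 / pi) *\<^sub>R (\<integral>u. res u Q S \<partial>lborel)"

text \<open>The integral of the derivative \<open>- r X r\<close> of the resolvent.\<close>

definition bwD :: "('d::finite) cmat \<Rightarrow> 'd cmat \<Rightarrow> 'd cmat \<Rightarrow> 'd cmat" where
  "bwD Q S X = - ((1 / pi) *\<^sub>R (\<integral>u. res u Q S ** X ** res u Q S \<partial>lborel))"

lemma res_measurable:
  assumes "Q \<in> pd" "(S :: ('d::finite) cmat) \<in> psd"
  shows "(\<lambda>u. res u Q S) \<in> borel_measurable lborel"
  using borel_measurable_continuous_countable_exceptions[OF _ res_continuous[OF assms]] by simp

lemma res_sandwich_measurable:
  assumes Q: "Q \<in> pd" "Q' \<in> pd" and S: "(S :: ('d::finite) cmat) \<in> psd"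
  shows "(\<lambda>u. res u Q S ** X ** res u Q' S) \<in> borel_measurable lborel"
proof -
  have "continuous_on (- {0}) (\<lambda>u. res u Q S ** X ** res u Q' S)"
    by (intro continuous_intros res_continuous Q S)
  then show ?thesis
    using borel_measurable_continuous_countable_exceptions[of "{0::real}"] by simp
qed

lemma norm_mm3:
  fixes A B C :: "('d::finite) cmat"
  assumes "norm A \<le> a" "norm C \<le> c"
  shows "norm (A ** B ** C) \<le> a * norm B * c"
proof -
  have "norm (A ** B ** C) \<le> norm (A ** B) * norm C" by (rule norm_mm)
  also have "\<dots> \<le> (norm A * norm B) * norm C" by (intro mult_right_mono norm_mm) simp
  also have "\<dots> \<le> (a * norm B) * c"
    using assms order_trans[OF norm_ge_zero assms(1)]
    by (intro mult_mono[of "norm A * norm B" "a * norm B"] mult_right_mono[of "norm A" a]) auto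
  finally show ?thesis .
qed

lemma res_const_nonneg: "0 < q \<Longrightarrow> 0 \<le> K \<Longrightarrow> 0 \<le> res_const TYPE('d::finite) q K"
  by (auto simp: res_const_def intro!: mult_nonneg_nonneg add_nonneg_nonneg divide_nonneg_nonneg)

text \<open>All estimates below follow from \<open>r' - r = r' (Q - Q') r\<close> for the resolvents and the common
  bound by the kernel \<open>k = s / (u\<^sup>2 + s)\<close>, \<open>s = norm S\<close>, whose powers are at most \<open>k\<close> itself. The
  integral of \<open>k\<close> is \<open>pi * sqrt s\<close>; so every constant is a multiple of \<open>sqrt (norm S)\<close> that is uniform
  over \<open>S\<close>.\<close>

context
  fixes q K :: real and Q S :: "('d::finite) cmat"
  assumes q: "0 < q" and Q: "pd_ge q Q" and K: "norm Q \<le> K" and S: "S \<in> psd"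
begin

private lemma kappa_nonneg: "0 \<le> res_const TYPE('d) q K"
  using order_trans[OF norm_ge_zero K] q by (rule res_const_nonneg[rotated])

private lemma Q_pd: "Q \<in> pd"
  using q Q by (rule pd_ge_imp_pd)

private lemma r_bound: "u \<noteq> 0 \<Longrightarrow> norm (res u Q S) \<le> res_const TYPE('d) q K * (norm S / (u\<^sup>2 + norm S))"
  by (rule res_norm[OF _ Q_pd S q Q K])

private lemma sandwich_bound:
  assumes "u \<noteq> 0"
  shows "norm (res u Q S ** X ** res u Q S) \<le> ((res_const TYPE('d) q K)\<^sup>2 * norm X) * (norm S / (u\<^sup>2 + norm S))"
proof -
  let ?k = "norm S / (u\<^sup>2 + norm S)"
  have k: "0 \<le> ?k" "?k \<le> 1" by (auto intro: kernel_le_1)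
  have "norm (res u Q S ** X ** res u Q S) \<le> (res_const TYPE('d) q K * ?k) * norm X * (res_const TYPE('d) q K * ?k)"
    by (rule norm_mm3[OF r_bound[OF assms] r_bound[OF assms]])
  also have "\<dots> = ((res_const TYPE('d) q K)\<^sup>2 * norm X) * (?k * ?k)" by (simp add: power2_eq_square)
  also have "\<dots> \<le> ((res_const TYPE('d) q K)\<^sup>2 * norm X) * (?k * 1)"
    using k by (intro mult_left_mono) auto
  finally show ?thesis by simp
qed

lemma res_integrable: "integrable lborel (\<lambda>u. res u Q S)"
  by (rule integral_kernel_bound(1)[OF norm_ge_zero res_measurable[OF Q_pd S] r_bound])

lemma bwT_norm: "norm (bwT Q S) \<le> res_const TYPE('d) q K * sqrt (norm S)"
  unfolding bwT_def
  by (rule integral_kernel_bound(2)[OF norm_ge_zero res_measurable[OF Q_pd S] r_bound])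

lemma sandwich_integrable: "integrable lborel (\<lambda>u. res u Q S ** X ** res u Q S)"
  by (rule integral_kernel_bound(1)[OF norm_ge_zero res_sandwich_measurable[OF Q_pd Q_pd S] sandwich_bound])

lemma bwD_norm: "norm (bwD Q S X) \<le> (res_const TYPE('d) q K)\<^sup>2 * norm X * sqrt (norm S)"
  unfolding bwD_def norm_minus_cancel
  by (rule integral_kernel_bound(2)[OF norm_ge_zero res_sandwich_measurable[OF Q_pd Q_pd S] sandwich_bound])

context
  fixes Q' :: "'d cmat"
  assumes Q': "pd_ge q Q'" and K': "norm Q' \<le> K"
begin

private lemma Q'_pd: "Q' \<in> pd"
  using q Q' by (rule pd_ge_imp_pd)

private lemma r'_bound: "u \<noteq> 0 \<Longrightarrow> norm (res u Q' S) \<le> res_const TYPE('d) q K * (norm S / (u\<^sup>2 + norm S))"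
  by (rule res_norm[OF _ Q'_pd S q Q' K'])

private lemma rdiff_bound:
  assumes "u \<noteq> 0"
  shows "norm (res u Q' S - res u Q S) \<le> ((res_const TYPE('d) q K)\<^sup>2 * norm (Q' - Q)) * (norm S / (u\<^sup>2 + norm S))"
proof -
  let ?k = "norm S / (u\<^sup>2 + norm S)"
  have k: "0 \<le> ?k" "?k \<le> 1" by (auto intro: kernel_le_1)
  have "norm (res u Q' S - res u Q S) \<le> (res_const TYPE('d) q K * ?k) * norm (Q - Q') * (res_const TYPE('d) q K * ?k)"
    unfolding res_diff[OF assms Q_pd Q'_pd S]
    by (rule norm_mm3[OF r'_bound[OF assms] r_bound[OF assms]])
  also have "\<dots> = ((res_const TYPE('d) q K)\<^sup>2 * norm (Q' - Q)) * (?k * ?k)"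
    by (simp add: power2_eq_square norm_minus_commute)
  also have "\<dots> \<le> ((res_const TYPE('d) q K)\<^sup>2 * norm (Q' - Q)) * (?k * 1)"
    using k by (intro mult_left_mono) auto
  finally show ?thesis by simp
qed

private lemma r'_integrable: "integrable lborel (\<lambda>u. res u Q' S)"
  by (rule integral_kernel_bound(1)[OF norm_ge_zero res_measurable[OF Q'_pd S] r'_bound])

lemma bwT_lipschitz: "norm (bwT Q' S - bwT Q S) \<le> (res_const TYPE('d) q K)\<^sup>2 * norm (Q' - Q) * sqrt (norm S)"
proof -
  have "bwT Q' S - bwT Q S = (1 / pi) *\<^sub>R (\<integral>u. res u Q' S - res u Q S \<partial>lborel)"
    by (simp add: bwT_def res_integrable r'_integrable scaleR_diff_right)
  then show ?thesis
    using integral_kernel_bound(2)[OF norm_ge_zero _ rdiff_bound]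
      res_measurable[OF Q'_pd S] res_measurable[OF Q_pd S] by simp
qed

lemma bwT_taylor:
  "norm (bwT Q' S - bwT Q S - bwD Q S (Q' - Q)) \<le> (res_const TYPE('d) q K) ^ 3 * (norm (Q' - Q))\<^sup>2 * sqrt (norm S)"
proof -
  let ?X = "Q' - Q"
  let ?f = "\<lambda>u. res u Q' S - res u Q S + res u Q S ** ?X ** res u Q S"
  have eq: "bwT Q' S - bwT Q S - bwD Q S ?X = (1 / pi) *\<^sub>R (\<integral>u. ?f u \<partial>lborel)"
    by (simp add: bwT_def bwD_def res_integrable r'_integrable sandwich_integrable
        scaleR_diff_right scaleR_add_right)
  have bound: "norm (?f u) \<le> ((res_const TYPE('d) q K) ^ 3 * (norm ?X)\<^sup>2) * (norm S / (u\<^sup>2 + norm S))" if u: "u \<noteq> 0" for u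
  proof -
    let ?k = "norm S / (u\<^sup>2 + norm S)"
    have k: "0 \<le> ?k" "?k \<le> 1" by (auto intro: kernel_le_1)
    have kk: "?k * ?k \<le> ?k * 1" using k by (intro mult_left_mono) auto
    have "res u Q' S - res u Q S = - (res u Q' S ** ?X ** res u Q S)"
      unfolding res_diff[OF u Q_pd Q'_pd S] by (simp add: mm_diff_left mm_diff_right)
    then have "?f u = (res u Q S - res u Q' S) ** ?X ** res u Q S"
      by (simp add: mm_diff_left)
    also have "norm \<dots> \<le> ((res_const TYPE('d) q K)\<^sup>2 * norm ?X * ?k) * norm ?X * (res_const TYPE('d) q K * ?k)"
      using rdiff_bound[OF u] by (intro norm_mm3 r_bound[OF u]) (simp add: norm_minus_commute)
    also have "\<dots> = ((res_const TYPE('d) q K) ^ 3 * (norm ?X)\<^sup>2) * (?k * ?k)"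
      by (simp add: power2_eq_square power3_eq_cube)
    also have "\<dots> \<le> ((res_const TYPE('d) q K) ^ 3 * (norm ?X)\<^sup>2) * (?k * 1)"
      by (rule mult_left_mono[OF kk]) (simp add: kappa_nonneg)
    finally show ?thesis by simp
  qed
  have "?f \<in> borel_measurable lborel"
    using res_measurable[OF Q'_pd S] res_measurable[OF Q_pd S] res_sandwich_measurable[OF Q_pd Q_pd S]
    by (intro borel_measurable_add borel_measurable_diff)
  from integral_kernel_bound(2)[OF norm_ge_zero this bound] show ?thesis
    unfolding eq .
qed

lemma bwD_lipschitz:
  "norm (bwD Q' S X - bwD Q S X) \<le> 2 * (res_const TYPE('d) q K) ^ 3 * norm (Q' - Q) * norm X * sqrt (norm S)"
proof -
  let ?f = "\<lambda>u. res u Q S ** X ** res u Q S - res u Q' S ** X ** res u Q' S"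
  have int': "integrable lborel (\<lambda>u. res u Q' S ** X ** res u Q' S)"
  proof (rule integral_kernel_bound(1)[OF norm_ge_zero res_sandwich_measurable[OF Q'_pd Q'_pd S]])
    fix u :: real assume u: "u \<noteq> 0"
    let ?k = "norm S / (u\<^sup>2 + norm S)"
    have k: "0 \<le> ?k" "?k \<le> 1" by (auto intro: kernel_le_1)
    have "norm (res u Q' S ** X ** res u Q' S) \<le> (res_const TYPE('d) q K * ?k) * norm X * (res_const TYPE('d) q K * ?k)"
      by (rule norm_mm3[OF r'_bound[OF u] r'_bound[OF u]])
    also have "\<dots> = ((res_const TYPE('d) q K)\<^sup>2 * norm X) * (?k * ?k)" by (simp add: power2_eq_square)
    also have "\<dots> \<le> ((res_const TYPE('d) q K)\<^sup>2 * norm X) * (?k * 1)" using k by (intro mult_left_mono) auto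
    finally show "norm (res u Q' S ** X ** res u Q' S) \<le> ((res_const TYPE('d) q K)\<^sup>2 * norm X) * ?k" by simp
  qed
  have eq: "bwD Q' S X - bwD Q S X = (1 / pi) *\<^sub>R (\<integral>u. ?f u \<partial>lborel)"
    by (simp add: bwD_def int' sandwich_integrable scaleR_diff_right)
  have bound: "norm (?f u) \<le> (2 * (res_const TYPE('d) q K) ^ 3 * norm (Q' - Q) * norm X) * (norm S / (u\<^sup>2 + norm S))"
    if u: "u \<noteq> 0" for u
  proof -
    let ?k = "norm S / (u\<^sup>2 + norm S)" and ?d = "res u Q' S - res u Q S"
    have k: "0 \<le> ?k" "?k \<le> 1" by (auto intro: kernel_le_1)
    have kk: "?k * ?k \<le> ?k * 1" using k by (intro mult_left_mono) auto
    have "?f u = - (?d ** X ** res u Q' S + res u Q S ** X ** ?d)"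
      by (simp add: mm_diff_left mm_diff_right)
    also have "norm \<dots> \<le> norm (?d ** X ** res u Q' S) + norm (res u Q S ** X ** ?d)"
      unfolding norm_minus_cancel by (rule norm_triangle_ineq)
    also have "\<dots> \<le> ((res_const TYPE('d) q K)\<^sup>2 * norm (Q' - Q) * ?k) * norm X * (res_const TYPE('d) q K * ?k)
        + (res_const TYPE('d) q K * ?k) * norm X * ((res_const TYPE('d) q K)\<^sup>2 * norm (Q' - Q) * ?k)"
      by (intro add_mono norm_mm3 r_bound[OF u] r'_bound[OF u] rdiff_bound[OF u])
    also have "\<dots> = (2 * (res_const TYPE('d) q K) ^ 3 * norm (Q' - Q) * norm X) * (?k * ?k)"
      by (simp add: power2_eq_square power3_eq_cube)
    also have "\<dots> \<le> (2 * (res_const TYPE('d) q K) ^ 3 * norm (Q' - Q) * norm X) * (?k * 1)"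
      by (rule mult_left_mono[OF kk]) (simp add: kappa_nonneg)
    finally show ?thesis by simp
  qed
  have "?f \<in> borel_measurable lborel"
    using res_sandwich_measurable[OF Q_pd Q_pd S] res_sandwich_measurable[OF Q'_pd Q'_pd S]
    by (intro borel_measurable_diff)
  from integral_kernel_bound(2)[OF norm_ge_zero this bound] show ?thesis
    unfolding eq .
qed

end

end

lemma integrable_res:
  "Q \<in> pd \<Longrightarrow> S \<in> psd \<Longrightarrow> integrable lborel (\<lambda>u. res u Q (S :: ('d::finite) cmat))"
  using pd_imp_pd_ge[of Q] res_integrable[of _ Q "norm Q" S] by blast

lemma integrable_sandwich:
  "Q \<in> pd \<Longrightarrow> S \<in> psd \<Longrightarrow> integrable lborel (\<lambda>u. res u Q (S :: ('d::finite) cmat) ** X ** res u Q S)"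
  using pd_imp_pd_ge[of Q] sandwich_integrable[of _ Q "norm Q" S X] by blast

lemma AE_nonzero: "(\<And>u::real. u \<noteq> 0 \<Longrightarrow> P u) \<Longrightarrow> AE u in lborel. P u"
  using AE_lborel_singleton[of "0::real"] by (auto elim!: eventually_mono)

lemma bounded_linear_bwT:
  assumes "bounded_linear L" "Q \<in> pd" "(S :: ('d::finite) cmat) \<in> psd"
  shows "L (bwT Q S) = (1 / pi) *\<^sub>R (\<integral>u. (L (res u Q S) :: 'b::{banach, second_countable_topology}) \<partial>lborel)"
  unfolding bwT_def integral_bounded_linear[OF assms(1) integrable_res[OF assms(2,3)]]
  by (rule linear_scale[OF bounded_linear.linear[OF assms(1)]])

lemma bwT_psd:
  assumes Q: "Q \<in> pd" and S: "(S :: ('d::finite) cmat) \<in> psd"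
  shows "bwT Q S \<in> psd"
  unfolding psd_def
proof (intro CollectI conjI allI)
  have bl: "bounded_linear (adj :: 'd cmat \<Rightarrow> 'd cmat)"
    using linear_adj by (simp add: linear_conv_bounded_linear)
  have "(\<lambda>u. adj (res u Q S)) \<in> borel_measurable lborel"
    using integrable_bounded_linear[OF bl integrable_res[OF Q S]] by (rule borel_measurable_integrable)
  then have "(\<integral>u. adj (res u Q S) \<partial>lborel) = (\<integral>u. res u Q S \<partial>lborel)"
    by (rule integral_cong_AE[OF _ res_measurable[OF Q S]])
      (rule AE_nonzero, rule hermitian_adj, rule res_hermitian[OF _ Q S])
  then show "bwT Q S \<in> hermitian"
    unfolding hermitian_iff_adj bounded_linear_bwT[OF bl Q S] by (simp add: bwT_def)
  fix v :: "complex ^ 'd"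
  have bl: "bounded_linear (\<lambda>A :: 'd cmat. v \<bullet> (A *v v))"
    by (rule bounded_linear_inner_right_comp[OF bounded_bilinear.bounded_linear_left[OF bounded_bilinear_mv]])
  have "0 \<le> (\<integral>u. v \<bullet> (res u Q S *v v) \<partial>lborel)"
    by (intro integral_nonneg_AE AE_nonzero psdD res_psd Q S)
  then show "0 \<le> v \<bullet> (bwT Q S *v v)"
    using bounded_linear_bwT[OF bl Q S] by simp
qed

text \<open>On an eigenvector the integral reduces to the scalar one of the kernel.\<close>

lemma bwT_eigenvector:
  assumes S: "(S :: ('d::finite) cmat) \<in> psd" and e: "S *v e = l *\<^sub>R e" and l: "0 \<le> l"
  shows "bwT (mat 1) S *v e = sqrt l *\<^sub>R e"
proof -
  have bl: "bounded_linear (\<lambda>A :: 'd cmat. A *v e)"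
    by (rule bounded_bilinear.bounded_linear_left[OF bounded_bilinear_mv])
  have "(\<lambda>u. res u (mat 1) S *v e) \<in> borel_measurable lborel"
    using integrable_bounded_linear[OF bl integrable_res[OF mat_1_pd S]]
    by (rule borel_measurable_integrable)
  then have "(\<integral>u. res u (mat 1) S *v e \<partial>lborel) = (\<integral>u. (l / (u\<^sup>2 + l)) *\<^sub>R e \<partial>lborel)"
    by (rule integral_cong_AE)
      (simp, rule AE_nonzero, rule res_eigenvector[OF _ mat_1_pd S refl e l])
  also have "\<dots> = (pi * sqrt l) *\<^sub>R e"
    using has_bochner_integral_cauchy_kernel[OF l] by (simp add: has_bochner_integral_iff)
  finally show ?thesis using bounded_linear_bwT[OF bl mat_1_pd S] by simp
qed

section \<open>Square roots of positive semi-definite matrices\<close>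

lemma hermitian_spectral:
  assumes "(A :: ('d::finite) cmat) \<in> hermitian"
  obtains B where "finite B" "span B = UNIV" "\<And>b. b \<in> B \<Longrightarrow> A *v b = (b \<bullet> (A *v b)) *\<^sub>R b"
proof -
  have "\<exists>B. finite B \<and> B \<subseteq> UNIV \<and> pairwise orthogonal B \<and> (\<forall>b\<in>B. norm b = 1) \<and> span B = UNIV \<and>
    (\<forall>b\<in>B. A *v b = ((A *v b) \<bullet> b) *\<^sub>R b)"
    by (rule spectral_theorem_subspace) (auto simp: inner_mv_hermitian[OF assms])
  then obtain B where B: "finite B" "span B = UNIV" "\<And>b. b \<in> B \<Longrightarrow> A *v b = ((A *v b) \<bullet> b) *\<^sub>R b"
    by blast
  show ?thesis
    by (rule that[OF B(1,2)]) (use B(3) in \<open>metis inner_commute\<close>)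
qed

lemma matrix_eq_on_span:
  assumes "span B = UNIV" "\<And>b. b \<in> B \<Longrightarrow> A *v b = C *v b"
  shows "A = (C :: ('d::finite) cmat)"
  by (rule matrix_eqI_mv, rule linear_eq_on_span[where B = B]) (use assms in auto)

lemma bwT_1_square:
  assumes S: "(S :: ('d::finite) cmat) \<in> psd"
  shows "bwT (mat 1) S ** bwT (mat 1) S = S"
proof -
  obtain B where B: "finite B" "span B = UNIV" "\<And>b. b \<in> B \<Longrightarrow> S *v b = (b \<bullet> (S *v b)) *\<^sub>R b"
    using hermitian_spectral[OF psd_hermitian[OF S]] by blast
  show ?thesis
  proof (rule matrix_eq_on_span[OF B(2)])
    fix b assume b: "b \<in> B"
    define l where "l = b \<bullet> (S *v b)"
    have l: "0 \<le> l" using psdD[OF S] by (simp add: l_def)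
    have Sb: "S *v b = l *\<^sub>R b" using B(3)[OF b] by (simp add: l_def)
    show "bwT (mat 1) S ** bwT (mat 1) S *v b = S *v b"
      using bwT_eigenvector[OF S Sb l] l Sb
      by (simp add: matrix_vector_mul_assoc[symmetric] mv_scaleR_right)
  qed
qed

text \<open>An eigenvector of a root \<open>R\<close> with eigenvalue \<open>l\<close> is one of \<open>S\<close> with eigenvalue \<open>l\<^sup>2\<close>, where the integral
  acts as \<open>l\<close>. So every root agrees with the integral on an eigenbasis of its own.\<close>

lemma psd_sqrt_unique:
  assumes R: "R \<in> psd" "R ** R = S"
  shows "R = bwT (mat 1) (S :: ('d::finite) cmat)"
proof -
  have S: "S \<in> psd"
    using psd_congruence[OF pd_imp_psd[OF mat_1_pd], of R] R
    by (simp add: hermitian_adj psd_hermitian)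
  obtain B where B: "finite B" "span B = UNIV" "\<And>b. b \<in> B \<Longrightarrow> R *v b = (b \<bullet> (R *v b)) *\<^sub>R b"
    using hermitian_spectral[OF psd_hermitian[OF R(1)]] by blast
  show ?thesis
  proof (rule matrix_eq_on_span[OF B(2)])
    fix b assume b: "b \<in> B"
    define l where "l = b \<bullet> (R *v b)"
    have l: "0 \<le> l" using psdD[OF R(1)] by (simp add: l_def)
    have Rb: "R *v b = l *\<^sub>R b" using B(3)[OF b] by (simp add: l_def)
    have "S *v b = l\<^sup>2 *\<^sub>R b"
      by (simp add: R(2)[symmetric] matrix_vector_mul_assoc[symmetric] Rb mv_scaleR_right power2_eq_square)
    from bwT_eigenvector[OF S this] show "R *v b = bwT (mat 1) S *v b"
      using l Rb by simp
  qed
qed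

lemma msqrt_eq: "S \<in> psd \<Longrightarrow> msqrt S = bwT (mat 1) (S :: ('d::finite) cmat)"
  unfolding msqrt_def
  by (rule the_equality) (auto intro: bwT_psd bwT_1_square psd_sqrt_unique mat_1_pd)

lemma msqrt_psd: "S \<in> psd \<Longrightarrow> msqrt S \<in> (psd :: ('d::finite) cmat set)"
  by (simp add: msqrt_eq bwT_psd mat_1_pd)

lemma msqrt_square: "S \<in> psd \<Longrightarrow> msqrt S ** msqrt S = (S :: ('d::finite) cmat)"
  by (simp add: msqrt_eq bwT_1_square)

lemma msqrt_adj: "S \<in> psd \<Longrightarrow> adj (msqrt S) = msqrt (S :: ('d::finite) cmat)"
  by (intro hermitian_adj psd_hermitian msqrt_psd)

lemma psd_on_mv: "A \<in> psd \<Longrightarrow> psd_on UNIV ((*v) (A :: ('d::finite) cmat))"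
  unfolding psd_on_def
proof (intro conjI ballI)
  assume A: "A \<in> psd"
  show "(A *v X) \<bullet> Y = X \<bullet> (A *v Y)" for X Y
    by (rule inner_mv_hermitian[OF psd_hermitian[OF A]])
  show "0 \<le> (A *v X) \<bullet> X" for X
    using psdD[OF A, of X] by (simp add: inner_commute)
qed auto

lemma msqrt_hoelder:
  fixes A B :: "('d::finite) cmat"
  assumes "A \<in> psd" "B \<in> psd"
  shows "norm (msqrt A - msqrt B) \<le> sqrt (norm (A - B)) * real CARD('d)"
proof (rule norm_matrix_le_of_mv)
  fix x :: "complex ^ 'd"
  have "norm (msqrt A *v x - msqrt B *v x) \<le> sqrt (norm (A - B)) * norm x"
  proof (rule psd_on_sqrt_hoelder[OF subspace_UNIV psd_on_mv psd_on_mv])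
    fix x :: "complex ^ 'd"
    show "norm (msqrt A *v (msqrt A *v x) - msqrt B *v (msqrt B *v x)) \<le> norm (A - B) * norm x"
      using norm_mv[of "A - B" x]
      by (simp add: matrix_vector_mul_assoc msqrt_square assms mv_distribs)
  qed (auto intro: msqrt_psd assms)
  then show "norm ((msqrt A - msqrt B) *v x) \<le> sqrt (norm (A - B)) * norm x"
    by (simp add: mv_distribs)
qed simp

lemma continuous_on_msqrt: "continuous_on psd (msqrt :: ('d::finite) cmat \<Rightarrow> 'd cmat)"
  unfolding continuous_on_def
proof
  fix A :: "'d cmat" assume A: "A \<in> psd"
  have "((\<lambda>B. sqrt (norm (B - A)) * real CARD('d)) \<longlongrightarrow> sqrt (norm (A - A)) * real CARD('d)) (at A within psd)"
    by (intro tendsto_intros)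
  then have lim: "((\<lambda>B. sqrt (norm (B - A)) * real CARD('d)) \<longlongrightarrow> 0) (at A within psd)" by simp
  have "\<forall>\<^sub>F B in at A within psd. norm (msqrt B - msqrt A) \<le> sqrt (norm (B - A)) * real CARD('d)"
    using A by (auto simp: eventually_at_filter intro!: msqrt_hoelder always_eventually)
  from Lim_null_comparison[OF this lim]
  show "(msqrt \<longlongrightarrow> msqrt A) (at A within psd)" by (rule LIM_zero_cancel)
qed

lemma psd_inner_nonneg:
  assumes A: "A \<in> psd" and B: "B \<in> psd"
  shows "0 \<le> A \<bullet> (B :: ('d::finite) cmat)"
proof -
  have "A \<bullet> B = A \<bullet> (msqrt B ** msqrt B)" by (simp add: msqrt_square[OF B])
  also have "\<dots> = (A ** msqrt B) \<bullet> msqrt B"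
    by (simp add: inner_mm_adj_right msqrt_adj[OF B])
  also have "\<dots> = (\<Sum>j\<in>UNIV. (msqrt B *v axis j 1) \<bullet> (A *v (msqrt B *v axis j 1)))"
    by (simp add: inner_matrix_columns matrix_vector_mul_assoc[symmetric] inner_commute[of "A *v _"])
  also have "\<dots> \<ge> 0" by (intro sum_nonneg psdD[OF A])
  finally show ?thesis .
qed

lemma psd_null_vector:
  assumes A: "A \<in> psd" and v: "v \<bullet> ((A :: ('d::finite) cmat) *v v) = 0"
  shows "A *v v = 0"
proof -
  have "v \<bullet> (msqrt A *v (msqrt A *v v)) = 0"
    using v by (simp add: matrix_vector_mul_assoc msqrt_square[OF A])
  then have "msqrt A *v v = 0"
    using inner_mv_adj[of v "msqrt A" "msqrt A *v v"] by (simp add: msqrt_adj[OF A])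
  then have "msqrt A *v (msqrt A *v v) = 0" by simp
  then show ?thesis by (simp only: matrix_vector_mul_assoc msqrt_square[OF A])
qed

lemma psd_invertible_pd:
  assumes A: "A \<in> psd" and inj: "\<And>v. (A :: ('d::finite) cmat) *v v = 0 \<Longrightarrow> v = 0"
  shows "A \<in> pd"
  unfolding pd_def
proof (intro CollectI conjI allI impI psd_hermitian[OF A])
  fix v :: "complex ^ 'd" assume "v \<noteq> 0"
  then have "v \<bullet> (A *v v) \<noteq> 0" using psd_null_vector[OF A] inj by blast
  then show "0 < v \<bullet> (A *v v)" using psdD[OF A, of v] by simp
qed

lemma msqrt_pd: "Q \<in> pd \<Longrightarrow> msqrt Q \<in> (pd :: ('d::finite) cmat set)"
proof (rule psd_invertible_pd)
  fix v assume Q: "Q \<in> pd" and "msqrt Q *v v = 0"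
  then have "msqrt Q *v (msqrt Q *v v) = 0" by simp
  then have "Q *v v = 0"
    by (simp only: matrix_vector_mul_assoc msqrt_square[OF pd_imp_psd[OF Q]])
  then show "v = 0" using Q by (force simp: pd_def)
qed (auto intro: msqrt_psd pd_imp_psd)

text \<open>With \<open>R\<close> the root of \<open>A\<close>, \<open>norm (R R) \<le> (norm R)\<^sup>2 = tr (R R)\<close>.\<close>

lemma psd_norm_le_trace: "A \<in> psd \<Longrightarrow> norm (A :: ('d::finite) cmat) \<le> Re (trace A)"
proof -
  assume A: "A \<in> psd"
  have "norm A = norm (msqrt A ** msqrt A)" by (simp add: msqrt_square[OF A])
  also have "\<dots> \<le> norm (msqrt A) * norm (msqrt A)" by (rule norm_mm)
  also have "\<dots> = msqrt A \<bullet> (msqrt A ** mat 1)" by (simp add: norm_eq_sqrt_inner)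
  also have "\<dots> = Re (trace A)"
    by (subst inner_mm_adj) (simp add: msqrt_adj[OF A] msqrt_square[OF A] Re_trace inner_commute[of A])
  finally show ?thesis .
qed

section \<open>The Bures--Wasserstein map and distance\<close>

lemma inv_pd:
  assumes Q: "(Q :: ('d::finite) cmat) \<in> pd"
  shows "matrix_inv Q \<in> pd"
proof (rule psd_invertible_pd)
  let ?N = "matrix_inv Q"
  note inv = matrix_inv_mult[OF pd_invertible[OF Q]]
  have "adj ?N = adj ?N ** (Q ** ?N)" by (simp add: inv)
  also have "\<dots> = adj (Q ** ?N) ** ?N"
    by (simp add: adj_mult hermitian_adj[OF pd_hermitian[OF Q]] matrix_mul_assoc)
  finally have adj: "adj ?N = ?N" by (simp add: inv)
  have "adj ?N ** Q ** ?N \<in> psd" by (rule psd_congruence[OF pd_imp_psd[OF Q]])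
  then show "?N \<in> psd" by (simp add: adj inv)
  fix v assume "?N *v v = 0"
  then have "Q *v (?N *v v) = 0" by simp
  then show "v = 0" by (simp add: matrix_vector_mul_assoc inv)
qed

text \<open>Conjugation by \<open>C = msqrt Q\<close> turns the resolvent of \<open>C S C\<close> at the identity into the one of \<open>S\<close> at \<open>Q\<close>.\<close>

lemma bwT_via_msqrt:
  assumes Q: "(Q :: ('d::finite) cmat) \<in> pd" and S: "S \<in> psd"
  defines "C \<equiv> msqrt Q"
  shows "bwT Q S = matrix_inv C ** msqrt (C ** S ** C) ** matrix_inv C"
proof -
  have C: "C \<in> pd" "C ** C = Q" "adj C = C"
    using Q unfolding C_def by (auto intro: msqrt_pd msqrt_square msqrt_adj pd_imp_psd)
  note inv = matrix_inv_mult[OF pd_invertible[OF C(1)]]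
  let ?N = "matrix_inv C" and ?H = "C ** S ** C"
  have H: "?H \<in> psd" using psd_congruence[OF S, of C] C(3) by simp
  have pw: "?N ** res u (mat 1) ?H ** ?N = res u Q S" if u: "u \<noteq> 0" for u
  proof (rule res_unique[OF u Q S])
    let ?r = "res u (mat 1) ?H"
    have "S ** Q ** (?N ** ?r ** ?N) = S ** C ** (C ** ?N) ** ?r ** ?N"
      by (simp only: C(2)[symmetric] matrix_mul_assoc)
    also have "\<dots> = (?N ** C) ** S ** C ** ?r ** ?N" by (simp add: inv)
    also have "\<dots> = ?N ** (?H ** ?r) ** ?N" by (simp only: matrix_mul_assoc)
    finally have "u\<^sup>2 *\<^sub>R (?N ** ?r ** ?N) + S ** Q ** (?N ** ?r ** ?N)
        = ?N ** (u\<^sup>2 *\<^sub>R ?r + ?H ** ?r) ** ?N"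
      by (simp add: mm_distribs)
    also have "u\<^sup>2 *\<^sub>R ?r + ?H ** ?r = ?H" using res_eq[OF u mat_1_pd H] by simp
    also have "?N ** ?H ** ?N = (?N ** C) ** S ** (C ** ?N)" by (simp only: matrix_mul_assoc)
    also have "\<dots> = S" by (simp add: inv)
    finally show "u\<^sup>2 *\<^sub>R (?N ** ?r ** ?N) + S ** Q ** (?N ** ?r ** ?N) = S" .
  qed
  have bl: "bounded_linear (\<lambda>A. ?N ** A ** ?N)"
    by (intro bounded_linear_compose[OF bounded_bilinear.bounded_linear_left[OF bounded_bilinear_mm]]
        bounded_bilinear.bounded_linear_right[OF bounded_bilinear_mm])
  have "(\<lambda>u. ?N ** res u (mat 1) ?H ** ?N) \<in> borel_measurable lborel"
    using integrable_bounded_linear[OF bl integrable_res[OF mat_1_pd H]]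
    by (rule borel_measurable_integrable)
  then have "(\<integral>u. ?N ** res u (mat 1) ?H ** ?N \<partial>lborel) = (\<integral>u. res u Q S \<partial>lborel)"
    by (rule integral_cong_AE[OF _ res_measurable[OF Q S]]) (rule AE_nonzero, rule pw)
  then show ?thesis
    using bounded_linear_bwT[OF bl mat_1_pd H] by (simp add: msqrt_eq[OF H] bwT_def[of Q])
qed

lemma bw_map_eq: "Q \<in> pd \<Longrightarrow> S \<in> psd \<Longrightarrow> bw_map Q S = bwT Q (S :: ('d::finite) cmat)"
  by (simp add: bwT_via_msqrt bw_map_def)

lemma msqrt_sandwich:
  assumes Q: "(Q :: ('d::finite) cmat) \<in> pd" and S: "S \<in> psd"
  shows "msqrt (msqrt Q ** S ** msqrt Q) = msqrt Q ** bwT Q S ** msqrt Q"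
proof -
  let ?C = "msqrt Q" and ?R = "msqrt (msqrt Q ** S ** msqrt Q)"
  note inv = matrix_inv_mult[OF pd_invertible[OF msqrt_pd[OF Q]]]
  have "?C ** bwT Q S ** ?C = (?C ** matrix_inv ?C) ** ?R ** (matrix_inv ?C ** ?C)"
    unfolding bwT_via_msqrt[OF Q S] by (simp only: matrix_mul_assoc)
  then show ?thesis by (simp add: inv)
qed

text \<open>The optimal map is characterised by a Riccati equation, which involves no square roots.\<close>

lemma bwT_riccati:
  assumes Q: "(Q :: ('d::finite) cmat) \<in> pd" and S: "S \<in> psd"
  shows "bwT Q S ** Q ** bwT Q S = S"
proof -
  let ?C = "msqrt Q" and ?T = "bwT Q S"
  let ?N = "matrix_inv ?C"
  note inv = matrix_inv_mult[OF pd_invertible[OF msqrt_pd[OF Q]]]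
  have C: "?C ** ?C = Q" "adj ?C = ?C"
    using Q by (auto intro: msqrt_square msqrt_adj pd_imp_psd)
  have "?C ** S ** ?C \<in> psd" using psd_congruence[OF S, of ?C] C(2) by simp
  from msqrt_square[OF this] have "?C ** S ** ?C = ?C ** ?T ** (?C ** ?C) ** ?T ** ?C"
    by (simp only: msqrt_sandwich[OF Q S] matrix_mul_assoc)
  then have "?N ** (?C ** S ** ?C) ** ?N = ?N ** (?C ** ?T ** Q ** ?T ** ?C) ** ?N"
    by (simp only: C)
  then have "(?N ** ?C) ** S ** (?C ** ?N) = (?N ** ?C) ** (?T ** Q ** ?T) ** (?C ** ?N)"
    by (simp only: matrix_mul_assoc)
  then show ?thesis by (simp add: inv)
qed

lemma bwT_adj: "Q \<in> pd \<Longrightarrow> S \<in> psd \<Longrightarrow> adj (bwT Q S) = bwT Q (S :: ('d::finite) cmat)"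
  by (intro hermitian_adj psd_hermitian bwT_psd)

lemma bwT_pd:
  assumes Q: "(Q :: ('d::finite) cmat) \<in> pd" and S: "S \<in> pd"
  shows "bwT Q S \<in> pd"
proof (rule psd_invertible_pd[OF bwT_psd[OF Q pd_imp_psd[OF S]]])
  fix v assume "bwT Q S *v v = 0"
  then have "bwT Q S *v (Q *v (bwT Q S *v v)) = 0" by simp
  then have "S *v v = 0"
    by (simp only: matrix_vector_mul_assoc matrix_mul_assoc bwT_riccati[OF Q pd_imp_psd[OF S]])
  then have "v \<bullet> (S *v v) = 0" by simp
  then show "v = 0" using S by (auto simp: pd_def)
qed

definition fidelity :: "('d::finite) cmat \<Rightarrow> 'd cmat \<Rightarrow> real" where
  "fidelity Q S = Re (trace (msqrt (msqrt Q ** S ** msqrt Q)))"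

lemma bw_dist2_fidelity: "bw_dist2 Q S = mat 1 \<bullet> Q + mat 1 \<bullet> S - 2 * fidelity Q S"
  by (simp add: bw_dist2_def fidelity_def Re_trace)

lemma inner_sandwich: "(adj A ** X ** A) \<bullet> Y = X \<bullet> (A ** Y ** adj (A :: ('d::finite) cmat))"
  using inner_mm_adj[of X A "Y ** adj A"] inner_mm_adj_right[of "adj A ** X" Y "adj A"]
  by (simp add: matrix_mul_assoc)

lemma fidelity_pd:
  assumes Q: "(Q :: ('d::finite) cmat) \<in> pd" and S: "S \<in> psd"
  shows "fidelity Q S = Q \<bullet> bwT Q S"
proof -
  have "fidelity Q S = mat 1 \<bullet> (msqrt Q ** bwT Q S ** msqrt Q)"
    by (simp add: fidelity_def msqrt_sandwich[OF Q S] Re_trace)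
  also have "\<dots> = (msqrt Q ** mat 1 ** msqrt Q) \<bullet> bwT Q S"
    using inner_sandwich[of "msqrt Q" "mat 1" "bwT Q S"] by (simp add: msqrt_adj[OF pd_imp_psd[OF Q]])
  finally show ?thesis by (simp add: msqrt_square[OF pd_imp_psd[OF Q]])
qed

lemma tendsto_msqrt:
  assumes "(f \<longlongrightarrow> A) F" "\<forall>\<^sub>F x in F. f x \<in> psd" "A \<in> psd"
  shows "((\<lambda>x. msqrt (f x)) \<longlongrightarrow> msqrt (A :: ('d::finite) cmat)) F"
  by (rule continuous_on_tendsto_compose[OF continuous_on_msqrt assms(1,3,2)])

lemma sandwich_msqrt_psd:
  "Q \<in> psd \<Longrightarrow> S \<in> psd \<Longrightarrow> msqrt Q ** S ** msqrt Q \<in> (psd :: ('d::finite) cmat set)"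
  using psd_congruence[of S "msqrt Q"] by (simp add: msqrt_adj)

lemma tendsto_fidelity:
  fixes f g :: "'b \<Rightarrow> ('d::finite) cmat"
  assumes "(f \<longlongrightarrow> Q) F" "\<And>x. f x \<in> psd" "Q \<in> psd" "(g \<longlongrightarrow> S) F" "\<And>x. g x \<in> psd" "S \<in> psd"
  shows "((\<lambda>x. fidelity (f x) (g x)) \<longlongrightarrow> fidelity Q S) F"
  unfolding fidelity_def Re_trace
  using assms by (intro tendsto_intros tendsto_msqrt sandwich_msqrt_psd always_eventually allI)

lemma tendsto_bwT:
  fixes g :: "'b \<Rightarrow> ('d::finite) cmat"
  assumes Q: "Q \<in> pd" and g: "(g \<longlongrightarrow> S) F" "\<And>x. g x \<in> psd" "S \<in> psd"
  shows "((\<lambda>x. bwT Q (g x)) \<longlongrightarrow> bwT Q S) F"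
  unfolding bwT_via_msqrt[OF Q g(2)] bwT_via_msqrt[OF Q g(3)]
  using g by (intro tendsto_intros tendsto_msqrt sandwich_msqrt_psd always_eventually allI pd_imp_psd[OF Q])

text \<open>Concavity of the fidelity in its first argument. For positive definite matrices it follows by
  completing the square: with \<open>T = T\<^sub>Q\<close>, \<open>T' = T\<^sub>Q\<^sub>'\<close>, the difference of the two sides is
  \<open>\<langle>(T' - T) T'\<^sup>-\<^sup>1 (T' - T), Q\<rangle>\<close>. The singular cases follow by continuity.\<close>

lemma fidelity_le_pd:
  assumes Q: "(Q :: ('d::finite) cmat) \<in> pd" and Q': "Q' \<in> pd" and S: "S \<in> pd"
  shows "2 * fidelity Q S \<le> Q \<bullet> bwT Q' S + Q' \<bullet> bwT Q' S"
proof -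
  note S' = pd_imp_psd[OF S]
  define T where "T = bwT Q S"
  define T' where "T' = bwT Q' S"
  let ?N = "matrix_inv T'"
  have T: "adj T = T" "T ** Q ** T = S" using Q S' by (auto simp: T_def bwT_adj bwT_riccati)
  have T': "adj T' = T'" "T' ** Q' ** T' = S" using Q' S' by (auto simp: T'_def bwT_adj bwT_riccati)
  have T'_pd: "T' \<in> pd" unfolding T'_def by (rule bwT_pd[OF Q' S])
  note inv = matrix_inv_mult[OF pd_invertible[OF T'_pd]]
  have "T' ** ?N ** T' = T'" "T' ** ?N ** T = T" by (simp_all add: inv)
  moreover have "T ** ?N ** T' = T" by (simp add: inv matrix_mul_assoc[symmetric])
  ultimately have "(T' - T) ** ?N ** (T' - T) = T' - 2 *\<^sub>R T + T ** ?N ** T"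
    by (simp add: mm_diff_left mm_diff_right scaleR_2)
  moreover have "(T ** ?N ** T) \<bullet> Q = T' \<bullet> Q'"
  proof -
    have "(T ** ?N ** T) \<bullet> Q = ?N \<bullet> S" using inner_sandwich[of T ?N Q] T by simp
    also have "\<dots> = (T' ** ?N ** T') \<bullet> Q'" using inner_sandwich[of T' ?N Q'] T' by simp
    finally show ?thesis by (simp add: inv)
  qed
  ultimately have "((T' - T) ** ?N ** (T' - T)) \<bullet> Q = Q \<bullet> T' + Q' \<bullet> T' - 2 * (Q \<bullet> T)"
    by (simp add: inner_diff_left inner_add_left inner_diff_right inner_add_right inner_commute)
  moreover have "0 \<le> ((T' - T) ** ?N ** (T' - T)) \<bullet> Q"
    using psd_congruence[OF pd_imp_psd[OF inv_pd[OF T'_pd]], of "T' - T"] T(1) T'(1)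
    by (intro psd_inner_nonneg pd_imp_psd[OF Q]) (simp add: adj_diff)
  ultimately show ?thesis
    using fidelity_pd[OF Q S'] by (simp add: T_def T'_def)
qed

lemma fidelity_le:
  assumes Q: "(Q :: ('d::finite) cmat) \<in> psd" and Q': "Q' \<in> pd" and S: "S \<in> psd"
  shows "2 * fidelity Q S \<le> Q \<bullet> bwT Q' S + Q' \<bullet> bwT Q' S"
proof -
  let ?e = "\<lambda>n. inverse (real (Suc n)) *\<^sub>R (mat 1 :: 'd cmat)"
  have e: "?e n \<in> pd" for n by (intro pd_scaleR mat_1_pd) simp
  have "?e \<longlonglongrightarrow> 0 *\<^sub>R mat 1" by (intro tendsto_scaleR LIMSEQ_inverse_real_of_nat tendsto_const)
  then have e0: "?e \<longlonglongrightarrow> 0" by simp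
  have pd: "?e n + A \<in> pd" if "A \<in> psd" for A n by (rule pd_psd_add[OF e that])
  have lim: "(\<lambda>n. ?e n + A) \<longlonglongrightarrow> A" for A
    using tendsto_add[OF e0 tendsto_const[of A]] by simp
  show ?thesis
  proof (rule LIMSEQ_le)
    show "(\<lambda>n. 2 * fidelity (?e n + Q) (?e n + S)) \<longlonglongrightarrow> 2 * fidelity Q S"
      by (intro tendsto_intros tendsto_fidelity lim Q S pd_imp_psd pd)
    show "(\<lambda>n. (?e n + Q) \<bullet> bwT Q' (?e n + S) + Q' \<bullet> bwT Q' (?e n + S)) \<longlonglongrightarrow>
        Q \<bullet> bwT Q' S + Q' \<bullet> bwT Q' S"
      by (intro tendsto_add tendsto_inner tendsto_bwT lim Q' S pd_imp_psd pd tendsto_const)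
    show "\<exists>N. \<forall>n\<ge>N. 2 * fidelity (?e n + Q) (?e n + S)
        \<le> (?e n + Q) \<bullet> bwT Q' (?e n + S) + Q' \<bullet> bwT Q' (?e n + S)"
      by (intro exI allI impI fidelity_le_pd pd Q Q' S)
  qed
qed

lemma fidelity_nonneg: "Q \<in> psd \<Longrightarrow> S \<in> psd \<Longrightarrow> 0 \<le> fidelity Q (S :: ('d::finite) cmat)"
  unfolding fidelity_def Re_trace
  by (intro psd_inner_nonneg msqrt_psd sandwich_msqrt_psd pd_imp_psd[OF mat_1_pd])

text \<open>Convexity of the squared distance in its first argument. The point \<open>Q\<close> may be singular, which is
  what is needed to compare with minimisers of which only semi-definiteness is known.\<close>

lemma bw_dist2_gradient_inequality:
  assumes Q: "(Q :: ('d::finite) cmat) \<in> psd" and Q': "Q' \<in> pd" and S: "S \<in> psd"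
  shows "bw_dist2 Q' S + (mat 1 - bwT Q' S) \<bullet> (Q - Q') \<le> bw_dist2 Q S"
  using fidelity_le[OF assms] fidelity_pd[OF Q' S]
  by (simp add: bw_dist2_fidelity inner_diff_left inner_diff_right inner_commute[of "bwT Q' S"])

text \<open>Where \<open>Q\<close> degenerates, the optimal map blows up. Put \<open>y = T\<^sup>-\<^sup>1 v\<close>. By the Riccati equation
  \<open>s \<bar>y\<bar>\<^sup>2 \<le> \<langle>y, S y\<rangle> = \<langle>v, Q v\<rangle>\<close>, and the Cauchy--Schwarz inequality for the form of \<open>T\<close> gives
  \<open>\<bar>v\<bar>\<^sup>4 = \<langle>y, T v\<rangle>\<^sup>2 \<le> \<langle>y, v\<rangle> \<langle>v, T v\<rangle>\<close>.\<close>

lemma bwT_blow_up: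
  assumes Q: "(Q :: ('d::finite) cmat) \<in> pd" and s: "0 < s" "pd_ge s S"
  shows "sqrt s * norm v ^ 3 \<le> sqrt (v \<bullet> (Q *v v)) * (v \<bullet> (bwT Q S *v v))"
proof (cases "v = 0")
  case True
  then show ?thesis by simp
next
  case False
  have S: "S \<in> pd" by (rule pd_ge_imp_pd[OF s])
  define T where "T = bwT Q S"
  have T: "T \<in> pd" "adj T = T" "T ** Q ** T = S"
    using Q S by (auto simp: T_def bwT_pd bwT_adj bwT_riccati pd_imp_psd)
  define y where "y = matrix_inv T *v v"
  have Ty: "T *v y = v"
    by (simp add: y_def matrix_vector_mul_assoc matrix_inv_mult[OF pd_invertible[OF T(1)]])
  have "s * (norm y)\<^sup>2 \<le> y \<bullet> (S *v y)" using s by (simp add: pd_ge_def)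
  also have "\<dots> = y \<bullet> (T *v (Q *v (T *v y)))"
    by (simp only: matrix_vector_mul_assoc matrix_mul_assoc T(3))
  also have "\<dots> = v \<bullet> (Q *v v)" by (simp add: inner_mv_adj[of y T] T(2) Ty)
  finally have "sqrt (s * (norm y)\<^sup>2) \<le> sqrt (v \<bullet> (Q *v v))" by (rule real_sqrt_le_mono)
  then have y: "sqrt s * norm y \<le> sqrt (v \<bullet> (Q *v v))" by (simp add: real_sqrt_mult)
  define R where "R = msqrt T"
  have R: "adj R = R" "R ** R = T"
    using T(1) by (auto simp: R_def msqrt_adj msqrt_square pd_imp_psd)
  have RR: "x \<bullet> (T *v z) = (R *v x) \<bullet> (R *v z)" for x z
    using inner_mv_adj[of x R "R *v z"] by (simp add: matrix_vector_mul_assoc R)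
  have yTv: "y \<bullet> (T *v v) = v \<bullet> v" by (simp add: inner_mv_adj[of y T] T(2) Ty)
  have pos: "0 \<le> v \<bullet> (T *v v)" using T(1) by (intro psdD pd_imp_psd)
  have "(v \<bullet> v)\<^sup>2 \<le> (y \<bullet> (T *v y)) * (v \<bullet> (T *v v))"
    unfolding yTv[symmetric] RR by (rule Cauchy_Schwarz_ineq)
  also have "\<dots> \<le> (norm y * norm v) * (v \<bullet> (T *v v))"
    unfolding Ty using pos by (intro mult_right_mono norm_cauchy_schwarz)
  finally have "norm v ^ 3 * norm v \<le> norm y * (v \<bullet> (T *v v)) * norm v"
    by (simp add: dot_square_norm power2_eq_square power3_eq_cube mult_ac)
  then have "norm v ^ 3 \<le> norm y * (v \<bullet> (T *v v))" using False by simp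
  then have "sqrt s * norm v ^ 3 \<le> (sqrt s * norm y) * (v \<bullet> (T *v v))"
    using s(1) by (simp add: mult.assoc)
  also have "\<dots> \<le> sqrt (v \<bullet> (Q *v v)) * (v \<bullet> (T *v v))"
    by (rule mult_right_mono[OF y pos])
  finally show ?thesis by (simp add: T_def)
qed

section \<open>The differential of the optimal map\<close>

lemma linear_bwD:
  assumes Q: "Q \<in> pd" and S: "(S :: ('d::finite) cmat) \<in> psd"
  shows "linear (bwD Q S)"
proof (rule linearI)
  show "bwD Q S (X + Y) = bwD Q S X + bwD Q S Y" for X Y
    unfolding bwD_def mm_add_left mm_add_right
      Bochner_Integration.integral_add[OF integrable_sandwich[OF Q S] integrable_sandwich[OF Q S]]
    by (simp only: scaleR_add_right minus_add_distrib)
  show "bwD Q S (c *\<^sub>R X) = c *\<^sub>R bwD Q S X" for c X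
    unfolding bwD_def scaleR_mm_left scaleR_mm_right integral_scaleR_right
    by (simp only: scaleR_minus_right scaleR_left_commute)
qed

lemma bwD_inner:
  assumes Q: "Q \<in> pd" and S: "(S :: ('d::finite) cmat) \<in> psd"
  shows "bwD Q S X \<bullet> Y = - (1 / pi) * (\<integral>u. (res u Q S ** X ** res u Q S) \<bullet> Y \<partial>lborel)"
  by (simp add: bwD_def integrable_sandwich[OF Q S])

lemma bwD_symmetric:
  assumes Q: "Q \<in> pd" and S: "(S :: ('d::finite) cmat) \<in> psd"
  shows "bwD Q S X \<bullet> Y = X \<bullet> bwD Q S Y"
proof -
  have "(\<integral>u. (res u Q S ** X ** res u Q S) \<bullet> Y \<partial>lborel) = (\<integral>u. (res u Q S ** Y ** res u Q S) \<bullet> X \<partial>lborel)"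
  proof (rule integral_cong_AE)
    show "AE u in lborel. (res u Q S ** X ** res u Q S) \<bullet> Y = (res u Q S ** Y ** res u Q S) \<bullet> X"
    proof (rule AE_nonzero)
      fix u :: real assume "u \<noteq> 0"
      then have "adj (res u Q S) = res u Q S" by (intro hermitian_adj res_hermitian Q S)
      then show "(res u Q S ** X ** res u Q S) \<bullet> Y = (res u Q S ** Y ** res u Q S) \<bullet> X"
        using inner_sandwich[of "res u Q S" X Y] by (simp add: inner_commute)
    qed
  qed (use integrable_sandwich[OF Q S] in auto)
  then show ?thesis by (simp add: bwD_inner[OF Q S] inner_commute[of X])
qed

lemma sandwich_inner:
  assumes r: "r \<in> psd" and X: "X \<in> hermitian"
  shows "(r ** X ** r) \<bullet> X = (norm (msqrt r ** X ** msqrt (r :: ('d::finite) cmat)))\<^sup>2"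
proof -
  define C where "C = msqrt r"
  have C: "adj C = C" "C ** C = r" using r by (auto simp: C_def intro: msqrt_adj msqrt_square)
  have "(r ** X ** r) \<bullet> X = (C ** (C ** X ** C) ** C) \<bullet> X"
    by (simp only: C(2)[symmetric] matrix_mul_assoc)
  also have "\<dots> = (C ** X ** C) \<bullet> (C ** X ** C)"
    using inner_sandwich[of C "C ** X ** C" X] C(1) by simp
  finally show ?thesis by (simp add: dot_square_norm C_def)
qed

lemma bwD_nonpos:
  assumes Q: "Q \<in> pd" and S: "(S :: ('d::finite) cmat) \<in> psd" and X: "X \<in> hermitian"
  shows "bwD Q S X \<bullet> X \<le> 0"
proof -
  have "0 \<le> (\<integral>u. (res u Q S ** X ** res u Q S) \<bullet> X \<partial>lborel)"
    by (intro integral_nonneg_AE AE_nonzero) (simp add: sandwich_inner res_psd Q S X)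
  then show ?thesis by (simp add: bwD_inner[OF Q S] divide_nonneg_pos)
qed

text \<open>The integrand is \<open>\<bar>C X C\<bar>\<^sup>2\<close> with \<open>C\<close> the root of the resolvent, which is invertible if \<open>S\<close> is.\<close>

lemma bwD_neg:
  assumes Q: "Q \<in> pd" and S: "(S :: ('d::finite) cmat) \<in> pd" and X: "X \<in> hermitian" "X \<noteq> 0"
  shows "bwD Q S X \<bullet> X < 0"
proof (rule ccontr)
  note S' = pd_imp_psd[OF S]
  let ?g = "\<lambda>u. (res u Q S ** X ** res u Q S) \<bullet> X"
  have int: "integrable lborel ?g" by (intro integrable_inner_left integrable_sandwich[OF Q S'])
  have nn: "AE u in lborel. 0 \<le> ?g u"
    by (rule AE_nonzero) (simp add: sandwich_inner res_psd Q S' X)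
  assume "\<not> ?thesis"
  with bwD_nonpos[OF Q S' X(1)] have "bwD Q S X \<bullet> X = 0" by simp
  then have "(\<integral>u. ?g u \<partial>lborel) = 0" by (simp add: bwD_inner[OF Q S'])
  then have "AE u in lborel. ?g u = 0" using integral_nonneg_eq_0_iff_AE[OF int nn] by simp
  moreover have "AE u in lborel. ?g u \<noteq> 0"
  proof (rule AE_nonzero)
    fix u :: real assume u: "u \<noteq> 0"
    let ?C = "msqrt (res u Q S)"
    have "?C \<in> pd" by (rule msqrt_pd[OF res_pd[OF u Q S' S]])
    note inv = matrix_inv_mult[OF pd_invertible[OF this]]
    have "?C ** X ** ?C \<noteq> 0"
    proof
      assume "?C ** X ** ?C = 0"
      then have "matrix_inv ?C ** (?C ** X ** ?C) ** matrix_inv ?C = 0" by simp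
      then have "(matrix_inv ?C ** ?C) ** X ** (?C ** matrix_inv ?C) = 0"
        by (simp only: matrix_mul_assoc)
      then show False using X by (simp add: inv)
    qed
    then show "?g u \<noteq> 0" by (simp add: sandwich_inner[OF res_psd[OF u Q S'] X(1)])
  qed
  ultimately have "AE u in (lborel :: real measure). False" by eventually_elim simp
  then show False by (simp add: trivial_limit_def[symmetric] ae_filter_eq_bot_iff)
qed

lemma pd_ge_neighbourhood:
  assumes q: "pd_ge q Q" and R: "R \<in> hermitian" "norm (R - Q) \<le> q / 2"
  shows "pd_ge (q / 2) R" "norm R \<le> norm Q + q / 2" "pd_ge (q / 2) (Q :: ('d::finite) cmat)"
proof -
  have q0: "0 \<le> q" using R(2) norm_ge_zero[of "R - Q"] by linarith
  show "pd_ge (q / 2) R" using pd_ge_perturb[OF q R] by simp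
  show "norm R \<le> norm Q + q / 2" using norm_triangle_sub[of R Q] R(2) by simp
  show "pd_ge (q / 2) Q" using pd_ge_perturb[OF q, of Q "q / 2"] q q0 by (simp add: pd_ge_def)
qed

lemma bw_map_has_derivative:
  assumes Q: "Q \<in> pd" and S: "(S :: ('d::finite) cmat) \<in> psd"
  shows "((\<lambda>R. bw_map R S) has_derivative bwD Q S) (at Q within hermitian)"
proof -
  obtain q where q: "0 < q" "pd_ge q Q" using pd_imp_pd_ge[OF Q] by blast
  define c where "c = res_const TYPE('d) (q / 2) (norm Q + q / 2) ^ 3 * sqrt (norm S)"
  show ?thesis
  proof (rule has_derivativeI_sandwich[where e = "q / 2" and H = "\<lambda>R. c * norm (R - Q)"])
    show "bounded_linear (bwD Q S)"
      using linear_bwD[OF Q S] by (simp add: linear_conv_bounded_linear)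
    have "((\<lambda>R. c * norm (R - Q)) \<longlongrightarrow> c * norm (Q - Q)) (at Q within hermitian)"
      by (intro tendsto_intros)
    then show "((\<lambda>R. c * norm (R - Q)) \<longlongrightarrow> 0) (at Q within hermitian)" by simp
    fix R assume R: "R \<in> hermitian" "R \<noteq> Q" "dist R Q < q / 2"
    then have "norm (R - Q) \<le> q / 2" by (simp add: dist_norm)
    note nb = pd_ge_neighbourhood[OF q(2) R(1) this]
    have Rpd: "R \<in> pd" using nb(1) q(1) by (intro pd_ge_imp_pd[of "q / 2"]) auto
    have "norm (bwT R S - bwT Q S - bwD Q S (R - Q)) \<le> c * (norm (R - Q))\<^sup>2"
      using bwT_taylor[OF _ nb(3) _ S nb(1,2)] q(1) by (simp add: c_def mult_ac)
    then show "norm (bw_map R S - bw_map Q S - bwD Q S (R - Q)) / norm (R - Q) \<le> c * norm (R - Q)"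
      using R(2) by (simp add: bw_map_eq Rpd Q S divide_le_eq power2_eq_square mult.assoc)
  qed (use q in auto)
qed

text \<open>A derivative within a proper subspace is determined on that subspace only; restricting it to the
  line through \<open>Q\<close> with direction \<open>X\<close> recovers its value at \<open>X\<close>.\<close>

lemma bw_map_deriv_eq:
  assumes Q: "Q \<in> pd" and S: "(S :: ('d::finite) cmat) \<in> psd" and X: "X \<in> hermitian"
  shows "bw_map_deriv Q S X = bwD Q S X"
proof -
  have d1: "((\<lambda>R. bw_map R S) has_derivative bw_map_deriv Q S) (at Q within hermitian)"
    unfolding bw_map_deriv_def using bw_map_has_derivative[OF Q S]
    by (intro iffD1[OF frechet_derivative_works]) (auto simp: differentiable_def)
  have line: "((\<lambda>t. Q + t *\<^sub>R X) has_derivative (\<lambda>t. t *\<^sub>R X)) (at (0::real) within UNIV)"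
    by (auto intro!: derivative_eq_intros)
  have sub: "range (\<lambda>t::real. Q + t *\<^sub>R X) \<subseteq> hermitian"
    using X pd_hermitian[OF Q] subspace_hermitian by (auto intro!: subspace_add subspace_mul)
  have comp: "((\<lambda>t. bw_map (Q + t *\<^sub>R X) S) has_derivative (\<lambda>t. D (t *\<^sub>R X))) (at (0::real))"
    if "((\<lambda>R. bw_map R S) has_derivative D) (at Q within hermitian)" for D
    using has_derivative_in_compose[OF line, of "\<lambda>R. bw_map R S" D] has_derivative_subset[OF that sub]
    by simp
  have "(\<lambda>t::real. bw_map_deriv Q S (t *\<^sub>R X)) = (\<lambda>t. bwD Q S (t *\<^sub>R X))"
    by (rule has_derivative_unique[OF comp[OF d1] comp[OF bw_map_has_derivative[OF Q S]]])
  from fun_cong[OF this, of 1] show ?thesis by simp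
qed

lemma bwT_continuous_on: "Q \<in> pd \<Longrightarrow> continuous_on psd (bwT (Q :: ('d::finite) cmat))"
  unfolding continuous_on_sequentially by (auto simp: comp_def intro!: tendsto_bwT)

section \<open>Sums of independent real random variables\<close>

context prob_space
begin

lemma second_moment_sum:
  fixes X :: "'i \<Rightarrow> 'a \<Rightarrow> real"
  assumes "finite I" "indep_vars (\<lambda>_. borel) X I"
    and "\<And>i. i \<in> I \<Longrightarrow> integrable M (\<lambda>x. (X i x)\<^sup>2)" "\<And>i. i \<in> I \<Longrightarrow> expectation (X i) = 0"
  shows "integrable M (\<lambda>x. (\<Sum>i\<in>I. X i x)\<^sup>2) \<and>
    expectation (\<lambda>x. (\<Sum>i\<in>I. X i x)\<^sup>2) = (\<Sum>i\<in>I. expectation (\<lambda>x. (X i x)\<^sup>2))"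
  using assms
proof (induction I)
  case empty
  then show ?case by simp
next
  case (insert i I)
  let ?S = "\<lambda>x. \<Sum>i\<in>I. X i x"
  have meas: "X j \<in> borel_measurable M" if "j \<in> insert i I" for j
    using insert.prems(1) that by (auto simp: indep_vars_def)
  have int: "integrable M (X j)" if "j \<in> insert i I" for j
    using insert.prems(2)[OF that] meas[OF that] by (rule square_integrable_imp_integrable[rotated])
  have IH: "integrable M (\<lambda>x. (?S x)\<^sup>2)"
    "expectation (\<lambda>x. (?S x)\<^sup>2) = (\<Sum>i\<in>I. expectation (\<lambda>x. (X i x)\<^sup>2))"
    using insert.IH insert.prems indep_vars_subset[OF insert.prems(1)] by auto
  have ind: "indep_var borel (X i) borel ?S"
    by (rule indep_vars_sum[OF insert.hyps insert.prems(1)])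
  have Sint: "integrable M ?S" using int by (intro Bochner_Integration.integrable_sum) auto
  have cross: "integrable M (\<lambda>x. X i x * ?S x)" "expectation (\<lambda>x. X i x * ?S x) = 0"
    using indep_var_integrable[OF ind int Sint] indep_var_lebesgue_integral[OF ind int Sint]
      insert.prems(3)[of i] by auto
  have eq: "(\<lambda>x. (\<Sum>i\<in>insert i I. X i x)\<^sup>2) = (\<lambda>x. (X i x)\<^sup>2 + 2 * (X i x * ?S x) + (?S x)\<^sup>2)"
    using insert.hyps by (auto simp: power2_sum)
  have 2: "integrable M (\<lambda>x. 2 * (X i x * ?S x))" using cross by simp
  have 1: "integrable M (\<lambda>x. (X i x)\<^sup>2)" using insert.prems(2) by simp
  have "integrable M (\<lambda>x. (X i x)\<^sup>2 + 2 * (X i x * ?S x) + (?S x)\<^sup>2)"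
    by (intro Bochner_Integration.integrable_add 1 2 IH)
  moreover have "expectation (\<lambda>x. (X i x)\<^sup>2 + 2 * (X i x * ?S x) + (?S x)\<^sup>2)
      = expectation (\<lambda>x. (X i x)\<^sup>2) + expectation (\<lambda>x. 2 * (X i x * ?S x)) + expectation (\<lambda>x. (?S x)\<^sup>2)"
    using 1 2 IH(1) by simp
  ultimately show ?case
    unfolding eq using cross(2) IH(2) insert.hyps by simp
qed

lemma prob_sum_ge:
  fixes X :: "nat \<Rightarrow> 'a \<Rightarrow> real"
  assumes indep: "indep_vars (\<lambda>_. borel) X UNIV"
    and sq: "\<And>i. integrable M (\<lambda>x. (X i x)\<^sup>2)" and mean: "\<And>i. expectation (X i) = 0"
    and v: "\<And>i. expectation (\<lambda>x. (X i x)\<^sup>2) = v" and c: "0 < c"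
  shows "prob {x \<in> space M. c \<le> \<bar>\<Sum>i<n. X i x\<bar>} \<le> real n * v / c\<^sup>2"
proof -
  let ?S = "\<lambda>x. \<Sum>i<n. X i x"
  have "indep_vars (\<lambda>_. borel) X {..<n}" by (rule indep_vars_subset[OF indep]) simp
  from second_moment_sum[OF _ this] sq mean v
  have S: "integrable M (\<lambda>x. (?S x)\<^sup>2)" "expectation (\<lambda>x. (?S x)\<^sup>2) = real n * v" by auto
  have [measurable]: "X i \<in> borel_measurable M" for i
    using indep by (auto simp: indep_vars_def)
  have "expectation ?S = 0"
    using sq mean square_integrable_imp_integrable[of "X _"] by (subst Bochner_Integration.integral_sum) auto
  with Chebyshev_inequality[of ?S c] S c show ?thesis by simp
qed

end

locale iid_real = prob_space +
  fixes X :: "nat \<Rightarrow> 'a \<Rightarrow> real"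
  assumes indep: "indep_vars (\<lambda>_. borel) X UNIV"
    and ident: "\<And>i. distr M borel (X i) = distr M borel (X 0)"
begin

lemma X_measurable [measurable]: "X i \<in> borel_measurable M"
  using indep by (auto simp: indep_vars_def)

lemma expectation_ident:
  "g \<in> borel_measurable borel \<Longrightarrow> expectation (\<lambda>x. g (X i x)) = (expectation (\<lambda>x. g (X 0 x)) :: real)"
  using integral_distr[of "X i" M borel g] integral_distr[of "X 0" M borel g] ident[of i] by simp

lemma integrable_ident:
  "g \<in> borel_measurable borel \<Longrightarrow> integrable M (\<lambda>x. g (X 0 x) :: real) \<Longrightarrow> integrable M (\<lambda>x. g (X i x))"
  using integrable_distr_eq[of "X i" M borel g] integrable_distr_eq[of "X 0" M borel g] ident[of i] by simp

lemma iid_compose: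
  assumes [measurable]: "g \<in> borel_measurable borel"
  shows "iid_real M (\<lambda>i x. g (X i x))"
proof
  show "indep_vars (\<lambda>_. borel) (\<lambda>i x. g (X i x)) UNIV"
    by (rule indep_vars_compose2[OF indep]) simp
  show "distr M borel (\<lambda>x. g (X i x)) = distr M borel (\<lambda>x. g (X 0 x))" for i
    using distr_distr[of g borel borel "X i" M] distr_distr[of g borel borel "X 0" M] ident[of i]
    by (simp add: comp_def)
qed

lemma prob_mean_ge:
  assumes sq: "integrable M (\<lambda>x. (X 0 x)\<^sup>2)" and mean: "expectation (X 0) = 0" and c: "0 < c"
  shows "prob {x \<in> space M. c \<le> \<bar>\<Sum>i<n. X i x\<bar>} \<le> real n * expectation (\<lambda>x. (X 0 x)\<^sup>2) / c\<^sup>2"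
  using integrable_ident[of "\<lambda>y. y\<^sup>2"] expectation_ident[of "\<lambda>y. y\<^sup>2"] expectation_ident[of "\<lambda>y. y"] sq mean c
  by (intro prob_sum_ge indep) auto

text \<open>The weak law under a first moment only, by truncation at a level \<open>k\<close>: the truncated part obeys
  Chebyshev's inequality, the rest is small in mean.\<close>

theorem weak_law:
  assumes int: "integrable M (X 0)" and \<epsilon>: "0 < \<epsilon>"
  shows "(\<lambda>n. prob {x \<in> space M. \<epsilon> \<le> \<bar>(\<Sum>i<n. X i x) / real n - expectation (X 0)\<bar>}) \<longlonglongrightarrow> 0"
proof (rule LIMSEQ_I)
  fix \<delta> :: real assume \<delta>: "0 < \<delta>"
  define t :: "nat \<Rightarrow> real \<Rightarrow> real" where "t k y = (if \<bar>y\<bar> \<le> real k then y else 0)" for k y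
  have t_meas [measurable]: "t k \<in> borel_measurable borel" for k unfolding t_def by measurable
  have t_bound: "\<bar>t k y\<bar> \<le> real k" for k y by (simp add: t_def)
  have "(\<lambda>k. expectation (\<lambda>x. \<bar>X 0 x - t k (X 0 x)\<bar>)) \<longlonglongrightarrow> expectation (\<lambda>x. 0)"
  proof (rule integral_dominated_convergence[where w = "\<lambda>x. \<bar>X 0 x\<bar>"])
    show "AE x in M. (\<lambda>k. \<bar>X 0 x - t k (X 0 x)\<bar>) \<longlonglongrightarrow> 0"
    proof (rule AE_I2)
      fix x
      obtain N :: nat where N: "\<bar>X 0 x\<bar> \<le> real N" using real_arch_simple by blast
      have "\<bar>X 0 x\<bar> \<le> real k" if "k \<ge> N" for k using N that by linarith
      then have "eventually (\<lambda>k. \<bar>X 0 x - t k (X 0 x)\<bar> = 0) sequentially"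
        unfolding eventually_sequentially by (intro exI[of _ N]) (simp add: t_def)
      then show "(\<lambda>k. \<bar>X 0 x - t k (X 0 x)\<bar>) \<longlonglongrightarrow> 0" by (rule tendsto_eventually)
    qed
    show "AE x in M. norm \<bar>X 0 x - t k (X 0 x)\<bar> \<le> \<bar>X 0 x\<bar>" for k
      by (rule AE_I2) (simp add: t_def)
  qed (use int in auto)
  then have "(\<lambda>k. expectation (\<lambda>x. \<bar>X 0 x - t k (X 0 x)\<bar>)) \<longlonglongrightarrow> 0" by simp
  \<comment> \<open>The first bound controls the bias of the truncation, the second the probability of a large remainder.\<close>
  moreover define \<eta> where "\<eta> = min (\<epsilon> / 3) (\<delta> * \<epsilon> / 9)"
  have \<eta>: "0 < \<eta>" using \<epsilon> \<delta> by (simp add: \<eta>_def)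
  ultimately obtain k where "\<bar>expectation (\<lambda>x. \<bar>X 0 x - t k (X 0 x)\<bar>) - 0\<bar> < \<eta>"
    using LIMSEQ_D[of "\<lambda>k. expectation (\<lambda>x. \<bar>X 0 x - t k (X 0 x)\<bar>)" 0 \<eta>] by force
  then have k: "expectation (\<lambda>x. \<bar>X 0 x - t k (X 0 x)\<bar>) < \<eta>" by simp
  define m where "m = expectation (\<lambda>x. t k (X 0 x))"
  define Z where "Z i x = t k (X i x) - m" for i x
  define R where "R i x = \<bar>X i x - t k (X i x)\<bar>" for i x
  interpret Z: iid_real M Z
    unfolding Z_def by (rule iid_compose) measurable
  have t_int: "integrable M (\<lambda>x. t k (X i x))" for i
    by (rule integrable_const_bound[of _ "real k"]) (auto simp: t_bound)
  have R_int: "integrable M (R i)" and R_mean: "expectation (R i) < \<eta>" for i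
    using integrable_ident[of "\<lambda>y. \<bar>y - t k y\<bar>" i] expectation_ident[of "\<lambda>y. \<bar>y - t k y\<bar>" i] int t_int k
    unfolding R_def by auto
  have Zsq: "integrable M (\<lambda>x. (Z 0 x)\<^sup>2)"
  proof (rule integrable_const_bound[of _ "(real k + \<bar>m\<bar>)\<^sup>2"])
    show "AE x in M. norm ((Z 0 x)\<^sup>2) \<le> (real k + \<bar>m\<bar>)\<^sup>2"
    proof (rule AE_I2)
      fix x
      have "\<bar>Z 0 x\<bar> \<le> real k + \<bar>m\<bar>" using t_bound[of k "X 0 x"] unfolding Z_def by linarith
      then show "norm ((Z 0 x)\<^sup>2) \<le> (real k + \<bar>m\<bar>)\<^sup>2" by (simp add: abs_le_square_iff[symmetric])
    qed
  qed simp
  have Zmean: "expectation (Z 0) = 0" using t_int[of 0] by (simp add: Z_def[abs_def] m_def prob_space)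
  define v where "v = expectation (\<lambda>x. (Z 0 x)\<^sup>2)"
  have m_close: "\<bar>m - expectation (X 0)\<bar> < \<epsilon> / 3"
  proof -
    have "m - expectation (X 0) = expectation (\<lambda>x. t k (X 0 x) - X 0 x)"
      using t_int int by (simp add: m_def)
    also have "\<bar>\<dots>\<bar> \<le> expectation (\<lambda>x. \<bar>t k (X 0 x) - X 0 x\<bar>)" by (rule integral_abs_bound)
    also have "\<dots> < \<epsilon> / 3" using k unfolding \<eta>_def by (simp add: abs_minus_commute)
    finally show ?thesis .
  qed
  have bound: "prob {x \<in> space M. \<epsilon> \<le> \<bar>(\<Sum>i<n. X i x) / real n - expectation (X 0)\<bar>} \<le>
      9 * v / (\<epsilon>\<^sup>2 * real n) + \<delta> / 3" if n: "n > 0" for n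
  proof -
    let ?A = "{x \<in> space M. real n * \<epsilon> / 3 \<le> \<bar>\<Sum>i<n. Z i x\<bar>}"
    let ?B = "{x \<in> space M. real n * \<epsilon> / 3 \<le> (\<Sum>i<n. R i x)}"
    have [measurable]: "R i \<in> borel_measurable M" for i unfolding R_def by measurable
    have "{x \<in> space M. \<epsilon> \<le> \<bar>(\<Sum>i<n. X i x) / real n - expectation (X 0)\<bar>} \<subseteq> ?A \<union> ?B"
    proof (rule ccontr)
      assume "\<not> ?thesis"
      then obtain x where x: "x \<in> space M" "\<epsilon> \<le> \<bar>(\<Sum>i<n. X i x) / real n - expectation (X 0)\<bar>"
        "\<bar>\<Sum>i<n. Z i x\<bar> < real n * \<epsilon> / 3" "(\<Sum>i<n. R i x) < real n * \<epsilon> / 3" by force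
      have "(\<Sum>i<n. X i x) - real n * m = (\<Sum>i<n. Z i x) + (\<Sum>i<n. X i x - t k (X i x))"
        by (simp add: Z_def sum_subtractf)
      moreover have "\<bar>\<Sum>i<n. X i x - t k (X i x)\<bar> \<le> (\<Sum>i<n. R i x)"
        unfolding R_def by (rule sum_abs)
      ultimately have "\<bar>(\<Sum>i<n. X i x) - real n * m\<bar> < real n * (2 * \<epsilon> / 3)"
        using x(3,4) by linarith
      moreover have "(\<Sum>i<n. X i x) / real n - m = ((\<Sum>i<n. X i x) - real n * m) / real n"
        using n by (simp add: field_simps)
      ultimately have "\<bar>(\<Sum>i<n. X i x) / real n - m\<bar> < 2 * \<epsilon> / 3"
        using n by (simp add: abs_divide pos_divide_less_eq mult.commute)
      with m_close x(2) show False by linarith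
    qed
    then have "prob {x \<in> space M. \<epsilon> \<le> \<bar>(\<Sum>i<n. X i x) / real n - expectation (X 0)\<bar>} \<le> prob (?A \<union> ?B)"
      by (intro finite_measure_mono) measurable
    also have "\<dots> \<le> prob ?A + prob ?B" by (intro measure_Un_le) measurable
    also have "prob ?A \<le> real n * v / (real n * \<epsilon> / 3)\<^sup>2"
      unfolding v_def using n \<epsilon> by (intro Z.prob_mean_ge Zsq Zmean) simp
    also have "real n * v / (real n * \<epsilon> / 3)\<^sup>2 = 9 * v / (\<epsilon>\<^sup>2 * real n)"
      using n \<epsilon> by (simp add: power2_eq_square field_simps)
    also have "prob ?B \<le> \<delta> / 3"
    proof -
      have "prob ?B \<le> expectation (\<lambda>x. \<Sum>i<n. R i x) / (real n * \<epsilon> / 3)"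
      proof (rule integral_Markov_inequality_measure[where A = "{}"])
        show "integrable M (\<lambda>x. \<Sum>i<n. R i x)"
          by (intro Bochner_Integration.integrable_sum R_int)
        show "AE x in M. 0 \<le> (\<Sum>i<n. R i x)"
          by (intro AE_I2 sum_nonneg) (simp add: R_def)
      qed (use n \<epsilon> in auto)
      also have "expectation (\<lambda>x. \<Sum>i<n. R i x) = (\<Sum>i<n. expectation (R i))"
        by (rule Bochner_Integration.integral_sum) (rule R_int)
      also have "(\<Sum>i<n. expectation (R i)) \<le> (\<Sum>i<n. \<eta>)"
        using R_mean by (intro sum_mono less_imp_le)
      also have "(\<Sum>i<n. \<eta>) \<le> real n * (\<delta> * \<epsilon> / 9)" using n by (simp add: \<eta>_def)
      finally show ?thesis using n \<epsilon> by (simp add: divide_right_mono field_simps)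
    qed
    finally show ?thesis by simp
  qed
  have "(\<lambda>n. 9 * v / (\<epsilon>\<^sup>2 * real n)) \<longlonglongrightarrow> 0" using \<epsilon> by real_asymp
  from LIMSEQ_D[OF this, of "\<delta> / 3"] \<delta>
  obtain N where N: "\<And>n. n \<ge> N \<Longrightarrow> \<bar>9 * v / (\<epsilon>\<^sup>2 * real n)\<bar> < \<delta> / 3" by auto
  show "\<exists>no. \<forall>n\<ge>no. norm (prob {x \<in> space M. \<epsilon> \<le> \<bar>(\<Sum>i<n. X i x) / real n - expectation (X 0)\<bar>} - 0) < \<delta>"
  proof (intro exI[of _ "max N 1"] allI impI)
    fix n assume "max N 1 \<le> n"
    then have "n > 0" "n \<ge> N" by auto
    then show "norm (prob {x \<in> space M. \<epsilon> \<le> \<bar>(\<Sum>i<n. X i x) / real n - expectation (X 0)\<bar>} - 0) < \<delta>"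
      using bound[of n] N[of n] \<delta> measure_nonneg[of M]
      unfolding real_norm_def diff_0_right abs_of_nonneg[OF measure_nonneg] by linarith
  qed
qed

end

section \<open>Centred normal laws\<close>

text \<open>The centred normal law of standard deviation \<open>\<sigma>\<close>, with the point mass for \<open>\<sigma> = 0\<close>.\<close>

definition normal_law :: "real \<Rightarrow> real measure" where
  "normal_law \<sigma> = (if \<sigma> = 0 then return borel 0
     else density lborel (\<lambda>x. ennreal (normal_density 0 \<sigma> x)))"

lemma normal_law_centred_normal: "0 \<le> \<sigma> \<Longrightarrow> centred_normal (normal_law \<sigma>)"
  unfolding centred_normal_def normal_law_def by (cases "\<sigma> = 0") (auto intro!: exI[of _ \<sigma>])

lemma sets_normal_law [simp, measurable_cong]: "sets (normal_law \<sigma>) = sets borel"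
  by (simp add: normal_law_def)

lemma space_normal_law [simp]: "space (normal_law \<sigma>) = UNIV"
  by (simp add: normal_law_def)

lemma prob_space_normal_law: "0 \<le> \<sigma> \<Longrightarrow> prob_space (normal_law \<sigma>)"
  by (auto simp: normal_law_def prob_space_return prob_space_normal_density)

lemma normal_law_scale: "distr (normal_law 1) borel (\<lambda>x. c * x) = normal_law \<bar>c\<bar>"
proof (cases "c = 0")
  case True
  interpret prob_space "normal_law 1" by (rule prob_space_normal_law) simp
  have "distr (normal_law 1) borel (\<lambda>x. 0) = return borel (0::real)" by (rule distr_const) simp
  then show ?thesis using True by (simp add: normal_law_def[of 0])
next
  case False
  interpret prob_space "normal_law 1" by (rule prob_space_normal_law) simp
  have "distributed (normal_law 1) lborel (\<lambda>x. x) (normal_density 0 1)"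
    by (simp add: distributed_def normal_law_def distr_id2)
  from normal_density_affine[OF this, of c 0] False
  have "distributed (normal_law 1) lborel (\<lambda>x. c * x) (normal_density 0 \<bar>c\<bar>)" by simp
  then have "distr (normal_law 1) lborel (\<lambda>x. c * x) = normal_law \<bar>c\<bar>"
    using False by (simp add: distributed_def normal_law_def)
  moreover have "distr (normal_law 1) lborel (\<lambda>x. c * x) = distr (normal_law 1) borel (\<lambda>x. c * x)"
    by (intro distr_cong) auto
  ultimately show ?thesis by simp
qed

lemma normal_law_second_moment:
  assumes "0 \<le> \<sigma>"
  shows "has_bochner_integral (normal_law \<sigma>) (\<lambda>x. x\<^sup>2) (\<sigma>\<^sup>2)"
proof (cases "\<sigma> = 0")
  case True
  then show ?thesis
    using has_bochner_integral_cong_AE[of "\<lambda>x::real. x\<^sup>2" "return borel 0" "\<lambda>_. 0" 0]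
    by (simp add: normal_law_def AE_return has_bochner_integral_zero)
next
  case False
  with assms have \<sigma>: "0 < \<sigma>" by simp
  from normal_moment_even[OF \<sigma>, of 0 1] \<sigma>
  show ?thesis
    by (simp add: normal_law_def has_bochner_integral_iff integrable_density integral_density
      normal_density_nonneg power2_eq_square)
qed

text \<open>The one-dimensional central limit theorem with the degenerate case included, in the form in
  which it is applied to projections of random vectors, whose variance may vanish.\<close>

theorem (in iid_real) clt_bounded_continuous:
  assumes mean: "expectation (X 0) = 0" and sq: "integrable M (\<lambda>x. (X 0 x)\<^sup>2)"
    and \<sigma>: "0 \<le> \<sigma>" "expectation (\<lambda>x. (X 0 x)\<^sup>2) = \<sigma>\<^sup>2"
    and f: "continuous_on UNIV f" "\<And>y. \<bar>f y\<bar> \<le> (B::real)"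
  shows "(\<lambda>n. expectation (\<lambda>x. f ((\<Sum>i<n. X i x) / sqrt (real n)))) \<longlonglongrightarrow> (\<integral>y. f y \<partial>normal_law \<sigma>)"
proof (cases "\<sigma> = 0")
  case True
  have "AE x in M. X i x = 0" for i
  proof -
    have "integrable M (\<lambda>x. (X i x)\<^sup>2)" "expectation (\<lambda>x. (X i x)\<^sup>2) = 0"
      using integrable_ident[of "\<lambda>y. y\<^sup>2" i] expectation_ident[of "\<lambda>y. y\<^sup>2" i] sq \<sigma>(2) True
      by auto
    with integral_nonneg_eq_0_iff_AE[of M "\<lambda>x. (X i x)\<^sup>2"] show ?thesis by simp
  qed
  then have ae: "AE x in M. \<forall>i. X i x = 0" by (simp add: AE_all_countable)
  have f_meas [measurable]: "f \<in> borel_measurable borel" by (rule borel_measurable_continuous_onI[OF f(1)])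
  have "expectation (\<lambda>x. f ((\<Sum>i<n. X i x) / sqrt (real n))) = expectation (\<lambda>x. f 0)" for n
  proof (rule integral_cong_AE)
    show "AE x in M. f ((\<Sum>i<n. X i x) / sqrt (real n)) = f 0"
      using ae by eventually_elim simp
  qed measurable
  then show ?thesis using True by (simp add: normal_law_def prob_space integral_return)
next
  case False
  with \<sigma> have \<sigma>0: "0 < \<sigma>" by simp
  have f_meas [measurable]: "f \<in> borel_measurable borel" by (rule borel_measurable_continuous_onI[OF f(1)])
  have m: "expectation (X n) = 0" for n using expectation_ident[of "\<lambda>y. y" n] mean by simp
  have s: "integrable M (\<lambda>x. (X n x)\<^sup>2)" for n using integrable_ident[of "\<lambda>y. y\<^sup>2" n] sq by simp
  have v: "variance (X n) = \<sigma>\<^sup>2" for n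
    using m[of n] expectation_ident[of "\<lambda>y. y\<^sup>2" n] \<sigma>(2) by simp
  note weak = central_limit_theorem_zero_mean[OF indep m \<sigma>0 s v ident]
  have "(\<lambda>n. \<integral>y. f (\<sigma> * y) \<partial>distr M borel (\<lambda>x. (\<Sum>i<n. X i x) / sqrt (real n * \<sigma>\<^sup>2)))
      \<longlonglongrightarrow> (\<integral>y. f (\<sigma> * y) \<partial>std_normal_distribution)"
  proof (rule weak_conv_imp_integral_bdd_continuous_conv[OF _ _ weak])
    show "isCont (\<lambda>y. f (\<sigma> * y)) x" for x
      using f(1) by (intro isCont_o2[of _ "\<lambda>y. \<sigma> * y" f]) (auto simp: continuous_on_eq_continuous_at)
  qed (use f(2) in \<open>auto intro!: real_distribution_distr real_dist_normal_dist\<close>)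
  moreover have "(\<integral>y. f (\<sigma> * y) \<partial>distr M borel (\<lambda>x. (\<Sum>i<n. X i x) / sqrt (real n * \<sigma>\<^sup>2)))
      = expectation (\<lambda>x. f ((\<Sum>i<n. X i x) / sqrt (real n)))" for n
    using \<sigma>0 by (subst integral_distr) (auto simp: real_sqrt_mult)
  moreover have "(\<integral>y. f (\<sigma> * y) \<partial>std_normal_distribution) = (\<integral>y. f y \<partial>normal_law \<sigma>)"
  proof -
    have "(\<integral>y. f y \<partial>normal_law \<sigma>) = (\<integral>y. f y \<partial>distr (normal_law 1) borel (\<lambda>x. \<sigma> * x))"
      using normal_law_scale[of \<sigma>] \<sigma>0 by simp
    also have "\<dots> = (\<integral>y. f (\<sigma> * y) \<partial>normal_law 1)" by (subst integral_distr) auto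
    finally show ?thesis by (simp add: normal_law_def)
  qed
  ultimately show ?thesis by simp
qed

section \<open>Gaussian laws on a Euclidean space\<close>

lemma indep_vars_PiM_coordinates:
  assumes B: "finite B" "B \<noteq> {}" and N: "\<And>i. prob_space (N i)" "\<And>i. sets (N i) = sets (borel :: real measure)"
  shows "prob_space.indep_vars (PiM B N) (\<lambda>_. borel) (\<lambda>i x. x i) B"
proof -
  interpret prob_space "PiM B N" by (intro prob_space_PiM N)
  have meas: "(\<lambda>x. x i) \<in> measurable (PiM B N) borel" if "i \<in> B" for i
    using measurable_component_singleton[OF that, of N] measurable_cong_sets[OF refl N(2)] by blast
  have comp: "distr (PiM B N) borel (\<lambda>x. x i) = N i" if "i \<in> B" for i
  proof -
    have "distr (PiM B N) borel (\<lambda>x. x i) = distr (PiM B N) (N i) (\<lambda>x. x i)"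
      by (intro distr_cong) (auto simp: N)
    also have "\<dots> = N i" by (rule distr_PiM_component[OF N(1) that])
    finally show ?thesis .
  qed
  have "distr (PiM B N) (PiM B (\<lambda>_. borel)) (\<lambda>x. \<lambda>i\<in>B. x i) = distr (PiM B N) (PiM B N) (\<lambda>x. x)"
    by (intro distr_cong) (auto simp: space_PiM N intro!: sets_PiM_cong)
  also have "\<dots> = PiM B N" by (rule distr_id)
  also have "\<dots> = PiM B (\<lambda>i. distr (PiM B N) borel (\<lambda>x. x i))"
    by (intro PiM_cong) (auto simp: comp)
  finally show ?thesis
    by (subst indep_vars_iff_distr_eq_PiM'[OF B(2)]) (auto intro: meas)
qed

text \<open>The law of \<open>\<Sum>b. x\<^sub>b c\<^sub>b\<close> for independent standard normal coordinates \<open>x\<^sub>b\<close>.\<close>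

lemma gaussian_law_exists:
  fixes c :: "'b \<Rightarrow> 'a::euclidean_space"
  assumes B: "finite B"
  shows "\<exists>N. prob_space N \<and> sets N = sets borel \<and> (AE Z in N. Z \<in> span (c ` B)) \<and>
    (\<forall>X. distr N borel (\<lambda>Z. X \<bullet> Z) = normal_law (sqrt (\<Sum>b\<in>B. (X \<bullet> c b)\<^sup>2)))"
proof -
  let ?P = "PiM B (\<lambda>_. normal_law 1)"
  interpret prob_space ?P by (intro prob_space_PiM prob_space_normal_law) simp
  have meas [measurable]: "(\<lambda>x. x b) \<in> measurable ?P borel" if "b \<in> B" for b
    using measurable_component_singleton[OF that, of "\<lambda>_. normal_law 1"]
      measurable_cong_sets[OF refl sets_normal_law] by blast
  let ?G = "\<lambda>x. \<Sum>b\<in>B. x b *\<^sub>R c b"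
  have G [measurable]: "?G \<in> measurable ?P borel" by (intro borel_measurable_sum borel_measurable_scaleR) (auto intro: meas)
  define N where "N = distr ?P borel ?G"
  have "prob_space N" unfolding N_def by (rule prob_space_distr[OF G])
  moreover have "sets N = sets borel" by (simp add: N_def)
  moreover have "AE Z in N. Z \<in> span (c ` B)"
  proof -
    have "?G x \<in> span (c ` B)" for x by (intro span_sum span_scale) (auto intro: span_base)
    moreover have "{x \<in> space borel. x \<in> span (c ` B)} \<in> sets borel"
      using borel_closed[OF closed_subspace[OF subspace_span[of "c ` B"]]] by simp
    ultimately show ?thesis
      unfolding N_def by (subst AE_distr_iff[OF G]) auto
  qed
  moreover have "distr N borel (\<lambda>Z. X \<bullet> Z) = normal_law (sqrt (\<Sum>b\<in>B. (X \<bullet> c b)\<^sup>2))" for X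
  proof -
    define I where "I = {b \<in> B. X \<bullet> c b \<noteq> 0}"
    have I: "finite I" "I \<subseteq> B" using B by (auto simp: I_def)
    have inner: "X \<bullet> ?G x = (\<Sum>b\<in>I. (X \<bullet> c b) * x b)" for x
    proof -
      have "X \<bullet> ?G x = (\<Sum>b\<in>B. (X \<bullet> c b) * x b)" by (simp add: inner_sum_right mult.commute)
      also have "\<dots> = (\<Sum>b\<in>I. (X \<bullet> c b) * x b)"
        using B by (intro sum.mono_neutral_right) (auto simp: I_def)
      finally show ?thesis .
    qed
    have var: "(\<Sum>b\<in>B. (X \<bullet> c b)\<^sup>2) = (\<Sum>b\<in>I. \<bar>X \<bullet> c b\<bar>\<^sup>2)"
      using B by (simp, intro sum.mono_neutral_right) (auto simp: I_def)
    have dN: "distr N borel (\<lambda>Z. X \<bullet> Z) = distr ?P borel (\<lambda>x. \<Sum>b\<in>I. (X \<bullet> c b) * x b)"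
      unfolding N_def by (subst distr_distr) (auto simp: comp_def inner)
    show ?thesis
    proof (cases "I = {}")
      case True
      have "distr ?P borel (\<lambda>x. 0) = return borel (0::real)" by (rule distr_const) simp
      with True show ?thesis unfolding dN var by (simp add: normal_law_def[of 0])
    next
      case False
      then have "B \<noteq> {}" using I by auto
      have ind: "indep_vars (\<lambda>_. borel) (\<lambda>b x. (X \<bullet> c b) * x b) I"
        by (rule indep_vars_compose2[OF indep_vars_subset[OF indep_vars_PiM_coordinates[OF B \<open>B \<noteq> {}\<close>] I(2)]])
          (auto simp: prob_space_normal_law)
      have "distributed ?P lborel (\<lambda>x. \<Sum>b\<in>I. (X \<bullet> c b) * x b)
          (normal_density (\<Sum>b\<in>I. 0) (sqrt (\<Sum>b\<in>I. \<bar>X \<bullet> c b\<bar>\<^sup>2)))"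
      proof (rule sum_indep_normal[OF I(1) False ind])
        fix b assume b: "b \<in> I"
        then have bB: "b \<in> B" using I by auto
        have "distr ?P lborel (\<lambda>x. x b) = distr ?P (normal_law 1) (\<lambda>x. x b)"
          by (intro distr_cong) auto
        also have "\<dots> = normal_law 1"
          by (rule distr_PiM_component[OF _ bB]) (simp add: prob_space_normal_law)
        finally have "distributed ?P lborel (\<lambda>x. x b) (normal_density 0 1)"
          using meas[OF bB] by (simp add: distributed_def normal_law_def)
        from normal_density_affine[OF this, of "X \<bullet> c b" 0] b
        show "distributed ?P lborel (\<lambda>x. (X \<bullet> c b) * x b) (normal_density 0 \<bar>X \<bullet> c b\<bar>)"
          by (simp add: I_def)
        show "0 < \<bar>X \<bullet> c b\<bar>" using b by (simp add: I_def)
      qed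
      moreover have "0 < (\<Sum>b\<in>I. \<bar>X \<bullet> c b\<bar>\<^sup>2)"
        using I(1) False by (intro sum_pos) (auto simp: I_def)
      moreover have "distr ?P lborel (\<lambda>x. \<Sum>b\<in>I. (X \<bullet> c b) * x b) = distr ?P borel (\<lambda>x. \<Sum>b\<in>I. (X \<bullet> c b) * x b)"
        by (intro distr_cong) auto
      ultimately show ?thesis
        unfolding dN var by (simp add: distributed_def normal_law_def)
    qed
  qed
  ultimately show ?thesis by blast
qed

text \<open>Polarisation of the second moments of the one-dimensional marginals.\<close>

lemma gaussian_law_covariance:
  fixes c :: "'b \<Rightarrow> 'a::euclidean_space"
  assumes B: "finite B" and N: "prob_space N" "sets N = sets borel"
    and marg: "\<And>X. distr N borel (\<lambda>Z. X \<bullet> Z) = normal_law (sqrt (\<Sum>b\<in>B. (X \<bullet> c b)\<^sup>2))"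
  shows "(\<integral>Z. tensor_op Z Z X \<partial>N) = (\<Sum>b\<in>B. (X \<bullet> c b) *\<^sub>R c b)"
proof -
  interpret prob_space N by (rule N(1))
  note [measurable_cong] = N(2)
  have sq: "has_bochner_integral N (\<lambda>Z. (X \<bullet> Z)\<^sup>2) (\<Sum>b\<in>B. (X \<bullet> c b)\<^sup>2)" for X
  proof -
    have nn: "0 \<le> (\<Sum>b\<in>B. (X \<bullet> c b)\<^sup>2)" by (rule sum_nonneg) simp
    have "has_bochner_integral (distr N borel (\<lambda>Z. X \<bullet> Z)) (\<lambda>y. y\<^sup>2) (\<Sum>b\<in>B. (X \<bullet> c b)\<^sup>2)"
      unfolding marg using normal_law_second_moment[of "sqrt (\<Sum>b\<in>B. (X \<bullet> c b)\<^sup>2)"] nn by simp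
    then show ?thesis by (simp add: has_bochner_integral_iff integrable_distr_eq integral_distr)
  qed
  have cov: "has_bochner_integral N (\<lambda>Z. (X \<bullet> Z) * (Y \<bullet> Z)) (\<Sum>b\<in>B. (X \<bullet> c b) * (Y \<bullet> c b))" for X Y
  proof -
    have "has_bochner_integral N (\<lambda>Z. (((X + Y) \<bullet> Z)\<^sup>2 - ((X - Y) \<bullet> Z)\<^sup>2) / 4)
        (((\<Sum>b\<in>B. ((X + Y) \<bullet> c b)\<^sup>2) - (\<Sum>b\<in>B. ((X - Y) \<bullet> c b)\<^sup>2)) / 4)"
      by (intro has_bochner_integral_divide has_bochner_integral_diff sq)
    moreover have "(((X + Y) \<bullet> Z)\<^sup>2 - ((X - Y) \<bullet> Z)\<^sup>2) / 4 = (X \<bullet> Z) * (Y \<bullet> Z)" for Z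
      by (simp add: inner_add_left inner_diff_left power2_eq_square algebra_simps)
    ultimately show ?thesis
      by (simp add: sum_subtractf[symmetric] sum_divide_distrib)
  qed
  have int: "integrable N (\<lambda>Z. tensor_op Z Z X)"
  proof -
    have "integrable N (\<lambda>Z. \<Sum>e\<in>Basis. ((X \<bullet> Z) * (e \<bullet> Z)) *\<^sub>R e)"
      using cov by (intro Bochner_Integration.integrable_sum integrable_scaleR_left) (auto simp: has_bochner_integral_iff)
    moreover have "(\<Sum>e\<in>Basis. ((X \<bullet> Z) * (e \<bullet> Z)) *\<^sub>R e) = tensor_op Z Z X" for Z
    proof -
      have "(\<Sum>e\<in>Basis. ((X \<bullet> Z) * (e \<bullet> Z)) *\<^sub>R e) = (X \<bullet> Z) *\<^sub>R (\<Sum>e\<in>Basis. (Z \<bullet> e) *\<^sub>R e)"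
        by (simp add: scaleR_sum_right inner_commute[of Z])
      then show ?thesis by (simp only: euclidean_representation tensor_op_def inner_commute[of Z X])
    qed
    ultimately show ?thesis by simp
  qed
  show ?thesis
  proof (rule euclidean_eqI)
    fix e :: 'a
    have "(\<integral>Z. tensor_op Z Z X \<partial>N) \<bullet> e = (\<integral>Z. tensor_op Z Z X \<bullet> e \<partial>N)" using int by simp
    also have "\<dots> = (\<integral>Z. (X \<bullet> Z) * (e \<bullet> Z) \<partial>N)" by (simp add: tensor_op_def inner_commute)
    also have "\<dots> = (\<Sum>b\<in>B. (X \<bullet> c b) * (e \<bullet> c b))"
      using cov[of X e] by (rule has_bochner_integral_integral_eq)
    also have "\<dots> = (\<Sum>b\<in>B. (X \<bullet> c b) *\<^sub>R c b) \<bullet> e"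
      by (simp add: inner_sum_left inner_commute[of e])
    finally show "(\<integral>Z. tensor_op Z Z X \<partial>N) \<bullet> e = (\<Sum>b\<in>B. (X \<bullet> c b) *\<^sub>R c b) \<bullet> e" .
  qed
qed

section \<open>Trigonometric polynomials determine weak convergence\<close>

text \<open>Single frequencies are taken with both coefficients at once, so that closure under multiplication
  is the product-to-sum formula.\<close>

inductive trigpoly :: "('a::euclidean_space \<Rightarrow> real) \<Rightarrow> bool" where
  trig: "trigpoly (\<lambda>w. a * cos (X \<bullet> w) + b * sin (X \<bullet> w))"
| add: "trigpoly p \<Longrightarrow> trigpoly q \<Longrightarrow> trigpoly (\<lambda>w. p w + q w)"

lemma trigpoly_const: "trigpoly (\<lambda>w. c)"
  using trig[of c 0 0] by simp

lemma trigpoly_sum: "finite I \<Longrightarrow> (\<And>i. i \<in> I \<Longrightarrow> trigpoly (p i)) \<Longrightarrow> trigpoly (\<lambda>w. \<Sum>i\<in>I. p i w)"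
  by (induction I rule: finite_induct) (auto intro: trigpoly.add trigpoly_const)

lemma trigpoly_mult_trig:
  assumes "trigpoly q"
  shows "trigpoly (\<lambda>w. (a * cos (X \<bullet> w) + b * sin (X \<bullet> w)) * q w)"
  using assms
proof induction
  case (trig c Y d)
  have "(\<lambda>w. (a * cos (X \<bullet> w) + b * sin (X \<bullet> w)) * (c * cos (Y \<bullet> w) + d * sin (Y \<bullet> w))) =
    (\<lambda>w. ((a * c + b * d) / 2 * cos ((X - Y) \<bullet> w) + (b * c - a * d) / 2 * sin ((X - Y) \<bullet> w)) +
      ((a * c - b * d) / 2 * cos ((X + Y) \<bullet> w) + (b * c + a * d) / 2 * sin ((X + Y) \<bullet> w)))"
    by (rule ext) (simp add: inner_diff_left inner_add_left cos_add cos_diff sin_add sin_diff field_simps)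
  then show ?case by (simp only:) (intro trigpoly.intros)
next
  case (add p q)
  have "(\<lambda>w. (a * cos (X \<bullet> w) + b * sin (X \<bullet> w)) * (p w + q w)) =
    (\<lambda>w. (a * cos (X \<bullet> w) + b * sin (X \<bullet> w)) * p w + (a * cos (X \<bullet> w) + b * sin (X \<bullet> w)) * q w)"
    by (simp add: distrib_left)
  then show ?case using add.IH by (simp only:) (rule trigpoly.add)
qed

lemma trigpoly_mult: "trigpoly p \<Longrightarrow> trigpoly q \<Longrightarrow> trigpoly (\<lambda>w. p w * q w)"
proof (induction rule: trigpoly.induct)
  case (trig a X b)
  then show ?case by (rule trigpoly_mult_trig)
next
  case (add p p')
  have "(\<lambda>w. (p w + p' w) * q w) = (\<lambda>w. p w * q w + p' w * q w)" by (simp add: distrib_right)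
  with trigpoly.add[OF add.IH(1)[OF add.prems] add.IH(2)[OF add.prems]] show ?case by simp
qed

lemma trigpoly_continuous: "trigpoly p \<Longrightarrow> continuous_on UNIV p"
  by (induction rule: trigpoly.induct) (intro continuous_intros | assumption)+

lemma trigpoly_measurable: "trigpoly p \<Longrightarrow> p \<in> borel_measurable borel"
  by (intro borel_measurable_continuous_onI trigpoly_continuous)

lemma trigpoly_bounded: "trigpoly p \<Longrightarrow> \<exists>c. \<forall>w. \<bar>p w\<bar> \<le> c"
proof (induction rule: trigpoly.induct)
  case (trig a X b)
  have "\<bar>a * cos t + b * sin t\<bar> \<le> \<bar>a\<bar> + \<bar>b\<bar>" for t :: real
  proof -
    have "\<bar>a * cos t\<bar> \<le> \<bar>a\<bar>" "\<bar>b * sin t\<bar> \<le> \<bar>b\<bar>"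
      using mult_left_mono[OF abs_cos_le_one, of "\<bar>a\<bar>" t] mult_left_mono[OF abs_sin_le_one, of "\<bar>b\<bar>" t]
      by (auto simp: abs_mult)
    then show ?thesis by linarith
  qed
  then show ?case by blast
next
  case (add p q)
  then obtain c c' where "\<And>w. \<bar>p w\<bar> \<le> c" "\<And>w. \<bar>q w\<bar> \<le> c'" by blast
  then have "\<bar>p w + q w\<bar> \<le> c + c'" for w by (metis abs_triangle_ineq add_mono order_trans)
  then show ?case by blast
qed

text \<open>Two points have the same image iff they differ by a vector of the lattice of period \<open>2 L\<close> in every
  coordinate, so the image is a torus, embedded in the square of the space.\<close>

definition torus :: "real \<Rightarrow> 'a::euclidean_space \<Rightarrow> 'a \<times> 'a" where
  "torus L w = (\<Sum>b\<in>Basis. cos (pi * (w \<bullet> b) / L) *\<^sub>R b, \<Sum>b\<in>Basis. sin (pi * (w \<bullet> b) / L) *\<^sub>R b)"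

lemma torus_eq_iff:
  "torus L w = torus L w' \<longleftrightarrow> (\<forall>b\<in>Basis. cos (pi * (w \<bullet> b) / L) = cos (pi * (w' \<bullet> b) / L) \<and>
     sin (pi * (w \<bullet> b) / L) = sin (pi * (w' \<bullet> b) / L))"
  unfolding torus_def prod_eq_iff euclidean_eq_iff[where 'a = 'a] by auto

lemma trigpoly_polynomial_torus:
  fixes g :: "'a::euclidean_space \<times> 'a \<Rightarrow> real"
  assumes "real_polynomial_function g"
  shows "trigpoly (\<lambda>w. g (torus L w))"
  using assms
proof induction
  case (linear f)
  have lin: "linear f" using linear by (rule bounded_linear.linear)
  have "f (torus L w) = (\<Sum>b\<in>Basis. f (b, 0) * cos (((pi / L) *\<^sub>R b) \<bullet> w) + f (0, b) * sin (((pi / L) *\<^sub>R b) \<bullet> w))" for w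
  proof -
    have "torus L w = (\<Sum>b\<in>Basis. cos (pi * (w \<bullet> b) / L) *\<^sub>R (b, 0) + sin (pi * (w \<bullet> b) / L) *\<^sub>R (0, b))"
      by (simp add: torus_def prod_eq_iff fst_sum snd_sum)
    then have "f (torus L w) = (\<Sum>b\<in>Basis. cos (pi * (w \<bullet> b) / L) * f (b, 0) + sin (pi * (w \<bullet> b) / L) * f (0, b))"
      by (simp add: linear_sum[OF lin] linear_add[OF lin] linear_scale[OF lin] del: scaleR_Pair)
    then show ?thesis by (simp add: inner_commute mult.commute)
  qed
  then show ?case by (simp only:) (intro trigpoly_sum finite_Basis trigpoly.trig)
qed (auto intro: trigpoly_const trigpoly.add trigpoly_mult)

text \<open>A continuous function supported in the interior of a box of side \<open>2 L\<close> descends to the torus, where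
  the Stone--Weierstrass theorem applies. Pulling the approximation back gives a trigonometric
  polynomial whose supremum over the whole space is under control; this is what approximation on
  compact subsets of the space would not give.\<close>

lemma trigpoly_approximation:
  fixes f :: "'a::euclidean_space \<Rightarrow> real"
  assumes f: "continuous_on UNIV f" "\<And>w. \<bar>f w\<bar> \<le> B" and K: "0 \<le> K" and e: "0 < e"
  shows "\<exists>p. trigpoly p \<and> (\<forall>w. norm w \<le> K \<longrightarrow> \<bar>f w - p w\<bar> \<le> e) \<and> (\<forall>w. \<bar>p w\<bar> \<le> B + e)"
proof -
  define L where "L = K + 1"
  have L: "0 < L" using K by (simp add: L_def)
  \<comment> \<open>Cut off to be supported in the ball of radius \<open>K + 1 = L\<close>, so that \<open>h\<close> vanishes on the boundary of the box.\<close>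
  define h where "h w = f w * max 0 (min 1 (K + 1 - norm w))" for w
  have h_cont: "continuous_on UNIV h"
    unfolding h_def by (intro continuous_intros f)
  have h_bound: "\<bar>h w\<bar> \<le> B" for w
  proof -
    have "\<bar>h w\<bar> = \<bar>f w\<bar> * max 0 (min 1 (K + 1 - norm w))" by (simp add: h_def abs_mult)
    also have "\<dots> \<le> \<bar>f w\<bar> * 1" by (intro mult_left_mono) auto
    also have "\<dots> \<le> B" using f(2)[of w] by simp
    finally show ?thesis .
  qed
  have h_in: "h w = f w" if "norm w \<le> K" for w using that by (simp add: h_def)
  have h_out: "h w = 0" if "K + 1 \<le> norm w" for w using that by (simp add: h_def)
  define C where "C = {w::'a. \<forall>b\<in>Basis. - L \<le> w \<bullet> b \<and> w \<bullet> b \<le> L}"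
  have C_cbox: "C = cbox (\<Sum>b\<in>Basis. (- L) *\<^sub>R b) (\<Sum>b\<in>Basis. L *\<^sub>R b)"
    unfolding C_def cbox_def by (intro Collect_cong ball_cong refl) (simp only: inner_sum_left_Basis)
  have C: "compact C" unfolding C_cbox by (rule compact_cbox)
  have well: "h w = h w'" if w: "w \<in> C" "w' \<in> C" "torus L w = torus L w'" for w w'
  proof (cases "w = w'")
    case False
    then obtain b where b: "b \<in> Basis" "w \<bullet> b \<noteq> w' \<bullet> b" by (auto simp: euclidean_eq_iff[where 'a = 'a])
    have "sin (pi * (w \<bullet> b) / L) = sin (pi * (w' \<bullet> b) / L) \<and> cos (pi * (w \<bullet> b) / L) = cos (pi * (w' \<bullet> b) / L)"
      using w(3) b(1) by (simp add: torus_eq_iff)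
    then obtain n :: int where n: "pi * (w \<bullet> b) / L = pi * (w' \<bullet> b) / L + 2 * pi * n"
      unfolding sin_cos_eq_iff by blast
    have "w \<bullet> b - w' \<bullet> b = 2 * L * n"
    proof -
      have "pi * (w \<bullet> b) = pi * (w' \<bullet> b + 2 * L * n)" using n L by (simp add: field_simps)
      then show ?thesis by simp
    qed
    moreover have "\<bar>w \<bullet> b - w' \<bullet> b\<bar> \<le> 2 * L"
      using w(1,2) b(1) by (auto simp: C_def abs_le_iff) (smt (verit))+
    ultimately have "\<bar>real_of_int n\<bar> \<le> 1" "n \<noteq> 0" using L b(2) by (auto simp: abs_mult)
    then have "n = 1 \<or> n = - 1" by linarith
    then have "w \<bullet> b - w' \<bullet> b = 2 * L \<or> w \<bullet> b - w' \<bullet> b = - 2 * L"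
      using \<open>w \<bullet> b - w' \<bullet> b = 2 * L * n\<close> by auto
    then have "\<bar>w \<bullet> b\<bar> = L" "\<bar>w' \<bullet> b\<bar> = L"
      using w(1,2) b(1) L by (auto simp: C_def) (smt (verit))+
    then have "L \<le> norm w" "L \<le> norm w'" using Basis_le_norm[OF b(1)] by metis+
    then show ?thesis using h_out by (simp add: L_def)
  qed simp
  have torus_cont: "continuous_on A (torus L :: 'a \<Rightarrow> _)" for A
    unfolding torus_def using L by (intro continuous_intros) auto
  have T: "compact (torus L ` C)" by (intro compact_continuous_image torus_cont C)
  define F where "F y = h (SOME w. w \<in> C \<and> torus L w = y)" for y
  have F: "F (torus L w) = h w" if "w \<in> C" for w
  proof -
    have "(SOME w'. w' \<in> C \<and> torus L w' = torus L w) \<in> C \<and>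
        torus L (SOME w'. w' \<in> C \<and> torus L w' = torus L w) = torus L w"
      by (rule someI[of _ w]) (use that in simp)
    then show ?thesis unfolding F_def using well that by blast
  qed
  have F_cont: "continuous_on (torus L ` C) F"
    unfolding continuous_on_closed_invariant
  proof (intro allI impI)
    fix B :: "real set" assume B: "closed B"
    have "compact (C \<inter> h -` B)"
      using continuous_closed_vimage[OF B] h_cont C
      by (auto simp: continuous_on_eq_continuous_at intro!: compact_Int_closed)
    then have "closed (torus L ` (C \<inter> h -` B))"
      by (intro compact_imp_closed compact_continuous_image torus_cont)
    moreover have "torus L ` (C \<inter> h -` B) \<inter> torus L ` C = F -` B \<inter> torus L ` C"
      using F by auto
    ultimately show "\<exists>A. closed A \<and> A \<inter> torus L ` C = F -` B \<inter> torus L ` C" by blast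
  qed
  obtain g where g: "real_polynomial_function g" "\<And>y. y \<in> torus L ` C \<Longrightarrow> \<bar>F y - g y\<bar> < e"
    using Stone_Weierstrass_real_polynomial_function[OF T F_cont e] by blast
  have period: "\<exists>w'\<in>C. torus L w' = torus L w" for w :: 'a
  proof -
    define k where "k b = \<lfloor>(w \<bullet> b + L) / (2 * L)\<rfloor>" for b
    define w' where "w' = (\<Sum>b\<in>Basis. (w \<bullet> b - 2 * L * k b) *\<^sub>R b)"
    have w'b: "w' \<bullet> b = w \<bullet> b - 2 * L * k b" if "b \<in> Basis" for b
      using that by (simp add: w'_def)
    have "- L \<le> w' \<bullet> b \<and> w' \<bullet> b \<le> L" if b: "b \<in> Basis" for b
    proof -
      have "k b \<le> (w \<bullet> b + L) / (2 * L)" "(w \<bullet> b + L) / (2 * L) < k b + 1"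
        unfolding k_def by linarith+
      then have "k b * (2 * L) \<le> w \<bullet> b + L" "w \<bullet> b + L < (k b + 1) * (2 * L)"
        using L by (simp_all add: pos_le_divide_eq pos_divide_less_eq)
      then show ?thesis by (simp add: w'b[OF b] algebra_simps)
    qed
    then have "w' \<in> C" by (simp add: C_def)
    moreover have "torus L w' = torus L w"
      unfolding torus_eq_iff
    proof
      fix b :: 'a assume b: "b \<in> Basis"
      have "pi * (w \<bullet> b) / L = pi * (w' \<bullet> b) / L + 2 * pi * k b"
        using L by (simp add: w'b[OF b] field_simps)
      then show "cos (pi * (w' \<bullet> b) / L) = cos (pi * (w \<bullet> b) / L) \<and>
          sin (pi * (w' \<bullet> b) / L) = sin (pi * (w \<bullet> b) / L)"
        using sin_cos_eq_iff[of "pi * (w \<bullet> b) / L" "pi * (w' \<bullet> b) / L"] by metis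
    qed
    ultimately show ?thesis by blast
  qed
  show ?thesis
  proof (intro exI conjI allI impI)
    show "trigpoly (\<lambda>w. g (torus L w))" by (rule trigpoly_polynomial_torus[OF g(1)])
    fix w :: 'a
    show "\<bar>f w - g (torus L w)\<bar> \<le> e" if "norm w \<le> K"
    proof -
      have "w \<in> C" unfolding C_def
      proof (intro CollectI ballI)
        fix b :: 'a assume "b \<in> Basis"
        then have "\<bar>w \<bullet> b\<bar> \<le> K" using Basis_le_norm[of b w] that by simp
        then show "- L \<le> w \<bullet> b \<and> w \<bullet> b \<le> L" by (simp add: L_def abs_le_iff)
      qed
      then show ?thesis using g(2)[of "torus L w"] F[of w] h_in[OF that] by simp
    qed
    obtain w' where w': "w' \<in> C" "torus L w' = torus L w" using period by blast
    then have "\<bar>h w' - g (torus L w)\<bar> < e"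
      using g(2)[OF imageI[OF w'(1), of "torus L"]] F[OF w'(1)] by simp
    then show "\<bar>g (torus L w)\<bar> \<le> B + e" using h_bound[of w'] by linarith
  qed
qed

lemma prob_space_tight:
  fixes \<nu> :: "'a::euclidean_space measure"
  assumes "prob_space \<nu>" "sets \<nu> = sets borel" "0 < e"
  shows "\<exists>K\<ge>0. measure \<nu> {w. K < norm w} \<le> e"
proof -
  interpret prob_space \<nu> by (rule assms(1))
  note [measurable_cong] = assms(2)
  have sp: "space \<nu> = UNIV" using sets_eq_imp_space_eq[OF assms(2)] by simp
  have "(\<lambda>n. measure \<nu> {w. real n < norm w}) \<longlonglongrightarrow> measure \<nu> (\<Inter>n. {w. real n < norm w})"
  proof (rule finite_Lim_measure_decseq)
    have "{w \<in> space \<nu>. real n < norm w} \<in> sets \<nu>" for n by measurable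
    then show "range (\<lambda>n. {w. real n < norm w}) \<subseteq> sets \<nu>" by (auto simp: sp)
    show "decseq (\<lambda>n. {w::'a. real n < norm w})"
      by (intro decseq_SucI) auto
  qed
  moreover have "(\<Inter>n. {w::'a. real n < norm w}) = {}"
  proof -
    have "\<exists>n. \<not> real n < norm w" for w :: 'a using real_arch_simple[of "norm w"] by (auto simp: not_less)
    then show ?thesis by blast
  qed
  ultimately have "(\<lambda>n. measure \<nu> {w. real n < norm w}) \<longlonglongrightarrow> 0" by simp
  from LIMSEQ_D[OF this assms(3)] obtain N where "\<bar>measure \<nu> {w. real N < norm w}\<bar> < e" by auto
  then show ?thesis by (intro exI[of _ "real N"]) auto
qed

text \<open>Inside the ball the error is \<open>e\<close>; outside, both functions are bounded and the mass is at most \<open>e\<close>.\<close>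

lemma trigpoly_integral_error:
  fixes \<nu> :: "'a::euclidean_space measure"
  assumes \<nu>: "prob_space \<nu>" "sets \<nu> = sets borel" and f: "f \<in> borel_measurable borel" "\<And>w. \<bar>f w\<bar> \<le> B"
    and p: "trigpoly p" "\<And>w. norm w \<le> K \<Longrightarrow> \<bar>f w - p w\<bar> \<le> e" "\<And>w. \<bar>p w\<bar> \<le> B + e"
    and tail: "measure \<nu> {w. K < norm w} \<le> e" and e: "0 < e"
  shows "\<bar>(\<integral>w. f w \<partial>\<nu>) - (\<integral>w. p w \<partial>\<nu>)\<bar> \<le> e + (2 * B + e) * e"
proof -
  interpret prob_space \<nu> by (rule \<nu>(1))
  note [measurable_cong] = \<nu>(2)
  note [measurable] = f(1) trigpoly_measurable[OF p(1)]
  have sp: "space \<nu> = UNIV" using sets_eq_imp_space_eq[OF \<nu>(2)] by simp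
  have B: "0 \<le> B" using f(2)[of 0] by linarith
  have int: "integrable \<nu> f" "integrable \<nu> p"
    using f(2) p(3) integrable_const_bound[of f B] integrable_const_bound[of p "B + e"] by simp_all
  let ?T = "{w::'a. K < norm w}"
  have "{w \<in> space \<nu>. K < norm w} \<in> sets \<nu>" by measurable
  then have T [measurable]: "?T \<in> sets \<nu>" by (simp add: sp)
  have "\<bar>(\<integral>w. f w \<partial>\<nu>) - (\<integral>w. p w \<partial>\<nu>)\<bar> = \<bar>\<integral>w. f w - p w \<partial>\<nu>\<bar>" using int by simp
  also have "\<dots> \<le> (\<integral>w. \<bar>f w - p w\<bar> \<partial>\<nu>)" by (rule integral_abs_bound)
  also have "\<dots> \<le> (\<integral>w. e + (2 * B + e) * indicator ?T w \<partial>\<nu>)"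
  proof (rule integral_mono)
    show "integrable \<nu> (\<lambda>w. e + (2 * B + e) * indicator ?T w)"
      by (intro Bochner_Integration.integrable_add integrable_mult_right integrable_real_indicator)
        (auto simp: less_top[symmetric])
    fix w
    show "\<bar>f w - p w\<bar> \<le> e + (2 * B + e) * indicator ?T w"
      using p(2)[of w] f(2)[of w] p(3)[of w] e by (cases "norm w \<le> K") auto
  qed (use int in auto)
  also have "\<dots> = e + (2 * B + e) * measure \<nu> ?T"
    using prob_space[unfolded sp]
    by (subst Bochner_Integration.integral_add) (auto simp: sp less_top[symmetric])
  also have "\<dots> \<le> e + (2 * B + e) * e"
    using tail e B by (intro add_left_mono mult_left_mono) auto
  finally show ?thesis .
qed

text \<open>Tightness reduces a test function to a large ball; there a trigonometric polynomial takes its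
  place, for which convergence is assumed.\<close>

theorem weak_conv_law_of_trigonometric:
  fixes \<nu> :: "'a::euclidean_space measure"
  assumes \<mu>: "\<And>n. n \<ge> 1 \<Longrightarrow> prob_space (\<mu> n)" "\<And>n. n \<ge> 1 \<Longrightarrow> sets (\<mu> n) = sets borel"
    and \<nu>: "prob_space \<nu>" "sets \<nu> = sets borel"
    and cos: "\<And>X. (\<lambda>n. \<integral>w. cos (X \<bullet> w) \<partial>\<mu> n) \<longlonglongrightarrow> (\<integral>w. cos (X \<bullet> w) \<partial>\<nu>)"
    and sin: "\<And>X. (\<lambda>n. \<integral>w. sin (X \<bullet> w) \<partial>\<mu> n) \<longlonglongrightarrow> (\<integral>w. sin (X \<bullet> w) \<partial>\<nu>)"
    and tight: "\<And>e. 0 < e \<Longrightarrow> \<exists>K. \<forall>\<^sub>F n in sequentially. measure (\<mu> n) {w. K < norm w} \<le> e"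
  shows "weak_conv_law \<mu> \<nu>"
  unfolding weak_conv_law_def
proof (intro allI impI)
  have int: "integrable \<rho> p" if \<rho>: "prob_space \<rho>" "sets \<rho> = sets borel" "trigpoly p" for p and \<rho> :: "'a measure"
  proof -
    interpret \<rho>: prob_space \<rho> by (rule \<rho>)
    obtain c where "\<And>w. \<bar>p w\<bar> \<le> c" using trigpoly_bounded[OF \<rho>(3)] by blast
    then show ?thesis
      using trigpoly_measurable[OF \<rho>(3)] measurable_cong_sets[OF \<rho>(2) refl]
      by (intro \<rho>.integrable_const_bound[of _ c]) auto
  qed
  have conv: "(\<lambda>n. \<integral>w. p w \<partial>\<mu> n) \<longlonglongrightarrow> (\<integral>w. p w \<partial>\<nu>)" if "trigpoly p" for p
    using that
  proof induction
    case (trig a X b)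
    have c: "trigpoly (\<lambda>w. cos (X \<bullet> w))" "trigpoly (\<lambda>w. sin (X \<bullet> w))"
      using trigpoly.trig[of 1 X 0] trigpoly.trig[of 0 X 1] by auto
    have "(\<lambda>n. a * (\<integral>w. cos (X \<bullet> w) \<partial>\<mu> n) + b * (\<integral>w. sin (X \<bullet> w) \<partial>\<mu> n)) \<longlonglongrightarrow>
        a * (\<integral>w. cos (X \<bullet> w) \<partial>\<nu>) + b * (\<integral>w. sin (X \<bullet> w) \<partial>\<nu>)"
      by (intro tendsto_intros cos sin)
    moreover have "a * (\<integral>w. cos (X \<bullet> w) \<partial>\<nu>) + b * (\<integral>w. sin (X \<bullet> w) \<partial>\<nu>)
        = (\<integral>w. a * cos (X \<bullet> w) + b * sin (X \<bullet> w) \<partial>\<nu>)"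
      using int[OF \<nu> c(1)] int[OF \<nu> c(2)] by simp
    moreover have "\<forall>\<^sub>F n in sequentially. a * (\<integral>w. cos (X \<bullet> w) \<partial>\<mu> n) + b * (\<integral>w. sin (X \<bullet> w) \<partial>\<mu> n)
        = (\<integral>w. a * cos (X \<bullet> w) + b * sin (X \<bullet> w) \<partial>\<mu> n)"
      using eventually_ge_at_top[of 1]
      by eventually_elim (simp add: int[OF \<mu> c(1)] int[OF \<mu> c(2)])
    ultimately show ?case by (simp add: tendsto_cong)
  next
    case (add p q)
    have "\<forall>\<^sub>F n in sequentially. (\<integral>w. p w \<partial>\<mu> n) + (\<integral>w. q w \<partial>\<mu> n) = (\<integral>w. p w + q w \<partial>\<mu> n)"
      using eventually_ge_at_top[of 1]
      by eventually_elim (simp add: int[OF \<mu> add.hyps(1)] int[OF \<mu> add.hyps(2)])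
    moreover have "(\<integral>w. p w \<partial>\<nu>) + (\<integral>w. q w \<partial>\<nu>) = (\<integral>w. p w + q w \<partial>\<nu>)"
      by (simp add: int[OF \<nu> add.hyps(1)] int[OF \<nu> add.hyps(2)])
    moreover note tendsto_add[OF add.IH]
    ultimately show ?case by (simp add: tendsto_cong)
  qed
  fix f :: "'a \<Rightarrow> real" assume "continuous_on UNIV f \<and> bounded (range f)"
  then have f: "continuous_on UNIV f" and "bounded (range f)" by auto
  then obtain B where B: "\<And>w. \<bar>f w\<bar> \<le> B" by (auto simp: bounded_iff)
  have B0: "0 \<le> B" using B[of 0] by linarith
  have f_meas: "f \<in> borel_measurable borel" by (rule borel_measurable_continuous_onI[OF f])
  show "(\<lambda>n. \<integral>w. f w \<partial>\<mu> n) \<longlonglongrightarrow> (\<integral>w. f w \<partial>\<nu>)"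
  proof (rule LIMSEQ_I)
    fix r :: real assume r: "0 < r"
    define e where "e = min 1 (r / (3 * (2 * B + 2)))"
    have e: "0 < e" "e \<le> 1" using r B0 by (auto simp: e_def)
    have err: "e + (2 * B + e) * e \<le> r / 3"
    proof -
      have "e + (2 * B + e) * e = (2 * B + 1 + e) * e" by (simp add: algebra_simps)
      also have "\<dots> \<le> (2 * B + 2) * e" using e by (intro mult_right_mono) auto
      also have "\<dots> \<le> (2 * B + 2) * (r / (3 * (2 * B + 2)))"
        using B0 unfolding e_def by (intro mult_left_mono) auto
      also have "\<dots> = r / 3"
      proof -
        have "c * (r / (3 * c)) = r / 3" if "c \<noteq> 0" for c :: real using that by simp
        then show ?thesis using B0 by (metis add_nonneg_pos less_irrefl mult_nonneg_nonneg zero_le_numeral zero_less_numeral)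
      qed
      finally show ?thesis .
    qed
    obtain K1 where K1: "\<forall>\<^sub>F n in sequentially. measure (\<mu> n) {w. K1 < norm w} \<le> e"
      using tight[OF e(1)] by blast
    obtain K2 where K2: "0 \<le> K2" "measure \<nu> {w. K2 < norm w} \<le> e"
      using prob_space_tight[OF \<nu> e(1)] by blast
    define K where "K = max K1 K2"
    have tail: "measure \<rho> {w. K < norm w} \<le> e"
      if \<rho>: "prob_space \<rho>" "sets \<rho> = sets borel" "measure \<rho> {w. k < norm w} \<le> e" "k \<le> K" for k and \<rho> :: "'a measure"
    proof -
      interpret \<rho>: prob_space \<rho> by (rule \<rho>)
      have sp: "space \<rho> = UNIV" using sets_eq_imp_space_eq[OF \<rho>(2)] by simp
      note [measurable_cong] = \<rho>(2)
      have "{w \<in> space \<rho>. k < norm w} \<in> sets \<rho>" by measurable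
      then have "measure \<rho> {w. K < norm w} \<le> measure \<rho> {w. k < norm w}"
        using \<rho>(4) by (intro \<rho>.finite_measure_mono) (auto simp: sp)
      then show ?thesis using \<rho>(3) by simp
    qed
    have "0 \<le> K" using K2 by (simp add: K_def)
    from trigpoly_approximation[OF f B this e(1)]
    obtain p where p: "trigpoly p" "\<And>w. norm w \<le> K \<Longrightarrow> \<bar>f w - p w\<bar> \<le> e" "\<And>w. \<bar>p w\<bar> \<le> B + e" by blast
    have \<nu>e: "\<bar>(\<integral>w. f w \<partial>\<nu>) - (\<integral>w. p w \<partial>\<nu>)\<bar> \<le> r / 3"
      using trigpoly_integral_error[OF \<nu> f_meas B p tail[OF \<nu> K2(2)] e(1)] err by (simp add: K_def)
    have "\<forall>\<^sub>F n in sequentially. \<bar>(\<integral>w. f w \<partial>\<mu> n) - (\<integral>w. p w \<partial>\<mu> n)\<bar> \<le> r / 3"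
      using K1 eventually_ge_at_top[of 1]
    proof eventually_elim
      case (elim n)
      show ?case
        using trigpoly_integral_error[OF \<mu>[OF elim(2)] f_meas B p
            tail[OF \<mu>[OF elim(2)] elim(1)] e(1)] err by (simp add: K_def)
    qed
    moreover have "\<forall>\<^sub>F n in sequentially. \<bar>(\<integral>w. p w \<partial>\<mu> n) - (\<integral>w. p w \<partial>\<nu>)\<bar> < r / 3"
      using LIMSEQ_D[OF conv[OF p(1)], of "r / 3"] r by (auto simp: eventually_sequentially)
    ultimately have "\<forall>\<^sub>F n in sequentially. norm ((\<integral>w. f w \<partial>\<mu> n) - (\<integral>w. f w \<partial>\<nu>)) < r"
    proof eventually_elim
      case (elim n)
      then show ?case using \<nu>e unfolding real_norm_def by linarith
    qed
    then show "\<exists>no. \<forall>n\<ge>no. norm ((\<integral>w. f w \<partial>\<mu> n) - (\<integral>w. f w \<partial>\<nu>)) < r"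
      by (simp add: eventually_sequentially)
  qed
qed

text \<open>Slutsky's lemma: a perturbation that vanishes in probability does not change the weak limit.\<close>

theorem (in prob_space) weak_conv_law_perturbation:
  fixes U Y :: "nat \<Rightarrow> 'a \<Rightarrow> 'b::euclidean_space"
  assumes U: "\<And>n. n \<ge> 1 \<Longrightarrow> U n \<in> borel_measurable M" and Y: "\<And>n. n \<ge> 1 \<Longrightarrow> Y n \<in> borel_measurable M"
    and \<nu>: "prob_space \<nu>" "sets \<nu> = sets borel"
    and cos: "\<And>X. (\<lambda>n. expectation (\<lambda>x. cos (X \<bullet> U n x))) \<longlonglongrightarrow> (\<integral>w. cos (X \<bullet> w) \<partial>\<nu>)"
    and sin: "\<And>X. (\<lambda>n. expectation (\<lambda>x. sin (X \<bullet> U n x))) \<longlonglongrightarrow> (\<integral>w. sin (X \<bullet> w) \<partial>\<nu>)"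
    and tight: "\<And>e. 0 < e \<Longrightarrow> \<exists>K. \<forall>\<^sub>F n in sequentially. prob {x \<in> space M. K < norm (U n x)} \<le> e"
    and close: "\<And>e. 0 < e \<Longrightarrow> \<forall>\<^sub>F n in sequentially. prob {x \<in> space M. e < norm (Y n x - U n x)} \<le> e"
  shows "weak_conv_law (\<lambda>n. distr M borel (Y n)) \<nu>"
proof (rule weak_conv_law_of_trigonometric)
  show "prob_space (distr M borel (Y n))" if "n \<ge> 1" for n
    by (rule prob_space_distr[OF Y[OF that]])
  have perturb: "(\<lambda>n. \<integral>w. g (X \<bullet> w) \<partial>distr M borel (Y n)) \<longlonglongrightarrow> l"
    if lim: "(\<lambda>n. expectation (\<lambda>x. g (X \<bullet> U n x))) \<longlonglongrightarrow> l"
      and g: "\<And>s t. \<bar>g s - g t\<bar> \<le> \<bar>s - t\<bar>" "\<And>t. \<bar>g t\<bar> \<le> 1" "g \<in> borel_measurable borel"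
    for g :: "real \<Rightarrow> real" and X :: 'b and l
  proof (rule LIMSEQ_I)
    note [measurable] = g(3)
    fix r :: real assume r: "0 < r"
    define e where "e = r / (2 * (norm X + 2))"
    have nX: "0 < norm X + 2" by (simp add: add_nonneg_pos)
    have e: "0 < e" "(norm X + 2) * e = r / 2" using r nX by (simp_all add: e_def field_simps)
    have "\<forall>\<^sub>F n in sequentially. \<bar>expectation (\<lambda>x. g (X \<bullet> U n x)) - l\<bar> < r / 2"
      using LIMSEQ_D[OF lim, of "r / 2"] r by (auto simp: eventually_sequentially)
    then have "\<forall>\<^sub>F n in sequentially. norm ((\<integral>w. g (X \<bullet> w) \<partial>distr M borel (Y n)) - l) < r"
      using close[OF e(1)] eventually_ge_at_top[of 1]
    proof eventually_elim
      case (elim n)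
      note [measurable] = U[OF elim(3)] Y[OF elim(3)]
      let ?T = "{x \<in> space M. e < norm (Y n x - U n x)}"
      have T [measurable]: "?T \<in> sets M" by measurable
      have int: "integrable M (\<lambda>x. g (X \<bullet> Y n x))" "integrable M (\<lambda>x. g (X \<bullet> U n x))"
        using g(2) by (auto intro!: integrable_const_bound[of _ 1])
      have "(\<integral>w. g (X \<bullet> w) \<partial>distr M borel (Y n)) = expectation (\<lambda>x. g (X \<bullet> Y n x))"
        by (subst integral_distr) auto
      moreover have "\<bar>expectation (\<lambda>x. g (X \<bullet> Y n x)) - expectation (\<lambda>x. g (X \<bullet> U n x))\<bar> \<le> r / 2"
      proof -
        have "\<bar>expectation (\<lambda>x. g (X \<bullet> Y n x)) - expectation (\<lambda>x. g (X \<bullet> U n x))\<bar>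
            = \<bar>expectation (\<lambda>x. g (X \<bullet> Y n x) - g (X \<bullet> U n x))\<bar>" using int by simp
        also have "\<dots> \<le> expectation (\<lambda>x. \<bar>g (X \<bullet> Y n x) - g (X \<bullet> U n x)\<bar>)" by (rule integral_abs_bound)
        also have "\<dots> \<le> expectation (\<lambda>x. norm X * e + 2 * indicator ?T x)"
        proof (rule integral_mono)
          show "integrable M (\<lambda>x. norm X * e + 2 * indicator ?T x)"
            by (intro Bochner_Integration.integrable_add integrable_mult_right integrable_real_indicator T)
              (auto simp: less_top[symmetric])
          fix x assume x: "x \<in> space M"
          show "\<bar>g (X \<bullet> Y n x) - g (X \<bullet> U n x)\<bar> \<le> norm X * e + 2 * indicator ?T x"
          proof (cases "x \<in> ?T")
            case True
            have "0 \<le> norm X * e" using e(1) by simp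
            then show ?thesis using True g(2)[of "X \<bullet> Y n x"] g(2)[of "X \<bullet> U n x"] by simp
          next
            case False
            have "\<bar>g (X \<bullet> Y n x) - g (X \<bullet> U n x)\<bar> \<le> \<bar>X \<bullet> Y n x - X \<bullet> U n x\<bar>" by (rule g(1))
            also have "\<dots> \<le> norm X * norm (Y n x - U n x)"
              unfolding inner_diff_right[symmetric] by (rule Cauchy_Schwarz_ineq2)
            also have "\<dots> \<le> norm X * e" using False x by (intro mult_left_mono) auto
            finally show ?thesis using False by simp
          qed
        qed (use int in auto)
        also have "\<dots> = norm X * e + 2 * prob ?T"
          by (subst Bochner_Integration.integral_add) (auto simp: prob_space less_top[symmetric])
        also have "\<dots> \<le> norm X * e + 2 * e" using elim(2) by simp
        also have "\<dots> = r / 2" using e(2) by (simp add: algebra_simps)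
        finally show ?thesis .
      qed
      ultimately show ?case using elim(1) unfolding real_norm_def by linarith
    qed
    then show "\<exists>no. \<forall>n\<ge>no. norm ((\<integral>w. g (X \<bullet> w) \<partial>distr M borel (Y n)) - l) < r"
      by (simp add: eventually_sequentially)
  qed
  show "(\<lambda>n. \<integral>w. cos (X \<bullet> w) \<partial>distr M borel (Y n)) \<longlonglongrightarrow> (\<integral>w. cos (X \<bullet> w) \<partial>\<nu>)" for X
  proof (rule perturb[OF cos])
    show "\<bar>cos s - cos t\<bar> \<le> \<bar>s - t\<bar>" for s t :: real
    proof -
      have "\<bar>cos s - cos t\<bar> = 2 * \<bar>sin ((s + t) / 2)\<bar> * \<bar>sin ((t - s) / 2)\<bar>"
        by (simp add: cos_diff_cos abs_mult)
      also have "\<dots> \<le> 2 * 1 * \<bar>(t - s) / 2\<bar>"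
        by (intro mult_mono abs_sin_x_le_abs_x) auto
      finally show ?thesis by simp
    qed
  qed auto
  show "(\<lambda>n. \<integral>w. sin (X \<bullet> w) \<partial>distr M borel (Y n)) \<longlonglongrightarrow> (\<integral>w. sin (X \<bullet> w) \<partial>\<nu>)" for X
  proof (rule perturb[OF sin])
    show "\<bar>sin s - sin t\<bar> \<le> \<bar>s - t\<bar>" for s t :: real
    proof -
      have "\<bar>sin s - sin t\<bar> = 2 * \<bar>sin ((s - t) / 2)\<bar> * \<bar>cos ((s + t) / 2)\<bar>"
        by (simp add: sin_diff_sin abs_mult)
      also have "\<dots> \<le> 2 * \<bar>(s - t) / 2\<bar> * 1"
        by (intro mult_mono abs_sin_x_le_abs_x) auto
      finally show ?thesis by simp
    qed
  qed auto
  fix e :: real assume e: "0 < e"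
  define \<delta> where "\<delta> = min 1 (e / 2)"
  have \<delta>: "0 < \<delta>" "\<delta> \<le> 1" "\<delta> \<le> e / 2" using e by (auto simp: \<delta>_def)
  obtain K where K: "\<forall>\<^sub>F n in sequentially. prob {x \<in> space M. K < norm (U n x)} \<le> e / 2"
    using tight[of "e / 2"] e by auto
  have "\<forall>\<^sub>F n in sequentially. measure (distr M borel (Y n)) {w. K + 1 < norm w} \<le> e"
    using K close[OF \<delta>(1)] eventually_ge_at_top[of 1]
  proof eventually_elim
    case (elim n)
    note [measurable] = U[OF elim(3)] Y[OF elim(3)]
    have "measure (distr M borel (Y n)) {w. K + 1 < norm w} = prob {x \<in> space M. K + 1 < norm (Y n x)}"
      by (subst measure_distr) (auto intro!: arg_cong[where f = prob])
    also have "\<dots> \<le> prob ({x \<in> space M. K < norm (U n x)} \<union> {x \<in> space M. \<delta> < norm (Y n x - U n x)})"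
    proof (intro finite_measure_mono)
      show "{x \<in> space M. K + 1 < norm (Y n x)} \<subseteq>
          {x \<in> space M. K < norm (U n x)} \<union> {x \<in> space M. \<delta> < norm (Y n x - U n x)}"
      proof
        fix x assume "x \<in> {x \<in> space M. K + 1 < norm (Y n x)}"
        then show "x \<in> {x \<in> space M. K < norm (U n x)} \<union> {x \<in> space M. \<delta> < norm (Y n x - U n x)}"
          using norm_triangle_sub[of "Y n x" "U n x"] \<delta>(2) by auto
      qed
    qed measurable
    also have "\<dots> \<le> prob {x \<in> space M. K < norm (U n x)} + prob {x \<in> space M. \<delta> < norm (Y n x - U n x)}"
      by (intro measure_Un_le) measurable
    also have "\<dots> \<le> e" using elim(1,2) \<delta>(3) by linarith
    finally show ?case .
  qed
  then show "\<exists>K. \<forall>\<^sub>F n in sequentially. measure (distr M borel (Y n)) {w. K < norm w} \<le> e" by blast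
qed (use \<nu> in auto)

section \<open>Operators on a subspace\<close>

context
  fixes M :: "'a::euclidean_space set"
  assumes M: "subspace M"
begin

lemma orth_proj_props: "orth_proj M X \<in> M" "\<And>Y. Y \<in> M \<Longrightarrow> (X - orth_proj M X) \<bullet> Y = 0"
proof -
  obtain y z where yz: "y \<in> span M" "\<And>w. w \<in> span M \<Longrightarrow> orthogonal z w" "X = y + z"
    using orthogonal_subspace_decomp_exists[of M X] by blast
  have sp: "span M = M" using M by (simp add: span_eq_iff)
  have ex: "y \<in> M \<and> X - y \<in> orthogonal_comp M"
    using yz by (auto simp: sp orthogonal_comp_def orthogonal_commute)
  have uniq: "y' = y" if "y' \<in> M \<and> X - y' \<in> orthogonal_comp M" for y'
  proof -
    have d: "y' - y \<in> M" using that ex M by (auto intro: subspace_diff)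
    have "(y' - y) \<bullet> (X - y) = 0" "(y' - y) \<bullet> (X - y') = 0"
      using d that ex by (auto simp: orthogonal_comp_def orthogonal_def)
    then have "(y' - y) \<bullet> (y' - y) = 0" by (simp add: inner_diff_right)
    then show ?thesis by simp
  qed
  have "orth_proj M X = y"
    unfolding orth_proj_def using ex uniq by (rule the_equality)
  then show "orth_proj M X \<in> M" "\<And>Y. Y \<in> M \<Longrightarrow> (X - orth_proj M X) \<bullet> Y = 0"
    using ex by (auto simp: orthogonal_comp_def orthogonal_def inner_commute)
qed

lemma orth_proj_inner: "Y \<in> M \<Longrightarrow> orth_proj M X \<bullet> Y = X \<bullet> Y"
  using orth_proj_props(2)[of Y X] by (simp add: inner_diff_left)

lemma orth_proj_inner_right: "Y \<in> M \<Longrightarrow> Y \<bullet> orth_proj M X = Y \<bullet> X"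
  using orth_proj_inner[of Y X] by (simp add: inner_commute)

lemma eq_on_subspaceI:
  assumes "X \<in> M" "Y \<in> M" "\<And>Z. Z \<in> M \<Longrightarrow> X \<bullet> Z = Y \<bullet> Z"
  shows "X = Y"
proof -
  have "(X - Y) \<bullet> (X - Y) = 0"
    using assms(3)[of "X - Y"] assms(1,2) M by (simp add: inner_diff_left subspace_diff)
  then show ?thesis by simp
qed

lemma orth_proj_id: "X \<in> M \<Longrightarrow> orth_proj M X = X"
  by (rule eq_on_subspaceI) (auto simp: orth_proj_props orth_proj_inner)

lemma orth_proj_linear: "linear (orth_proj M)"
proof (rule linearI)
  show "orth_proj M (X + Y) = orth_proj M X + orth_proj M Y" for X Y
    by (rule eq_on_subspaceI)
      (auto simp: orth_proj_props orth_proj_inner inner_add_left intro!: subspace_add[OF M])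
  show "orth_proj M (c *\<^sub>R X) = c *\<^sub>R orth_proj M X" for c X
    by (rule eq_on_subspaceI)
      (auto simp: orth_proj_props orth_proj_inner intro!: subspace_mul[OF M])
qed

lemma orth_proj_norm: "norm (orth_proj M X) \<le> norm X"
proof -
  have "norm (orth_proj M X) * norm (orth_proj M X) = X \<bullet> orth_proj M X"
    using orth_proj_inner[OF orth_proj_props(1), of X X] by (simp add: dot_square_norm power2_eq_square)
  also have "\<dots> \<le> norm X * norm (orth_proj M X)" by (rule norm_cauchy_schwarz)
  finally show ?thesis by (cases "orth_proj M X = 0") auto
qed

lemma pos_def_coercive:
  assumes f: "linear f" and pos: "\<And>X. X \<in> M \<Longrightarrow> X \<noteq> 0 \<Longrightarrow> 0 < f X \<bullet> X"
  shows "\<exists>c>0. \<forall>X\<in>M. c * (norm X)\<^sup>2 \<le> f X \<bullet> X"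
proof (cases "M \<inter> sphere 0 1 = {}")
  case True
  have "X = 0" if "X \<in> M" for X
  proof (rule ccontr)
    assume "X \<noteq> 0"
    then have "X /\<^sub>R norm X \<in> M \<inter> sphere 0 1" using that M by (auto simp: subspace_mul)
    with True show False by blast
  qed
  then have "1 * (norm X)\<^sup>2 \<le> f X \<bullet> X" if "X \<in> M" for X
    using that linear_0[OF f] by force
  then show ?thesis by (intro exI[of _ 1] conjI ballI zero_less_one)
next
  case False
  have cpt: "compact (M \<inter> sphere 0 1)" by (simp add: closed_subspace[OF M] closed_Int_compact)
  have "continuous_on (M \<inter> sphere 0 1) (\<lambda>X. f X \<bullet> X)"
    using linear_continuous_on[OF f[unfolded linear_conv_bounded_linear]]
    by (intro continuous_intros) (auto intro: continuous_on_subset)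
  from continuous_attains_inf[OF cpt False this]
  obtain e where e: "e \<in> M" "norm e = 1" and min: "\<And>X. X \<in> M \<Longrightarrow> norm X = 1 \<Longrightarrow> f e \<bullet> e \<le> f X \<bullet> X"
    by auto
  define c where "c = f e \<bullet> e"
  have "e \<noteq> 0" using e(2) by auto
  then have c: "0 < c" using pos e by (simp add: c_def)
  have "c * (norm X)\<^sup>2 \<le> f X \<bullet> X" if X: "X \<in> M" for X
  proof (cases "X = 0")
    case True
    then show ?thesis by (simp add: linear_0[OF f])
  next
    case False
    have "c \<le> f (X /\<^sub>R norm X) \<bullet> (X /\<^sub>R norm X)"
      unfolding c_def using X False M by (intro min) (auto simp: subspace_mul)
    then show ?thesis
      using False by (simp add: linear_scale[OF f] power2_eq_square field_simps)
  qed
  with c show ?thesis by blast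
qed

text \<open>Invertibility with explicit constants: \<open>c\<close> bounds the inverse, and the property survives
  perturbations smaller than \<open>c\<close>.\<close>

definition coercive_on :: "real \<Rightarrow> ('a \<Rightarrow> 'a) \<Rightarrow> bool" where
  "coercive_on c f \<longleftrightarrow> 0 < c \<and> linear f \<and> f ` M \<subseteq> M \<and> (\<forall>X\<in>M. c * (norm X)\<^sup>2 \<le> f X \<bullet> X)"

lemma coercive_norm:
  assumes f: "coercive_on c f" and X: "X \<in> M"
  shows "c * norm X \<le> norm (f X)"
proof -
  have "c * (norm X)\<^sup>2 \<le> f X \<bullet> X" using f X by (simp add: coercive_on_def)
  also have "\<dots> \<le> norm (f X) * norm X" by (rule norm_cauchy_schwarz)
  finally have "(c * norm X) * norm X \<le> norm (f X) * norm X" by (simp add: power2_eq_square)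
  then show ?thesis by (cases "X = 0") auto
qed

lemma coercive_bij:
  assumes f: "coercive_on c f"
  shows "bij_betw f M M"
proof -
  have lin: "linear f" and sub: "f ` M \<subseteq> M" and c: "0 < c" using f by (auto simp: coercive_on_def)
  have inj: "inj_on f M"
  proof (rule inj_onI)
    fix X Y assume XY: "X \<in> M" "Y \<in> M" "f X = f Y"
    then have "f (X - Y) = 0" by (simp add: linear_diff[OF lin])
    then have "c * norm (X - Y) \<le> 0"
      using coercive_norm[OF f, of "X - Y"] XY M by (simp add: subspace_diff)
    then have "norm (X - Y) \<le> 0" using c by (simp add: mult_le_0_iff)
    then show "X = Y" by simp
  qed
  have "dim (f ` M) = dim M"
    using inj M span_eq_iff[of M] by (intro dim_image_eq[OF lin]) metis
  then have "f ` M = M"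
    using sub by (intro subspace_dim_equal M linear_subspace_image[OF lin]) auto
  with inj show ?thesis by (simp add: bij_betw_def)
qed

lemma coercive_inv:
  assumes f: "coercive_on c f" and Y: "Y \<in> M"
  shows "inv_into M f Y \<in> M" "f (inv_into M f Y) = Y" "norm (inv_into M f Y) \<le> norm Y / c"
proof -
  have Y': "Y \<in> f ` M" using coercive_bij[OF f] Y by (auto simp: bij_betw_def)
  show 1: "inv_into M f Y \<in> M" by (rule inv_into_into[OF Y'])
  show 2: "f (inv_into M f Y) = Y" by (rule f_inv_into_f[OF Y'])
  have "0 < c" using f by (simp add: coercive_on_def)
  with coercive_norm[OF f 1] show "norm (inv_into M f Y) \<le> norm Y / c"
    unfolding 2 by (simp add: field_simps)
qed

lemma coercive_inv_unique: "coercive_on c f \<Longrightarrow> X \<in> M \<Longrightarrow> inv_into M f (f X) = X"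
  using coercive_bij[of c f] by (simp add: bij_betw_def inv_into_f_f)

lemma coercive_inv_linear:
  assumes f: "coercive_on c f"
  shows "linear (\<lambda>X. inv_into M f (orth_proj M X))"
proof -
  have lin: "linear f" using f by (simp add: coercive_on_def)
  note P = orth_proj_props(1) and inv = coercive_inv[OF f orth_proj_props(1)]
  show ?thesis
  proof (rule linearI)
    fix X Y
    let ?i = "\<lambda>X. inv_into M f (orth_proj M X)"
    have "f (?i X + ?i Y) = orth_proj M (X + Y)"
      by (simp add: linear_add[OF lin] linear_add[OF orth_proj_linear] inv)
    then show "?i (X + Y) = ?i X + ?i Y"
      using coercive_inv_unique[OF f, of "?i X + ?i Y"] inv M by (simp add: subspace_add)
  next
    fix r X
    let ?i = "\<lambda>X. inv_into M f (orth_proj M X)"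
    have "f (r *\<^sub>R ?i X) = orth_proj M (r *\<^sub>R X)"
      by (simp add: linear_scale[OF lin] linear_scale[OF orth_proj_linear] inv)
    then show "?i (r *\<^sub>R X) = r *\<^sub>R ?i X"
      using coercive_inv_unique[OF f, of "r *\<^sub>R ?i X"] inv M by (simp add: subspace_mul)
  qed
qed

lemma coercive_inv_psd:
  assumes f: "coercive_on c f" and sym: "\<And>X Y. X \<in> M \<Longrightarrow> Y \<in> M \<Longrightarrow> f X \<bullet> Y = X \<bullet> f Y"
  shows "psd_on M (\<lambda>X. inv_into M f (orth_proj M X))"
  unfolding psd_on_def
proof (intro conjI ballI)
  show "linear (\<lambda>X. inv_into M f (orth_proj M X))" by (rule coercive_inv_linear[OF f])
  show "(\<lambda>X. inv_into M f (orth_proj M X)) ` M \<subseteq> M"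
    using coercive_inv(1)[OF f orth_proj_props(1)] by blast
  fix X assume X: "X \<in> M"
  note i = coercive_inv[OF f X]
  have "0 \<le> c * (norm (inv_into M f X))\<^sup>2" using f by (simp add: coercive_on_def)
  also have "\<dots> \<le> f (inv_into M f X) \<bullet> inv_into M f X" using f i(1) by (simp add: coercive_on_def)
  finally show "0 \<le> inv_into M f (orth_proj M X) \<bullet> X"
    using i(2) by (simp add: orth_proj_id[OF X] inner_commute)
  fix Y assume Y: "Y \<in> M"
  note j = coercive_inv[OF f Y]
  show "inv_into M f (orth_proj M X) \<bullet> Y = X \<bullet> inv_into M f (orth_proj M Y)"
    using sym[OF i(1) j(1)] i(2) j(2) by (simp add: orth_proj_id X Y)
qed

lemma coercive_perturb:
  assumes f: "coercive_on c f" and g: "linear g" "g ` M \<subseteq> M"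
    and d: "\<And>X. X \<in> M \<Longrightarrow> norm (g X - f X) \<le> \<delta> * norm X" and \<delta>: "\<delta> < c"
  shows "coercive_on (c - \<delta>) g"
  unfolding coercive_on_def
proof (intro conjI ballI g)
  show "0 < c - \<delta>" using \<delta> by simp
  fix X assume X: "X \<in> M"
  have "\<bar>(g X - f X) \<bullet> X\<bar> \<le> norm (g X - f X) * norm X" by (rule Cauchy_Schwarz_ineq2)
  also have "\<dots> \<le> (\<delta> * norm X) * norm X" using d[OF X] by (intro mult_right_mono) auto
  finally have "- (\<delta> * (norm X)\<^sup>2) \<le> g X \<bullet> X - f X \<bullet> X"
    by (simp add: inner_diff_left power2_eq_square mult.assoc)
  moreover have "c * (norm X)\<^sup>2 \<le> f X \<bullet> X" using f X by (simp add: coercive_on_def)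
  ultimately show "(c - \<delta>) * (norm X)\<^sup>2 \<le> g X \<bullet> X" by (simp add: left_diff_distrib)
qed

lemma coercive_inv_diff:
  assumes f: "coercive_on c f" and g: "coercive_on c g"
    and d: "\<And>X. X \<in> M \<Longrightarrow> norm (g X - f X) \<le> \<delta> * norm X" and Y: "Y \<in> M"
  shows "norm (inv_into M g Y - inv_into M f Y) \<le> \<delta> / c\<^sup>2 * norm Y"
proof -
  note i = coercive_inv[OF f Y] and j = coercive_inv[OF g Y]
  have c: "0 < c" and ling: "linear g" using f g by (auto simp: coercive_on_def)
  have mem: "inv_into M f Y - inv_into M g Y \<in> M" using i(1) j(1) M by (auto intro: subspace_diff)
  have "c * norm (inv_into M f Y - inv_into M g Y) \<le> norm (g (inv_into M f Y - inv_into M g Y))"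
    by (rule coercive_norm[OF g mem])
  also have "g (inv_into M f Y - inv_into M g Y) = g (inv_into M f Y) - f (inv_into M f Y)"
    by (simp add: linear_diff[OF ling] i(2) j(2))
  also have "norm \<dots> \<le> \<delta> * norm (inv_into M f Y)" by (rule d[OF i(1)])
  finally have 1: "c * norm (inv_into M f Y - inv_into M g Y) \<le> \<delta> * norm (inv_into M f Y)" .
  have "c * (c * norm (inv_into M f Y - inv_into M g Y)) \<le> \<delta> * norm Y"
  proof (cases "Y = 0")
    case True
    then show ?thesis using i(3) j(3) by simp
  next
    case False
    then have "inv_into M f Y \<noteq> 0" using i(2) f by (auto simp: coercive_on_def linear_0)
    moreover have "0 \<le> \<delta> * norm (inv_into M f Y)" using d[OF i(1)] norm_ge_zero order_trans by blast
    ultimately have "0 \<le> \<delta>" by (simp add: zero_le_mult_iff)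
    have "c * (c * norm (inv_into M f Y - inv_into M g Y)) \<le> c * (\<delta> * norm (inv_into M f Y))"
      using 1 c by simp
    also have "\<dots> = \<delta> * (c * norm (inv_into M f Y))" by simp
    also have "\<dots> \<le> \<delta> * norm Y"
      using i(3) c \<open>0 \<le> \<delta>\<close> by (intro mult_left_mono) (auto simp: field_simps)
    finally show ?thesis .
  qed
  then show ?thesis using c by (simp add: norm_minus_commute power2_eq_square field_simps)
qed

lemma inv_into_cong_on: "(\<And>X. X \<in> M \<Longrightarrow> f X = g X) \<Longrightarrow> inv_into M f = inv_into M g"
  unfolding inv_into_def by (intro ext arg_cong[where f = Eps]) auto

text \<open>Perturbation bound for \<open>F\<^sup>-\<^sup>1 \<Sigma> F\<^sup>-\<^sup>1\<close>.\<close>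

lemma sandwich_inv_perturb:
  assumes f: "coercive_on c f" and g: "coercive_on c g"
    and d: "\<And>X. X \<in> M \<Longrightarrow> norm (g X - f X) \<le> \<delta> * norm X"
    and C: "linear C" "C ` M \<subseteq> M" "\<And>X. X \<in> M \<Longrightarrow> norm (C X) \<le> s * norm X"
    and E: "E ` M \<subseteq> M" "\<And>X. X \<in> M \<Longrightarrow> norm (E X - C X) \<le> \<delta> * norm X"
    and \<delta>: "0 \<le> \<delta>" and s: "0 \<le> s" and X: "X \<in> M"
  shows "norm (inv_into M g (E (inv_into M g X)) - inv_into M f (C (inv_into M f X)))
    \<le> (1 / c\<^sup>2 + 2 * s / c ^ 3) * \<delta> * norm X"
proof -
  have c: "0 < c" using f by (simp add: coercive_on_def)
  let ?y = "inv_into M f X" and ?z = "inv_into M g X"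
  note y = coercive_inv[OF f X] and z = coercive_inv[OF g X]
  have Ez: "E ?z \<in> M" and Cy: "C ?y \<in> M" and dm: "?z - ?y \<in> M"
    using E(1) C(2) y(1) z(1) M by (auto intro: subspace_diff)
  have zy: "norm (?z - ?y) \<le> \<delta> / c\<^sup>2 * norm X" by (rule coercive_inv_diff[OF f g d X])
  have lin: "linear (\<lambda>X. inv_into M g (orth_proj M X))" by (rule coercive_inv_linear[OF g])
  have "norm (E ?z - C ?y) \<le> norm (E ?z - C ?z) + norm (C (?z - ?y))"
    using norm_triangle_ineq[of "E ?z - C ?z" "C (?z - ?y)"] by (simp add: linear_diff[OF C(1)])
  also have "\<dots> \<le> \<delta> * norm ?z + s * norm (?z - ?y)"
    by (intro add_mono E(2) C(3) z(1) dm)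
  also have "\<dots> \<le> \<delta> * (norm X / c) + s * (\<delta> / c\<^sup>2 * norm X)"
    using z(3) zy \<delta> s by (intro add_mono mult_left_mono) auto
  finally have 1: "norm (E ?z - C ?y) \<le> \<delta> * (norm X / c) + s * (\<delta> / c\<^sup>2 * norm X)" .
  have sub: "inv_into M g (E ?z) - inv_into M g (C ?y) = inv_into M g (E ?z - C ?y)"
    using linear_diff[OF lin, of "E ?z" "C ?y"] Ez Cy M by (simp add: orth_proj_id subspace_diff)
  have "norm (inv_into M g (E ?z) - inv_into M f (C ?y))
      \<le> norm (inv_into M g (E ?z - C ?y)) + norm (inv_into M g (C ?y) - inv_into M f (C ?y))"
    unfolding sub[symmetric] by (rule norm_triangle_ineq[THEN order_trans[rotated]]) simp
  also have "\<dots> \<le> norm (E ?z - C ?y) / c + \<delta> / c\<^sup>2 * norm (C ?y)"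
    using Ez Cy M by (intro add_mono coercive_inv(3)[OF g] coercive_inv_diff[OF f g d]) (auto intro: subspace_diff)
  also have "\<dots> \<le> (\<delta> * (norm X / c) + s * (\<delta> / c\<^sup>2 * norm X)) / c + \<delta> / c\<^sup>2 * (s * (norm X / c))"
  proof (intro add_mono divide_right_mono mult_left_mono 1)
    have "norm (C ?y) \<le> s * norm ?y" by (rule C(3)[OF y(1)])
    also have "\<dots> \<le> s * (norm X / c)" using y(3) s by (rule mult_left_mono)
    finally show "norm (C ?y) \<le> s * (norm X / c)" .
  qed (use c \<delta> in auto)
  also have "\<dots> = (1 / c\<^sup>2 + 2 * s / c ^ 3) * \<delta> * norm X"
    using c by (simp add: field_simps power2_eq_square power3_eq_cube)
  finally show ?thesis .
qed

text \<open>Cauchy--Schwarz for the form of \<open>f\<close>, read off a square root of \<open>f\<close>.\<close>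

lemma psd_on_null:
  assumes f: "psd_on M f" and X: "X \<in> M" "f X \<bullet> X = 0"
  shows "f X = 0"
proof -
  obtain g where g: "psd_on M g" "\<And>X. X \<in> M \<Longrightarrow> g (g X) = f X"
    using psd_on_sqrt_exists[OF M f] by blast
  have "g X \<in> M" using g(1) X(1) by (auto simp: psd_on_def)
  then have "g (g X) \<bullet> X = g X \<bullet> g X" using g(1) X(1) by (auto simp: psd_on_def)
  then have "g X = 0" using g(2)[OF X(1)] X(2) by simp
  then have "g (g X) = 0" using g(1) by (simp add: psd_on_def linear_0)
  then show ?thesis using g(2)[OF X(1)] by simp
qed

lemma psd_on_sqrt_coercive:
  assumes R: "psd_on M R" and inj: "\<And>X. X \<in> M \<Longrightarrow> R (R X) = 0 \<Longrightarrow> X = 0"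
  shows "\<exists>c. coercive_on c R"
proof -
  have lin: "linear R" and sub: "R ` M \<subseteq> M" using R by (auto simp: psd_on_def)
  have "0 < R X \<bullet> X" if X: "X \<in> M" "X \<noteq> 0" for X
  proof -
    have "R X \<noteq> 0" using inj[OF X(1)] X(2) linear_0[OF lin] by auto
    then have "R X \<bullet> X \<noteq> 0" using psd_on_null[OF R X(1)] by blast
    moreover have "0 \<le> R X \<bullet> X" using R X(1) unfolding psd_on_def by blast
    ultimately show ?thesis by simp
  qed
  from pos_def_coercive[OF lin this] show ?thesis
    using lin sub unfolding coercive_on_def by blast
qed

lemma op_sqrt_props:
  assumes f: "psd_on M f" and A: "\<And>X. X \<in> M \<Longrightarrow> A X = f X"
  shows "psd_on M (op_sqrt M A)" "\<And>X. X \<in> M \<Longrightarrow> op_sqrt M A (op_sqrt M A X) = f X"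
proof -
  let ?Q = "\<lambda>B. linear B \<and> B ` M \<subseteq> M \<and>
     (\<forall>X\<in>M. \<forall>Y\<in>M. B X \<bullet> Y = X \<bullet> B Y) \<and> (\<forall>X\<in>M. 0 \<le> B X \<bullet> X) \<and> (\<forall>X\<in>M. B (B X) = A X)"
  obtain g where "psd_on M g" "\<forall>X\<in>M. g (g X) = f X"
    using psd_on_sqrt_exists[OF M f] by blast
  moreover from this have "\<forall>X\<in>M. g (g X) = A X" using A by simp
  ultimately have "?Q g" unfolding psd_on_def by blast
  then have Q: "?Q (op_sqrt M A)" unfolding op_sqrt_def by (rule someI[of ?Q])
  then show "psd_on M (op_sqrt M A)" unfolding psd_on_def by blast
  from Q have "\<forall>X\<in>M. op_sqrt M A (op_sqrt M A X) = A X" by blast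
  then show "\<And>X. X \<in> M \<Longrightarrow> op_sqrt M A (op_sqrt M A X) = f X" using A by simp
qed

lemma psd_on_sandwich:
  assumes L: "psd_on M L" and C: "psd_on M C"
  shows "psd_on M (\<lambda>X. L (C (L X)))"
  unfolding psd_on_def
proof (intro conjI ballI)
  have l: "linear L" "linear C" using L C by (auto simp: psd_on_def)
  show "linear (\<lambda>X. L (C (L X)))"
    using linear_compose[OF linear_compose[OF l] l(1)] by (simp add: comp_def)
  show "(\<lambda>X. L (C (L X))) ` M \<subseteq> M" using L C unfolding psd_on_def by blast
  fix X assume X: "X \<in> M"
  have m: "L X \<in> M" "C (L X) \<in> M" using L C X unfolding psd_on_def by blast+
  have "L (C (L X)) \<bullet> X = C (L X) \<bullet> L X" using L X m unfolding psd_on_def by blast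
  moreover have "0 \<le> C (L X) \<bullet> L X" using C m unfolding psd_on_def by blast
  ultimately show "0 \<le> L (C (L X)) \<bullet> X" by simp
  fix Y assume Y: "Y \<in> M"
  have n: "L Y \<in> M" "C (L Y) \<in> M" using L C Y unfolding psd_on_def by blast+
  have "L (C (L X)) \<bullet> Y = C (L X) \<bullet> L Y" using L Y m unfolding psd_on_def by blast
  also have "\<dots> = L X \<bullet> C (L Y)" using C m n unfolding psd_on_def by blast
  also have "\<dots> = X \<bullet> L (C (L Y))" using L X n unfolding psd_on_def by blast
  finally show "L (C (L X)) \<bullet> Y = X \<bullet> L (C (L Y))" .
qed

text \<open>For an orthonormal eigenbasis \<open>b\<close> of \<open>C\<close> on \<open>M\<close> with eigenvalues \<open>\<lambda>\<^sub>b\<close>, the vectors \<open>sqrt \<lambda>\<^sub>b b\<close> weighted by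
  independent standard normal variables have covariance \<open>C\<close>.\<close>

lemma gaussian_on_subspace_exists:
  assumes C: "psd_on M C"
  shows "\<exists>N. prob_space N \<and> sets N = sets borel \<and> centred_gaussian M C N \<and>
    (\<forall>X. distr N borel (\<lambda>Z. X \<bullet> Z) = normal_law (sqrt (C (orth_proj M X) \<bullet> orth_proj M X)))"
proof -
  have c: "linear C" "C ` M \<subseteq> M" "\<And>X Y. X \<in> M \<Longrightarrow> Y \<in> M \<Longrightarrow> C X \<bullet> Y = X \<bullet> C Y"
    using C unfolding psd_on_def by blast+
  from spectral_theorem_subspace[OF M c]
  obtain B where B: "finite B" "B \<subseteq> M" "pairwise orthogonal B" "\<And>b. b \<in> B \<Longrightarrow> norm b = 1"
    "span B = M" "\<And>b. b \<in> B \<Longrightarrow> C b = (C b \<bullet> b) *\<^sub>R b" by blast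
  define v where "v b = sqrt (C b \<bullet> b) *\<^sub>R b" for b
  have vM: "v ` B \<subseteq> M" using B(2) M by (auto simp: v_def subspace_mul)
  have nn: "0 \<le> C b \<bullet> b" if "b \<in> B" for b using C B(2) that by (auto simp: psd_on_def)
  have Cv: "C X = (\<Sum>b\<in>B. (X \<bullet> v b) *\<^sub>R v b)" if X: "X \<in> M" for X
  proof -
    have "C X = C (\<Sum>b\<in>B. (X \<bullet> b) *\<^sub>R b)"
      using orthonormal_expansion[OF B(1,3,4), of X] X B(5) by simp
    also have "\<dots> = (\<Sum>b\<in>B. (X \<bullet> b) *\<^sub>R C b)" by (simp add: linear_sum[OF c(1)] linear_scale[OF c(1)])
    also have "\<dots> = (\<Sum>b\<in>B. (X \<bullet> v b) *\<^sub>R v b)"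
    proof (rule sum.cong[OF refl])
      fix b assume b: "b \<in> B"
      have "(X \<bullet> b) *\<^sub>R C b = ((X \<bullet> b) * (C b \<bullet> b)) *\<^sub>R b" by (subst B(6)[OF b]) simp
      also have "\<dots> = (X \<bullet> v b) *\<^sub>R v b" using nn[OF b] by (simp add: v_def mult_ac)
      finally show "(X \<bullet> b) *\<^sub>R C b = (X \<bullet> v b) *\<^sub>R v b" .
    qed
    finally show ?thesis .
  qed
  have quad: "(\<Sum>b\<in>B. (X \<bullet> v b)\<^sup>2) = C (orth_proj M X) \<bullet> orth_proj M X" for X
  proof -
    have "X \<bullet> v b = orth_proj M X \<bullet> v b" if "b \<in> B" for b
      using vM that by (subst orth_proj_inner) auto
    then have "(\<Sum>b\<in>B. (X \<bullet> v b)\<^sup>2) = (\<Sum>b\<in>B. (orth_proj M X \<bullet> v b)\<^sup>2)" by simp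
    also have "\<dots> = C (orth_proj M X) \<bullet> orth_proj M X"
      unfolding Cv[OF orth_proj_props(1)]
      by (simp add: inner_sum_left power2_eq_square inner_commute[of "v _"])
    finally show ?thesis .
  qed
  obtain N where N: "prob_space N" "sets N = sets borel" "AE Z in N. Z \<in> span (v ` B)"
    "\<And>X. distr N borel (\<lambda>Z. X \<bullet> Z) = normal_law (sqrt (\<Sum>b\<in>B. (X \<bullet> v b)\<^sup>2))"
    using gaussian_law_exists[OF B(1), of v] by blast
  have "span (v ` B) \<subseteq> M" using vM M by (rule span_minimal)
  then have "AE Z in N. Z \<in> M" using N(3) by (auto elim!: eventually_mono)
  moreover have "centred_normal (distr N borel (\<lambda>Z. X \<bullet> Z))" for X
    unfolding N(4) by (rule normal_law_centred_normal) (simp add: sum_nonneg)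
  moreover have "C X = (\<integral>Z. tensor_op Z Z X \<partial>N)" if "X \<in> M" for X
    unfolding Cv[OF that] by (rule gaussian_law_covariance[OF B(1) N(1,2,4), symmetric])
  ultimately have "centred_gaussian M C N"
    using N(1,2) by (simp add: centred_gaussian_def)
  then show ?thesis using N quad by metis
qed

end

section \<open>Independent samples\<close>

text \<open>The mean of the sample with indices \<open>1, \<dots>, n\<close>.\<close>

definition avg :: "nat \<Rightarrow> (nat \<Rightarrow> 'a::real_vector) \<Rightarrow> 'a" where
  "avg n f = (1 / real n) *\<^sub>R (\<Sum>i=1..n. f i)"

lemma avg_linear: "linear L \<Longrightarrow> L (avg n f) = avg n (\<lambda>i. L (f i))"
  by (simp add: avg_def linear_scale linear_sum)

lemma avg_inner: "avg n f \<bullet> y = avg n (\<lambda>i. f i \<bullet> y)"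
  by (simp add: avg_def inner_sum_left)

lemma avg_add: "avg n (\<lambda>i. f i + g i) = avg n f + avg n g"
  by (simp add: avg_def sum.distrib scaleR_add_right)

lemma avg_diff: "avg n (\<lambda>i. f i - g i) = avg n f - avg n g"
  by (simp add: avg_def sum_subtractf scaleR_diff_right)

lemma avg_minus: "avg n (\<lambda>i. - f i) = - avg n f"
  by (simp add: avg_def sum_negf)

lemma avg_const: "n \<ge> 1 \<Longrightarrow> avg n (\<lambda>i. c) = c"
  by (simp add: avg_def sum_constant_scaleR del: sum_constant)

lemma avg_mult_left: "avg n (\<lambda>i. c * f i) = c * (avg n f :: real)"
  by (simp add: avg_def sum_distrib_left sum_divide_distrib)

lemma avg_mono: "(\<And>i. i \<ge> 1 \<Longrightarrow> f i \<le> g i) \<Longrightarrow> avg n f \<le> (avg n g :: real)"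
  unfolding avg_def by (intro scaleR_left_mono sum_mono) auto

lemma avg_nonneg: "(\<And>i. i \<ge> 1 \<Longrightarrow> 0 \<le> f i) \<Longrightarrow> 0 \<le> (avg n f :: real)"
  unfolding avg_def by (intro scaleR_nonneg_nonneg sum_nonneg) auto

lemma avg_norm: "norm (avg n f) \<le> avg n (\<lambda>i. norm (f i :: 'a::real_normed_vector))"
  by (simp add: avg_def divide_right_mono norm_sum)

lemma avg_norm_le: "(\<And>i. i \<ge> 1 \<Longrightarrow> norm (f i :: 'a::real_normed_vector) \<le> g i) \<Longrightarrow> norm (avg n f) \<le> avg n g"
  by (rule order_trans[OF avg_norm avg_mono])

lemma avg_cong: "(\<And>i. i \<ge> 1 \<Longrightarrow> f i = g i) \<Longrightarrow> avg n f = avg n g"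
  by (simp add: avg_def)

lemma avg_shift: "avg n f = (\<Sum>i<n. f (Suc i)) /\<^sub>R real n"
  by (simp add: avg_def sum_bounds_lt_plus1 inverse_eq_divide)

lemma sqrt_avg: "sqrt (real n) *\<^sub>R avg n f = (\<Sum>i<n. f (Suc i)) /\<^sub>R sqrt (real n)"
proof (cases "n = 0")
  case False
  then have "sqrt (real n) / real n = inverse (sqrt (real n))"
    by (simp add: field_simps)
  then show ?thesis by (simp add: avg_shift divide_inverse)
qed simp

context prob_space
begin

text \<open>Events are only bounded from inside, so that the property itself need not be measurable.\<close>

definition likely :: "real \<Rightarrow> (nat \<Rightarrow> 'a \<Rightarrow> bool) \<Rightarrow> bool" where
  "likely e \<Phi> \<longleftrightarrow> (\<forall>\<^sub>F n in sequentially. \<exists>E\<in>events. 1 - e \<le> prob E \<and> (\<forall>x\<in>E. \<Phi> n x))"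

definition whp :: "(nat \<Rightarrow> 'a \<Rightarrow> bool) \<Rightarrow> bool" where
  "whp \<Phi> \<longleftrightarrow> (\<forall>e>0. likely e \<Phi>)"

lemma likely_conj:
  assumes "likely a \<Phi>" "likely b \<Psi>"
  shows "likely (a + b) (\<lambda>n x. \<Phi> n x \<and> \<Psi> n x)"
  using assms unfolding likely_def
proof eventually_elim
  case (elim n)
  then obtain E F where E: "E \<in> events" "1 - a \<le> prob E" "\<forall>x\<in>E. \<Phi> n x"
    and F: "F \<in> events" "1 - b \<le> prob F" "\<forall>x\<in>F. \<Psi> n x" by blast
  have "prob (space M - E \<inter> F) \<le> prob ((space M - E) \<union> (space M - F))"
    using E F by (intro finite_measure_mono) auto
  also have "\<dots> \<le> prob (space M - E) + prob (space M - F)"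
    using E F by (intro measure_Un_le) auto
  finally have "1 - (a + b) \<le> prob (E \<inter> F)"
    using E F by (simp add: prob_compl)
  then show ?case using E F by (intro bexI[of _ "E \<inter> F"]) auto
qed

lemma likely_mono:
  assumes "likely e \<Phi>" "\<forall>\<^sub>F n in sequentially. \<forall>x\<in>space M. \<Phi> n x \<longrightarrow> \<Psi> n x"
  shows "likely e \<Psi>"
  using assms unfolding likely_def
proof eventually_elim
  case (elim n)
  then obtain E where E: "E \<in> events" "1 - e \<le> prob E" "\<forall>x\<in>E. \<Phi> n x" by blast
  then show ?case using elim(2) sets.sets_into_space[OF E(1)] by (intro bexI[of _ E]) auto
qed

lemma whp_mono: "whp \<Phi> \<Longrightarrow> (\<And>n x. x \<in> space M \<Longrightarrow> \<Phi> n x \<Longrightarrow> \<Psi> n x) \<Longrightarrow> whp \<Psi>"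
  unfolding whp_def by (auto intro: likely_mono)

lemma whp_conj:
  assumes "whp \<Phi>" "whp \<Psi>"
  shows "whp (\<lambda>n x. \<Phi> n x \<and> \<Psi> n x)"
  unfolding whp_def
proof (intro allI impI)
  fix e :: real assume "0 < e"
  then have "likely (e / 2) \<Phi>" "likely (e / 2) \<Psi>" using assms by (auto simp: whp_def)
  from likely_conj[OF this] show "likely e (\<lambda>n x. \<Phi> n x \<and> \<Psi> n x)" by simp
qed

lemma likely_whp_conj:
  assumes "likely e \<Phi>" "whp \<Psi>" "e < e'"
  shows "likely e' (\<lambda>n x. \<Phi> n x \<and> \<Psi> n x)"
  using likely_conj[of e \<Phi> "e' - e" \<Psi>] assms by (simp add: whp_def)

lemma whp_const: "whp (\<lambda>n x. True)"
  unfolding whp_def likely_def by (auto intro!: always_eventually bexI[of _ "space M"] simp: prob_space)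

lemma whp_ball:
  assumes "finite I" "\<And>i. i \<in> I \<Longrightarrow> whp (\<Phi> i)"
  shows "whp (\<lambda>n x. \<forall>i\<in>I. \<Phi> i n x)"
  using assms
proof (induction I)
  case empty
  then show ?case by (simp add: whp_const)
next
  case (insert i I)
  have "whp (\<lambda>n x. \<Phi> i n x \<and> (\<forall>i\<in>I. \<Phi> i n x))"
    using insert by (intro whp_conj) auto
  then show ?case by simp
qed

lemma likely_complement:
  assumes "\<And>n. {x \<in> space M. \<not> \<Phi> n x} \<in> events"
    and "\<forall>\<^sub>F n in sequentially. prob {x \<in> space M. \<not> \<Phi> n x} \<le> e"
  shows "likely e \<Phi>"
  unfolding likely_def using assms(2)
proof eventually_elim
  case (elim n)
  show ?case
  proof (intro bexI conjI ballI)
    show "space M - {x \<in> space M. \<not> \<Phi> n x} \<in> events" using assms(1)[of n] by blast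
    show "1 - e \<le> prob (space M - {x \<in> space M. \<not> \<Phi> n x})"
      using elim prob_compl[OF assms(1)[of n]] by simp
  qed auto
qed

lemma likely_imp_prob:
  assumes "likely e \<Phi>" and meas: "\<forall>\<^sub>F n in sequentially. {x \<in> space M. \<not> \<Phi> n x} \<in> events"
  shows "\<forall>\<^sub>F n in sequentially. prob {x \<in> space M. \<not> \<Phi> n x} \<le> e"
  using assms(1)[unfolded likely_def] meas
proof eventually_elim
  case (elim n)
  then obtain E where E: "E \<in> events" "1 - e \<le> prob E" "\<forall>x\<in>E. \<Phi> n x" by blast
  have "prob {x \<in> space M. \<not> \<Phi> n x} \<le> prob (space M - E)"
    using E by (intro finite_measure_mono) auto
  then show ?case using E prob_compl[OF E(1)] by simp
qed

end

locale iid_sample = prob_space M for M :: "'a measure" +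
  fixes P :: "'b measure" and S :: "nat \<Rightarrow> 'a \<Rightarrow> 'b"
  assumes S_indep: "indep_vars (\<lambda>_. P) S {1..}"
    and S_law: "\<And>i. i \<ge> 1 \<Longrightarrow> distr M P (S i) = P"
begin

lemma S_measurable [measurable]: "i \<ge> 1 \<Longrightarrow> S i \<in> measurable M P"
  using S_indep by (auto simp: indep_vars_def)

lemma S_in_space: "i \<ge> 1 \<Longrightarrow> x \<in> space M \<Longrightarrow> S i x \<in> space P"
  using measurable_space[OF S_measurable] by blast

lemma prob_space_P: "prob_space P"
  using prob_space_distr[OF S_measurable[of 1]] S_law[of 1] by simp

text \<open>The sample starts at index \<open>1\<close>, the sums of real random variables at \<open>0\<close>; hence the shift.\<close>

lemma iid_realI:
  assumes [measurable]: "(\<phi> :: 'b \<Rightarrow> real) \<in> borel_measurable P"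
  shows "iid_real M (\<lambda>i x. \<phi> (S (Suc i) x))"
proof
  have ind: "indep_vars (\<lambda>_. borel) (\<lambda>i x. \<phi> (S i x)) {1..}"
    by (rule indep_vars_compose2[OF S_indep]) simp
  let ?F = "\<lambda>i. {(\<lambda>x. \<phi> (S i x)) -` A \<inter> space M |A. A \<in> sets borel}"
  have F: "\<And>J A. J \<subseteq> {1..} \<Longrightarrow> J \<noteq> {} \<Longrightarrow> finite J \<Longrightarrow> A \<in> Pi J ?F \<Longrightarrow>
      prob (\<Inter>j\<in>J. A j) = (\<Prod>j\<in>J. prob (A j))"
    using ind unfolding indep_vars_def2 indep_sets_def by blast
  show "indep_vars (\<lambda>_. borel) (\<lambda>i x. \<phi> (S (Suc i) x)) UNIV"
    unfolding indep_vars_def2 indep_sets_def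
  proof (intro conjI ballI allI impI)
    show "{(\<lambda>x. \<phi> (S (Suc i) x)) -` A \<inter> space M |A. A \<in> sets borel} \<subseteq> events" for i
      by (auto intro!: measurable_sets[of _ M borel])
    fix J :: "nat set" and A
    assume J: "J \<subseteq> UNIV" "J \<noteq> {}" "finite J"
      and A: "A \<in> (\<Pi> i\<in>J. {(\<lambda>x. \<phi> (S (Suc i) x)) -` A \<inter> space M |A. A \<in> sets borel})"
    define A' where "A' j = A (j - 1)" for j
    have "A' \<in> Pi (Suc ` J) ?F"
    proof (rule Pi_I)
      fix j assume "j \<in> Suc ` J"
      then obtain i where "i \<in> J" "j = Suc i" by blast
      then show "A' j \<in> ?F j" using Pi_mem[OF A, of i] by (simp add: A'_def)
    qed
    then have "prob (\<Inter>j\<in>Suc ` J. A' j) = (\<Prod>j\<in>Suc ` J. prob (A' j))"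
      using J by (intro F) auto
    then show "prob (\<Inter>j\<in>J. A j) = (\<Prod>j\<in>J. prob (A j))"
      by (simp add: A'_def prod.reindex)
  qed simp
  show "distr M borel (\<lambda>x. \<phi> (S (Suc i) x)) = distr M borel (\<lambda>x. \<phi> (S (Suc 0) x))" for i
    using distr_distr[of \<phi> P borel "S (Suc i)" M] distr_distr[of \<phi> P borel "S (Suc 0)" M]
    by (simp add: comp_def S_law)
qed

lemma expectation_S:
  "i \<ge> 1 \<Longrightarrow> (\<phi> :: 'b \<Rightarrow> real) \<in> borel_measurable P \<Longrightarrow> expectation (\<lambda>x. \<phi> (S i x)) = (\<integral>s. \<phi> s \<partial>P)"
  using integral_distr[of "S i" M P \<phi>] by (simp add: S_law)

lemma integrable_S: "i \<ge> 1 \<Longrightarrow> integrable P (\<phi> :: 'b \<Rightarrow> real) \<Longrightarrow> integrable M (\<lambda>x. \<phi> (S i x))"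
  using integrable_distr[of "S i" M P \<phi>] by (simp add: S_law)

lemma avg_measurable:
  assumes [measurable]: "(\<phi> :: 'b \<Rightarrow> 'c::euclidean_space) \<in> borel_measurable P"
  shows "(\<lambda>x. avg n (\<lambda>i. \<phi> (S i x))) \<in> borel_measurable M"
  unfolding avg_shift by measurable

lemma whp_mean_real:
  assumes int: "integrable P (\<phi> :: 'b \<Rightarrow> real)" and e: "0 < e"
  shows "whp (\<lambda>n x. \<bar>avg n (\<lambda>i. \<phi> (S i x)) - (\<integral>s. \<phi> s \<partial>P)\<bar> < e)"
proof -
  have [measurable]: "\<phi> \<in> borel_measurable P" using int by simp
  interpret X: iid_real M "\<lambda>i x. \<phi> (S (Suc i) x)" by (rule iid_realI) simp
  have lim: "(\<lambda>n. prob {x \<in> space M. e \<le> \<bar>avg n (\<lambda>i. \<phi> (S i x)) - (\<integral>s. \<phi> s \<partial>P)\<bar>}) \<longlonglongrightarrow> 0"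
    using X.weak_law[OF integrable_S[OF _ int] e] expectation_S[of "Suc 0" \<phi>]
    by (simp add: avg_shift divide_inverse mult.commute)
  show ?thesis
    unfolding whp_def
  proof (intro allI impI likely_complement)
    note [measurable] = avg_measurable
    show "{x \<in> space M. \<not> \<bar>avg n (\<lambda>i. \<phi> (S i x)) - (\<integral>s. \<phi> s \<partial>P)\<bar> < e} \<in> events" for n
      by measurable
    fix e' :: real assume "0 < e'"
    from order_tendstoD(2)[OF lim this]
    show "\<forall>\<^sub>F n in sequentially. prob {x \<in> space M. \<not> \<bar>avg n (\<lambda>i. \<phi> (S i x)) - (\<integral>s. \<phi> s \<partial>P)\<bar> < e} \<le> e'"
      by (auto simp: not_less elim!: eventually_mono)
  qed
qed

lemma whp_mean:
  assumes int: "integrable P (\<phi> :: 'b \<Rightarrow> 'c::euclidean_space)" and e: "0 < e"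
  shows "whp (\<lambda>n x. norm (avg n (\<lambda>i. \<phi> (S i x)) - (\<integral>s. \<phi> s \<partial>P)) \<le> e)"
proof -
  define d where "d = e / DIM('c)"
  have d: "0 < d" using e by (simp add: d_def)
  have "whp (\<lambda>n x. \<forall>b\<in>Basis. \<bar>avg n (\<lambda>i. \<phi> (S i x) \<bullet> b) - (\<integral>s. \<phi> s \<bullet> b \<partial>P)\<bar> < d)"
    using int by (intro whp_ball whp_mean_real d) auto
  then show ?thesis
  proof (rule whp_mono)
    fix n x assume x: "\<forall>b\<in>Basis. \<bar>avg n (\<lambda>i. \<phi> (S i x) \<bullet> b) - (\<integral>s. \<phi> s \<bullet> b \<partial>P)\<bar> < d"
    have "norm (avg n (\<lambda>i. \<phi> (S i x)) - (\<integral>s. \<phi> s \<partial>P))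
        \<le> (\<Sum>b\<in>Basis. \<bar>(avg n (\<lambda>i. \<phi> (S i x)) - (\<integral>s. \<phi> s \<partial>P)) \<bullet> b\<bar>)" by (rule norm_le_l1)
    also have "\<dots> \<le> (\<Sum>b\<in>(Basis::'c set). d)"
      using x int by (intro sum_mono) (simp add: inner_diff_left avg_inner less_imp_le)
    also have "\<dots> = e" by (simp add: d_def)
    finally show "norm (avg n (\<lambda>i. \<phi> (S i x)) - (\<integral>s. \<phi> s \<partial>P)) \<le> e" .
  qed
qed

end

locale centred_iid_sample = iid_sample +
  fixes V :: "'b \<Rightarrow> 'c::euclidean_space"
  assumes V_measurable [measurable]: "V \<in> borel_measurable P"
    and V_square: "integrable P (\<lambda>s. (norm (V s))\<^sup>2)"
    and V_mean: "(\<integral>s. V s \<partial>P) = 0"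
begin

lemma V_integrable: "integrable P V"
proof -
  interpret P: prob_space P by (rule prob_space_P)
  have "integrable P (\<lambda>s. norm (V s))"
    by (rule P.square_integrable_imp_integrable) (use V_square in auto)
  then show ?thesis by (subst (asm) integrable_norm_iff) auto
qed

lemma V_component_square: "integrable P (\<lambda>s. (X \<bullet> V s)\<^sup>2)"
proof (rule Bochner_Integration.integrable_bound)
  show "integrable P (\<lambda>s. (norm X)\<^sup>2 * (norm (V s))\<^sup>2)" using V_square by simp
  show "AE s in P. norm ((X \<bullet> V s)\<^sup>2) \<le> norm ((norm X)\<^sup>2 * (norm (V s))\<^sup>2)"
  proof (rule AE_I2)
    fix s
    have "\<bar>X \<bullet> V s\<bar> \<le> norm X * norm (V s)" by (rule Cauchy_Schwarz_ineq2)
    then have "\<bar>X \<bullet> V s\<bar>\<^sup>2 \<le> (norm X * norm (V s))\<^sup>2" by (intro power_mono) auto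
    then show "norm ((X \<bullet> V s)\<^sup>2) \<le> norm ((norm X)\<^sup>2 * (norm (V s))\<^sup>2)"
      by (simp add: power_mult_distrib)
  qed
qed simp

definition normalized_sum :: "nat \<Rightarrow> 'a \<Rightarrow> 'c" where
  "normalized_sum n x = sqrt (real n) *\<^sub>R avg n (\<lambda>i. V (S i x))"

lemma normalized_sum_measurable [measurable]: "normalized_sum n \<in> borel_measurable M"
  using avg_measurable[OF V_measurable, of n] by (simp add: normalized_sum_def[abs_def])

lemma normalized_sum_inner: "X \<bullet> normalized_sum n x = (\<Sum>i<n. X \<bullet> V (S (Suc i) x)) / sqrt (real n)"
  by (simp add: normalized_sum_def sqrt_avg inner_sum_right divide_inverse mult.commute)

lemma component_mean: "expectation (\<lambda>x. X \<bullet> V (S (Suc 0) x)) = 0"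
  using expectation_S[of "Suc 0" "\<lambda>s. X \<bullet> V s"] V_integrable by (simp add: V_mean)

text \<open>Chebyshev's inequality in every coordinate.\<close>

lemma normalized_sum_tight:
  assumes e: "0 < e"
  shows "\<exists>K>0. likely e (\<lambda>n x. norm (normalized_sum n x) \<le> K)"
proof -
  define v where "v = (\<Sum>b\<in>Basis. \<integral>s. (b \<bullet> V s)\<^sup>2 \<partial>P)"
  have v: "0 \<le> v" unfolding v_def by (intro sum_nonneg Bochner_Integration.integral_nonneg) simp
  define K where "K = real DIM('c) * sqrt ((v + 1) / e)"
  have K: "0 < K" using v e by (simp add: K_def)
  have "prob {x \<in> space M. \<not> norm (normalized_sum n x) \<le> K} \<le> e" if n: "n \<ge> 1" for n
  proof -
    let ?c = "K / DIM('c)"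
    let ?A = "\<lambda>b. {x \<in> space M. sqrt (real n) * ?c \<le> \<bar>\<Sum>i<n. b \<bullet> V (S (Suc i) x)\<bar>}"
    have A: "?A b \<in> events" for b by measurable
    have c: "0 < ?c" "?c\<^sup>2 = (v + 1) / e" using K v e by (auto simp: K_def)
    have "{x \<in> space M. \<not> norm (normalized_sum n x) \<le> K} \<subseteq> (\<Union>b\<in>Basis. ?A b)"
    proof
      fix x assume x: "x \<in> {x \<in> space M. \<not> norm (normalized_sum n x) \<le> K}"
      show "x \<in> (\<Union>b\<in>Basis. ?A b)"
      proof (rule ccontr)
        assume no: "x \<notin> (\<Union>b\<in>Basis. ?A b)"
        have "\<bar>normalized_sum n x \<bullet> b\<bar> \<le> ?c" if b: "b \<in> Basis" for b
        proof -
          have "\<bar>\<Sum>i<n. b \<bullet> V (S (Suc i) x)\<bar> \<le> sqrt (real n) * ?c" using no x b by force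
          then have "\<bar>b \<bullet> normalized_sum n x\<bar> \<le> ?c"
            using n unfolding normalized_sum_inner by (simp add: abs_divide divide_le_eq mult.commute)
          then show ?thesis by (simp add: inner_commute)
        qed
        then have "(\<Sum>b\<in>Basis. \<bar>normalized_sum n x \<bullet> b\<bar>) \<le> (\<Sum>b\<in>(Basis::'c set). ?c)"
          by (intro sum_mono)
        then have "norm (normalized_sum n x) \<le> K"
          using norm_le_l1[of "normalized_sum n x"] by simp
        with x show False by simp
      qed
    qed
    then have "prob {x \<in> space M. \<not> norm (normalized_sum n x) \<le> K} \<le> prob (\<Union>b\<in>Basis. ?A b)"
      using A by (intro finite_measure_mono) auto
    also have "\<dots> \<le> (\<Sum>b\<in>Basis. prob (?A b))"
      using A by (intro finite_measure_subadditive_finite) auto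
    also have "\<dots> \<le> (\<Sum>b\<in>(Basis::'c set). (\<integral>s. (b \<bullet> V s)\<^sup>2 \<partial>P) / ?c\<^sup>2)"
    proof (rule sum_mono)
      fix b :: 'c assume "b \<in> Basis"
      interpret X: iid_real M "\<lambda>i x. b \<bullet> V (S (Suc i) x)" by (rule iid_realI) simp
      have sq: "integrable M (\<lambda>x. (b \<bullet> V (S (Suc 0) x))\<^sup>2)"
        "expectation (\<lambda>x. (b \<bullet> V (S (Suc 0) x))\<^sup>2) = (\<integral>s. (b \<bullet> V s)\<^sup>2 \<partial>P)"
        using integrable_S[of "Suc 0" "\<lambda>s. (b \<bullet> V s)\<^sup>2"] expectation_S[of "Suc 0" "\<lambda>s. (b \<bullet> V s)\<^sup>2"]
          V_component_square by auto
      have "prob (?A b) \<le> real n * (\<integral>s. (b \<bullet> V s)\<^sup>2 \<partial>P) / (sqrt (real n) * ?c)\<^sup>2"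
      proof -
        have "0 < sqrt (real n) * ?c" using c(1) n by (intro mult_pos_pos) auto
        from X.prob_mean_ge[OF sq(1) component_mean this, of n] show ?thesis unfolding sq(2) .
      qed
      also have "\<dots> = (\<integral>s. (b \<bullet> V s)\<^sup>2 \<partial>P) / ?c\<^sup>2" unfolding power_mult_distrib using n by simp
      finally show "prob (?A b) \<le> (\<integral>s. (b \<bullet> V s)\<^sup>2 \<partial>P) / ?c\<^sup>2" .
    qed
    also have "\<dots> = v / ?c\<^sup>2" by (simp add: v_def sum_divide_distrib)
    also have "\<dots> \<le> e" unfolding c(2) using v e by (simp add: field_simps)
    finally show ?thesis .
  qed
  then have "likely e (\<lambda>n x. norm (normalized_sum n x) \<le> K)"
    by (intro likely_complement eventually_sequentiallyI[of 1]) (auto simp: not_le)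
  with K show ?thesis by blast
qed

text \<open>The multivariate central limit theorem, up to a perturbation that vanishes in probability.\<close>

theorem clt_perturbation:
  fixes N :: "'c measure"
  assumes N: "prob_space N" "sets N = sets borel"
    and marg: "\<And>X. distr N borel (\<lambda>Z. X \<bullet> Z) = normal_law (sqrt (\<integral>s. (X \<bullet> V s)\<^sup>2 \<partial>P))"
    and Y: "\<And>n. n \<ge> 1 \<Longrightarrow> Y n \<in> borel_measurable M"
    and close: "\<And>e. 0 < e \<Longrightarrow> likely e (\<lambda>n x. norm (Y n x - normalized_sum n x) \<le> e)"
  shows "weak_conv_law (\<lambda>n. distr M borel (Y n)) N"
proof (rule weak_conv_law_perturbation[OF _ Y N])
  have clt: "(\<lambda>n. expectation (\<lambda>x. g (X \<bullet> normalized_sum n x))) \<longlonglongrightarrow> (\<integral>w. g (X \<bullet> w) \<partial>N)"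
    if g: "continuous_on UNIV g" "\<And>t. \<bar>g t\<bar> \<le> 1" for g :: "real \<Rightarrow> real" and X
  proof -
    let ?s = "\<integral>s. (X \<bullet> V s)\<^sup>2 \<partial>P"
    have s: "0 \<le> ?s" by (rule Bochner_Integration.integral_nonneg) simp
    interpret X: iid_real M "\<lambda>i x. X \<bullet> V (S (Suc i) x)" by (rule iid_realI) simp
    have sq: "integrable M (\<lambda>x. (X \<bullet> V (S (Suc 0) x))\<^sup>2)"
      "expectation (\<lambda>x. (X \<bullet> V (S (Suc 0) x))\<^sup>2) = (sqrt ?s)\<^sup>2"
      using integrable_S[of "Suc 0" "\<lambda>s. (X \<bullet> V s)\<^sup>2"] expectation_S[of "Suc 0" "\<lambda>s. (X \<bullet> V s)\<^sup>2"]
        V_component_square s by auto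
    have [measurable]: "g \<in> borel_measurable borel" by (rule borel_measurable_continuous_onI[OF g(1)])
    have "(\<integral>w. g (X \<bullet> w) \<partial>N) = (\<integral>t. g t \<partial>distr N borel (\<lambda>Z. X \<bullet> Z))"
    proof -
      note [measurable_cong] = N(2)
      show ?thesis by (subst integral_distr) auto
    qed
    then show ?thesis
      using X.clt_bounded_continuous[OF component_mean sq(1) _ sq(2) g] s
      by (simp add: marg normalized_sum_inner)
  qed
  show "(\<lambda>n. expectation (\<lambda>x. cos (X \<bullet> normalized_sum n x))) \<longlonglongrightarrow> (\<integral>w. cos (X \<bullet> w) \<partial>N)" for X
    by (rule clt) (auto intro: continuous_intros)
  show "(\<lambda>n. expectation (\<lambda>x. sin (X \<bullet> normalized_sum n x))) \<longlonglongrightarrow> (\<integral>w. sin (X \<bullet> w) \<partial>N)" for X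
    by (rule clt) (auto intro: continuous_intros)
  show "\<exists>K. \<forall>\<^sub>F n in sequentially. prob {x \<in> space M. K < norm (normalized_sum n x)} \<le> e" if e: "0 < e" for e
  proof -
    obtain K where "likely e (\<lambda>n x. norm (normalized_sum n x) \<le> K)"
      using normalized_sum_tight[OF e] by blast
    from likely_imp_prob[OF this] show ?thesis by (auto simp: not_le)
  qed
  show "\<forall>\<^sub>F n in sequentially. prob {x \<in> space M. e < norm (Y n x - normalized_sum n x)} \<le> e" if "0 < e" for e
  proof -
    have "\<forall>\<^sub>F n in sequentially. {x \<in> space M. \<not> norm (Y n x - normalized_sum n x) \<le> e} \<in> events"
      using eventually_ge_at_top[of 1]
    proof eventually_elim
      case (elim n)
      note [measurable] = Y[OF elim]
      show ?case by measurable
    qed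
    from likely_imp_prob[OF close[OF that] this] show ?thesis by (simp add: not_le)
  qed
qed simp

end

section \<open>Local bounds for the optimal map\<close>

text \<open>The local bounds around \<open>Q\<close>, collected with one constant \<open>\<kappa>\<close> on a ball of radius \<open>\<rho>\<close>: size and
  Lipschitz continuity of the optimal map and of its differential, and the Taylor remainder.\<close>

definition bw_bounds :: "real \<Rightarrow> real \<Rightarrow> ('d::finite) cmat \<Rightarrow> bool" where
  "bw_bounds \<kappa> \<rho> Q \<longleftrightarrow> 0 < \<kappa> \<and> 0 < \<rho> \<and> (\<forall>R\<in>hermitian. norm (R - Q) \<le> \<rho> \<longrightarrow> R \<in> pd \<and> (\<forall>S\<in>psd.
     norm (bwT R S) \<le> \<kappa> * sqrt (norm S) \<and>
     norm (bwT R S - bwT Q S) \<le> \<kappa> * sqrt (norm S) * norm (R - Q) \<and>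
     norm (bwT R S - bwT Q S - bwD Q S (R - Q)) \<le> \<kappa> * sqrt (norm S) * (norm (R - Q))\<^sup>2 \<and>
     (\<forall>X. norm (bwD R S X) \<le> \<kappa> * sqrt (norm S) * norm X \<and>
          norm (bwD R S X - bwD Q S X) \<le> \<kappa> * sqrt (norm S) * norm (R - Q) * norm X)))"

lemma bw_bounds_exist:
  assumes Q: "(Q :: ('d::finite) cmat) \<in> pd"
  shows "\<exists>\<kappa> \<rho>. bw_bounds \<kappa> \<rho> Q"
proof -
  obtain q where q: "0 < q" "pd_ge q Q" using pd_imp_pd_ge[OF Q] by blast
  define k where "k = res_const TYPE('d) (q / 2) (norm Q + q / 2)"
  \<comment> \<open>A common bound for the four constants \<open>k\<close>, \<open>k\<^sup>2\<close>, \<open>k ^ 3\<close>, \<open>2 * k ^ 3\<close>; the summand \<open>1\<close> makes it positive.\<close>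
  define \<kappa> where "\<kappa> = 1 + k + k\<^sup>2 + 2 * k ^ 3"
  have k: "0 \<le> k" unfolding k_def using q(1) by (intro res_const_nonneg) auto
  have le: "k \<le> \<kappa>" "k\<^sup>2 \<le> \<kappa>" "k ^ 3 \<le> \<kappa>" "2 * k ^ 3 \<le> \<kappa>" "0 < \<kappa>"
    using k by (auto simp: \<kappa>_def add_pos_nonneg)
  have "bw_bounds \<kappa> (q / 2) Q"
    unfolding bw_bounds_def
  proof (intro conjI ballI impI allI)
    show "0 < \<kappa>" "0 < q / 2" using q(1) le by auto
    fix R :: "'d cmat" assume R: "R \<in> hermitian" "norm (R - Q) \<le> q / 2"
    note nb = pd_ge_neighbourhood[OF q(2) R]
    have q2: "0 < q / 2" using q(1) by simp
    have nQ: "norm Q \<le> norm Q + q / 2" using q(1) by simp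
    show "R \<in> pd" by (rule pd_ge_imp_pd[OF q2 nb(1)])
    fix S :: "'d cmat" assume S: "S \<in> psd"
    let ?h = "sqrt (norm S)"
    have "norm (bwT R S) \<le> k * ?h" unfolding k_def by (rule bwT_norm[OF q2 nb(1,2) S])
    also have "\<dots> \<le> \<kappa> * ?h" using le by (intro mult_right_mono) auto
    finally show "norm (bwT R S) \<le> \<kappa> * ?h" .
    have "norm (bwT R S - bwT Q S) \<le> k\<^sup>2 * norm (R - Q) * ?h"
      unfolding k_def by (rule bwT_lipschitz[OF q2 nb(3) nQ S nb(1,2)])
    also have "\<dots> = k\<^sup>2 * (?h * norm (R - Q))" by simp
    also have "\<dots> \<le> \<kappa> * (?h * norm (R - Q))" using le by (intro mult_right_mono) auto
    finally show "norm (bwT R S - bwT Q S) \<le> \<kappa> * ?h * norm (R - Q)" by simp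
    have "norm (bwT R S - bwT Q S - bwD Q S (R - Q)) \<le> k ^ 3 * (norm (R - Q))\<^sup>2 * ?h"
      unfolding k_def by (rule bwT_taylor[OF q2 nb(3) nQ S nb(1,2)])
    also have "\<dots> = k ^ 3 * (?h * (norm (R - Q))\<^sup>2)" by simp
    also have "\<dots> \<le> \<kappa> * (?h * (norm (R - Q))\<^sup>2)" using le by (intro mult_right_mono) auto
    finally show "norm (bwT R S - bwT Q S - bwD Q S (R - Q)) \<le> \<kappa> * ?h * (norm (R - Q))\<^sup>2" by simp
    fix X
    have "norm (bwD R S X) \<le> k\<^sup>2 * norm X * ?h"
      unfolding k_def by (rule bwD_norm[OF q2 nb(1,2) S])
    also have "\<dots> = k\<^sup>2 * (?h * norm X)" by simp
    also have "\<dots> \<le> \<kappa> * (?h * norm X)" using le by (intro mult_right_mono) auto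
    finally show "norm (bwD R S X) \<le> \<kappa> * ?h * norm X" by simp
    have "norm (bwD R S X - bwD Q S X) \<le> 2 * k ^ 3 * norm (R - Q) * norm X * ?h"
      unfolding k_def by (rule bwD_lipschitz[OF q2 nb(3) nQ S nb(1,2)])
    also have "\<dots> = (2 * k ^ 3) * (?h * norm (R - Q) * norm X)" by simp
    also have "\<dots> \<le> \<kappa> * (?h * norm (R - Q) * norm X)" using le by (intro mult_right_mono) auto
    finally show "norm (bwD R S X - bwD Q S X) \<le> \<kappa> * ?h * norm (R - Q) * norm X" by simp
  qed
  then show ?thesis by blast
qed

lemma bw_boundsD:
  assumes "bw_bounds \<kappa> \<rho> Q" "R \<in> hermitian" "norm (R - Q) \<le> \<rho>"
  shows "R \<in> pd"
    "S \<in> psd \<Longrightarrow> norm (bwT R S) \<le> \<kappa> * sqrt (norm S)"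
    "S \<in> psd \<Longrightarrow> norm (bwT R S - bwT Q S) \<le> \<kappa> * sqrt (norm S) * norm (R - Q)"
    "S \<in> psd \<Longrightarrow> norm (bwT R S - bwT Q S - bwD Q S (R - Q)) \<le> \<kappa> * sqrt (norm S) * (norm (R - Q))\<^sup>2"
    "S \<in> psd \<Longrightarrow> norm (bwD R S X) \<le> \<kappa> * sqrt (norm S) * norm X"
    "S \<in> psd \<Longrightarrow> norm (bwD R S X - bwD Q S X) \<le> \<kappa> * sqrt (norm S) * norm (R - Q) * norm X"
  using assms unfolding bw_bounds_def by blast+

text \<open>A minimality condition in the form of a variational inequality at nearby points. Continuity of
  \<open>g\<close> moves it to \<open>Q\<close>, where it holds for \<open>X\<close> and \<open>- X\<close>. In the applications, the inequality at nearby
  points follows from convexity alone, and the objective need not be differentiated.\<close>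

lemma first_order_condition:
  fixes g :: "'a::real_inner \<Rightarrow> 'a"
  assumes M: "subspace M" and \<rho>: "0 < \<rho>"
    and ge: "\<And>X. X \<in> M \<Longrightarrow> norm X < \<rho> \<Longrightarrow> 0 \<le> g (Q + X) \<bullet> X"
    and lip: "\<And>X. X \<in> M \<Longrightarrow> norm X < \<rho> \<Longrightarrow> norm (g (Q + X) - g Q) \<le> C * norm X"
    and X: "X \<in> M"
  shows "g Q \<bullet> X = 0"
proof -
  have nonneg: "0 \<le> g Q \<bullet> X" if X: "X \<in> M" for X
  proof (rule ccontr)
    assume neg: "\<not> ?thesis"
    define a where "a = - (g Q \<bullet> X)"
    have a: "0 < a" using neg by (simp add: a_def)
    define b where "b = \<bar>C\<bar> * (norm X)\<^sup>2 + 1"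
    have b: "0 < b" by (simp add: b_def add_nonneg_pos)
    define d where "d = norm X + 1"
    have d: "0 < d" "norm X \<le> d" by (auto simp: d_def add_nonneg_pos)
    \<comment> \<open>The first bound keeps \<open>Q + t X\<close> in the ball, the second keeps the Lipschitz error below \<open>a / 2\<close>.\<close>
    define t where "t = min (\<rho> / (2 * d)) (a / b / 2)"
    have t: "0 < t" using a b \<rho> d by (simp add: t_def)
    have "t * norm X \<le> \<rho> / (2 * d) * d"
      using d \<rho> t by (intro mult_mono) (auto simp: t_def)
    also have "\<dots> < \<rho>" using d \<rho> by simp
    finally have small: "norm (t *\<^sub>R X) < \<rho>" using t by simp
    have tX: "t *\<^sub>R X \<in> M" using X M by (simp add: subspace_mul)
    have "0 \<le> t * (g (Q + t *\<^sub>R X) \<bullet> X)" using ge[OF tX small] by simp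
    then have "0 \<le> g (Q + t *\<^sub>R X) \<bullet> X" using t by (simp add: zero_le_mult_iff)
    also have "\<dots> = g Q \<bullet> X + (g (Q + t *\<^sub>R X) - g Q) \<bullet> X" by (simp add: inner_diff_left)
    also have "(g (Q + t *\<^sub>R X) - g Q) \<bullet> X \<le> norm (g (Q + t *\<^sub>R X) - g Q) * norm X"
      by (rule norm_cauchy_schwarz)
    also have "\<dots> \<le> (C * norm (t *\<^sub>R X)) * norm X"
      using lip[OF tX small] by (intro mult_right_mono) auto
    also have "\<dots> = t * (C * (norm X)\<^sup>2)" using t by (simp add: power2_eq_square)
    also have "\<dots> \<le> t * b"
    proof (rule mult_left_mono)
      have "C * (norm X)\<^sup>2 \<le> \<bar>C\<bar> * (norm X)\<^sup>2" by (intro mult_right_mono) auto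
      then show "C * (norm X)\<^sup>2 \<le> b" by (simp add: b_def)
    qed (use t in simp)
    also have "t * b \<le> a / b / 2 * b" using b by (intro mult_right_mono) (auto simp: t_def)
    also have "\<dots> = a / 2" using b by simp
    finally show False using a by (simp add: a_def)
  qed
  from nonneg[OF X] nonneg[of "- X"] X M show ?thesis by (simp add: subspace_neg)
qed

section \<open>The population barycenter\<close>

locale bw_population = P: prob_space P for P :: "('d::finite) cmat measure" +
  fixes M A :: "'d cmat set" and Q0 Qs :: "'d cmat"
  assumes P_sets: "sets P = sets (restrict_space borel psd)"
    and P_pd: "measure P pd > 0"
    and P_trace: "integrable P (\<lambda>X. Re (trace X))"
    and M_subspace: "subspace M" and M_herm: "M \<subseteq> hermitian"
    and A_def: "A = (\<lambda>X. Q0 + X) ` M"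
    and A_pd: "pd \<inter> A \<noteq> {}"
    and Qs_bary: "bw_barycenter P A Qs"
begin

abbreviation "proj \<equiv> orth_proj M"

lemmas proj_mem = orth_proj_props(1)[OF M_subspace]
  and proj_inner = orth_proj_inner[OF M_subspace]
  and proj_inner_right = orth_proj_inner_right[OF M_subspace]
  and proj_id = orth_proj_id[OF M_subspace]
  and proj_linear = orth_proj_linear[OF M_subspace]
  and proj_norm = orth_proj_norm[OF M_subspace]

lemma proj_herm: "proj X \<in> hermitian"
  using proj_mem M_herm by blast

lemma bounded_linear_proj: "bounded_linear proj"
  using proj_linear by (simp add: linear_conv_bounded_linear)

lemma space_P: "space P = psd"
  using sets_eq_imp_space_eq[OF P_sets] by (simp add: space_restrict_space)

lemma measurable_P:
  "continuous_on psd f \<Longrightarrow> (f :: _ \<Rightarrow> 'b::topological_space) \<in> borel_measurable P"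
  using borel_measurable_continuous_on_restrict[of psd f] measurable_cong_sets[OF P_sets refl] by blast

lemma norm_measurable [measurable]: "(\<lambda>s. norm s) \<in> borel_measurable P"
  by (intro measurable_P continuous_intros)

lemma norm_integrable: "integrable P (\<lambda>s. norm s)"
proof (rule Bochner_Integration.integrable_bound[OF P_trace])
  show "AE s in P. norm (norm s) \<le> norm (Re (trace s))"
    using psd_norm_le_trace by (intro AE_I2) (auto simp: space_P intro: order_trans[OF _ abs_ge_self])
qed simp

lemma sqrt_norm_integrable: "integrable P (\<lambda>s. sqrt (norm s))"
  by (rule P.square_integrable_imp_integrable) (use norm_integrable in auto)

lemma integrable_sqrt_norm_bound:
  fixes f :: "'d cmat \<Rightarrow> 'b::{banach, second_countable_topology}"
  assumes "f \<in> borel_measurable P" "\<And>s. s \<in> psd \<Longrightarrow> norm (f s) \<le> c * sqrt (norm s)"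
  shows "integrable P f"
proof (rule Bochner_Integration.integrable_bound[OF _ assms(1)])
  show "integrable P (\<lambda>s. c * sqrt (norm s))" using sqrt_norm_integrable by simp
  show "AE s in P. norm (f s) \<le> norm (c * sqrt (norm s))"
    using assms(2) by (intro AE_I2) (auto simp: space_P intro: order_trans[OF _ abs_ge_self])
qed

lemma T_measurable: "Q \<in> pd \<Longrightarrow> bwT Q \<in> borel_measurable P"
  by (intro measurable_P bwT_continuous_on)

lemma T_bound: "Q \<in> pd \<Longrightarrow> \<exists>\<kappa>>0. \<forall>s\<in>psd. norm (bwT Q s) \<le> \<kappa> * sqrt (norm s)"
proof -
  assume Q: "Q \<in> pd"
  then obtain \<kappa> \<rho> where b: "bw_bounds \<kappa> \<rho> Q" using bw_bounds_exist by blast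
  then show ?thesis
    using bw_boundsD(2)[OF b pd_hermitian[OF Q]] by (auto simp: bw_bounds_def)
qed

lemma T_integrable: "Q \<in> pd \<Longrightarrow> integrable P (bwT Q)"
  using T_bound[of Q] integrable_sqrt_norm_bound[OF T_measurable] by blast

lemma fidelity_bound: "(Q :: 'd cmat) \<in> psd \<Longrightarrow> \<exists>c. \<forall>s\<in>psd. fidelity Q s \<le> c * sqrt (norm s)"
proof -
  assume Q: "Q \<in> psd"
  obtain \<kappa> where k: "\<And>s. s \<in> psd \<Longrightarrow> norm (bwT (mat 1) s) \<le> \<kappa> * sqrt (norm (s :: 'd cmat))"
    using T_bound[OF mat_1_pd] by blast
  have "fidelity Q s \<le> norm (Q + mat 1) * \<kappa> * sqrt (norm s)" if s: "s \<in> psd" for s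
  proof -
    have "0 \<le> fidelity Q s" by (rule fidelity_nonneg[OF Q s])
    then have "fidelity Q s \<le> (Q + mat 1) \<bullet> bwT (mat 1) s"
      using fidelity_le[OF Q mat_1_pd s] by (simp add: inner_add_left)
    also have "\<dots> \<le> norm (Q + mat 1) * norm (bwT (mat 1) s)" by (rule norm_cauchy_schwarz)
    also have "\<dots> \<le> norm (Q + mat 1) * (\<kappa> * sqrt (norm s))"
      using k[OF s] by (rule mult_left_mono) simp
    finally show ?thesis by simp
  qed
  then show ?thesis by blast
qed

lemma bw_dist2_integrable: "Q \<in> psd \<Longrightarrow> integrable P (bw_dist2 Q)"
proof -
  assume Q: "Q \<in> psd"
  have "continuous_on psd (fidelity Q)"
    unfolding continuous_on_sequentially comp_def
    using Q by (auto intro!: tendsto_fidelity)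
  then have m: "fidelity Q \<in> borel_measurable P" by (rule measurable_P)
  obtain c where c: "\<And>s. s \<in> psd \<Longrightarrow> fidelity Q s \<le> c * sqrt (norm s)" using fidelity_bound[OF Q] by blast
  have "integrable P (fidelity Q)"
    using c fidelity_nonneg[OF Q] by (intro integrable_sqrt_norm_bound[OF m]) auto
  then have "integrable P (\<lambda>s. mat 1 \<bullet> Q + Re (trace s) - 2 * fidelity Q s)"
    using P_trace by simp
  then show ?thesis by (simp add: bw_dist2_fidelity[abs_def] Re_trace)
qed

lemma population_gradient:
  assumes Q: "Q \<in> psd" and Q': "Q' \<in> pd"
  shows "(\<integral>s. bw_dist2 Q' s \<partial>P) + (mat 1 - (\<integral>s. bwT Q' s \<partial>P)) \<bullet> (Q - Q') \<le> (\<integral>s. bw_dist2 Q s \<partial>P)"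
proof -
  have int: "integrable P (\<lambda>s. (mat 1 - bwT Q' s) \<bullet> (Q - Q'))"
    using T_integrable[OF Q'] by simp
  have "(\<integral>s. bw_dist2 Q' s + (mat 1 - bwT Q' s) \<bullet> (Q - Q') \<partial>P) \<le> (\<integral>s. bw_dist2 Q s \<partial>P)"
    using bw_dist2_integrable[OF Q] bw_dist2_integrable[OF pd_imp_psd[OF Q']] int
    by (intro integral_mono) (auto simp: space_P intro!: bw_dist2_gradient_inequality Q Q')
  moreover have "(\<integral>s. bw_dist2 Q' s + (mat 1 - bwT Q' s) \<bullet> (Q - Q') \<partial>P)
      = (\<integral>s. bw_dist2 Q' s \<partial>P) + (\<integral>s. (mat 1 - bwT Q' s) \<bullet> (Q - Q') \<partial>P)"
    by (rule Bochner_Integration.integral_add[OF bw_dist2_integrable[OF pd_imp_psd[OF Q']] int])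
  moreover have "(\<integral>s. (mat 1 - bwT Q' s) \<bullet> (Q - Q') \<partial>P) = (mat 1 - (\<integral>s. bwT Q' s \<partial>P)) \<bullet> (Q - Q')"
    using T_integrable[OF Q'] by (simp add: P.prob_space)
  ultimately show ?thesis by simp
qed

lemma Qs_mem: "Qs \<in> psd" "Qs \<in> A"
  and Qs_min: "R \<in> psd \<Longrightarrow> R \<in> A \<Longrightarrow> (\<integral>s. bw_dist2 Qs s \<partial>P) \<le> (\<integral>s. bw_dist2 R s \<partial>P)"
  using Qs_bary by (auto simp: bw_barycenter_def is_arg_min_def not_less)

lemma A_iff: "X \<in> A \<longleftrightarrow> X - Qs \<in> M"
proof -
  obtain Y where Y: "Y \<in> M" "Qs = Q0 + Y" using Qs_mem(2) by (auto simp: A_def)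
  show ?thesis
  proof
    assume "X \<in> A"
    then obtain Z where "Z \<in> M" "X = Q0 + Z" by (auto simp: A_def)
    then show "X - Qs \<in> M" using Y M_subspace by (simp add: subspace_diff)
  next
    assume "X - Qs \<in> M"
    then have "(X - Qs) + Y \<in> M" using Y(1) by (rule subspace_add[OF M_subspace])
    moreover have "X = Q0 + ((X - Qs) + Y)" using Y(2) by simp
    ultimately show "X \<in> A" unfolding A_def by blast
  qed
qed

text \<open>The positive definite matrices are the countable union of the closed sets on which the
  eigenvalues are bounded below by \<open>1 / (n + 1)\<close>.\<close>

lemma ex_pd_ge_mass: "\<exists>k>0. {s \<in> psd. pd_ge k s} \<in> sets P \<and> 0 < measure P {s \<in> psd. pd_ge k s}"
proof (rule ccontr)
  let ?B = "\<lambda>n. {s :: 'd cmat. s \<in> psd \<and> pd_ge (inverse (real (Suc n))) s}"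
  have cl: "closed {s :: 'd cmat. s \<in> psd \<and> pd_ge k s}" for k
  proof -
    have "{s :: 'd cmat. s \<in> psd \<and> pd_ge k s} = psd \<inter> (\<Inter>v. {s. k * (norm v)\<^sup>2 \<le> v \<bullet> (s *v v)})"
      by (auto simp: pd_ge_def psd_def)
    moreover have "closed {s :: 'd cmat. k * (norm v)\<^sup>2 \<le> v \<bullet> (s *v v)}" for v
      by (intro closed_Collect_le continuous_intros)
    ultimately show ?thesis using closed_psd by (metis (no_types, lifting) closed_INT closed_Int)
  qed
  have sets: "{s :: 'd cmat. s \<in> psd \<and> pd_ge k s} \<in> sets P" for k
    unfolding P_sets using borel_closed[OF cl[of k]] borel_closed[OF closed_psd]
    by (subst sets_restrict_space_iff) auto
  have pd_eq: "pd = (\<Union>n. ?B n)"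
  proof
    show "pd \<subseteq> (\<Union>n. ?B n)"
    proof
      fix s :: "'d cmat" assume s: "s \<in> pd"
      obtain q where q: "0 < q" "pd_ge q s" using pd_imp_pd_ge[OF s] by blast
      obtain n where n: "inverse (real (Suc n)) < q" using reals_Archimedean[OF q(1)] by blast
      have "pd_ge (inverse (real (Suc n))) s"
        unfolding pd_ge_def
      proof (intro conjI allI)
        show "s \<in> hermitian" using q(2) by (simp add: pd_ge_def)
        fix v :: "complex ^ 'd"
        have "inverse (real (Suc n)) * (norm v)\<^sup>2 \<le> q * (norm v)\<^sup>2"
          using n by (intro mult_right_mono) auto
        also have "\<dots> \<le> v \<bullet> (s *v v)" using q(2) by (simp add: pd_ge_def)
        finally show "inverse (real (Suc n)) * (norm v)\<^sup>2 \<le> v \<bullet> (s *v v)" .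
      qed
      then show "s \<in> (\<Union>n. ?B n)" using pd_imp_psd[OF s] by blast
    qed
    show "(\<Union>n. ?B n) \<subseteq> pd"
      using pd_ge_imp_pd[of "inverse (real (Suc _))"] by auto
  qed
  assume "\<not> ?thesis"
  then have no: "\<not> (0 < k \<and> {s :: 'd cmat. s \<in> psd \<and> pd_ge k s} \<in> sets P \<and>
      0 < measure P {s :: 'd cmat. s \<in> psd \<and> pd_ge k s})" for k by blast
  have "measure P (?B n) = 0" for n
    using no[of "inverse (real (Suc n))"] sets[of "inverse (real (Suc n))"]
    by (simp add: not_less measure_le_0_iff)
  then have "?B n \<in> null_sets P" for n
    using sets by (auto simp: null_sets_def P.emeasure_eq_measure)
  then have "pd \<in> null_sets P" unfolding pd_eq by (intro null_sets_UN) auto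
  then show False using P_pd by (auto simp: measure_def null_sets_def)
qed

text \<open>\<open>Q1 \<ge> q1 I\<close>, and the trace of \<open>T\<close> dominates its quadratic form on unit vectors.\<close>

lemma unit_form_le_inner:
  assumes q1: "0 < q1" "pd_ge q1 Q1" and T: "T \<in> psd" and v: "norm v = 1"
  shows "q1 * (v \<bullet> (T *v v)) \<le> T \<bullet> (Q1 :: 'd cmat)"
proof -
  have "v \<bullet> (T *v v) \<le> norm v * norm (T *v v)" by (rule norm_cauchy_schwarz)
  also have "\<dots> \<le> norm T" using norm_mv[of T v] v by simp
  also have "\<dots> \<le> mat 1 \<bullet> T" using psd_norm_le_trace[OF T] by (simp add: Re_trace)
  finally have "q1 * (v \<bullet> (T *v v)) \<le> T \<bullet> (q1 *\<^sub>R mat 1)" using q1(1) by (simp add: inner_commute)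
  moreover have "Q1 - q1 *\<^sub>R mat 1 \<in> psd"
    using q1 by (simp add: psd_def hermitian_iff_adj adj_diff adj_scaleR pd_ge_def mv_distribs
        inner_diff_right dot_square_norm)
  then have "0 \<le> T \<bullet> (Q1 - q1 *\<^sub>R mat 1)" by (rule psd_inner_nonneg[OF T])
  ultimately show ?thesis by (simp add: inner_diff_right)
qed

text \<open>Let \<open>v\<close> be a unit null vector of \<open>Qs\<close> and move from \<open>Qs\<close> towards a positive definite \<open>Q1 \<in> A\<close>. Minimality
  and convexity bound \<open>E \<langle>T, Q1\<rangle>\<close> along the segment by a constant \<open>K\<close>. But at distance \<open>\<epsilon>\<close> the form of \<open>Q\<close> at
  \<open>v\<close> is of order \<open>\<epsilon>\<close>, so that \<open>T\<close> is at least of order \<open>\<epsilon>\<^sup>-\<^sup>1\<^sup>/\<^sup>2\<close> there for all \<open>S\<close> in a set of positive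
  probability.\<close>

theorem Qs_pd: "Qs \<in> pd"
proof (rule ccontr)
  assume "Qs \<notin> pd"
  with Qs_mem(1) obtain w where w: "w \<noteq> 0" "w \<bullet> (Qs *v w) \<le> 0"
    unfolding pd_def psd_def by (auto simp: not_less)
  define v where "v = w /\<^sub>R norm w"
  have v: "norm v = 1" using w(1) by (simp add: v_def)
  have "v \<bullet> (Qs *v v) \<le> 0"
    using w by (simp add: v_def mv_scaleR_right mult_le_0_iff mult_nonneg_nonpos)
  with psdD[OF Qs_mem(1), of v] have vQ: "v \<bullet> (Qs *v v) = 0" by simp
  obtain Q1 where Q1: "Q1 \<in> pd" "Q1 \<in> A" using A_pd by blast
  obtain q1 where q1: "0 < q1" "pd_ge q1 Q1" using pd_imp_pd_ge[OF Q1(1)] by blast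
  define X where "X = Q1 - Qs"
  have X: "X \<in> M" using Q1(2) by (simp add: X_def A_iff)
  define R where "R \<epsilon> = Qs + \<epsilon> *\<^sub>R X" for \<epsilon>
  have R_eq: "R \<epsilon> = \<epsilon> *\<^sub>R Q1 + (1 - \<epsilon>) *\<^sub>R Qs" for \<epsilon>
    by (simp add: R_def X_def algebra_simps)
  have inner_R: "B \<bullet> R \<epsilon> = \<epsilon> * (B \<bullet> Q1) + (1 - \<epsilon>) * (B \<bullet> Qs)" for B \<epsilon>
    by (simp add: R_eq inner_add_right)
  have R_pd: "R \<epsilon> \<in> pd" if "0 < \<epsilon>" "\<epsilon> \<le> 1" for \<epsilon>
    unfolding R_eq using that Q1(1) Qs_mem(1) by (intro pd_psd_add pd_scaleR psd_scaleR) auto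
  have R_A: "R \<epsilon> \<in> A" for \<epsilon> using X M_subspace by (simp add: A_iff R_def subspace_mul)
  obtain k where k: "0 < k" "{s \<in> psd. pd_ge k s} \<in> sets P" "0 < measure P {s \<in> psd. pd_ge k s}"
    using ex_pd_ge_mass by blast
  let ?B = "{s :: 'd cmat. s \<in> psd \<and> pd_ge k s}"
  define a where "a = v \<bullet> (Q1 *v v)"
  have "v \<noteq> 0" using v by auto
  then have a: "0 < a" using Q1(1) by (simp add: a_def pd_def)
  obtain \<kappa> where \<kappa>: "0 < \<kappa>" "\<And>s. s \<in> psd \<Longrightarrow> norm (bwT (mat 1) s) \<le> \<kappa> * sqrt (norm (s :: 'd cmat))"
    using T_bound[OF mat_1_pd] by blast
  define C where "C = (norm Qs + norm X + norm (mat 1 :: 'd cmat)) * \<kappa>"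
  define K where "K = mat 1 \<bullet> X + C * (\<integral>s. sqrt (norm s) \<partial>P)"
  have upper: "(\<integral>s. bwT (R \<epsilon>) s \<partial>P) \<bullet> Q1 \<le> K" if \<epsilon>: "0 < \<epsilon>" "\<epsilon> \<le> 1 / 2" for \<epsilon>
  proof -
    have Rp: "R \<epsilon> \<in> pd" using \<epsilon> by (intro R_pd) auto
    let ?E = "\<integral>s. bwT (R \<epsilon>) s \<partial>P"
    have "(mat 1 - ?E) \<bullet> (Qs - R \<epsilon>) \<le> 0"
      using population_gradient[OF Qs_mem(1) Rp] Qs_min[OF pd_imp_psd[OF Rp] R_A] by simp
    then have "0 \<le> \<epsilon> * ((mat 1 - ?E) \<bullet> X)" by (simp add: R_def)
    then have 1: "?E \<bullet> X \<le> mat 1 \<bullet> X" using \<epsilon>(1) by (simp add: zero_le_mult_iff inner_diff_left)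
    have "?E \<bullet> Qs = (\<integral>s. bwT (R \<epsilon>) s \<bullet> Qs \<partial>P)" using T_integrable[OF Rp] by simp
    also have "\<dots> \<le> (\<integral>s. C * sqrt (norm s) \<partial>P)"
    proof (rule integral_mono)
      show "integrable P (\<lambda>s. bwT (R \<epsilon>) s \<bullet> Qs)" using T_integrable[OF Rp] by simp
      show "integrable P (\<lambda>s. C * sqrt (norm s))" using sqrt_norm_integrable by simp
      fix s assume "s \<in> space P"
      then have s: "s \<in> psd" by (simp add: space_P)
      have T: "bwT (R \<epsilon>) s \<in> psd" by (rule bwT_psd[OF Rp s])
      have "(1 / 2) * (bwT (R \<epsilon>) s \<bullet> Qs) \<le> (1 - \<epsilon>) * (bwT (R \<epsilon>) s \<bullet> Qs)"
        using \<epsilon> psd_inner_nonneg[OF T Qs_mem(1)] by (intro mult_right_mono) auto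
      also have "\<dots> \<le> bwT (R \<epsilon>) s \<bullet> R \<epsilon>"
        unfolding inner_R using \<epsilon> psd_inner_nonneg[OF T pd_imp_psd[OF Q1(1)]] by simp
      also have "\<dots> = fidelity (R \<epsilon>) s" by (simp add: fidelity_pd[OF Rp s] inner_commute)
      finally have "bwT (R \<epsilon>) s \<bullet> Qs \<le> 2 * fidelity (R \<epsilon>) s" by simp
      also have "\<dots> \<le> (R \<epsilon> + mat 1) \<bullet> bwT (mat 1) s"
        using fidelity_le[OF pd_imp_psd[OF Rp] mat_1_pd s] by (simp add: inner_add_left)
      also have "\<dots> \<le> norm (R \<epsilon> + mat 1) * norm (bwT (mat 1) s)" by (rule norm_cauchy_schwarz)
      also have "\<dots> \<le> (norm Qs + norm X + norm (mat 1 :: 'd cmat)) * (\<kappa> * sqrt (norm s))"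
      proof (intro mult_mono \<kappa>(2)[OF s])
        have "norm (\<epsilon> *\<^sub>R X) \<le> 1 * norm X" using \<epsilon> unfolding norm_scaleR by (intro mult_right_mono) auto
        then show "norm (R \<epsilon> + mat 1) \<le> norm Qs + norm X + norm (mat 1 :: 'd cmat)"
          using norm_triangle_ineq[of "R \<epsilon>" "mat 1"] norm_triangle_ineq[of Qs "\<epsilon> *\<^sub>R X"]
          unfolding R_def by linarith
      qed auto
      finally show "bwT (R \<epsilon>) s \<bullet> Qs \<le> C * sqrt (norm s)" by (simp add: C_def mult.assoc)
    qed
    also have "\<dots> = C * (\<integral>s. sqrt (norm s) \<partial>P)" by simp
    finally have "?E \<bullet> Qs \<le> C * (\<integral>s. sqrt (norm s) \<partial>P)" .
    with 1 have "?E \<bullet> X + ?E \<bullet> Qs \<le> K" by (simp add: K_def)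
    then show ?thesis by (simp add: X_def inner_diff_right)
  qed
  have lower: "q1 * sqrt k * measure P ?B \<le> K * sqrt (\<epsilon> * a)" if \<epsilon>: "0 < \<epsilon>" "\<epsilon> \<le> 1 / 2" for \<epsilon>
  proof -
    have Rp: "R \<epsilon> \<in> pd" using \<epsilon> by (intro R_pd) auto
    have vR: "v \<bullet> (R \<epsilon> *v v) = \<epsilon> * a"
      by (simp add: R_eq mv_distribs inner_add_right vQ a_def)
    have ea: "0 < sqrt (\<epsilon> * a)" using \<epsilon> a by simp
    have int: "integrable P (\<lambda>s. bwT (R \<epsilon>) s \<bullet> Q1)" using T_integrable[OF Rp] by simp
    have "(\<integral>s. (q1 * sqrt k / sqrt (\<epsilon> * a)) * indicator ?B s \<partial>P) \<le> (\<integral>s. bwT (R \<epsilon>) s \<bullet> Q1 \<partial>P)"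
    proof (rule integral_mono[OF _ int])
      show "integrable P (\<lambda>s. (q1 * sqrt k / sqrt (\<epsilon> * a)) * indicator ?B s)"
        using k(2) by (intro integrable_mult_right integrable_real_indicator) (auto simp: less_top[symmetric])
      fix s assume "s \<in> space P"
      then have s: "s \<in> psd" by (simp add: space_P)
      have T: "bwT (R \<epsilon>) s \<in> psd" by (rule bwT_psd[OF Rp s])
      show "(q1 * sqrt k / sqrt (\<epsilon> * a)) * indicator ?B s \<le> bwT (R \<epsilon>) s \<bullet> Q1"
      proof (cases "pd_ge k s")
        case True
        have "sqrt k \<le> sqrt (\<epsilon> * a) * (v \<bullet> (bwT (R \<epsilon>) s *v v))"
          using bwT_blow_up[OF Rp k(1) True, of v] v vR by simp
        then have "sqrt k / sqrt (\<epsilon> * a) \<le> v \<bullet> (bwT (R \<epsilon>) s *v v)"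
          using ea by (simp add: pos_divide_le_eq mult.commute)
        then have "q1 * (sqrt k / sqrt (\<epsilon> * a)) \<le> q1 * (v \<bullet> (bwT (R \<epsilon>) s *v v))"
          using q1(1) by (intro mult_left_mono) auto
        also have "\<dots> \<le> bwT (R \<epsilon>) s \<bullet> Q1" by (rule unit_form_le_inner[OF q1 T v])
        finally show ?thesis using True s by simp
      next
        case False
        then show ?thesis using psd_inner_nonneg[OF T pd_imp_psd[OF Q1(1)]] by simp
      qed
    qed
    also have "(\<integral>s. bwT (R \<epsilon>) s \<bullet> Q1 \<partial>P) \<le> K" using upper[OF \<epsilon>] T_integrable[OF Rp] by simp
    finally have "q1 * sqrt k / sqrt (\<epsilon> * a) * measure P ?B \<le> K"
      using k(2) by (simp add: space_P Int_absorb2 Collect_conj_eq)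
    then show ?thesis using ea by (simp add: pos_divide_le_eq field_simps)
  qed
  have "(\<lambda>n. K * sqrt (inverse (real (Suc (Suc n))) * a)) \<longlonglongrightarrow> K * sqrt (0 * a)"
    by (intro tendsto_intros LIMSEQ_Suc[OF LIMSEQ_inverse_real_of_nat])
  then have "q1 * sqrt k * measure P ?B \<le> K * sqrt (0 * a)"
  proof (rule LIMSEQ_le_const)
    show "\<exists>N. \<forall>n\<ge>N. q1 * sqrt k * measure P ?B \<le> K * sqrt (inverse (real (Suc (Suc n))) * a)"
      by (intro exI[of _ 0] allI impI lower) (auto simp: field_simps)
  qed
  moreover have "0 < q1 * sqrt k * measure P ?B" using q1(1) k(1,3) by simp
  ultimately show False by simp
qed

lemma Qs_herm: "Qs \<in> hermitian"
  by (rule pd_hermitian[OF Qs_pd])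

lemma Qs_add_herm: "X \<in> M \<Longrightarrow> Qs + X \<in> hermitian"
  using Qs_herm M_herm subspace_add[OF subspace_hermitian] by blast

lemma Qs_stationary:
  assumes "X \<in> M"
  shows "(mat 1 - (\<integral>s. bwT Qs s \<partial>P)) \<bullet> X = 0"
proof -
  obtain \<kappa> \<rho> where b: "bw_bounds \<kappa> \<rho> Qs" using bw_bounds_exist[OF Qs_pd] by blast
  define g where "g Q = mat 1 - (\<integral>s. bwT Q s \<partial>P)" for Q
  have nb: "Qs + X \<in> pd" if "X \<in> M" "norm X < \<rho>" for X
    using bw_boundsD(1)[OF b Qs_add_herm[OF that(1)]] that(2) by simp
  have "g Qs \<bullet> X = 0"
  proof (rule first_order_condition[where g = g and Q = Qs and \<rho> = \<rho> and C = "\<kappa> * (\<integral>s. sqrt (norm s) \<partial>P)", OF M_subspace _ _ _ assms])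
    show "0 < \<rho>" using b by (simp add: bw_bounds_def)
    fix X assume X: "X \<in> M" "norm X < \<rho>"
    have "Qs + X \<in> A" using X(1) by (simp add: A_iff)
    then show "0 \<le> g (Qs + X) \<bullet> X"
      using population_gradient[OF Qs_mem(1) nb[OF X]] Qs_min[OF pd_imp_psd[OF nb[OF X]]]
      by (simp add: g_def)
    have "g (Qs + X) - g Qs = (\<integral>s. bwT Qs s - bwT (Qs + X) s \<partial>P)"
      using T_integrable[OF Qs_pd] T_integrable[OF nb[OF X]] by (simp add: g_def)
    also have "norm \<dots> \<le> (\<integral>s. norm (bwT Qs s - bwT (Qs + X) s) \<partial>P)" by (rule integral_norm_bound)
    also have "\<dots> \<le> (\<integral>s. (\<kappa> * norm X) * sqrt (norm s) \<partial>P)"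
    proof (rule integral_mono)
      fix s assume "s \<in> space P"
      then have "s \<in> psd" by (simp add: space_P)
      then show "norm (bwT Qs s - bwT (Qs + X) s) \<le> (\<kappa> * norm X) * sqrt (norm s)"
        using bw_boundsD(3)[OF b Qs_add_herm[OF X(1)]] X(2) by (simp add: norm_minus_commute mult_ac)
    qed (use T_integrable[OF Qs_pd] T_integrable[OF nb[OF X]] sqrt_norm_integrable in auto)
    also have "\<dots> = (\<kappa> * (\<integral>s. sqrt (norm s) \<partial>P)) * norm X" by simp
    finally show "norm (g (Qs + X) - g Qs) \<le> (\<kappa> * (\<integral>s. sqrt (norm s) \<partial>P)) * norm X" .
  qed
  then show ?thesis by (simp add: g_def)
qed

section \<open>The operators F and Sigma\<close>

text \<open>A pointwise limit of difference quotients of the optimal map.\<close>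

lemma D_measurable:
  assumes X: "X \<in> hermitian"
  shows "(\<lambda>s. bwD Qs s X) \<in> borel_measurable P"
proof -
  obtain \<kappa> \<rho> where b: "bw_bounds \<kappa> \<rho> Qs" using bw_bounds_exist[OF Qs_pd] by blast
  have \<rho>: "0 < \<rho>" using b by (simp add: bw_bounds_def)
  define t where "t n = \<rho> / (norm X + 1) * inverse (real (Suc n))" for n
  have nX: "0 < norm X + 1" by (simp add: add_nonneg_pos)
  have t: "0 < t n" for n using \<rho> nX by (simp add: t_def)
  have t0: "t \<longlonglongrightarrow> 0"
    unfolding t_def using tendsto_mult[OF tendsto_const LIMSEQ_inverse_real_of_nat, of "\<rho> / (norm X + 1)"] by simp
  have small: "norm (t n *\<^sub>R X) \<le> \<rho>" for n
  proof -
    have "norm (t n *\<^sub>R X) \<le> t n * (norm X + 1)" using t[of n] by (simp add: distrib_left)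
    also have "\<dots> = \<rho> * inverse (real (Suc n))" using nX by (simp add: t_def)
    also have "\<dots> \<le> \<rho> * 1" using \<rho> by (intro mult_left_mono) (auto simp: field_simps)
    finally show ?thesis by simp
  qed
  have herm: "Qs + t n *\<^sub>R X \<in> hermitian" for n
    using Qs_herm X subspace_hermitian by (auto intro!: subspace_add subspace_mul)
  have small': "norm ((Qs + t n *\<^sub>R X) - Qs) \<le> \<rho>" for n using small by simp
  note bd = bw_boundsD[OF b herm small']
  show ?thesis
  proof (rule borel_measurable_LIMSEQ_metric)
    show "(\<lambda>s. (1 / t n) *\<^sub>R (bwT (Qs + t n *\<^sub>R X) s - bwT Qs s)) \<in> borel_measurable P" for n
      by (intro borel_measurable_scaleR borel_measurable_diff borel_measurable_const T_measurable bd(1) Qs_pd)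
    fix s assume "s \<in> space P"
    then have s: "s \<in> psd" by (simp add: space_P)
    let ?c = "\<kappa> * sqrt (norm s) * (norm X)\<^sup>2"
    have lim: "(\<lambda>n. t n * ?c) \<longlonglongrightarrow> 0" using tendsto_mult[OF t0 tendsto_const[of ?c]] by simp
    have "norm ((1 / t n) *\<^sub>R (bwT (Qs + t n *\<^sub>R X) s - bwT Qs s) - bwD Qs s X) \<le> t n * ?c" for n
    proof -
      have "(1 / t n) *\<^sub>R (bwT (Qs + t n *\<^sub>R X) s - bwT Qs s) - bwD Qs s X =
          (1 / t n) *\<^sub>R (bwT (Qs + t n *\<^sub>R X) s - bwT Qs s - bwD Qs s (t n *\<^sub>R X))"
        using t[of n] by (simp add: linear_scale[OF linear_bwD[OF Qs_pd s]] scaleR_diff_right)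
      also have "norm \<dots> \<le> (1 / t n) * (\<kappa> * sqrt (norm s) * (norm (t n *\<^sub>R X))\<^sup>2)"
        using bd(4)[OF s, of n] t[of n] by (simp add: divide_right_mono)
      also have "\<dots> = t n * ?c" using t[of n] by (simp add: power2_eq_square)
      finally show ?thesis .
    qed
    from Lim_null_comparison[OF always_eventually[OF allI, OF this] lim]
    show "(\<lambda>n. (1 / t n) *\<^sub>R (bwT (Qs + t n *\<^sub>R X) s - bwT Qs s)) \<longlonglongrightarrow> bwD Qs s X"
      by (rule LIM_zero_cancel)
  qed
qed

lemma D_integrable:
  assumes X: "X \<in> hermitian"
  shows "integrable P (\<lambda>s. bwD Qs s X)"
proof -
  obtain \<kappa> \<rho> where b: "bw_bounds \<kappa> \<rho> Qs" using bw_bounds_exist[OF Qs_pd] by blast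
  then have \<rho>: "0 < \<rho>" by (simp add: bw_bounds_def)
  show ?thesis
    using bw_boundsD(5)[OF b Qs_herm] \<rho>
    by (intro integrable_sqrt_norm_bound[OF D_measurable[OF X], of "\<kappa> * norm X"]) (auto simp: mult_ac)
qed

text \<open>Defined on the whole space through the projection, so that it is linear everywhere; on \<open>M\<close> it is the
  operator of the theorem.\<close>

definition F :: "'d cmat \<Rightarrow> 'd cmat" where
  "F X = - proj (\<integral>s. bwD Qs s (proj X) \<partial>P)"

lemma F_op_eq:
  assumes X: "X \<in> M"
  shows "F_op P M Qs X = F X"
proof -
  have "(\<integral>s. compress M (bw_map_deriv Qs s) X \<partial>P) = (\<integral>s. proj (bwD Qs s X) \<partial>P)"
    unfolding compress_def using X M_herm
    by (intro Bochner_Integration.integral_cong refl) (auto simp: space_P bw_map_deriv_eq[OF Qs_pd])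
  also have "\<dots> = proj (\<integral>s. bwD Qs s X \<partial>P)"
    using X M_herm by (intro integral_bounded_linear[OF bounded_linear_proj D_integrable]) auto
  finally show ?thesis by (simp add: F_op_def F_def proj_id[OF X])
qed

lemma F_mean: "F X = (\<integral>s. - proj (bwD Qs s (proj X)) \<partial>P)"
  using integral_bounded_linear[OF bounded_linear_proj D_integrable[OF proj_herm, of X]]
  by (simp add: F_def)

lemma F_mem: "F X \<in> M"
  using proj_mem M_subspace by (simp add: F_def subspace_neg)

lemma F_linear: "linear F"
proof (rule linearI)
  show "F (X + Y) = F X + F Y" for X Y
  proof -
    have "(\<integral>s. bwD Qs s (proj (X + Y)) \<partial>P) = (\<integral>s. bwD Qs s (proj X) + bwD Qs s (proj Y) \<partial>P)"
      by (intro Bochner_Integration.integral_cong refl)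
        (simp add: space_P linear_add[OF proj_linear] linear_add[OF linear_bwD[OF Qs_pd]])
    then show ?thesis
      by (simp add: F_def D_integrable[OF proj_herm] linear_add[OF proj_linear])
  qed
  show "F (c *\<^sub>R X) = c *\<^sub>R F X" for c X
  proof -
    have "(\<integral>s. bwD Qs s (proj (c *\<^sub>R X)) \<partial>P) = (\<integral>s. c *\<^sub>R bwD Qs s (proj X) \<partial>P)"
      by (intro Bochner_Integration.integral_cong refl)
        (simp add: space_P linear_scale[OF proj_linear] linear_scale[OF linear_bwD[OF Qs_pd]])
    then show ?thesis by (simp add: F_def linear_scale[OF proj_linear])
  qed
qed

lemma F_inner:
  assumes "X \<in> M" "Y \<in> M"
  shows "F X \<bullet> Y = - (\<integral>s. bwD Qs s X \<bullet> Y \<partial>P)"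
proof -
  have "X \<in> hermitian" using assms(1) M_herm by blast
  then show ?thesis
    using assms by (simp add: F_def proj_inner proj_id D_integrable)
qed

lemma F_symmetric: "X \<in> M \<Longrightarrow> Y \<in> M \<Longrightarrow> F X \<bullet> Y = X \<bullet> F Y"
proof -
  assume XY: "X \<in> M" "Y \<in> M"
  have "(\<integral>s. bwD Qs s X \<bullet> Y \<partial>P) = (\<integral>s. bwD Qs s Y \<bullet> X \<partial>P)"
    by (intro Bochner_Integration.integral_cong refl)
      (simp add: space_P bwD_symmetric[OF Qs_pd, of _ X Y] inner_commute[of X])
  then show ?thesis using XY by (simp add: F_inner inner_commute[of X])
qed

text \<open>The differential is strictly negative for \<open>S \<in> pd\<close>, an event of positive probability. The factor
  \<open>2\<close> leaves room for the perturbations of \<open>F\<close> below.\<close>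

lemma F_coercive: "\<exists>c>0. coercive_on M (2 * c) F"
proof -
  have pos: "0 < F X \<bullet> X" if X: "X \<in> M" "X \<noteq> 0" for X
  proof -
    have Xh: "X \<in> hermitian" using X M_herm by blast
    have int: "integrable P (\<lambda>s. - (bwD Qs s X \<bullet> X))" using D_integrable[OF Xh] by simp
    have nn: "AE s in P. 0 \<le> - (bwD Qs s X \<bullet> X)"
      using bwD_nonpos[OF Qs_pd _ Xh] by (intro AE_I2) (simp add: space_P)
    have "F X \<bullet> X = (\<integral>s. - (bwD Qs s X \<bullet> X) \<partial>P)" using X by (simp add: F_inner)
    moreover have "0 \<le> (\<integral>s. - (bwD Qs s X \<bullet> X) \<partial>P)" using nn by (rule integral_nonneg_AE)
    moreover have "(\<integral>s. - (bwD Qs s X \<bullet> X) \<partial>P) \<noteq> 0"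
    proof
      assume "(\<integral>s. - (bwD Qs s X \<bullet> X) \<partial>P) = 0"
      then have "AE s in P. - (bwD Qs s X \<bullet> X) = 0" using integral_nonneg_eq_0_iff_AE[OF int nn] by simp
      then have "AE s in P. s \<notin> pd"
      proof eventually_elim
        case (elim s)
        then show ?case using bwD_neg[OF Qs_pd _ Xh X(2), of s] by auto
      qed
      then have "measure P pd = 0"
      proof -
        assume ae: "AE s in P. s \<notin> pd"
        have pd: "pd \<in> sets P" using P_pd measure_notin_sets[of pd P] by auto
        have "pd \<in> null_sets P"
          using ae by (subst AE_iff_null_sets[OF pd]) simp
        then show ?thesis by (simp add: measure_def null_sets_def)
      qed
      then show False using P_pd by simp
    qed
    ultimately show ?thesis by simp
  qed
  obtain c where "c > 0" "\<forall>X\<in>M. c * (norm X)\<^sup>2 \<le> F X \<bullet> X"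
    using pos_def_coercive[OF M_subspace F_linear pos] by blast
  then have "coercive_on M (2 * (c / 2)) F"
    using F_linear F_mem by (auto simp: coercive_on_def[OF M_subspace])
  then show ?thesis using \<open>c > 0\<close> by (intro exI[of _ "c / 2"]) simp
qed

definition V :: "'d cmat \<Rightarrow> 'd cmat" where
  "V s = proj (bwT Qs s - mat 1)"

lemma V_mem: "V s \<in> M"
  by (simp add: V_def proj_mem)

lemma V_measurable: "V \<in> borel_measurable P"
proof -
  have "(\<lambda>s. bwT Qs s - mat 1) \<in> borel_measurable P" using T_measurable[OF Qs_pd] by simp
  then show ?thesis
    unfolding V_def[abs_def]
    using borel_measurable_continuous_onI[OF linear_continuous_on[OF bounded_linear_proj]]
    by (rule measurable_compose)
qed

lemma V_bound: "bw_bounds \<kappa> \<rho> Qs \<Longrightarrow> s \<in> psd \<Longrightarrow> norm (V s) \<le> \<kappa> * sqrt (norm s) + norm (mat 1 :: 'd cmat)"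
proof -
  assume b: "bw_bounds \<kappa> \<rho> Qs" and s: "s \<in> psd"
  have "norm (V s) \<le> norm (bwT Qs s - mat 1)" unfolding V_def by (rule proj_norm)
  also have "\<dots> \<le> norm (bwT Qs s) + norm (mat 1 :: 'd cmat)" by (rule norm_triangle_ineq4)
  also have "norm (bwT Qs s) \<le> \<kappa> * sqrt (norm s)"
    using bw_boundsD(2)[OF b Qs_herm _ s] b by (simp add: bw_bounds_def)
  finally show ?thesis by simp
qed

lemma square_integrable_bound:
  fixes f :: "'d cmat \<Rightarrow> 'd cmat"
  assumes "f \<in> borel_measurable P" "\<And>s. s \<in> psd \<Longrightarrow> norm (f s) \<le> a * sqrt (norm s) + b"
  shows "integrable P (\<lambda>s. (norm (f s))\<^sup>2)"
proof (rule Bochner_Integration.integrable_bound)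
  show "integrable P (\<lambda>s. 2 * a\<^sup>2 * norm s + 2 * b\<^sup>2)" using norm_integrable by simp
  show "AE s in P. norm ((norm (f s))\<^sup>2) \<le> norm (2 * a\<^sup>2 * norm s + 2 * b\<^sup>2)"
  proof (rule AE_I2)
    fix s assume "s \<in> space P"
    then have s: "s \<in> psd" by (simp add: space_P)
    have "(norm (f s))\<^sup>2 \<le> (a * sqrt (norm s) + b)\<^sup>2" using assms(2)[OF s] by (intro power_mono) auto
    also have "\<dots> \<le> 2 * (a * sqrt (norm s))\<^sup>2 + 2 * b\<^sup>2"
      using sum_squares_bound[of "a * sqrt (norm s)" b] by (simp add: power2_sum)
    also have "\<dots> = 2 * a\<^sup>2 * norm s + 2 * b\<^sup>2" by (simp add: power_mult_distrib)
    finally show "norm ((norm (f s))\<^sup>2) \<le> norm (2 * a\<^sup>2 * norm s + 2 * b\<^sup>2)" by simp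
  qed
qed (use assms(1) in measurable)

lemma V_square: "integrable P (\<lambda>s. (norm (V s))\<^sup>2)"
proof -
  obtain \<kappa> \<rho> where b: "bw_bounds \<kappa> \<rho> Qs" using bw_bounds_exist[OF Qs_pd] by blast
  show ?thesis by (rule square_integrable_bound[OF V_measurable V_bound[OF b]])
qed

lemma V_mean: "(\<integral>s. V s \<partial>P) = 0"
proof -
  have "(\<integral>s. V s \<partial>P) = proj (\<integral>s. bwT Qs s - mat 1 \<partial>P)"
    unfolding V_def using T_integrable[OF Qs_pd]
    by (intro integral_bounded_linear[OF bounded_linear_proj]) simp
  also have "(\<integral>s. bwT Qs s - mat 1 \<partial>P) = (\<integral>s. bwT Qs s \<partial>P) - mat 1"
    using T_integrable[OF Qs_pd] by (simp add: P.prob_space)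
  also have "proj ((\<integral>s. bwT Qs s \<partial>P) - mat 1) = 0"
  proof (rule eq_on_subspaceI[OF M_subspace proj_mem subspace_0[OF M_subspace]])
    fix Z assume "Z \<in> M"
    then show "proj ((\<integral>s. bwT Qs s \<partial>P) - mat 1) \<bullet> Z = 0 \<bullet> Z"
      using Qs_stationary by (simp add: proj_inner inner_diff_left)
  qed
  finally show ?thesis .
qed

definition Sig :: "'d cmat \<Rightarrow> 'd cmat" where
  "Sig X = (\<integral>s. (V s \<bullet> X) *\<^sub>R V s \<partial>P)"

lemma product_integrable:
  fixes f g :: "'d cmat \<Rightarrow> 'd cmat"
  assumes [measurable]: "f \<in> borel_measurable P" "g \<in> borel_measurable P"
    and "integrable P (\<lambda>s. (norm (f s))\<^sup>2)" "integrable P (\<lambda>s. (norm (g s))\<^sup>2)"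
  shows "integrable P (\<lambda>s. (f s \<bullet> X) *\<^sub>R g s)"
proof (rule Bochner_Integration.integrable_bound)
  show "integrable P (\<lambda>s. norm X * ((norm (f s))\<^sup>2 + (norm (g s))\<^sup>2))" using assms(3,4) by simp
  show "AE s in P. norm ((f s \<bullet> X) *\<^sub>R g s) \<le> norm (norm X * ((norm (f s))\<^sup>2 + (norm (g s))\<^sup>2))"
  proof (rule AE_I2)
    fix s
    have "norm ((f s \<bullet> X) *\<^sub>R g s) = \<bar>f s \<bullet> X\<bar> * norm (g s)" by simp
    also have "\<dots> \<le> (norm (f s) * norm X) * norm (g s)"
      by (intro mult_right_mono Cauchy_Schwarz_ineq2) simp
    also have "\<dots> = norm X * (norm (f s) * norm (g s))" by simp
    also have "\<dots> \<le> norm X * ((norm (f s))\<^sup>2 + (norm (g s))\<^sup>2)"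
    proof (rule mult_left_mono)
      have "0 \<le> (norm (f s))\<^sup>2 + (norm (g s))\<^sup>2" by simp
      then show "norm (f s) * norm (g s) \<le> (norm (f s))\<^sup>2 + (norm (g s))\<^sup>2"
        using sum_squares_bound[of "norm (f s)" "norm (g s)"] by linarith
    qed simp
    finally show "norm ((f s \<bullet> X) *\<^sub>R g s) \<le> norm (norm X * ((norm (f s))\<^sup>2 + (norm (g s))\<^sup>2))" by simp
  qed
qed measurable

lemma Sig_integrable: "integrable P (\<lambda>s. (V s \<bullet> X) *\<^sub>R V s)"
  by (rule product_integrable[OF V_measurable V_measurable V_square V_square])

lemma Sig_inner: "Sig X \<bullet> Y = (\<integral>s. (V s \<bullet> X) * (V s \<bullet> Y) \<partial>P)"
proof -
  have "Sig X \<bullet> Y = (\<integral>s. ((V s \<bullet> X) *\<^sub>R V s) \<bullet> Y \<partial>P)"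
    unfolding Sig_def using integral_inner_left[of Y P, OF Sig_integrable[of X]] by simp
  then show ?thesis by simp
qed

lemma Sig_mem: "Sig X \<in> M"
proof -
  have "Sig X = (\<integral>s. proj ((V s \<bullet> X) *\<^sub>R V s) \<partial>P)"
    unfolding Sig_def
    by (intro Bochner_Integration.integral_cong refl)
      (simp add: proj_id V_mem subspace_mul[OF M_subspace])
  also have "\<dots> = proj (Sig X)"
    unfolding Sig_def by (rule integral_bounded_linear[OF bounded_linear_proj Sig_integrable])
  finally show ?thesis using proj_mem[of "Sig X"] by simp
qed

lemma Sig_psd: "psd_on M Sig"
  unfolding psd_on_def
proof (intro conjI ballI)
  show "linear Sig"
  proof (rule linearI)
    show "Sig (X + Y) = Sig X + Sig Y" for X Y
      using Sig_integrable[of X] Sig_integrable[of Y]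
      by (simp add: Sig_def inner_add_right scaleR_left_distrib)
    show "Sig (c *\<^sub>R X) = c *\<^sub>R Sig X" for c X
      by (simp add: Sig_def scaleR_scaleR[symmetric] del: scaleR_scaleR)
  qed
  show "Sig ` M \<subseteq> M" using Sig_mem by blast
  show "Sig X \<bullet> Y = X \<bullet> Sig Y" for X Y
    using Sig_inner[of Y X] by (simp add: Sig_inner inner_commute[of X] mult.commute)
  show "0 \<le> Sig X \<bullet> X" for X
    unfolding Sig_inner by (intro Bochner_Integration.integral_nonneg) simp
qed

text \<open>The mean of the optimal map differs from the identity by a matrix orthogonal to \<open>M\<close>, so that
  centring at either gives the same compression.\<close>

lemma compress_Sigma_op_eq:
  assumes X: "X \<in> M"
  shows "compress M (Sigma_op P Qs) X = Sig X"
proof -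
  define m where "m = (\<integral>s. bwT Qs s \<partial>P)"
  have m: "(\<integral>s. bw_map Qs s \<partial>P) = m"
    unfolding m_def by (intro Bochner_Integration.integral_cong refl) (simp add: space_P bw_map_eq[OF Qs_pd])
  have inner: "(bwT Qs s - m) \<bullet> Z = V s \<bullet> Z" if "Z \<in> M" for s Z
    using Qs_stationary[OF that] by (simp add: V_def proj_inner[OF that] m_def inner_diff_left)
  have projV: "proj (bwT Qs s - m) = V s" for s
    by (rule eq_on_subspaceI[OF M_subspace proj_mem V_mem]) (simp add: proj_inner inner)
  have meas: "(\<lambda>s. bwT Qs s - m) \<in> borel_measurable P" using T_measurable[OF Qs_pd] by simp
  obtain \<kappa> where \<kappa>: "\<And>s. s \<in> psd \<Longrightarrow> norm (bwT Qs s) \<le> \<kappa> * sqrt (norm s)"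
    using T_bound[OF Qs_pd] by blast
  have sq: "integrable P (\<lambda>s. (norm (bwT Qs s - m))\<^sup>2)"
    using \<kappa> norm_triangle_ineq4[of "bwT Qs _" m]
    by (intro square_integrable_bound[OF meas, of \<kappa> "norm m"]) (meson add_right_mono order_trans)
  have "Sigma_op P Qs X = (\<integral>s. ((bwT Qs s - m) \<bullet> X) *\<^sub>R (bwT Qs s - m) \<partial>P)"
    unfolding Sigma_op_def Let_def m tensor_op_def
    by (intro Bochner_Integration.integral_cong refl) (simp add: space_P bw_map_eq[OF Qs_pd])
  then have "compress M (Sigma_op P Qs) X = (\<integral>s. proj (((bwT Qs s - m) \<bullet> X) *\<^sub>R (bwT Qs s - m)) \<partial>P)"
    unfolding compress_def
    using integral_bounded_linear[OF bounded_linear_proj product_integrable[OF meas meas sq sq, of X]] by simp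
  also have "\<dots> = Sig X"
    by (simp add: Sig_def linear_scale[OF proj_linear] projV inner[OF X])
  finally show ?thesis .
qed

lemma Sig_nondegenerate:
  assumes nd: "\<forall>X\<in>hermitian. Sigma_op P Qs X = 0 \<longrightarrow> X = 0" and X: "X \<in> M" "Sig X = 0"
  shows "X = 0"
proof -
  have int: "integrable P (\<lambda>s. (V s \<bullet> X) * (V s \<bullet> X))"
    using integrable_inner_left[of X P, OF Sig_integrable[of X]] by simp
  have "(\<integral>s. (V s \<bullet> X) * (V s \<bullet> X) \<partial>P) = 0" using X(2) Sig_inner[of X X] by simp
  then have ae: "AE s in P. V s \<bullet> X = 0"
    using integral_nonneg_eq_0_iff_AE[OF int] by simp
  define m where "m = (\<integral>s. bw_map Qs s \<partial>P)"
  have m: "m = (\<integral>s. bwT Qs s \<partial>P)"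
    unfolding m_def by (intro Bochner_Integration.integral_cong refl) (simp add: space_P bw_map_eq[OF Qs_pd])
  have "Sigma_op P Qs X = (\<integral>s. 0 \<partial>P)"
    unfolding Sigma_op_def Let_def m_def[symmetric] tensor_op_def
  proof (rule integral_cong_AE)
    show "AE s in P. ((bw_map Qs s - m) \<bullet> X) *\<^sub>R (bw_map Qs s - m) = 0"
      using ae AE_space
    proof eventually_elim
      case (elim s)
      then have "(bw_map Qs s - m) \<bullet> X = V s \<bullet> X"
        using Qs_stationary[OF X(1)]
        by (simp add: space_P bw_map_eq[OF Qs_pd] V_def proj_inner[OF X(1)] m inner_diff_left)
      then show ?case using elim(1) by simp
    qed
    have "bw_map Qs \<in> borel_measurable P \<longleftrightarrow> bwT Qs \<in> borel_measurable P"
      by (intro measurable_cong) (simp add: space_P bw_map_eq[OF Qs_pd])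
    then have [measurable]: "bw_map Qs \<in> borel_measurable P" using T_measurable[OF Qs_pd] by simp
    show "(\<lambda>s. ((bw_map Qs s - m) \<bullet> X) *\<^sub>R (bw_map Qs s - m)) \<in> borel_measurable P" by measurable
  qed simp
  then have "Sigma_op P Qs X = 0" by simp
  then show ?thesis using nd X(1) M_herm by blast
qed

end

section \<open>Empirical barycenters near the population barycenter\<close>

locale bw_local = bw_population P M A Q0 Qs
  for P :: "('d::finite) cmat measure" and M A Q0 Qs +
  fixes \<kappa> \<rho> c :: real
  assumes bounds: "bw_bounds \<kappa> \<rho> Qs" and c: "0 < c" and F_coercive_c: "coercive_on M (2 * c) F"
begin

lemma kappa_rho: "0 < \<kappa>" "0 < \<rho>"
  using bounds by (auto simp: bw_bounds_def)

definition T_avg :: "nat \<Rightarrow> (nat \<Rightarrow> 'd cmat) \<Rightarrow> 'd cmat \<Rightarrow> 'd cmat" where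
  "T_avg n s R = avg n (\<lambda>i. bwT R (s i))"

definition F_avg :: "nat \<Rightarrow> (nat \<Rightarrow> 'd cmat) \<Rightarrow> 'd cmat \<Rightarrow> 'd cmat \<Rightarrow> 'd cmat" where
  "F_avg n s R X = - avg n (\<lambda>i. proj (bwD R (s i) (proj X)))"

definition V_at :: "'d cmat \<Rightarrow> 'd cmat \<Rightarrow> 'd cmat" where
  "V_at R S = proj (bwT R S - mat 1)"

definition Sig_avg :: "nat \<Rightarrow> (nat \<Rightarrow> 'd cmat) \<Rightarrow> 'd cmat \<Rightarrow> 'd cmat \<Rightarrow> 'd cmat" where
  "Sig_avg n s R X = avg n (\<lambda>i. (V_at R (s i) \<bullet> X) *\<^sub>R V_at R (s i))"

text \<open>A sample for which the law of large numbers has taken effect.\<close>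

definition good :: "real \<Rightarrow> real \<Rightarrow> nat \<Rightarrow> (nat \<Rightarrow> 'd cmat) \<Rightarrow> bool" where
  "good \<delta> K n s \<longleftrightarrow> avg n (\<lambda>i. sqrt (norm (s i))) \<le> K \<and> avg n (\<lambda>i. norm (s i)) \<le> K \<and>
     (\<forall>X\<in>M. norm (F_avg n s Qs X - F X) \<le> \<delta> * norm X) \<and>
     (\<forall>X\<in>M. norm (Sig_avg n s Qs X - Sig X) \<le> \<delta> * norm X)"

lemma V_at_Qs: "V_at Qs = V"
  by (rule ext) (simp add: V_at_def V_def)

lemma avg_mem: "(\<And>i. i \<ge> 1 \<Longrightarrow> f i \<in> M) \<Longrightarrow> avg n f \<in> M"
  unfolding avg_def using M_subspace by (auto intro!: subspace_mul subspace_sum)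

lemma F_avg_mem: "F_avg n s R X \<in> M"
  unfolding F_avg_def by (intro subspace_neg[OF M_subspace] avg_mem proj_mem)

lemma Sig_avg_psd: "psd_on M (Sig_avg n s R)"
  unfolding psd_on_def
proof (intro conjI ballI)
  show "linear (Sig_avg n s R)"
  proof (rule linearI)
    show "Sig_avg n s R (X + Y) = Sig_avg n s R X + Sig_avg n s R Y" for X Y
      unfolding Sig_avg_def avg_add[symmetric] by (simp add: inner_add_right scaleR_left_distrib)
    show "Sig_avg n s R (r *\<^sub>R X) = r *\<^sub>R Sig_avg n s R X" for r X
      unfolding Sig_avg_def avg_linear[OF linear_scale_self, of r] by simp
  qed
  show "Sig_avg n s R ` M \<subseteq> M"
    unfolding Sig_avg_def V_at_def using proj_mem M_subspace by (auto intro!: avg_mem subspace_mul)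
  show "Sig_avg n s R X \<bullet> Y = X \<bullet> Sig_avg n s R Y" for X Y
    unfolding Sig_avg_def inner_commute[of X] avg_inner by (simp add: mult.commute)
  show "0 \<le> Sig_avg n s R X \<bullet> X" for X
    unfolding Sig_avg_def avg_inner by (intro avg_nonneg) simp
qed

context
  fixes n :: nat and s :: "nat \<Rightarrow> 'd cmat"
  assumes n: "n \<ge> 1" and s: "\<And>i. i \<ge> 1 \<Longrightarrow> s i \<in> psd"
begin

lemma F_avg_linear:
  assumes R: "R \<in> pd"
  shows "linear (F_avg n s R)"
proof (rule linearI)
  note lin = linear_bwD[OF R s]
  show "F_avg n s R (X + Y) = F_avg n s R X + F_avg n s R Y" for X Y
    unfolding F_avg_def minus_add_distrib[symmetric] avg_add[symmetric]
    by (intro arg_cong[where f = uminus] avg_cong)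
      (simp add: linear_add[OF proj_linear] linear_add[OF lin])
  show "F_avg n s R (r *\<^sub>R X) = r *\<^sub>R F_avg n s R X" for r X
    unfolding F_avg_def scaleR_minus_right avg_linear[OF linear_scale_self, of r]
    by (intro arg_cong[where f = uminus] avg_cong)
      (simp add: linear_scale[OF proj_linear] linear_scale[OF lin])
qed

lemma F_avg_inner:
  assumes R: "R \<in> pd" and XY: "X \<in> M" "Y \<in> M"
  shows "F_avg n s R X \<bullet> Y = - avg n (\<lambda>i. bwD R (s i) X \<bullet> Y)"
  using XY by (simp add: F_avg_def avg_inner proj_inner proj_id)

lemma F_avg_symmetric:
  assumes R: "R \<in> pd" and XY: "X \<in> M" "Y \<in> M"
  shows "F_avg n s R X \<bullet> Y = X \<bullet> F_avg n s R Y"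
  unfolding F_avg_inner[OF R XY] inner_commute[of X] F_avg_inner[OF R XY(2,1)]
  by (intro arg_cong[where f = uminus] avg_cong) (simp add: bwD_symmetric[OF R s] inner_commute[of X])

lemma F_hat_eq:
  assumes R: "R \<in> pd" and X: "X \<in> M"
  shows "F_hat n s M R X = F_avg n s R X"
proof -
  have "avg n (\<lambda>i. proj (bw_map_deriv R (s i) X)) = avg n (\<lambda>i. proj (bwD R (s i) (proj X)))"
    using X M_herm by (intro avg_cong) (auto simp: bw_map_deriv_eq[OF R s] proj_id)
  then show ?thesis by (simp add: F_hat_def F_avg_def avg_def compress_def)
qed

lemma compress_Sigma_hat_eq:
  assumes R: "R \<in> pd" and X: "X \<in> M"
  shows "compress M (Sigma_hat n s R) X = Sig_avg n s R X"
proof -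
  have "compress M (Sigma_hat n s R) X
      = proj (avg n (\<lambda>i. ((bw_map R (s i) - mat 1) \<bullet> X) *\<^sub>R (bw_map R (s i) - mat 1)))"
    by (simp add: compress_def Sigma_hat_def tensor_op_def avg_def)
  also have "\<dots> = avg n (\<lambda>i. ((bw_map R (s i) - mat 1) \<bullet> X) *\<^sub>R proj (bw_map R (s i) - mat 1))"
    by (simp add: avg_linear[OF proj_linear] linear_scale[OF proj_linear])
  also have "\<dots> = Sig_avg n s R X"
    unfolding Sig_avg_def
    by (intro avg_cong) (simp add: bw_map_eq[OF R s] V_at_def proj_inner[OF X])
  finally show ?thesis .
qed

lemma empirical_gradient:
  assumes Q: "Q \<in> psd" and R: "R \<in> pd"
  shows "avg n (\<lambda>i. bw_dist2 R (s i)) + (mat 1 - T_avg n s R) \<bullet> (Q - R) \<le> avg n (\<lambda>i. bw_dist2 Q (s i))"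
proof -
  have "avg n (\<lambda>i. bw_dist2 R (s i) + (mat 1 - bwT R (s i)) \<bullet> (Q - R)) \<le> avg n (\<lambda>i. bw_dist2 Q (s i))"
    by (intro avg_mono bw_dist2_gradient_inequality Q R s)
  then show ?thesis
    by (simp add: avg_add avg_inner[symmetric] avg_diff avg_const[OF n] T_avg_def)
qed

lemma T_avg_taylor:
  assumes X: "X \<in> M" "norm X \<le> \<rho>" and K: "avg n (\<lambda>i. sqrt (norm (s i))) \<le> K"
  shows "norm (T_avg n s (Qs + X) - T_avg n s Qs - avg n (\<lambda>i. bwD Qs (s i) X)) \<le> \<kappa> * K * (norm X)\<^sup>2"
proof -
  have "norm (avg n (\<lambda>i. bwT (Qs + X) (s i) - bwT Qs (s i) - bwD Qs (s i) X))
      \<le> avg n (\<lambda>i. (\<kappa> * (norm X)\<^sup>2) * sqrt (norm (s i)))"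
  proof (rule avg_norm_le)
    fix i :: nat assume "i \<ge> 1"
    from bw_boundsD(4)[OF bounds Qs_add_herm[OF X(1)] _ s[OF this]] X(2)
    show "norm (bwT (Qs + X) (s i) - bwT Qs (s i) - bwD Qs (s i) X) \<le> (\<kappa> * (norm X)\<^sup>2) * sqrt (norm (s i))"
      by (simp add: mult_ac)
  qed
  also have "\<dots> = (\<kappa> * (norm X)\<^sup>2) * avg n (\<lambda>i. sqrt (norm (s i)))" by (rule avg_mult_left)
  also have "\<dots> \<le> (\<kappa> * (norm X)\<^sup>2) * K" using K kappa_rho by (intro mult_left_mono) auto
  finally show ?thesis by (simp add: avg_diff T_avg_def mult_ac)
qed

context
  fixes \<delta> K r :: real
  assumes good: "good \<delta> K n s" and \<delta>: "\<delta> \<le> c / 2" and K: "0 < K"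
    and r: "0 < r" "r \<le> \<rho>" "\<kappa> * K * r \<le> c / 2"
begin

text \<open>Of the lower bound \<open>2 c\<close> for \<open>F\<close>, the deviation of the sample from \<open>F\<close> uses up \<open>c / 2\<close> and the Taylor
  remainder on the ball of radius \<open>r\<close> another \<open>c / 2\<close>.\<close>

lemma strong_monotonicity:
  assumes X: "X \<in> M" "norm X \<le> r"
  shows "c * (norm X)\<^sup>2 \<le> (T_avg n s Qs - T_avg n s (Qs + X)) \<bullet> X"
proof -
  let ?D = "avg n (\<lambda>i. bwD Qs (s i) X)"
  define E where "E = T_avg n s (Qs + X) - T_avg n s Qs - ?D"
  have H: "avg n (\<lambda>i. sqrt (norm (s i))) \<le> K" using good by (simp add: good_def)
  have "norm E \<le> \<kappa> * K * (norm X)\<^sup>2"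
    unfolding E_def using X r(2) by (intro T_avg_taylor H) auto
  then have "norm E * norm X \<le> (\<kappa> * K * (norm X)\<^sup>2) * norm X" by (intro mult_right_mono) auto
  also have "\<dots> = (\<kappa> * K * norm X) * (norm X)\<^sup>2" by simp
  also have "\<dots> \<le> (c / 2) * (norm X)\<^sup>2"
  proof (rule mult_right_mono)
    have "\<kappa> * K * norm X \<le> \<kappa> * K * r" using X(2) kappa_rho K by (intro mult_left_mono) auto
    then show "\<kappa> * K * norm X \<le> c / 2" using r(3) by linarith
  qed simp
  finally have E: "E \<bullet> X \<le> (c / 2) * (norm X)\<^sup>2"
    using norm_cauchy_schwarz[of E X] by linarith
  have "\<bar>(F_avg n s Qs X - F X) \<bullet> X\<bar> \<le> norm (F_avg n s Qs X - F X) * norm X"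
    by (rule Cauchy_Schwarz_ineq2)
  also have "\<dots> \<le> (c / 2 * norm X) * norm X"
  proof (rule mult_right_mono)
    have "norm (F_avg n s Qs X - F X) \<le> \<delta> * norm X" using good X(1) by (simp add: good_def)
    also have "\<dots> \<le> c / 2 * norm X" using \<delta> by (intro mult_right_mono) auto
    finally show "norm (F_avg n s Qs X - F X) \<le> c / 2 * norm X" .
  qed simp
  finally have "- ((F_avg n s Qs X - F X) \<bullet> X) \<le> c / 2 * norm X * norm X" by (rule abs_le_D2)
  then have "F X \<bullet> X - c / 2 * (norm X)\<^sup>2 \<le> F_avg n s Qs X \<bullet> X"
    by (simp add: inner_diff_left power2_eq_square mult.assoc)
  moreover have "2 * c * (norm X)\<^sup>2 \<le> F X \<bullet> X"
    using F_coercive_c X(1) by (simp add: coercive_on_def[OF M_subspace])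
  moreover have "F_avg n s Qs X \<bullet> X = - (?D \<bullet> X)"
    by (simp add: F_avg_inner[OF Qs_pd X(1) X(1)] avg_inner)
  moreover have "(T_avg n s Qs - T_avg n s (Qs + X)) \<bullet> X = - (?D \<bullet> X) - E \<bullet> X"
    by (simp add: E_def inner_diff_left)
  ultimately show ?thesis using E by (simp add: field_simps)
qed

context
  fixes Q :: "'d cmat"
  assumes Q: "emp_bw_barycenter n s A Q" and W: "norm (avg n (\<lambda>i. V (s i))) < c * r"
begin

lemma emp_mem: "Q \<in> psd" "Q - Qs \<in> M"
  and emp_min: "R \<in> psd \<Longrightarrow> R - Qs \<in> M \<Longrightarrow> avg n (\<lambda>i. bw_dist2 Q (s i)) \<le> avg n (\<lambda>i. bw_dist2 R (s i))"
  using Q by (auto simp: emp_bw_barycenter_def is_arg_min_def not_less A_iff avg_def)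

lemma V_avg_inner: "X \<in> M \<Longrightarrow> avg n (\<lambda>i. V (s i)) \<bullet> X = - ((mat 1 - T_avg n s Qs) \<bullet> X)"
proof -
  assume X: "X \<in> M"
  have "avg n (\<lambda>i. V (s i)) = proj (T_avg n s Qs - mat 1)"
    unfolding V_def avg_linear[OF proj_linear, symmetric] avg_diff T_avg_def avg_const[OF n] ..
  then show ?thesis using X by (simp add: proj_inner inner_diff_left)
qed

text \<open>If the empirical barycenter were outside the ball of radius \<open>r\<close>, the objective would decrease
  from the point \<open>R\<close> where the segment leaves the ball; but strong monotonicity forces it to
  increase there. In particular the empirical barycenter is positive definite.\<close>

lemma emp_location: "norm (Q - Qs) \<le> r"
proof (rule ccontr)
  assume far: "\<not> ?thesis"
  define t where "t = r / norm (Q - Qs)"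
  have far': "r < norm (Q - Qs)" "0 < norm (Q - Qs)" using far r(1) by linarith+
  have t: "0 < t" "t < 1"
    unfolding t_def using r(1) far' by (auto intro!: divide_pos_pos simp only: pos_divide_less_eq mult_1)
  define X where "X = t *\<^sub>R (Q - Qs)"
  define R where "R = Qs + X"
  have X: "X \<in> M" using emp_mem(2) M_subspace by (simp add: X_def subspace_mul)
  have Xr: "norm X = r" using far r(1) by (auto simp: X_def t_def)
  have R_pd: "R \<in> pd"
    unfolding R_def using Xr r(2) by (intro bw_boundsD(1)[OF bounds Qs_add_herm[OF X]]) simp
  have "(mat 1 - T_avg n s R) \<bullet> (Q - R) \<le> 0"
    using empirical_gradient[OF emp_mem(1) R_pd] emp_min[OF pd_imp_psd[OF R_pd]] X by (simp add: R_def)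
  moreover have "t *\<^sub>R (Q - R) = (1 - t) *\<^sub>R X"
    by (simp add: R_def X_def algebra_simps)
  then have "t * ((mat 1 - T_avg n s R) \<bullet> (Q - R)) = (1 - t) * ((mat 1 - T_avg n s R) \<bullet> X)"
    by (metis inner_scaleR_right)
  ultimately have "(1 - t) * ((mat 1 - T_avg n s R) \<bullet> X) \<le> 0"
    using t(1) by (metis less_imp_le mult_nonneg_nonpos)
  then have 1: "(mat 1 - T_avg n s R) \<bullet> X \<le> 0" using t(2) by (simp add: mult_le_0_iff)
  have "(mat 1 - T_avg n s R) \<bullet> X = (mat 1 - T_avg n s Qs) \<bullet> X + (T_avg n s Qs - T_avg n s R) \<bullet> X"
    by (simp add: inner_diff_left)
  then have "c * (norm X)\<^sup>2 \<le> avg n (\<lambda>i. V (s i)) \<bullet> X"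
    using strong_monotonicity[OF X] Xr 1 V_avg_inner[OF X] by (simp add: R_def)
  also have "\<dots> \<le> norm (avg n (\<lambda>i. V (s i))) * norm X" by (rule norm_cauchy_schwarz)
  finally have "c * r \<le> norm (avg n (\<lambda>i. V (s i)))" using r(1) by (simp add: Xr power2_eq_square)
  then show False using W by simp
qed

lemma emp_pd: "Q \<in> pd"
  using bw_boundsD(1)[OF bounds Qs_add_herm[OF emp_mem(2)]] emp_location r(2) by simp

lemma emp_stationary:
  assumes X: "X \<in> M"
  shows "(mat 1 - T_avg n s Q) \<bullet> X = 0"
proof -
  obtain \<kappa>' \<rho>' where b: "bw_bounds \<kappa>' \<rho>' Q" using bw_bounds_exist[OF emp_pd] by blast
  define g where "g R = mat 1 - T_avg n s R" for R
  have herm: "Q + X \<in> hermitian" if "X \<in> M" for X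
    using that M_herm pd_hermitian[OF emp_pd] subspace_add[OF subspace_hermitian] by blast
  have pd: "Q + X \<in> pd" if "X \<in> M" "norm X < \<rho>'" for X
    using bw_boundsD(1)[OF b herm[OF that(1)]] that(2) by simp
  have "g Q \<bullet> X = 0"
  proof (rule first_order_condition[where g = g and Q = Q and \<rho> = \<rho>'
        and C = "\<kappa>' * avg n (\<lambda>i. sqrt (norm (s i)))", OF M_subspace _ _ _ X])
    show "0 < \<rho>'" using b by (simp add: bw_bounds_def)
    fix X assume X: "X \<in> M" "norm X < \<rho>'"
    have "Q + X - Qs \<in> M"
      using subspace_add[OF M_subspace emp_mem(2) X(1)] by (simp add: algebra_simps)
    then show "0 \<le> g (Q + X) \<bullet> X"
      using empirical_gradient[OF emp_mem(1) pd[OF X]] emp_min[OF pd_imp_psd[OF pd[OF X]]]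
      by (simp add: g_def)
    have "norm (avg n (\<lambda>i. bwT (Q + X) (s i) - bwT Q (s i))) \<le> avg n (\<lambda>i. (\<kappa>' * norm X) * sqrt (norm (s i)))"
    proof (rule avg_norm_le)
      fix i :: nat assume "i \<ge> 1"
      from bw_boundsD(3)[OF b herm[OF X(1)] _ s[OF this]] X(2)
      show "norm (bwT (Q + X) (s i) - bwT Q (s i)) \<le> (\<kappa>' * norm X) * sqrt (norm (s i))"
        by (simp add: mult_ac)
    qed
    then show "norm (g (Q + X) - g Q) \<le> (\<kappa>' * avg n (\<lambda>i. sqrt (norm (s i)))) * norm X"
      unfolding avg_mult_left by (simp add: g_def T_avg_def avg_diff norm_minus_commute mult_ac)
  qed
  then show ?thesis by (simp add: g_def)
qed

lemma emp_rate: "c * norm (Q - Qs) \<le> norm (avg n (\<lambda>i. V (s i)))"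
proof -
  let ?X = "Q - Qs"
  have "c * (norm ?X)\<^sup>2 \<le> (T_avg n s Qs - T_avg n s (Qs + ?X)) \<bullet> ?X"
    by (rule strong_monotonicity[OF emp_mem(2) emp_location])
  also have "\<dots> = avg n (\<lambda>i. V (s i)) \<bullet> ?X"
    using emp_stationary[OF emp_mem(2)] V_avg_inner[OF emp_mem(2)] by (simp add: inner_diff_left)
  also have "\<dots> \<le> norm (avg n (\<lambda>i. V (s i))) * norm ?X" by (rule norm_cauchy_schwarz)
  finally have "(c * norm ?X) * norm ?X \<le> norm (avg n (\<lambda>i. V (s i))) * norm ?X"
    by (simp add: power2_eq_square)
  then show ?thesis by (cases "?X = 0") auto
qed

text \<open>The gradient vanishes on \<open>M\<close> at the empirical barycenter; its Taylor expansion at \<open>Qs\<close> expresses this in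
  terms of \<open>F\<close>.\<close>

lemma emp_linearization:
  "norm (F (Q - Qs) - avg n (\<lambda>i. V (s i))) \<le> \<delta> * norm (Q - Qs) + \<kappa> * K * (norm (Q - Qs))\<^sup>2"
proof -
  let ?X = "Q - Qs"
  define D where "D = avg n (\<lambda>i. bwD Qs (s i) ?X)"
  have H: "avg n (\<lambda>i. sqrt (norm (s i))) \<le> K" using good by (simp add: good_def)
  have "norm (T_avg n s (Qs + ?X) - T_avg n s Qs - D) \<le> \<kappa> * K * (norm ?X)\<^sup>2"
    unfolding D_def using emp_mem(2) emp_location r(2) by (intro T_avg_taylor H) auto
  then have E: "norm (T_avg n s Q - T_avg n s Qs - D) \<le> \<kappa> * K * (norm ?X)\<^sup>2" by simp
  have "F_avg n s Qs ?X = - proj D"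
    by (simp add: F_avg_def D_def avg_linear[OF proj_linear] proj_id[OF emp_mem(2)])
  moreover have "avg n (\<lambda>i. V (s i)) = proj (T_avg n s Qs - T_avg n s Q)"
  proof (rule eq_on_subspaceI[OF M_subspace avg_mem proj_mem])
    fix Z assume Z: "Z \<in> M"
    show "avg n (\<lambda>i. V (s i)) \<bullet> Z = proj (T_avg n s Qs - T_avg n s Q) \<bullet> Z"
      using V_avg_inner[OF Z] emp_stationary[OF Z] by (simp add: proj_inner[OF Z] inner_diff_left)
  qed (rule V_mem)
  ultimately have "F_avg n s Qs ?X - avg n (\<lambda>i. V (s i)) = proj (T_avg n s Q - T_avg n s Qs - D)"
    by (simp add: linear_diff[OF proj_linear])
  then have 1: "norm (F_avg n s Qs ?X - avg n (\<lambda>i. V (s i))) \<le> \<kappa> * K * (norm ?X)\<^sup>2"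
    using order_trans[OF proj_norm E] by simp
  have 2: "norm (F_avg n s Qs ?X - F ?X) \<le> \<delta> * norm ?X"
    using good emp_mem(2) by (simp add: good_def)
  have eq: "F ?X - avg n (\<lambda>i. V (s i)) = (F_avg n s Qs ?X - avg n (\<lambda>i. V (s i))) - (F_avg n s Qs ?X - F ?X)"
    by simp
  show ?thesis
    unfolding eq
    using norm_triangle_ineq4[of "F_avg n s Qs ?X - avg n (\<lambda>i. V (s i))" "F_avg n s Qs ?X - F ?X"] 1 2
    by linarith
qed

lemma emp_F_close:
  assumes X: "X \<in> M"
  shows "norm (F_avg n s Q X - F X) \<le> (\<delta> + \<kappa> * K * norm (Q - Qs)) * norm X"
proof -
  have H: "avg n (\<lambda>i. sqrt (norm (s i))) \<le> K" using good by (simp add: good_def)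
  have "F_avg n s Q X - F_avg n s Qs X = - avg n (\<lambda>i. proj (bwD Q (s i) X - bwD Qs (s i) X))"
    by (simp add: F_avg_def avg_diff linear_diff[OF proj_linear] proj_id[OF X])
  then have "norm (F_avg n s Q X - F_avg n s Qs X) = norm (avg n (\<lambda>i. proj (bwD Q (s i) X - bwD Qs (s i) X)))"
    by simp
  also have "\<dots> \<le> avg n (\<lambda>i. (\<kappa> * norm (Q - Qs) * norm X) * sqrt (norm (s i)))"
  proof (rule avg_norm_le)
    fix i :: nat assume i: "i \<ge> 1"
    have "norm (proj (bwD Q (s i) X - bwD Qs (s i) X)) \<le> norm (bwD Q (s i) X - bwD Qs (s i) X)"
      by (rule proj_norm)
    also have "\<dots> \<le> \<kappa> * sqrt (norm (s i)) * norm (Q - Qs) * norm X"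
      using emp_location r(2) by (intro bw_boundsD(6)[OF bounds pd_hermitian[OF emp_pd] _ s[OF i]]) simp
    finally show "norm (proj (bwD Q (s i) X - bwD Qs (s i) X)) \<le> (\<kappa> * norm (Q - Qs) * norm X) * sqrt (norm (s i))"
      by (simp add: mult_ac)
  qed
  also have "\<dots> \<le> (\<kappa> * norm (Q - Qs) * norm X) * K"
    unfolding avg_mult_left using H kappa_rho by (intro mult_left_mono) auto
  finally have "norm (F_avg n s Q X - F_avg n s Qs X) \<le> \<kappa> * K * norm (Q - Qs) * norm X" by (simp add: mult_ac)
  moreover have "norm (F_avg n s Qs X - F X) \<le> \<delta> * norm X" using good X by (simp add: good_def)
  ultimately show ?thesis
    using norm_triangle_ineq[of "F_avg n s Q X - F_avg n s Qs X" "F_avg n s Qs X - F X"]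
    by (simp add: distrib_right)
qed

lemma emp_Sig_close:
  assumes X: "X \<in> M"
  shows "norm (Sig_avg n s Q X - Sig X)
    \<le> (\<delta> + 2 * \<kappa> * K * (\<kappa> + norm (mat 1 :: 'd cmat)) * norm (Q - Qs)) * norm X"
proof -
  let ?d = "norm (mat 1 :: 'd cmat)" and ?m = "norm (Q - Qs)"
  have H: "avg n (\<lambda>i. sqrt (norm (s i))) \<le> K" "avg n (\<lambda>i. norm (s i)) \<le> K"
    using good by (auto simp: good_def)
  have loc: "norm (Q - Qs) \<le> \<rho>" using emp_location r(2) by simp
  have "norm (avg n (\<lambda>i. (V_at Q (s i) \<bullet> X) *\<^sub>R V_at Q (s i) - (V_at Qs (s i) \<bullet> X) *\<^sub>R V_at Qs (s i)))
      \<le> avg n (\<lambda>i. (2 * \<kappa> * ?m * norm X) * (\<kappa> * norm (s i) + ?d * sqrt (norm (s i))))"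
  proof (rule avg_norm_le)
    fix i :: nat assume i: "i \<ge> 1"
    let ?h = "sqrt (norm (s i))" and ?a = "V_at Q (s i)" and ?b = "V_at Qs (s i)"
    have b: "norm ?b \<le> \<kappa> * ?h + ?d" unfolding V_at_Qs by (rule V_bound[OF bounds s[OF i]])
    have a: "norm ?a \<le> \<kappa> * ?h + ?d"
    proof -
      have "norm ?a \<le> norm (bwT Q (s i) - mat 1)" unfolding V_at_def by (rule proj_norm)
      also have "\<dots> \<le> norm (bwT Q (s i)) + ?d" by (rule norm_triangle_ineq4)
      also have "norm (bwT Q (s i)) \<le> \<kappa> * ?h"
        by (rule bw_boundsD(2)[OF bounds pd_hermitian[OF emp_pd] loc s[OF i]])
      finally show ?thesis by simp
    qed
    have ab: "norm (?a - ?b) \<le> \<kappa> * ?h * ?m"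
    proof -
      have "?a - ?b = proj (bwT Q (s i) - bwT Qs (s i))"
        by (simp add: V_at_def linear_diff[OF proj_linear])
      then show ?thesis
        using order_trans[OF proj_norm bw_boundsD(3)[OF bounds pd_hermitian[OF emp_pd] loc s[OF i]]] by simp
    qed
    have "(?a \<bullet> X) *\<^sub>R ?a - (?b \<bullet> X) *\<^sub>R ?b = ((?a - ?b) \<bullet> X) *\<^sub>R ?a + (?b \<bullet> X) *\<^sub>R (?a - ?b)"
      by (simp add: inner_diff_left algebra_simps)
    then have "norm ((?a \<bullet> X) *\<^sub>R ?a - (?b \<bullet> X) *\<^sub>R ?b)
        \<le> norm (((?a - ?b) \<bullet> X) *\<^sub>R ?a) + norm ((?b \<bullet> X) *\<^sub>R (?a - ?b))"
      using norm_triangle_ineq[of "((?a - ?b) \<bullet> X) *\<^sub>R ?a" "(?b \<bullet> X) *\<^sub>R (?a - ?b)"] by simp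
    also have "\<dots> = \<bar>(?a - ?b) \<bullet> X\<bar> * norm ?a + \<bar>?b \<bullet> X\<bar> * norm (?a - ?b)" by simp
    also have "\<dots> \<le> (norm (?a - ?b) * norm X) * norm ?a + (norm ?b * norm X) * norm (?a - ?b)"
      by (intro add_mono mult_right_mono Cauchy_Schwarz_ineq2) auto
    also have "\<dots> = norm (?a - ?b) * (norm X * (norm ?a + norm ?b))" by (simp add: algebra_simps)
    also have "\<dots> \<le> (\<kappa> * ?h * ?m) * (norm X * ((\<kappa> * ?h + ?d) + (\<kappa> * ?h + ?d)))"
      using kappa_rho by (intro mult_mono mult_left_mono add_mono a b ab) auto
    also have "\<dots> = (2 * \<kappa> * ?m * norm X) * (\<kappa> * (?h * ?h) + ?d * ?h)" by (simp add: algebra_simps)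
    also have "?h * ?h = norm (s i)" by simp
    finally show "norm ((?a \<bullet> X) *\<^sub>R ?a - (?b \<bullet> X) *\<^sub>R ?b) \<le> (2 * \<kappa> * ?m * norm X) * (\<kappa> * norm (s i) + ?d * ?h)" .
  qed
  also have "\<dots> = (2 * \<kappa> * ?m * norm X) * (\<kappa> * avg n (\<lambda>i. norm (s i)) + ?d * avg n (\<lambda>i. sqrt (norm (s i))))"
    by (simp only: avg_mult_left avg_add)
  also have "\<dots> \<le> (2 * \<kappa> * ?m * norm X) * (\<kappa> * K + ?d * K)"
    using H kappa_rho by (intro mult_left_mono add_mono) auto
  also have "\<dots> = 2 * \<kappa> * K * (\<kappa> + ?d) * ?m * norm X" by (simp add: algebra_simps)
  finally have "norm (Sig_avg n s Q X - Sig_avg n s Qs X) \<le> 2 * \<kappa> * K * (\<kappa> + ?d) * ?m * norm X"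
    by (simp add: Sig_avg_def avg_diff)
  moreover have "norm (Sig_avg n s Qs X - Sig X) \<le> \<delta> * norm X" using good X by (simp add: good_def)
  ultimately show ?thesis
    using norm_triangle_ineq[of "Sig_avg n s Q X - Sig_avg n s Qs X" "Sig_avg n s Qs X - Sig X"]
    by (simp add: distrib_right)
qed

end
end
end
end

section \<open>The central limit theorems\<close>

lemma eventually_over_sqrt: "0 < b \<Longrightarrow> \<forall>\<^sub>F n in sequentially. a / sqrt (real n) < (b :: real)"
proof -
  assume b: "0 < b"
  have "(\<lambda>n. a * inverse (sqrt (real n))) \<longlonglongrightarrow> a * 0"
    by (intro tendsto_mult tendsto_const tendsto_inverse_0_at_top
        filterlim_compose[OF sqrt_at_top filterlim_real_sequentially])
  then have "(\<lambda>n. a / sqrt (real n)) \<longlonglongrightarrow> 0" by (simp add: divide_inverse)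
  from order_tendstoD(2)[OF this b] show ?thesis .
qed

lemma linear_norm_le_Basis:
  fixes L :: "'a::euclidean_space \<Rightarrow> 'b::real_normed_vector"
  assumes L: "linear L" and b: "\<And>b. b \<in> Basis \<Longrightarrow> norm (L b) \<le> e / DIM('a)"
  shows "norm (L X) \<le> e * norm X"
proof -
  have "L X = L (\<Sum>b\<in>Basis. (X \<bullet> b) *\<^sub>R b)" by (simp add: euclidean_representation)
  also have "\<dots> = (\<Sum>b\<in>Basis. (X \<bullet> b) *\<^sub>R L b)" by (simp add: linear_sum[OF L] linear_scale[OF L])
  also have "norm \<dots> \<le> (\<Sum>b\<in>(Basis::'a set). norm X * (e / DIM('a)))"
  proof (rule sum_norm_le)
    fix i :: 'a assume i: "i \<in> Basis"
    have "norm ((X \<bullet> i) *\<^sub>R L i) = \<bar>X \<bullet> i\<bar> * norm (L i)" by simp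
    also have "\<dots> \<le> norm X * (e / DIM('a))"
      using Basis_le_norm[OF i, of X] b[OF i] by (intro mult_mono) auto
    finally show "norm ((X \<bullet> i) *\<^sub>R L i) \<le> norm X * (e / DIM('a))" .
  qed
  also have "\<dots> = e * norm X" by simp
  finally show ?thesis .
qed

locale bw_model = bw_local P M A Q0 Qs \<kappa> \<rho> c + iid_sample \<Omega> P S
  for P :: "('d::finite) cmat measure" and M A Q0 Qs \<kappa> \<rho> c and \<Omega> :: "'w measure" and S +
  fixes Qn :: "nat \<Rightarrow> 'w \<Rightarrow> 'd cmat"
  assumes Qn_meas: "\<And>n. n \<ge> 1 \<Longrightarrow> Qn n \<in> borel_measurable \<Omega>"
    and Qn_bary: "\<And>n \<omega>. n \<ge> 1 \<Longrightarrow> \<omega> \<in> space \<Omega> \<Longrightarrow> emp_bw_barycenter n (\<lambda>i. S i \<omega>) A (Qn n \<omega>)"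
begin

sublocale CV: centred_iid_sample \<Omega> P S V
  by unfold_locales (rule V_measurable V_square V_mean)+

lemma S_psd: "i \<ge> 1 \<Longrightarrow> x \<in> space \<Omega> \<Longrightarrow> S i x \<in> psd"
  using S_in_space by (simp add: space_P)

lemma whp_F_avg:
  assumes e: "0 < e"
  shows "whp (\<lambda>n x. n \<ge> 1 \<longrightarrow> (\<forall>X\<in>M. norm (F_avg n (\<lambda>i. S i x) Qs X - F X) \<le> e * norm X))"
proof -
  have int: "integrable P (\<lambda>s. - proj (bwD Qs s (proj b)))" for b
    by (intro integrable_minus integrable_bounded_linear[OF bounded_linear_proj] D_integrable proj_herm)
  have "whp (\<lambda>n x. \<forall>b\<in>Basis. norm (avg n (\<lambda>i. - proj (bwD Qs (S i x) (proj b)))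
      - (\<integral>s. - proj (bwD Qs s (proj b)) \<partial>P)) \<le> e / DIM('d cmat))"
    using e by (intro whp_ball finite_Basis whp_mean int divide_pos_pos) simp_all
  then show ?thesis
  proof (rule whp_mono, intro impI ballI)
    fix n x X
    assume x: "x \<in> space \<Omega>" and n: "n \<ge> 1"
      and b: "\<forall>b\<in>Basis. norm (avg n (\<lambda>i. - proj (bwD Qs (S i x) (proj b)))
        - (\<integral>s. - proj (bwD Qs s (proj b)) \<partial>P)) \<le> e / DIM('d cmat)"
    have "linear (\<lambda>X. F_avg n (\<lambda>i. S i x) Qs X - F X)"
      by (intro linear_compose_sub F_avg_linear[OF n] S_psd x F_linear Qs_pd)
    then show "norm (F_avg n (\<lambda>i. S i x) Qs X - F X) \<le> e * norm X"
      using b by (intro linear_norm_le_Basis[of "\<lambda>X. F_avg n (\<lambda>i. S i x) Qs X - F X"])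
        (simp_all add: F_avg_def F_mean avg_minus)
  qed
qed

lemma whp_Sig_avg:
  assumes e: "0 < e"
  shows "whp (\<lambda>n x. \<forall>X\<in>M. norm (Sig_avg n (\<lambda>i. S i x) Qs X - Sig X) \<le> e * norm X)"
proof -
  have "whp (\<lambda>n x. \<forall>b\<in>Basis. norm (avg n (\<lambda>i. (V (S i x) \<bullet> b) *\<^sub>R V (S i x))
      - (\<integral>s. (V s \<bullet> b) *\<^sub>R V s \<partial>P)) \<le> e / DIM('d cmat))"
    using e by (intro whp_ball finite_Basis whp_mean Sig_integrable divide_pos_pos) simp_all
  then show ?thesis
  proof (rule whp_mono, intro ballI)
    fix n x X
    assume b: "\<forall>b\<in>Basis. norm (avg n (\<lambda>i. (V (S i x) \<bullet> b) *\<^sub>R V (S i x))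
      - (\<integral>s. (V s \<bullet> b) *\<^sub>R V s \<partial>P)) \<le> e / DIM('d cmat)"
    have "linear (\<lambda>X. Sig_avg n (\<lambda>i. S i x) Qs X - Sig X)"
      using Sig_avg_psd Sig_psd by (intro linear_compose_sub) (auto simp: psd_on_def)
    then show "norm (Sig_avg n (\<lambda>i. S i x) Qs X - Sig X) \<le> e * norm X"
      using b by (intro linear_norm_le_Basis[of "\<lambda>X. Sig_avg n (\<lambda>i. S i x) Qs X - Sig X"])
        (simp_all add: Sig_avg_def Sig_def V_at_Qs)
  qed
qed

lemma whp_good:
  "\<exists>K>0. \<forall>\<delta>>0. whp (\<lambda>n x. n \<ge> 1 \<longrightarrow> good \<delta> K n (\<lambda>i. S i x))"
proof -
  let ?m1 = "\<integral>s. sqrt (norm s) \<partial>P" and ?m2 = "\<integral>s. norm s \<partial>P"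
  have m: "0 \<le> ?m1" "0 \<le> ?m2" by (intro Bochner_Integration.integral_nonneg; simp)+
  define K where "K = ?m1 + ?m2 + 1"
  have "whp (\<lambda>n x. n \<ge> 1 \<longrightarrow> good \<delta> K n (\<lambda>i. S i x))" if \<delta>: "0 < \<delta>" for \<delta>
  proof -
    have "whp (\<lambda>n x. (\<bar>avg n (\<lambda>i. sqrt (norm (S i x))) - ?m1\<bar> < 1 \<and> \<bar>avg n (\<lambda>i. norm (S i x)) - ?m2\<bar> < 1) \<and>
        (n \<ge> 1 \<longrightarrow> (\<forall>X\<in>M. norm (F_avg n (\<lambda>i. S i x) Qs X - F X) \<le> \<delta> * norm X)) \<and>
        (\<forall>X\<in>M. norm (Sig_avg n (\<lambda>i. S i x) Qs X - Sig X) \<le> \<delta> * norm X))"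
      by (intro whp_conj whp_F_avg whp_Sig_avg \<delta> whp_mean_real sqrt_norm_integrable norm_integrable zero_less_one)
    then show ?thesis
    proof (rule whp_mono, intro impI)
      fix n x
      assume *: "(\<bar>avg n (\<lambda>i. sqrt (norm (S i x))) - ?m1\<bar> < 1 \<and> \<bar>avg n (\<lambda>i. norm (S i x)) - ?m2\<bar> < 1) \<and>
        (n \<ge> 1 \<longrightarrow> (\<forall>X\<in>M. norm (F_avg n (\<lambda>i. S i x) Qs X - F X) \<le> \<delta> * norm X)) \<and>
        (\<forall>X\<in>M. norm (Sig_avg n (\<lambda>i. S i x) Qs X - Sig X) \<le> \<delta> * norm X)" and n: "n \<ge> 1"
      have "avg n (\<lambda>i. sqrt (norm (S i x))) \<le> K" "avg n (\<lambda>i. norm (S i x)) \<le> K"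
        using * m unfolding K_def by linarith+
      then show "good \<delta> K n (\<lambda>i. S i x)" using * n unfolding good_def by blast
    qed
  qed
  moreover have "0 < K" using m unfolding K_def by linarith
  ultimately show ?thesis by blast
qed

text \<open>The quantity whose limit law is sought.\<close>

definition err :: "nat \<Rightarrow> 'w \<Rightarrow> 'd cmat" where
  "err n x = sqrt (real n) *\<^sub>R (Qn n x - Qs)"

text \<open>What is known about a sample of large size with high probability: the rescaled error is bounded
  by \<open>K\<close>, it solves the linearised equation up to \<open>\<eta>\<close>, and the plug-in operators are \<open>\<eta>\<close>-close to their
  limits.\<close>

definition regular :: "real \<Rightarrow> real \<Rightarrow> nat \<Rightarrow> 'w \<Rightarrow> bool" where
  "regular K \<eta> n x \<longleftrightarrow> n \<ge> 1 \<and> Qn n x \<in> pd \<and> Qn n x - Qs \<in> M \<and> norm (err n x) \<le> K \<and>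
     norm (F (err n x) - CV.normalized_sum n x) \<le> \<eta> \<and>
     (\<forall>X\<in>M. norm (F_avg n (\<lambda>i. S i x) (Qn n x) X - F X) \<le> \<eta> * norm X) \<and>
     (\<forall>X\<in>M. norm (Sig_avg n (\<lambda>i. S i x) (Qn n x) X - Sig X) \<le> \<eta> * norm X)"

text \<open>The bound \<open>K\<close> comes from the tightness of the normalised sum and is fixed before \<open>\<eta>\<close>, so that \<open>\<eta>\<close> may later
  be chosen depending on \<open>K\<close>.\<close>

lemma likely_regular:
  assumes e: "0 < e"
  shows "\<exists>K>0. \<forall>\<eta>>0. likely e (regular K \<eta>)"
proof -
  obtain K where K: "0 < K" and good: "\<And>\<delta>. 0 < \<delta> \<Longrightarrow> whp (\<lambda>n x. n \<ge> 1 \<longrightarrow> good \<delta> K n (\<lambda>i. S i x))"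
    using whp_good by blast
  obtain K0 where K0: "0 < K0" and tight: "likely (e / 2) (\<lambda>n x. norm (CV.normalized_sum n x) \<le> K0)"
    using CV.normalized_sum_tight[of "e / 2"] e by auto
  define K1 where "K1 = K0 / c"
  have K1: "0 < K1" using K0 c by (simp add: K1_def)
  \<comment> \<open>The radius on which the Taylor remainder is at most \<open>c / 2\<close>.\<close>
  define r where "r = min \<rho> (c / (2 * (\<kappa> * K)))"
  have kK: "0 < \<kappa> * K" using kappa_rho K by simp
  have r: "0 < r" "r \<le> \<rho>" "\<kappa> * K * r \<le> c / 2"
  proof -
    show "0 < r" "r \<le> \<rho>" using kappa_rho c kK by (auto simp: r_def)
    have "\<kappa> * K * r \<le> \<kappa> * K * (c / (2 * (\<kappa> * K)))"
      using kK by (intro mult_left_mono) (auto simp: r_def)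
    also have "\<dots> = c / 2" using kappa_rho(1) K by simp
    finally show "\<kappa> * K * r \<le> c / 2" .
  qed
  define C where "C = \<kappa> * K + 2 * \<kappa> * K * (\<kappa> + norm (mat 1 :: 'd cmat))"
  have C: "\<kappa> * K \<le> C" "2 * \<kappa> * K * (\<kappa> + norm (mat 1 :: 'd cmat)) \<le> C"
    using kK kappa_rho K by (auto simp: C_def)
  have "likely e (regular K1 \<eta>)" if \<eta>: "0 < \<eta>" for \<eta>
  proof -
    define \<delta> where "\<delta> = min (c / 2) (min (\<eta> / 2) (\<eta> / (2 * K1)))"
    have \<delta>: "0 < \<delta>" "\<delta> \<le> c / 2" "\<delta> \<le> \<eta> / 2" "\<delta> * K1 \<le> \<eta> / 2"
    proof -
      show "0 < \<delta>" "\<delta> \<le> c / 2" "\<delta> \<le> \<eta> / 2" using c \<eta> K1 by (auto simp: \<delta>_def)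
      have "\<delta> * K1 \<le> \<eta> / (2 * K1) * K1" using K1 by (intro mult_right_mono) (auto simp: \<delta>_def)
      also have "\<dots> = \<eta> / 2" using K1 by simp
      finally show "\<delta> * K1 \<le> \<eta> / 2" .
    qed
    have lk: "likely e (\<lambda>n x. norm (CV.normalized_sum n x) \<le> K0 \<and> (n \<ge> 1 \<longrightarrow> good \<delta> K n (\<lambda>i. S i x)))"
      using e by (intro likely_whp_conj[OF tight good[OF \<delta>(1)]]) simp
    have cr: "0 < c * r" and \<eta>2: "0 < \<eta> / 2" using c r \<eta> by simp_all
    have "\<forall>\<^sub>F n in sequentially. \<forall>x\<in>space \<Omega>.
        norm (CV.normalized_sum n x) \<le> K0 \<and> (n \<ge> 1 \<longrightarrow> good \<delta> K n (\<lambda>i. S i x)) \<longrightarrow> regular K1 \<eta> n x"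
      using eventually_over_sqrt[OF cr, of K0] eventually_over_sqrt[OF \<eta>2, of "\<kappa> * K * K1\<^sup>2"]
        eventually_over_sqrt[OF \<eta>2, of "C * K1"] eventually_ge_at_top[of 1]
    proof eventually_elim
      case (elim n)
      show ?case
      proof (intro ballI impI)
        fix x assume x: "x \<in> space \<Omega>"
          and *: "norm (CV.normalized_sum n x) \<le> K0 \<and> (n \<ge> 1 \<longrightarrow> good \<delta> K n (\<lambda>i. S i x))"
        define s where "s = (\<lambda>i. S i x)"
        define Q where "Q = Qn n x"
        define W where "W = avg n (\<lambda>i. V (s i))"
        have n: "n \<ge> 1" by (rule elim(4))
        have g: "good \<delta> K n s" using * n by (simp add: s_def)
        have ns: "CV.normalized_sum n x = sqrt (real n) *\<^sub>R W"
          by (simp add: CV.normalized_sum_def W_def s_def)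
        have sn: "0 < sqrt (real n)" using n by simp
        have nW: "sqrt (real n) * norm W \<le> K0" using * ns by simp
        then have Wle: "norm W \<le> K0 / sqrt (real n)" using sn by (simp add: pos_le_divide_eq mult.commute)
        then have W: "norm (avg n (\<lambda>i. V (s i))) < c * r" using elim(1) \<eta> unfolding W_def by linarith
        have s: "\<And>i. i \<ge> 1 \<Longrightarrow> s i \<in> psd" using S_psd x by (simp add: s_def)
        have emp: "emp_bw_barycenter n s A Q" using Qn_bary[OF n x] by (simp add: s_def Q_def)
        note facts = n s g \<delta>(2) K r emp W
        define X where "X = Q - Qs"
        have X: "X \<in> M" unfolding X_def by (rule emp_mem(2)[OF facts])
        have rate: "c * norm X \<le> norm W" unfolding X_def W_def by (rule emp_rate[OF facts])
        have er: "err n x = sqrt (real n) *\<^sub>R X" by (simp add: err_def X_def Q_def)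
        have nX: "sqrt (real n) * norm X \<le> K1"
        proof -
          have "c * (sqrt (real n) * norm X) = sqrt (real n) * (c * norm X)" by simp
          also have "\<dots> \<le> sqrt (real n) * norm W" using rate sn by (intro mult_left_mono) auto
          also have "\<dots> \<le> K0" by (rule nW)
          finally show ?thesis using c by (simp add: K1_def pos_le_divide_eq mult.commute)
        qed
        then have Xle: "norm X \<le> K1 / sqrt (real n)" using sn by (simp add: pos_le_divide_eq mult.commute)
        have lin: "norm (F (err n x) - CV.normalized_sum n x) \<le> \<eta>"
        proof -
          have "norm (F (err n x) - CV.normalized_sum n x) = sqrt (real n) * norm (F X - W)"
            unfolding er ns linear_scale[OF F_linear] scaleR_diff_right[symmetric] by simp
          also have "\<dots> \<le> sqrt (real n) * (\<delta> * norm X + \<kappa> * K * (norm X)\<^sup>2)"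
            using emp_linearization[OF facts] sn unfolding X_def W_def by (intro mult_left_mono) auto
          also have "\<dots> = \<delta> * (sqrt (real n) * norm X) + \<kappa> * K * ((sqrt (real n) * norm X) * norm X)"
            by (simp add: algebra_simps power2_eq_square)
          also have "\<dots> \<le> \<delta> * K1 + \<kappa> * K * (K1 * (K1 / sqrt (real n)))"
            using nX Xle \<delta>(1) kK K1 by (intro add_mono mult_left_mono mult_mono) auto
          also have "\<kappa> * K * (K1 * (K1 / sqrt (real n))) = \<kappa> * K * K1\<^sup>2 / sqrt (real n)"
            by (simp add: power2_eq_square)
          also have "\<delta> * K1 + \<kappa> * K * K1\<^sup>2 / sqrt (real n) \<le> \<eta>" using \<delta>(4) elim(2) \<eta> by linarith
          finally show ?thesis .
        qed
        have small: "\<delta> + a * norm X \<le> \<eta>" if "a \<le> C" for a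
        proof -
          have "a * norm X \<le> C * norm X" using that by (intro mult_right_mono) auto
          also have "\<dots> \<le> C * (K1 / sqrt (real n))" using Xle C(1) kK by (intro mult_left_mono) auto
          also have "\<dots> < \<eta> / 2" using elim(3) \<eta> by simp
          finally show ?thesis using \<delta>(3) by linarith
        qed
        have "norm (F_avg n s Q Y - F Y) \<le> \<eta> * norm Y" if Y: "Y \<in> M" for Y
          using emp_F_close[OF facts Y] mult_right_mono[OF small[OF C(1)], of "norm Y"]
          unfolding X_def by simp
        moreover have "norm (Sig_avg n s Q Y - Sig Y) \<le> \<eta> * norm Y" if Y: "Y \<in> M" for Y
          using emp_Sig_close[OF facts Y] mult_right_mono[OF small[OF C(2)], of "norm Y"]
          unfolding X_def by simp
        ultimately show "regular K1 \<eta> n x"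
          unfolding regular_def
          using n emp_pd[OF facts] X nX lin by (simp add: er X_def s_def Q_def)
      qed
    qed
    from likely_mono[OF lk this] show ?thesis .
  qed
  then show ?thesis using K1 by blast
qed

lemma regular_err_mem: "regular K \<eta> n x \<Longrightarrow> err n x \<in> M"
  using M_subspace by (simp add: regular_def err_def subspace_mul)

lemma normalized_sum_mem: "CV.normalized_sum n x \<in> M"
  unfolding CV.normalized_sum_def by (intro subspace_mul[OF M_subspace] avg_mem V_mem)

text \<open>The inverse of \<open>F\<close> on \<open>M\<close>, extended to a linear map.\<close>

definition L :: "'d cmat \<Rightarrow> 'd cmat" where
  "L X = inv_into M F (proj X)"

lemma L_psd: "psd_on M L"
  unfolding L_def[abs_def] by (rule coercive_inv_psd[OF M_subspace F_coercive_c F_symmetric])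

lemma L_linear: "linear L"
  using L_psd by (simp add: psd_on_def)

lemma L_mem: "L X \<in> M"
  unfolding L_def by (rule coercive_inv(1)[OF M_subspace F_coercive_c proj_mem])

lemma F_L: "X \<in> M \<Longrightarrow> F (L X) = X"
  using coercive_inv(2)[OF M_subspace F_coercive_c, of X] by (simp add: L_def proj_id)

lemma L_F: "X \<in> M \<Longrightarrow> L (F X) = X"
  using coercive_inv_unique[OF M_subspace F_coercive_c, of X] by (simp add: L_def proj_id F_mem)

lemma L_norm: "X \<in> M \<Longrightarrow> norm (L X) \<le> norm X / (2 * c)"
  using coercive_inv(3)[OF M_subspace F_coercive_c, of X] by (simp add: L_def proj_id)

text \<open>The asymptotic covariance operator.\<close>

definition C :: "'d cmat \<Rightarrow> 'd cmat" where
  "C X = L (Sig (L X))"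

lemma C_psd: "psd_on M C"
  unfolding C_def[abs_def] by (rule psd_on_sandwich[OF M_subspace L_psd Sig_psd])

lemma Xi_op_eq:
  assumes X: "X \<in> M"
  shows "Xi_op P M Qs X = C X"
proof -
  have inv: "inv_into M (F_op P M Qs) = inv_into M F" by (rule inv_into_cong_on[OF M_subspace F_op_eq])
  have "inv_into M F X = L X" using X by (simp add: L_def proj_id)
  then show ?thesis
    by (simp add: Xi_op_def inv compress_Sigma_op_eq[OF L_mem] C_def L_def[of "Sig _"] proj_id Sig_mem)
qed

lemma regular_L:
  assumes reg: "regular K \<eta> n x"
  shows "norm (err n x - L (CV.normalized_sum n x)) \<le> \<eta> / (2 * c)"
proof -
  have e: "err n x \<in> M" by (rule regular_err_mem[OF reg])
  have d: "F (err n x) - CV.normalized_sum n x \<in> M"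
    by (intro subspace_diff[OF M_subspace] F_mem normalized_sum_mem)
  have "err n x - L (CV.normalized_sum n x) = L (F (err n x) - CV.normalized_sum n x)"
    by (simp add: linear_diff[OF L_linear] L_F[OF e])
  also have "norm \<dots> \<le> norm (F (err n x) - CV.normalized_sum n x) / (2 * c)" by (rule L_norm[OF d])
  also have "\<dots> \<le> \<eta> / (2 * c)" using reg c by (intro divide_right_mono) (auto simp: regular_def)
  finally show ?thesis .
qed

text \<open>The rescaled errors behave like linear images of the normalised sum of \<open>V\<close>; those are themselves
  normalised sums of a centred sample, and \<open>B'\<close> is the adjoint of \<open>B\<close> relative to \<open>M\<close>.\<close>

lemma linear_image_sample:
  assumes B: "linear B" and adj: "\<And>X s. X \<bullet> B (V s) = B' X \<bullet> V s"
  shows "centred_iid_sample \<Omega> P S (\<lambda>s. B (V s))"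
    and "(\<integral>s. (X \<bullet> B (V s))\<^sup>2 \<partial>P) = Sig (B' X) \<bullet> B' X"
    and "centred_iid_sample.normalized_sum S (\<lambda>s. B (V s)) n x = B (CV.normalized_sum n x)"
proof -
  have bl: "bounded_linear B" using B by (simp add: linear_conv_bounded_linear)
  obtain b where b: "0 < b" "\<And>X. norm (B X) \<le> b * norm X" using linear_bounded_pos[OF B] by blast
  have meas: "(\<lambda>s. B (V s)) \<in> borel_measurable P"
    using V_measurable borel_measurable_continuous_onI[OF linear_continuous_on[OF bl]]
    by (rule measurable_compose)
  show 1: "centred_iid_sample \<Omega> P S (\<lambda>s. B (V s))"
  proof unfold_locales
    show "(\<lambda>s. B (V s)) \<in> borel_measurable P" by (rule meas)
    show "integrable P (\<lambda>s. (norm (B (V s)))\<^sup>2)"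
    proof (rule Bochner_Integration.integrable_bound)
      show "integrable P (\<lambda>s. b\<^sup>2 * (norm (V s))\<^sup>2)" using V_square by simp
      show "AE s in P. norm ((norm (B (V s)))\<^sup>2) \<le> norm (b\<^sup>2 * (norm (V s))\<^sup>2)"
      proof (rule AE_I2)
        fix s
        have "(norm (B (V s)))\<^sup>2 \<le> (b * norm (V s))\<^sup>2" using b(2) by (intro power_mono) auto
        then show "norm ((norm (B (V s)))\<^sup>2) \<le> norm (b\<^sup>2 * (norm (V s))\<^sup>2)" by (simp add: power_mult_distrib)
      qed
    qed (use meas in measurable)
    show "(\<integral>s. B (V s) \<partial>P) = 0"
      using integral_bounded_linear[OF bl CV.V_integrable] by (simp add: V_mean linear_0[OF B])
  qed
  show "(\<integral>s. (X \<bullet> B (V s))\<^sup>2 \<partial>P) = Sig (B' X) \<bullet> B' X"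
    unfolding adj Sig_inner by (simp add: power2_eq_square inner_commute)
  show "centred_iid_sample.normalized_sum S (\<lambda>s. B (V s)) n x = B (CV.normalized_sum n x)"
    unfolding centred_iid_sample.normalized_sum_def[OF 1] CV.normalized_sum_def
    by (simp add: linear_scale[OF B] avg_linear[OF B])
qed

lemma L_adjoint: "X \<bullet> L (V s) = L (proj X) \<bullet> V s"
proof -
  have "X \<bullet> L (V s) = proj X \<bullet> L (V s)" by (simp add: proj_inner[OF L_mem])
  also have "\<dots> = L (proj X) \<bullet> V s" using L_psd proj_mem V_mem by (simp add: psd_on_def)
  finally show ?thesis .
qed

theorem clt_barycenter:
  "\<exists>N. centred_gaussian M (Xi_op P M Qs) N \<and>
     weak_conv_law (\<lambda>n. distr \<Omega> borel (\<lambda>\<omega>. sqrt (real n) *\<^sub>R (Qn n \<omega> - Qs))) N"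
proof -
  obtain N where N: "prob_space N" "sets N = sets borel" "centred_gaussian M C N"
    and marg: "\<And>X. distr N borel (\<lambda>Z. X \<bullet> Z) = normal_law (sqrt (C (proj X) \<bullet> proj X))"
    using gaussian_on_subspace_exists[OF M_subspace C_psd] by blast
  interpret CL: centred_iid_sample \<Omega> P S "\<lambda>s. L (V s)"
    by (rule linear_image_sample(1)[OF L_linear L_adjoint])
  have "weak_conv_law (\<lambda>n. distr \<Omega> borel (err n)) N"
  proof (rule CL.clt_perturbation[OF N(1,2)])
    fix X
    have "Sig (L (proj X)) \<bullet> L (proj X) = C (proj X) \<bullet> proj X"
      using L_psd proj_mem Sig_mem by (simp add: C_def psd_on_def)
    then show "distr N borel (\<lambda>Z. X \<bullet> Z) = normal_law (sqrt (\<integral>s. (X \<bullet> L (V s))\<^sup>2 \<partial>P))"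
      unfolding marg linear_image_sample(2)[OF L_linear L_adjoint] by simp
  next
    show "err n \<in> borel_measurable \<Omega>" if "n \<ge> 1" for n
      using Qn_meas[OF that] unfolding err_def[abs_def] by measurable
  next
    fix e :: real assume e: "0 < e"
    then obtain K where K: "\<forall>\<eta>>0. likely e (regular K \<eta>)" using likely_regular by blast
    have "0 < 2 * c * e" using c e by simp
    with K have "likely e (regular K (2 * c * e))" by blast
    then show "likely e (\<lambda>n x. norm (err n x - CL.normalized_sum n x) \<le> e)"
    proof (rule likely_mono, intro always_eventually allI ballI impI)
      fix n x assume "regular K (2 * c * e) n x"
      from regular_L[OF this] c show "norm (err n x - CL.normalized_sum n x) \<le> e"
        by (simp add: linear_image_sample(3)[OF L_linear L_adjoint])
    qed
  qed
  moreover have "centred_gaussian M (Xi_op P M Qs) N"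
    using N(3) by (simp add: centred_gaussian_def Xi_op_eq)
  ultimately show ?thesis unfolding err_def[abs_def] by blast
qed

text \<open>On a regular sample the plug-in covariance operator is close to \<open>C\<close> by the perturbation bound for
  \<open>F\<^sup>-\<^sup>1 \<Sigma> F\<^sup>-\<^sup>1\<close>, its root is close to the root \<open>R\<close> of \<open>C\<close> by Hoelder continuity, and coercivity of \<open>R\<close> passes to
  the perturbed root and bounds the difference of the inverses.\<close>

lemma regular_standardized:
  assumes R: "psd_on M R" "\<And>X. X \<in> M \<Longrightarrow> R (R X) = C X" "coercive_on M \<beta> R"
    and sb: "0 \<le> b" "\<And>X. norm (Sig X) \<le> b * norm X"
    and reg: "regular K \<eta> n x" and x: "x \<in> space \<Omega>" and \<eta>: "0 \<le> \<eta>" "\<eta> \<le> c"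
    and \<theta>: "sqrt ((1 / c\<^sup>2 + 2 * b / c ^ 3) * \<eta>) \<le> \<theta>" "\<theta> \<le> \<beta> / 2"
  defines "R' \<equiv> op_sqrt M (Xi_hat n (\<lambda>i. S i x) M (Qn n x))"
  shows "Xi_hat_well_defined n (\<lambda>i. S i x) M (Qn n x)"
    and "norm (sqrt (real n) *\<^sub>R inv_into M R' (Qn n x - Qs) - inv_into M R (err n x)) \<le> \<theta> / (\<beta> / 2)\<^sup>2 * K"
proof -
  define s where "s = (\<lambda>i. S i x)"
  define Q where "Q = Qn n x"
  define G where "G = F_avg n s Q"
  define E where "E = Sig_avg n s Q"
  have n: "n \<ge> 1" and Q: "Q \<in> pd" and Qm: "Q - Qs \<in> M" and eK: "norm (err n x) \<le> K"
    and FG: "\<And>X. X \<in> M \<Longrightarrow> norm (G X - F X) \<le> \<eta> * norm X"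
    and SE: "\<And>X. X \<in> M \<Longrightarrow> norm (E X - Sig X) \<le> \<eta> * norm X"
    using reg by (auto simp: regular_def G_def E_def s_def Q_def)
  have s: "\<And>i. i \<ge> 1 \<Longrightarrow> s i \<in> psd" using S_psd x by (simp add: s_def)
  have \<beta>: "0 < \<beta>" using R(3) by (simp add: coercive_on_def[OF M_subspace])
  have weaken: "coercive_on M a f" if "coercive_on M a' f" "0 < a" "a \<le> a'" for a a' and f :: "'d cmat \<Rightarrow> 'd cmat"
    using that mult_right_mono[OF that(3)] unfolding coercive_on_def[OF M_subspace]
    by (meson order_trans zero_le_power2)
  have Gm: "G ` M \<subseteq> M" unfolding G_def using F_avg_mem by blast
  have Gc0: "coercive_on M (2 * c - \<eta>) G"
    using \<eta> c by (intro coercive_perturb[OF M_subspace F_coercive_c _ Gm FG])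
      (auto simp: G_def intro: F_avg_linear[OF n s Q])
  have Gc: "coercive_on M c G" by (rule weaken[OF Gc0 c]) (use \<eta> in simp)
  have Fc: "coercive_on M c F" using c by (intro weaken[OF F_coercive_c]) simp_all
  have Gsym: "G X \<bullet> Y = X \<bullet> G Y" if "X \<in> M" "Y \<in> M" for X Y
    unfolding G_def by (rule F_avg_symmetric[OF n s Q that])
  have Epsd: "psd_on M E" unfolding E_def by (rule Sig_avg_psd)
  have Em: "E ` M \<subseteq> M" using Epsd by (simp add: psd_on_def)
  define H where "H X = inv_into M G (proj X)" for X
  have H_psd: "psd_on M H"
    unfolding H_def[abs_def] by (rule coercive_inv_psd[OF M_subspace Gc Gsym])
  have Hm: "H X \<in> M" for X unfolding H_def by (rule coercive_inv(1)[OF M_subspace Gc proj_mem])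
  have HE_psd: "psd_on M (\<lambda>X. H (E (H X)))" by (rule psd_on_sandwich[OF M_subspace H_psd Epsd])
  have inv_eq: "inv_into M (F_hat n s M Q) = inv_into M G"
    unfolding G_def by (rule inv_into_cong_on[OF M_subspace F_hat_eq[OF n s Q]])
  have Xi_eq: "Xi_hat n s M Q X = H (E (H X))" if X: "X \<in> M" for X
  proof -
    have HX: "inv_into M G X = H X" using X by (simp add: H_def proj_id)
    have "E (H X) \<in> M" using Em Hm by blast
    then show ?thesis
      by (simp add: Xi_hat_def inv_eq HX compress_Sigma_hat_eq[OF n s Q Hm] E_def[symmetric] H_def[of "E _"] proj_id)
  qed
  have R'_def': "R' = op_sqrt M (Xi_hat n s M Q)" by (simp add: R'_def s_def Q_def)
  have R': "psd_on M R'" "\<And>X. X \<in> M \<Longrightarrow> R' (R' X) = H (E (H X))"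
    unfolding R'_def' using op_sqrt_props[OF M_subspace HE_psd, of "Xi_hat n s M Q"] Xi_eq by blast+
  let ?B = "(1 / c\<^sup>2 + 2 * b / c ^ 3) * \<eta>"
  have Xi_close: "norm (R' (R' X) - R (R X)) \<le> ?B * norm X" if X: "X \<in> M" for X
  proof -
    have Sm: "Sig ` M \<subseteq> M" using Sig_mem by blast
    have Slin: "linear Sig" using Sig_psd by (simp add: psd_on_def)
    have "norm (inv_into M G (E (inv_into M G X)) - inv_into M F (Sig (inv_into M F X))) \<le> ?B * norm X"
      by (rule sandwich_inv_perturb[OF M_subspace Fc Gc FG Slin Sm sb(2) Em SE \<eta>(1) sb(1) X])
    moreover have "inv_into M G (E (inv_into M G X)) = H (E (H X))"
      using X Em Hm[of X] by (simp add: H_def proj_id image_subset_iff)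
    moreover have "inv_into M F (Sig (inv_into M F X)) = C X"
      using X by (simp add: C_def L_def proj_id Sig_mem)
    ultimately show ?thesis by (simp add: R'(2)[OF X] R(2)[OF X])
  qed
  have RR: "norm (R' X - R X) \<le> \<theta> * norm X" if X: "X \<in> M" for X
  proof -
    have "norm (R' X - R X) \<le> sqrt ?B * norm X"
      by (rule psd_on_sqrt_hoelder[OF M_subspace R'(1) R(1) Xi_close X])
    also have "\<dots> \<le> \<theta> * norm X" using \<theta>(1) by (intro mult_right_mono) auto
    finally show ?thesis .
  qed
  have R'c0: "coercive_on M (\<beta> - \<theta>) R'"
    using R'(1) \<theta>(2) \<beta> by (intro coercive_perturb[OF M_subspace R(3) _ _ RR]) (auto simp: psd_on_def)
  have R'c: "coercive_on M (\<beta> / 2) R'" by (rule weaken[OF R'c0]) (use \<theta>(2) \<beta> in simp_all)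
  have Rc: "coercive_on M (\<beta> / 2) R" using \<beta> by (intro weaken[OF R(3)]) simp_all
  have "bij_betw (F_hat n s M Q) M M"
    using coercive_bij[OF M_subspace Gc] bij_betw_cong[of M "F_hat n s M Q" G M] F_hat_eq[OF n s Q]
    by (simp add: G_def)
  moreover have "bij_betw (Xi_hat n s M Q) M M"
  proof -
    have "bij_betw (R' \<circ> R') M M"
      by (rule bij_betw_trans[OF coercive_bij[OF M_subspace R'c] coercive_bij[OF M_subspace R'c]])
    then show ?thesis
      using bij_betw_cong[of M "Xi_hat n s M Q" "R' \<circ> R'" M] by (simp add: Xi_eq R'(2))
  qed
  ultimately show "Xi_hat_well_defined n (\<lambda>i. S i x) M (Qn n x)"
    using Q by (simp add: Xi_hat_well_defined_def s_def Q_def)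
  have e: "err n x \<in> M" by (rule regular_err_mem[OF reg])
  have "sqrt (real n) *\<^sub>R inv_into M R' (Q - Qs) = inv_into M R' (err n x)"
    using linear_scale[OF coercive_inv_linear[OF M_subspace R'c], of "sqrt (real n)" "Q - Qs"] Qm e
    by (simp add: proj_id err_def Q_def)
  moreover have "norm (inv_into M R' (err n x) - inv_into M R (err n x)) \<le> \<theta> / (\<beta> / 2)\<^sup>2 * norm (err n x)"
    by (rule coercive_inv_diff[OF M_subspace Rc R'c RR e])
  moreover have "\<theta> / (\<beta> / 2)\<^sup>2 * norm (err n x) \<le> \<theta> / (\<beta> / 2)\<^sup>2 * K"
  proof (rule mult_left_mono[OF eK])
    have "0 \<le> sqrt ?B" using \<eta>(1) sb(1) c by simp
    from this \<theta>(1) have "0 \<le> \<theta>" by (rule order_trans)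
    then show "0 \<le> \<theta> / (\<beta> / 2)\<^sup>2" by simp
  qed
  ultimately show "norm (sqrt (real n) *\<^sub>R inv_into M R' (Qn n x - Qs) - inv_into M R (err n x)) \<le> \<theta> / (\<beta> / 2)\<^sup>2 * K"
    by (simp add: Q_def)
qed

text \<open>With \<open>J\<close> the inverse of the root \<open>R\<close> of \<open>C\<close>, the statistic is close to the image of the normalised sum
  under \<open>J L\<close>, and \<open>(J L) \<Sigma> (L J) = J C J\<close> is the identity of \<open>M\<close>.\<close>

theorem clt_standardized:
  assumes nd: "\<forall>X\<in>hermitian. Sigma_op P Qs X = 0 \<longrightarrow> X = 0"
    and Y_meas: "\<And>n. n \<ge> 1 \<Longrightarrow> Y n \<in> borel_measurable \<Omega>"
    and Y: "\<And>n \<omega>. n \<ge> 1 \<Longrightarrow> \<omega> \<in> space \<Omega> \<Longrightarrow> Xi_hat_well_defined n (\<lambda>i. S i \<omega>) M (Qn n \<omega>) \<Longrightarrow>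
      Y n \<omega> = sqrt (real n) *\<^sub>R inv_into M (op_sqrt M (Xi_hat n (\<lambda>i. S i \<omega>) M (Qn n \<omega>))) (Qn n \<omega> - Qs)"
  shows "\<exists>N. centred_gaussian M id N \<and> weak_conv_law (\<lambda>n. distr \<Omega> borel (Y n)) N"
proof -
  have L_inj: "X = 0" if "X \<in> M" "L X = 0" for X
    using F_L[OF that(1)] that(2) linear_0[OF F_linear] by simp
  obtain R where R: "psd_on M R" "\<And>X. X \<in> M \<Longrightarrow> R (R X) = C X"
    using psd_on_sqrt_exists[OF M_subspace C_psd] by blast
  have "\<exists>\<beta>. coercive_on M \<beta> R"
  proof (rule psd_on_sqrt_coercive[OF M_subspace R(1)])
    fix X assume X: "X \<in> M" "R (R X) = 0"
    then have "L (Sig (L X)) = 0" using R(2) by (simp add: C_def)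
    then have "Sig (L X) = 0" by (rule L_inj[OF Sig_mem])
    then have "L X = 0" by (rule Sig_nondegenerate[OF nd L_mem])
    then show "X = 0" by (rule L_inj[OF X(1)])
  qed
  then obtain \<beta> where Rc: "coercive_on M \<beta> R" by blast
  then have \<beta>: "0 < \<beta>" by (simp add: coercive_on_def[OF M_subspace])
  have Rsym: "R X \<bullet> Y = X \<bullet> R Y" if "X \<in> M" "Y \<in> M" for X Y using R(1) that unfolding psd_on_def by blast
  define J where "J X = inv_into M R (proj X)" for X
  have J_psd: "psd_on M J" unfolding J_def[abs_def] by (rule coercive_inv_psd[OF M_subspace Rc Rsym])
  have J_mem: "J X \<in> M" for X unfolding J_def by (rule coercive_inv(1)[OF M_subspace Rc proj_mem])
  have RJ: "R (J X) = X" if "X \<in> M" for X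
    using coercive_inv(2)[OF M_subspace Rc that] that by (simp add: J_def proj_id)
  have J_norm: "norm (J X) \<le> norm X / \<beta>" if "X \<in> M" for X
    using coercive_inv(3)[OF M_subspace Rc that] that by (simp add: J_def proj_id)
  have J_lin: "linear J" using J_psd by (simp add: psd_on_def)
  have JL_lin: "linear (\<lambda>X. J (L X))" using linear_compose[OF L_linear J_lin] by (simp add: comp_def)
  have adj: "X \<bullet> J (L (V s)) = L (J (proj X)) \<bullet> V s" for X s
  proof -
    have "X \<bullet> J (L (V s)) = proj X \<bullet> J (L (V s))" by (simp add: proj_inner[OF J_mem])
    also have "\<dots> = J (proj X) \<bullet> L (V s)" using J_psd proj_mem L_mem by (simp add: psd_on_def)
    also have "\<dots> = L (J (proj X)) \<bullet> V s" using L_psd J_mem V_mem by (simp add: psd_on_def)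
    finally show ?thesis .
  qed
  have "psd_on M id" by (auto simp: psd_on_def linear_id)
  from gaussian_on_subspace_exists[OF M_subspace this]
  obtain N where N: "prob_space N" "sets N = sets borel" "centred_gaussian M id N"
    and marg: "\<And>X. distr N borel (\<lambda>Z. X \<bullet> Z) = normal_law (sqrt (id (proj X) \<bullet> proj X))" by blast
  interpret CJ: centred_iid_sample \<Omega> P S "\<lambda>s. J (L (V s))"
    by (rule linear_image_sample(1)[OF JL_lin adj])
  have Slin: "linear Sig" using Sig_psd by (simp add: psd_on_def)
  obtain b where b: "0 < b" "\<And>X. norm (Sig X) \<le> b * norm X" using linear_bounded_pos[OF Slin] by blast
  define B where "B = 1 / c\<^sup>2 + 2 * b / c ^ 3"
  have B: "0 < B" using c b(1) by (simp add: B_def add_pos_pos)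
  have "weak_conv_law (\<lambda>n. distr \<Omega> borel (Y n)) N"
  proof (rule CJ.clt_perturbation[OF N(1,2) _ Y_meas])
    fix X
    have "Sig (L (J (proj X))) \<bullet> L (J (proj X)) = C (J (proj X)) \<bullet> J (proj X)"
      using L_psd J_mem Sig_mem by (simp add: C_def psd_on_def)
    also have "\<dots> = R (R (J (proj X))) \<bullet> J (proj X)" by (simp add: R(2) J_mem)
    also have "\<dots> = R (J (proj X)) \<bullet> R (J (proj X))"
      by (rule Rsym) (simp_all add: RJ proj_mem J_mem)
    also have "\<dots> = proj X \<bullet> proj X" by (simp add: RJ proj_mem)
    finally show "distr N borel (\<lambda>Z. X \<bullet> Z) = normal_law (sqrt (\<integral>s. (X \<bullet> J (L (V s)))\<^sup>2 \<partial>P))"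
      unfolding marg linear_image_sample(2)[OF JL_lin adj] by simp
  next
    fix e :: real assume e: "0 < e"
    then obtain K where K: "0 < K" "\<forall>\<eta>>0. likely e (regular K \<eta>)" using likely_regular by blast
    \<comment> \<open>The admissible distance of the roots, then the accuracy of the operators that guarantees it.\<close>
    define \<theta> where "\<theta> = min (\<beta> / 2) (e * (\<beta> / 2)\<^sup>2 / (2 * K))"
    have \<theta>: "0 < \<theta>" "\<theta> \<le> \<beta> / 2" "\<theta> / (\<beta> / 2)\<^sup>2 * K \<le> e / 2"
    proof -
      show "0 < \<theta>" "\<theta> \<le> \<beta> / 2" using \<beta> e K(1) by (auto simp: \<theta>_def)
      have "\<theta> / (\<beta> / 2)\<^sup>2 * K \<le> (e * (\<beta> / 2)\<^sup>2 / (2 * K)) / (\<beta> / 2)\<^sup>2 * K"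
        using K(1) by (intro mult_right_mono divide_right_mono) (auto simp: \<theta>_def)
      also have "\<dots> = e / 2" using K(1) \<beta> by simp
      finally show "\<theta> / (\<beta> / 2)\<^sup>2 * K \<le> e / 2" .
    qed
    define \<eta> where "\<eta> = min c (min (\<theta>\<^sup>2 / B) (\<beta> * c * e))"
    have \<eta>: "0 < \<eta>" "\<eta> \<le> c" "sqrt (B * \<eta>) \<le> \<theta>" "\<eta> / (2 * c) / \<beta> \<le> e / 2"
    proof -
      show "0 < \<eta>" "\<eta> \<le> c" using c \<theta>(1) B \<beta> e by (auto simp: \<eta>_def)
      have "B * \<eta> \<le> B * (\<theta>\<^sup>2 / B)" using B by (intro mult_left_mono) (auto simp: \<eta>_def)
      also have "\<dots> = \<theta>\<^sup>2" using B by simp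
      finally have "sqrt (B * \<eta>) \<le> sqrt (\<theta>\<^sup>2)" by (rule real_sqrt_le_mono)
      then show "sqrt (B * \<eta>) \<le> \<theta>" using \<theta>(1) by simp
      have "\<eta> / (2 * c) / \<beta> \<le> (\<beta> * c * e) / (2 * c) / \<beta>"
        using c \<beta> by (intro divide_right_mono) (auto simp: \<eta>_def)
      also have "\<dots> = e / 2" using c \<beta> by simp
      finally show "\<eta> / (2 * c) / \<beta> \<le> e / 2" .
    qed
    from K(2) \<eta>(1) have "likely e (regular K \<eta>)" by blast
    then show "likely e (\<lambda>n x. norm (Y n x - CJ.normalized_sum n x) \<le> e)"
    proof (rule likely_mono, intro always_eventually allI ballI impI)
      fix n x assume x: "x \<in> space \<Omega>" and reg: "regular K \<eta> n x"
      note st = regular_standardized[OF R Rc less_imp_le[OF b(1)] b(2) reg x less_imp_le[OF \<eta>(1)] \<eta>(2)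
          \<eta>(3)[unfolded B_def] \<theta>(2)]
      have n: "n \<ge> 1" using reg by (simp add: regular_def)
      have em: "err n x \<in> M" by (rule regular_err_mem[OF reg])
      have 1: "norm (Y n x - J (err n x)) \<le> e / 2"
        using order_trans[OF st(2) \<theta>(3)] Y[OF n x st(1)] em by (simp add: J_def proj_id)
      have "J (err n x) - J (L (CV.normalized_sum n x)) = J (err n x - L (CV.normalized_sum n x))"
        by (simp add: linear_diff[OF J_lin])
      also have "norm \<dots> \<le> norm (err n x - L (CV.normalized_sum n x)) / \<beta>"
        by (intro J_norm subspace_diff[OF M_subspace em L_mem])
      also have "\<dots> \<le> \<eta> / (2 * c) / \<beta>" using regular_L[OF reg] \<beta> by (intro divide_right_mono) auto
      also have "\<dots> \<le> e / 2" by (rule \<eta>(4))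
      finally have 2: "norm (J (err n x) - J (L (CV.normalized_sum n x))) \<le> e / 2" .
      show "norm (Y n x - CJ.normalized_sum n x) \<le> e"
        unfolding linear_image_sample(3)[OF JL_lin adj]
        using norm_triangle_ineq[of "Y n x - J (err n x)" "J (err n x) - J (L (CV.normalized_sum n x))"] 1 2
        by simp
    qed
  qed
  with N(3) show ?thesis by blast
qed

end

theorem theorem2p2:
  fixes P :: "('d::finite) cmat measure"
    and M A :: "'d cmat set"
    and Q0 Qs :: "'d cmat"
    and \<Omega> :: "'w measure"
    and S :: "nat \<Rightarrow> 'w \<Rightarrow> 'd cmat"
    and Qn :: "nat \<Rightarrow> 'w \<Rightarrow> 'd cmat"
  assumes P_prob: "prob_space P"
    and P_sets: "sets P = sets (restrict_space borel psd)"
    and P_pd: "measure P pd > 0"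
    and P_trace: "integrable P (\<lambda>X. Re (trace X))"
    and M_subspace: "subspace M" and M_herm: "M \<subseteq> hermitian"
    and Q0_herm: "Q0 \<in> hermitian"
    and A_def: "A = (\<lambda>X. Q0 + X) ` M"
    and A_pd: "pd \<inter> A \<noteq> {}"
    and Omega_prob: "prob_space \<Omega>"
    and S_indep: "prob_space.indep_vars \<Omega> (\<lambda>_. P) S {1..}"
    and S_law: "\<And>i. i \<ge> 1 \<Longrightarrow> distr \<Omega> P (S i) = P"
    and Qs_bary: "bw_barycenter P A Qs"
    and Qn_meas: "\<And>n. n \<ge> 1 \<Longrightarrow> Qn n \<in> borel_measurable \<Omega>"
    and Qn_bary: "\<And>n \<omega>. n \<ge> 1 \<Longrightarrow> \<omega> \<in> space \<Omega> \<Longrightarrow> emp_bw_barycenter n (\<lambda>i. S i \<omega>) A (Qn n \<omega>)"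
  shows
    "(\<exists>N. centred_gaussian M (Xi_op P M Qs) N \<and>
          weak_conv_law (\<lambda>n. distr \<Omega> borel (\<lambda>\<omega>. sqrt (real n) *\<^sub>R (Qn n \<omega> - Qs))) N)
     \<and>
     ((\<forall>X\<in>hermitian. Sigma_op P Qs X = 0 \<longrightarrow> X = 0) \<longrightarrow>
        (\<forall>Y :: nat \<Rightarrow> 'w \<Rightarrow> 'd cmat.
           (\<forall>n\<ge>1. Y n \<in> borel_measurable \<Omega>) \<and>
           (\<forall>n\<ge>1. \<forall>\<omega>\<in>space \<Omega>. Xi_hat_well_defined n (\<lambda>i. S i \<omega>) M (Qn n \<omega>) \<longrightarrow>
              Y n \<omega> = sqrt (real n) *\<^sub>R
                inv_into M (op_sqrt M (Xi_hat n (\<lambda>i. S i \<omega>) M (Qn n \<omega>))) (Qn n \<omega> - Qs))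
           \<longrightarrow> (\<exists>N. centred_gaussian M id N \<and> weak_conv_law (\<lambda>n. distr \<Omega> borel (Y n)) N)))"
proof -
  interpret pop: bw_population P M A Q0 Qs
    using P_prob P_sets P_pd P_trace M_subspace M_herm A_def A_pd Qs_bary
    by (intro bw_population.intro bw_population_axioms.intro)
  obtain \<kappa> \<rho> where "bw_bounds \<kappa> \<rho> Qs" using bw_bounds_exist[OF pop.Qs_pd] by blast
  moreover obtain c where "0 < c" "coercive_on M (2 * c) pop.F" using pop.F_coercive by blast
  ultimately interpret bw_model P M A Q0 Qs \<kappa> \<rho> c \<Omega> S Qn
    using Omega_prob S_indep S_law Qn_meas Qn_bary
    by (intro bw_model.intro bw_local.intro bw_local_axioms.intro iid_sample.intro iid_sample_axioms.intro
        bw_model_axioms.intro pop.bw_population_axioms)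
  show ?thesis
    using clt_barycenter clt_standardized by blast
qed

end
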